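(* Let $\mathcal{H}_1,\mathcal{H}_2$ be finite-dimensional Hilbert spaces, $\rho_1,\sigma_1\in\mathcal{S}(\mathcal{H}_1)$ and $\rho_2,\sigma_2\in\mathcal{S}(\mathcal{H}_2)$ such that $\mathrm{supp}(\rho_1)\subseteq\mathrm{supp}(\sigma_1)$ or $\mathrm{supp}(\rho_2)\subseteq\mathrm{supp}(\sigma_2)$, and let $r>0$. Then $$E^P_{sc}(\rho_1,\sigma_1,\rho_2,\sigma_2,r)=\sup_{\frac12\le\alpha\le1}\frac{1-\alpha}{\alpha}\Big\{rD^*_\alpha(\rho_2\|\sigma_2)-D^*_{\frac{\alpha}{2\alpha-1}}(\rho_1\|\sigma_1)\Big\}.$$
   Context: $\mathcal{S}(\mathcal{H})$ denotes the set of density operators on $\mathcal{H}$; logarithms are base 2. The fidelity is $F(\rho,\sigma)=\|\sqrt\rho\sqrt\sigma\|_1$, the purified distance is $P(\rho,\sigma)=\sqrt{1-F^2(\rho,\sigma)}$ and the trace distance is $d(\rho,\sigma)=\frac12\|\rho-\sigma\|_1$. For $\Delta\in\{d,P\}$, $n\in\mathbb{N}$ and rate $r>0$ (with $nr$ understood as an integer number of copies), define $$\epsilon^{\Delta,r}(n)=\min\{\Delta(\mathcal{E}_n(\rho_1^{\otimes n}),\rho_2^{\otimes nr}) : \mathcal{E}_n \text{ a quantum channel (CPTP map) with } \mathcal{E}_n(\sigma_1^{\otimes n})=\sigma_2^{\otimes nr}\},$$ and the strong converse exponent $E^\Delta_{sc}(\rho_1,\sigma_1,\rho_2,\sigma_2,r)=\lim_{n\to\infty}-\frac1n\log(1-\epsilon^{\Delta,r}(n))$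 (the claim includes existence of the limit). Equivalently $E^P_{sc}=\lim_n -\frac1n\log\max_{\mathcal{E}_n:\mathcal{E}_n(\sigma_1^{\otimes n})=\sigma_2^{\otimes nr}}F^2(\mathcal{E}_n(\rho_1^{\otimes n}),\rho_2^{\otimes nr})$. The sandwiched Rényi divergence for $\alpha\in(0,\infty)\setminus\{1\}$ is $D^*_\alpha(\rho\|\sigma)=\frac{1}{\alpha-1}\log\operatorname{Tr}(\sigma^{\frac{1-\alpha}{2\alpha}}\rho\sigma^{\frac{1-\alpha}{2\alpha}})^\alpha$ when $\alpha>1$ and $\mathrm{supp}(\rho)\subseteq\mathrm{supp}(\sigma)$, or $\alpha<1$ and $\mathrm{supp}(\rho)\not\perp\mathrm{supp}(\sigma)$; otherwise $+\infty$. At $\alpha=1$ it is the Umegaki relative entropy $D(\rho\|\sigma)=\operatorname{Tr}\rho(\log\rho-\log\sigma)$ (or $+\infty$ if $\mathrm{supp}(\rho)\not\subseteq\mathrm{supp}(\sigma)$), and at order $\infty$ (arising for $\alpha=1/2$) it is the limit $\beta\to\infty$. *)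

theory Defs
  imports "Jordan_Normal_Form.Matrix" "HOL-Library.Extended_Real"
begin

text \<open>A finite-dimensional Hilbert space is identified with \<open>\<complex>^d\<close>; operators are
  \<open>d \<times> d\<close> complex matrices (Jordan_Normal_Form \<open>mat\<close>).\<close>

definition adj :: "complex mat \<Rightarrow> complex mat" where
  "adj A = mat (dim_col A) (dim_row A) (\<lambda>(i,j). cnj (A $$ (j,i)))"

definition mtrace :: "complex mat \<Rightarrow> complex" where
  "mtrace A = (\<Sum>i<dim_row A. A $$ (i,i))"

definition cinner :: "complex vec \<Rightarrow> complex vec \<Rightarrow> complex" where
  "cinner v w = (\<Sum>i<dim_vec v. cnj (v $ i) * w $ i)"

definition psd :: "nat \<Rightarrow> complex mat \<Rightarrow> bool" where
  "psd d A \<longleftrightarrow> A \<in> carrier_mat d d \<and>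
     (\<forall>v \<in> carrier_vec d. Im (cinner v (A *\<^sub>v v)) = 0 \<and> Re (cinner v (A *\<^sub>v v)) \<ge> 0)"

definition density :: "nat \<Rightarrow> complex mat \<Rightarrow> bool" where
  "density d \<rho> \<longleftrightarrow> psd d \<rho> \<and> mtrace \<rho> = 1"

definition unitary :: "nat \<Rightarrow> complex mat \<Rightarrow> bool" where
  "unitary d U \<longleftrightarrow> U \<in> carrier_mat d d \<and> U * adj U = 1\<^sub>m d \<and> adj U * U = 1\<^sub>m d"

definition mat_fun :: "(real \<Rightarrow> real) \<Rightarrow> complex mat \<Rightarrow> complex mat" where
  "mat_fun f A = (SOME B. \<exists>U (ev :: nat \<Rightarrow> real).
      unitary (dim_row A) U \<and>
      A = U * mat_diag (dim_row A) (\<lambda>i. complex_of_real (ev i)) * adj U \<and>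
      B = U * mat_diag (dim_row A) (\<lambda>i. complex_of_real (f (ev i))) * adj U)"

text \<open>Real powers of a PSD matrix (taken on the support, i.e. \<open>0 \<mapsto> 0\<close>;
  note \<open>0 powr p = 0\<close> in Isabelle).\<close>
definition mpow :: "complex mat \<Rightarrow> real \<Rightarrow> complex mat" where
  "mpow A p = mat_fun (\<lambda>x. x powr p) A"

definition msqrt :: "complex mat \<Rightarrow> complex mat" where
  "msqrt A = mat_fun sqrt A"

text \<open>Base-2 matrix logarithm on the support (\<open>log 2 0 = 0\<close> in Isabelle).\<close>
definition mlog :: "complex mat \<Rightarrow> complex mat" where
  "mlog A = mat_fun (\<lambda>x. log 2 x) A"

definition trace_norm :: "complex mat \<Rightarrow> real" where
  "trace_norm A = Re (mtrace (msqrt (adj A * A)))"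

definition fidelity :: "complex mat \<Rightarrow> complex mat \<Rightarrow> real" where
  "fidelity \<rho> \<sigma> = trace_norm (msqrt \<rho> * msqrt \<sigma>)"

definition purified_distance :: "complex mat \<Rightarrow> complex mat \<Rightarrow> real" where
  "purified_distance \<rho> \<sigma> = sqrt (1 - (fidelity \<rho> \<sigma>)\<^sup>2)"

definition supp :: "complex mat \<Rightarrow> complex vec set" where
  "supp A = {A *\<^sub>v v | v. v \<in> carrier_vec (dim_col A)}"

definition supp_perp :: "complex mat \<Rightarrow> complex mat \<Rightarrow> bool" where
  "supp_perp A B \<longleftrightarrow> (\<forall>x \<in> supp A. \<forall>y \<in> supp B. cinner x y = 0)"

definition kron :: "complex mat \<Rightarrow> complex mat \<Rightarrow> complex mat" where
  "kron A B = mat (dim_row A * dim_row B) (dim_col A * dim_col B)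
     (\<lambda>(i,j). A $$ (i div dim_row B, j div dim_col B) * B $$ (i mod dim_row B, j mod dim_col B))"

fun tpow :: "complex mat \<Rightarrow> nat \<Rightarrow> complex mat" where
  "tpow A 0 = 1\<^sub>m 1"
| "tpow A (Suc n) = kron A (tpow A n)"

definition block :: "nat \<Rightarrow> complex mat \<Rightarrow> nat \<Rightarrow> nat \<Rightarrow> complex mat" where
  "block d X a b = mat d d (\<lambda>(i,j). X $$ (a * d + i, b * d + j))"

text \<open>\<open>(id_k \<otimes> E)(X)\<close>, acting blockwise.\<close>
definition ampliate :: "nat \<Rightarrow> nat \<Rightarrow> nat \<Rightarrow> (complex mat \<Rightarrow> complex mat) \<Rightarrow> complex mat \<Rightarrow> complex mat" where
  "ampliate k d1 d2 E X = mat (k * d2) (k * d2)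
     (\<lambda>(i,j). E (block d1 X (i div d2) (j div d2)) $$ (i mod d2, j mod d2))"

definition channel :: "nat \<Rightarrow> nat \<Rightarrow> (complex mat \<Rightarrow> complex mat) \<Rightarrow> bool" where
  "channel d1 d2 E \<longleftrightarrow>
     (\<forall>X \<in> carrier_mat d1 d1. E X \<in> carrier_mat d2 d2) \<and>
     (\<forall>X \<in> carrier_mat d1 d1. \<forall>Y \<in> carrier_mat d1 d1. \<forall>c :: complex.
        E (c \<cdot>\<^sub>m X + Y) = c \<cdot>\<^sub>m E X + E Y) \<and>
     (\<forall>X \<in> carrier_mat d1 d1. mtrace (E X) = mtrace X) \<and>
     (\<forall>k X. psd (k * d1) X \<longrightarrow> psd (k * d2) (ampliate k d1 d2 E X))"

definition umegaki :: "complex mat \<Rightarrow> complex mat \<Rightarrow> ereal" where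
  "umegaki \<rho> \<sigma> = (if supp \<rho> \<subseteq> supp \<sigma>
      then ereal (Re (mtrace (\<rho> * (mlog \<rho> - mlog \<sigma>)))) else \<infinity>)"

definition sandwiched :: "real \<Rightarrow> complex mat \<Rightarrow> complex mat \<Rightarrow> ereal" where
  "sandwiched \<alpha> \<rho> \<sigma> =
    (if \<alpha> = 1 then umegaki \<rho> \<sigma>
     else if (\<alpha> > 1 \<and> supp \<rho> \<subseteq> supp \<sigma>) \<or> (\<alpha> < 1 \<and> \<not> supp_perp \<rho> \<sigma>)
     then ereal (1 / (\<alpha> - 1) * log 2 (Re (mtrace
            (mpow (mpow \<sigma> ((1 - \<alpha>) / (2 * \<alpha>)) * \<rho> * mpow \<sigma> ((1 - \<alpha>) / (2 * \<alpha>))) \<alpha>))))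
     else \<infinity>)"

definition sandwiched_inf :: "complex mat \<Rightarrow> complex mat \<Rightarrow> ereal" where
  "sandwiched_inf \<rho> \<sigma> = Lim at_top (\<lambda>\<beta>. sandwiched \<beta> \<rho> \<sigma>)"

text \<open>Number of output copies: \<open>nr\<close> read as \<open>\<lfloor>n r\<rfloor>\<close>.\<close>
definition copies :: "real \<Rightarrow> nat \<Rightarrow> nat" where
  "copies r n = nat \<lfloor>real n * r\<rfloor>"

definition eps_P :: "nat \<Rightarrow> nat \<Rightarrow> complex mat \<Rightarrow> complex mat \<Rightarrow> complex mat \<Rightarrow> complex mat
    \<Rightarrow> real \<Rightarrow> nat \<Rightarrow> real" where
  "eps_P d1 d2 \<rho>1 \<sigma>1 \<rho>2 \<sigma>2 r n =
     Inf {purified_distance (E (tpow \<rho>1 n)) (tpow \<rho>2 (copies r n)) | E.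
            channel (d1 ^ n) (d2 ^ copies r n) E \<and> E (tpow \<sigma>1 n) = tpow \<sigma>2 (copies r n)}"

definition elog2 :: "real \<Rightarrow> ereal" where
  "elog2 x = (if x = 0 then -\<infinity> else ereal (log 2 x))"

end

theory Submission
  imports Defs "Jordan_Normal_Form.Schur_Decomposition" "HOL-Analysis.Convex"
begin

text \<open>
  Pinching \<open>\<rho>\<close> by \<open>\<sigma>\<close> and diagonalising gives a commuting pair, i.e. classical weights \<open>p\<close> and \<open>q\<close>. Its Renyi
  quantities agree with the sandwiched ones of \<open>(\<rho>, \<sigma>)\<close> up to powers of the number of distinct eigenvalues of
  \<open>\<sigma>\<close>, which is polynomial in \<open>n\<close> for an \<open>n\<close>-fold tensor power and so does not affect exponents.

  Converse: a channel taking \<open>\<sigma>\<^sub>1\<close> to \<open>\<sigma>\<^sub>2\<close> acts between the two pinched bases as a stochastic matrix. The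
  fidelity is bounded by a pinched one, and Hoelder's inequality with the dual orders \<open>\<alpha>\<close> and
  \<open>\<beta> = \<alpha> / (2 * \<alpha> - 1)\<close> followed by classical data processing for order \<open>\<beta>\<close> bounds it by a product of a power
  of the order-\<open>\<alpha>\<close> quantity of the second pair and a power of the order-\<open>\<beta>\<close> quantity of the first pair.

  Achievability: measure a test \<open>M\<close>; on success prepare a state \<open>\<omega>\<close> close to \<open>\<rho>\<^sub>2\<close>, otherwise prepare the state
  that makes the average over \<open>\<sigma>\<^sub>1\<close> equal to \<open>\<sigma>\<^sub>2\<close>. The test and \<open>\<omega>\<close> come from typical sets of tilted
  distributions of the pinched pairs, and a minimax argument in the plane chooses the tilting so that the success
  probability times the fidelity reaches the supremum over \<open>\<alpha>\<close>.
\<close>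

section \<open>Adjoints, unitaries and spectral decompositions\<close>

text \<open>The pinching of a tensor power is not a product law, so typical sets do not apply to it
  directly. Achievability therefore cuts the copies into blocks of a fixed length k, pinches a
  single block and treats blocks as independent letters. The pinching costs are of order ln (k + 1)
  / k per copy, and k is chosen from the tolerance before n grows. The converse pinches all n copies
  at once, where the cost is polynomial. All orders are parametrised by s = (1 - \<alpha>) /
  \<alpha> in [0,1], that is \<alpha> = 1 / (1 + s) with dual order 1 / (1 - s). A prepared state
  \<omega> must satisfy b \<omega> \<le> \<sigma>_2, where b is the success probability under
  \<sigma>_1; if the test succeeds too often it is damped. The exponent is thus the maximum of an
  undamped value A and a damped value B, and s is the weight in the Lagrangian (1 - s) A + s B. At s
  = 1 the dual order is infinite, and likelihood ratios take the place of Hoelder's inequality. The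
  purified distance enters only through F^2 / 2 \<le> 1 - sqrt (1 - F^2) \<le> F^2.\<close>

lemma adj_carrier [simp]: "A \<in> carrier_mat n m \<Longrightarrow> adj A \<in> carrier_mat m n"
  by (auto simp: adj_def)

lemma adj_dims [simp]: "dim_row (adj A) = dim_col A" "dim_col (adj A) = dim_row A"
  by (auto simp: adj_def)

lemma adj_index [simp]: "i < dim_col A \<Longrightarrow> j < dim_row A \<Longrightarrow> adj A $$ (i,j) = cnj (A $$ (j,i))"
  by (auto simp: adj_def)

lemma mult_mat_index:
  assumes "A \<in> carrier_mat n k" "B \<in> carrier_mat k m" "i < n" "j < m"
  shows "(A * B) $$ (i,j) = (\<Sum>l<k. A $$ (i,l) * B $$ (l,j))"
  using assms by (auto simp: scalar_prod_def atLeast0LessThan intro!: sum.cong)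

lemma mult_vec_index:
  assumes "A \<in> carrier_mat n k" "v \<in> carrier_vec k" "i < n"
  shows "(A *\<^sub>v v) $ i = (\<Sum>l<k. A $$ (i,l) * v $ l)"
  using assms by (auto simp: scalar_prod_def atLeast0LessThan intro!: sum.cong)

lemma adj_mult:
  assumes "A \<in> carrier_mat n k" "B \<in> carrier_mat k m"
  shows "adj (A * B) = adj B * adj A"
  by (rule eq_matI) (use assms in \<open>auto simp: mult_mat_index[OF assms]
      mult_mat_index[OF adj_carrier[OF assms(2)] adj_carrier[OF assms(1)]] mult.commute
      simp del: index_mult_mat(1) intro!: sum.cong\<close>)

lemma adj_adj [simp]: "adj (adj A) = A"
  by (rule eq_matI) auto

lemma adj_one [simp]: "adj (1\<^sub>m n) = 1\<^sub>m n"
  by (rule eq_matI) (auto simp: adj_def)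

lemma cmod_sq:
  "z * cnj z = (complex_of_real (cmod z))\<^sup>2" "cnj z * z = (complex_of_real (cmod z))\<^sup>2"
  using complex_norm_square[of z] by (simp_all add: mult.commute)

abbreviation rdiag :: "nat \<Rightarrow> (nat \<Rightarrow> real) \<Rightarrow> complex mat" where
  "rdiag n f \<equiv> mat_diag n (\<lambda>i. complex_of_real (f i))"

lemma mat_diag_dims [simp]: "dim_row (mat_diag n f) = n" "dim_col (mat_diag n f) = n"
  by (auto simp: mat_diag_def)

lemma mat_diag_index [simp]: "i < n \<Longrightarrow> j < n \<Longrightarrow> mat_diag n f $$ (i,j) = (if i = j then f j else 0)"
  by (auto simp: mat_diag_def)

lemma adj_mat_diag: "adj (mat_diag n f) = mat_diag n (\<lambda>i. cnj (f i))"
  by (rule eq_matI) auto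

lemma adj_rdiag [simp]: "adj (rdiag n f) = rdiag n f"
  by (simp add: adj_mat_diag)

lemma unitaryD:
  assumes "unitary n U"
  shows "U \<in> carrier_mat n n" "U * adj U = 1\<^sub>m n" "adj U * U = 1\<^sub>m n"
    "dim_row U = n" "dim_col U = n" "adj U \<in> carrier_mat n n"
  using assms by (auto simp: unitary_def)

lemma unitary_adj: "unitary n U \<Longrightarrow> unitary n (adj U)"
  by (auto simp: unitary_def)

lemma mat_assoc:
  fixes A B C :: "complex mat"
  shows "A \<in> carrier_mat n n \<Longrightarrow> B \<in> carrier_mat n n \<Longrightarrow> C \<in> carrier_mat n n
    \<Longrightarrow> A * B * C = A * (B * C)"
  by (rule assoc_mult_mat)

lemma unitary_cancel:
  assumes "unitary n U" "X \<in> carrier_mat n n"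
  shows "U * (adj U * X) = X" "adj U * (U * X) = X"
  using assms unitaryD[OF assms(1)] by (simp_all add: assoc_mult_mat[symmetric, of _ n n _ n _ n])

lemma unitary_conj_inverse:
  assumes U: "unitary n U" and X: "X \<in> carrier_mat n n"
  shows "U * (adj U * X * U) * adj U = X" "adj U * (U * X * adj U) * U = X"
  using X unitaryD[OF U] by (simp_all add: mat_assoc[of _ n] unitary_cancel[OF U])

lemma unitary_conj_mult:
  assumes U: "unitary n U" and X: "X \<in> carrier_mat n n" and Y: "Y \<in> carrier_mat n n"
  shows "(U * X * adj U) * (U * Y * adj U) = U * (X * Y) * adj U"
  using X Y unitaryD[OF U] by (simp add: mat_assoc[of _ n] unitary_cancel[OF U])

lemma unitary_mult:
  assumes U: "unitary n U" and V: "unitary n V" shows "unitary n (U * V)"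
proof -
  note c = unitaryD(1,6)[OF U] unitaryD(1,6)[OF V]
  have "U * V * adj (U * V) = U * (V * (adj V * adj U))"
    using c by (simp only: adj_mult[OF c(1,3)] mat_assoc[OF c(1,3) mult_carrier_mat[OF c(4,2)]])
  moreover have "adj (U * V) * (U * V) = adj V * (adj U * (U * V))"
    using c by (simp only: adj_mult[OF c(1,3)] mat_assoc[OF c(4,2) mult_carrier_mat[OF c(1,3)]])
  ultimately show ?thesis
    using unitary_cancel[OF U c(3)] unitary_cancel[OF V c(2)] unitaryD[OF U] unitaryD[OF V] c
    by (auto simp: unitary_def)
qed

lemma unitary_rows_sum:
  assumes "unitary n U" "i < n" "j < n"
  shows "(\<Sum>l<n. U $$ (i,l) * cnj (U $$ (j,l))) = (if i = j then 1 else 0)"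
proof -
  have "(U * adj U) $$ (i,j) = (\<Sum>l<n. U $$ (i,l) * adj U $$ (l,j))"
    using assms unitaryD[OF assms(1)] by (intro mult_mat_index) auto
  moreover have "\<dots> = (\<Sum>l<n. U $$ (i,l) * cnj (U $$ (j,l)))"
    using assms unitaryD[OF assms(1)] by (intro sum.cong) auto
  ultimately show ?thesis using assms unitaryD[OF assms(1)] by simp
qed

lemma unitary_cols_sum:
  assumes "unitary n U" "i < n" "j < n"
  shows "(\<Sum>l<n. cnj (U $$ (l,i)) * U $$ (l,j)) = (if i = j then 1 else 0)"
proof -
  have "(\<Sum>l<n. cnj (U $$ (l,i)) * U $$ (l,j)) = (\<Sum>l<n. adj U $$ (i,l) * cnj (adj U $$ (j,l)))"
    using assms unitaryD[OF assms(1)] by (intro sum.cong) auto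
  thus ?thesis using unitary_rows_sum[OF unitary_adj[OF assms(1)] assms(2,3)] by simp
qed

lemma unitary_row_norm:
  assumes "unitary n U" "i < n"
  shows "(\<Sum>l<n. (cmod (U $$ (i,l)))\<^sup>2) = 1"
proof -
  have "complex_of_real (\<Sum>l<n. (cmod (U $$ (i,l)))\<^sup>2) = 1"
    using unitary_rows_sum[OF assms(1,2,2)] by (simp add: cmod_sq)
  thus ?thesis using of_real_eq_1_iff by blast
qed

lemma unitary_col_norm:
  assumes "unitary n U" "i < n"
  shows "(\<Sum>l<n. (cmod (U $$ (l,i)))\<^sup>2) = 1"
proof -
  have "(\<Sum>l<n. (cmod (U $$ (l,i)))\<^sup>2) = (\<Sum>l<n. (cmod (adj U $$ (i,l)))\<^sup>2)"
    using assms unitaryD[OF assms(1)] by (intro sum.cong) auto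
  thus ?thesis using unitary_row_norm[OF unitary_adj[OF assms(1)] assms(2)] by simp
qed

lemma unitaryI_left:
  assumes "U \<in> carrier_mat n n" "adj U * U = 1\<^sub>m n" shows "unitary n U"
  using assms mat_mult_left_right_inverse[of "adj U" n U] by (auto simp: unitary_def)

lemma unitaryI_cols:
  assumes U: "U \<in> carrier_mat n n"
    and o: "\<And>i j. i < n \<Longrightarrow> j < n \<Longrightarrow> (\<Sum>l<n. cnj (U $$ (l,i)) * U $$ (l,j)) = (if i = j then 1 else 0)"
  shows "unitary n U"
proof (rule unitaryI_left[OF U])
  show "adj U * U = 1\<^sub>m n"
  proof (rule eq_matI)
    fix i j assume ij: "i < dim_row (1\<^sub>m n)" "j < dim_col (1\<^sub>m n)"
    have "(adj U * U) $$ (i,j) = (\<Sum>l<n. adj U $$ (i,l) * U $$ (l,j))"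
      using ij U by (intro mult_mat_index) auto
    also have "\<dots> = (\<Sum>l<n. cnj (U $$ (l,i)) * U $$ (l,j))"
      using ij U by (intro sum.cong) auto
    finally show "(adj U * U) $$ (i,j) = 1\<^sub>m n $$ (i,j)" using o ij by simp
  qed (use U in auto)
qed

text \<open>Gram-Schmidt on a basis that starts with v keeps v in front and yields orthogonal
  vectors that are not yet normalised; dividing each by its norm gives the columns of W.\<close>

lemma unitary_with_first_column:
  assumes v: "(v :: complex vec) \<in> carrier_vec n" and v0: "v \<noteq> 0\<^sub>v n" and n: "n \<noteq> 0"
  shows "\<exists>W c. unitary n W \<and> col W 0 = c \<cdot>\<^sub>v v"
proof -
  define b where "b = basis_completion v"
  define ws where "ws = gram_schmidt n b"
  interpret cof_vec_space n "TYPE(complex)" .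
  from basis_completion[OF v v0, folded b_def]
  have dist_b: "distinct b" and indep: "\<not> lin_dep (set b)" and b: "set b \<subseteq> carrier_vec n"
    and hdb: "hd b = v" and len_b: "length b = n" by auto
  from hdb len_b n obtain vs where bv: "b = v # vs" by (cases b, auto)
  from gram_schmidt_result[OF b dist_b indep refl, folded ws_def]
  have ws: "set ws \<subseteq> carrier_vec n" "corthogonal ws" "length ws = n"
    by (auto simp: len_b)
  from gram_schmidt_hd[OF v, of vs, folded bv] have "hd ws = v" unfolding ws_def .
  hence ws0: "ws ! 0 = v" using ws(3) n by (cases ws) auto
  define nr where "nr j = (\<Sum>l<n. (cmod (ws ! j $ l))\<^sup>2)" for j
  define W where "W = Matrix.mat n n (\<lambda>(i,j). complex_of_real (1 / sqrt (nr j)) * ws ! j $ i)"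
  have car: "ws ! j \<in> carrier_vec n" if "j < n" for j using ws that by auto
  have prod: "ws ! j \<bullet>c ws ! i = (\<Sum>l<n. cnj (ws ! i $ l) * ws ! j $ l)" if "i < n" "j < n" for i j
    using car[OF that(1)] car[OF that(2)]
    by (auto simp: scalar_prod_def atLeast0LessThan intro!: sum.cong)
  have nr: "complex_of_real (nr j) = ws ! j \<bullet>c ws ! j" if "j < n" for j
    unfolding prod[OF that that] nr_def of_real_sum
    by (intro sum.cong) (auto simp: cmod_sq)
  have nr_pos: "nr j > 0" if "j < n" for j
  proof -
    have "ws ! j \<bullet>c ws ! j \<noteq> 0" using corthogonalD[OF ws(2)] that ws(3) by auto
    hence "nr j \<noteq> 0" using nr[OF that] by auto
    moreover have "nr j \<ge> 0" by (auto simp: nr_def intro: sum_nonneg)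
    ultimately show ?thesis by simp
  qed
  have W: "unitary n W"
  proof (rule unitaryI_cols)
    fix i j assume ij: "i < n" "j < n"
    have "(\<Sum>l<n. cnj (W $$ (l,i)) * W $$ (l,j))
        = (\<Sum>l<n. complex_of_real (1 / sqrt (nr i)) * complex_of_real (1 / sqrt (nr j)) *
            (cnj (ws ! i $ l) * ws ! j $ l))"
      using ij by (intro sum.cong) (auto simp: W_def)
    also have "\<dots> = complex_of_real (1 / sqrt (nr i)) * complex_of_real (1 / sqrt (nr j)) * (ws ! j \<bullet>c ws ! i)"
      by (simp only: prod[OF ij] sum_distrib_left)
    also have "\<dots> = (if i = j then 1 else 0)"
    proof (cases "i = j")
      case True
      have "complex_of_real (1 / sqrt (nr j)) * complex_of_real (1 / sqrt (nr j)) * complex_of_real (nr j)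
          = complex_of_real ((1 / sqrt (nr j)) * (1 / sqrt (nr j)) * nr j)"
        by (simp only: of_real_mult)
      also have "(1 / sqrt (nr j)) * (1 / sqrt (nr j)) * nr j = 1"
        using nr_pos[OF ij(2)] by (simp add: field_simps)
      finally show ?thesis using True nr[OF ij(2)] by simp
    next
      case False
      thus ?thesis using corthogonalD[OF ws(2), of j i] ij ws(3) by auto
    qed
    finally show "(\<Sum>l<n. cnj (W $$ (l,i)) * W $$ (l,j)) = (if i = j then 1 else 0)" .
  qed (auto simp: W_def)
  moreover have "col W 0 = complex_of_real (1 / sqrt (nr 0)) \<cdot>\<^sub>v v"
    using n v by (intro eq_vecI) (auto simp: W_def ws0)
  ultimately show ?thesis by blast
qed

text \<open>Schur's theorem by deflation: a unitary whose first column is a scaled eigenvector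
  clears the first column below the diagonal, and the remaining block is triangularised by
  induction.\<close>

lemma unitary_triangularization:
  "(A :: complex mat) \<in> carrier_mat n n \<Longrightarrow> \<exists>U. unitary n U \<and> upper_triangular (adj U * A * U)"
proof (induction n arbitrary: A)
  case 0
  thus ?case by (intro exI[of _ "1\<^sub>m 0"]) (auto simp: unitary_def)
next
  case (Suc n)
  note A = Suc.prems
  from char_poly_factorized[OF A] obtain as where
    as: "char_poly A = (\<Prod>a\<leftarrow>as. [:- a, 1:])" "length as = Suc n" by auto
  then obtain e es where "as = e # es" by (cases as) auto
  hence "poly (char_poly A) e = 0" using as by simp
  hence "eigenvalue A e" using eigenvalue_root_char_poly[OF A] by simp
  then obtain v where v: "v \<in> carrier_vec (Suc n)" "v \<noteq> 0\<^sub>v (Suc n)" "A *\<^sub>v v = e \<cdot>\<^sub>v v"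
    using A unfolding eigenvalue_def eigenvector_def by auto
  from unitary_with_first_column[OF v(1,2)] obtain W c
    where W: "unitary (Suc n) W" and Wc: "col W 0 = c \<cdot>\<^sub>v v" by auto
  note Wcar = unitaryD(1)[OF W]
  have eig: "A *\<^sub>v col W 0 = e \<cdot>\<^sub>v col W 0"
    using A v unfolding Wc
    by (auto simp: mult_mat_vec[of _ "Suc n" "Suc n"] smult_smult_assoc mult.commute)
  define A' where "A' = adj W * A * W"
  have A'car: "A' \<in> carrier_mat (Suc n) (Suc n)" using A Wcar by (auto simp: A'_def)
  have A'0: "A' $$ (i,0) = (if i = 0 then e else 0)" if "i < Suc n" for i
  proof -
    have "A' $$ (i,0) = (\<Sum>l<Suc n. adj W $$ (i,l) * (A * W) $$ (l,0))"
      unfolding A'_def using A Wcar that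
      by (subst mat_assoc[of _ "Suc n"]) (auto simp del: index_mult_mat(1) sum.lessThan_Suc
          simp: mult_mat_index[of _ "Suc n" "Suc n" _ "Suc n"])
    also have "\<dots> = (\<Sum>l<Suc n. e * (cnj (W $$ (l,i)) * W $$ (l,0)))"
    proof (rule sum.cong)
      fix l assume l: "l \<in> {..<Suc n}"
      have "(A * W) $$ (l,0) = (A *\<^sub>v col W 0) $ l" using A Wcar l by auto
      also have "\<dots> = e * W $$ (l,0)" unfolding eig using l Wcar by auto
      finally show "adj W $$ (i,l) * (A * W) $$ (l,0) = e * (cnj (W $$ (l,i)) * W $$ (l,0))"
        using l that Wcar by auto
    qed auto
    also have "\<dots> = e * (\<Sum>l<Suc n. (cnj (W $$ (l,i)) * W $$ (l,0)))" by (rule sum_distrib_left[symmetric])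
    finally show ?thesis using unitary_cols_sum[OF W that, of 0] by auto
  qed
  define A2 where "A2 = Matrix.mat 1 n (\<lambda>(i,j). A' $$ (0, Suc j))"
  define A3 where "A3 = Matrix.mat n n (\<lambda>(i,j). A' $$ (Suc i, Suc j))"
  have A2: "A2 \<in> carrier_mat 1 n" and A3: "A3 \<in> carrier_mat n n" by (auto simp: A2_def A3_def)
  have blk: "A' = four_block_mat (Matrix.mat 1 1 (\<lambda>_. e)) A2 (0\<^sub>m n 1) A3"
    by (rule eq_matI) (use A'car A'0 in \<open>auto simp: A2_def A3_def four_block_mat_def Let_def less_Suc_eq_0_disj\<close>)
  from Suc.IH[OF A3] obtain P where P: "unitary n P" and ut: "upper_triangular (adj P * A3 * P)" by auto
  note Pcar = unitaryD(1)[OF P]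
  \<comment> \<open>The unitary of the smaller block is extended so that it fixes the first basis
    vector; conjugation by it leaves the cleared column untouched.\<close>
  define F where "F = four_block_mat (1\<^sub>m 1) (0\<^sub>m 1 n) (0\<^sub>m n 1) P"
  have Fcar: "F \<in> carrier_mat (Suc n) (Suc n)" using Pcar by (auto simp: F_def)
  have Fadj: "adj F = four_block_mat (1\<^sub>m 1) (0\<^sub>m 1 n) (0\<^sub>m n 1) (adj P)"
    by (rule eq_matI) (use Pcar in \<open>auto simp: F_def four_block_mat_def Let_def\<close>)
  have F: "unitary (Suc n) F"
  proof (rule unitaryI_left[OF Fcar])
    have "adj F * F = four_block_mat (1\<^sub>m 1) (0\<^sub>m 1 n) (0\<^sub>m n 1) (1\<^sub>m n)"
      unfolding Fadj unfolding F_def using Pcar unitaryD[OF P]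
      by (subst mult_four_block_mat[of _ 1 1 _ n _ n _ _ 1 _ n]) auto
    also have "\<dots> = 1\<^sub>m (Suc n)"
      by (rule eq_matI) (auto simp: four_block_mat_def Let_def)
    finally show "adj F * F = 1\<^sub>m (Suc n)" .
  qed
  have FA: "adj F * A' * F = four_block_mat (Matrix.mat 1 1 (\<lambda>_. e)) (A2 * P) (0\<^sub>m n 1) (adj P * A3 * P)"
  proof -
    note c = Pcar A2 A3 adj_carrier[OF Pcar] mult_carrier_mat[OF adj_carrier[OF Pcar] A3]
      mult_carrier_mat[OF A2 Pcar] mult_carrier_mat[OF mult_carrier_mat[OF adj_carrier[OF Pcar] A3] Pcar]
    have e: "Matrix.mat 1 1 (\<lambda>_. e) \<in> carrier_mat 1 1" by simp
    have "adj F * A' = four_block_mat (Matrix.mat 1 1 (\<lambda>_. e)) A2 (0\<^sub>m n 1) (adj P * A3)"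
      unfolding blk Fadj
      by (subst mult_four_block_mat[OF one_carrier_mat zero_carrier_mat zero_carrier_mat c(4) e A2 zero_carrier_mat A3])
         (use c e in simp)
    also have "\<dots> * F = four_block_mat (Matrix.mat 1 1 (\<lambda>_. e)) (A2 * P) (0\<^sub>m n 1) (adj P * A3 * P)"
      unfolding F_def
      by (subst mult_four_block_mat[OF e A2 zero_carrier_mat c(5) one_carrier_mat zero_carrier_mat zero_carrier_mat Pcar])
         (use c e in simp)
    finally show ?thesis .
  qed
  have "upper_triangular (adj F * A' * F)" unfolding FA
    using Pcar A3 ut
    by (intro upper_triangular_four_block[of _ 1 _ n]) auto
  moreover have "adj F * A' * F = adj (W * F) * A * (W * F)"
  proof -
    have "adj F * (adj W * A * W) * F = adj F * adj W * A * (W * F)"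
      using adj_carrier[OF Wcar] adj_carrier[OF Fcar] Wcar Fcar A
      by (simp only: mat_assoc[of _ "Suc n"] mult_carrier_mat[of _ "Suc n" "Suc n" _ "Suc n"])
    thus ?thesis unfolding A'_def adj_mult[OF Wcar Fcar] .
  qed
  ultimately have "upper_triangular (adj (W * F) * A * (W * F))" by simp
  thus ?case using unitary_mult[OF W F] by (intro exI[of _ "W * F"]) simp
qed

text \<open>Normality makes row i and column i equally long. Once the earlier rows are known to be
  diagonal, column i contains only its diagonal entry, so the rest of row i must vanish.\<close>

lemma upper_triangular_normal_diagonal:
  assumes T: "(T :: complex mat) \<in> carrier_mat n n" and ut: "upper_triangular T"
    and nrm: "T * adj T = adj T * T"
  shows "i < n \<Longrightarrow> j < n \<Longrightarrow> i \<noteq> j \<Longrightarrow> T $$ (i,j) = 0"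
proof -
  have main: "\<forall>j<n. i \<noteq> j \<longrightarrow> T $$ (i,j) = 0" if "i < n" for i
    using that
  proof (induction i rule: less_induct)
    case (less i)
    have low: "T $$ (l,i) = 0" if "l < n" "l \<noteq> i" for l
      using less that ut T by (cases "l < i") auto
    have "(T * adj T) $$ (i,i) = (\<Sum>l<n. T $$ (i,l) * adj T $$ (l,i))"
      using T less by (intro mult_mat_index) auto
    also have "\<dots> = complex_of_real (\<Sum>l<n. (cmod (T $$ (i,l)))\<^sup>2)"
      unfolding of_real_sum using T less by (intro sum.cong) (auto simp: cmod_sq)
    finally have 1: "(T * adj T) $$ (i,i) = complex_of_real (\<Sum>l<n. (cmod (T $$ (i,l)))\<^sup>2)" .
    have "(adj T * T) $$ (i,i) = (\<Sum>l<n. adj T $$ (i,l) * T $$ (l,i))"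
      using T less by (intro mult_mat_index) auto
    also have "\<dots> = (\<Sum>l<n. if l = i then complex_of_real ((cmod (T $$ (i,i)))\<^sup>2) else 0)"
      using T less low by (intro sum.cong) (auto simp: cmod_sq)
    also have "\<dots> = complex_of_real ((cmod (T $$ (i,i)))\<^sup>2)" using less by simp
    finally have "complex_of_real (\<Sum>l<n. (cmod (T $$ (i,l)))\<^sup>2) = complex_of_real ((cmod (T $$ (i,i)))\<^sup>2)"
      using 1 nrm by simp
    hence "(\<Sum>l<n. (cmod (T $$ (i,l)))\<^sup>2) = (cmod (T $$ (i,i)))\<^sup>2" using of_real_eq_iff by blast
    moreover have "(\<Sum>l<n. (cmod (T $$ (i,l)))\<^sup>2) = (cmod (T $$ (i,i)))\<^sup>2 + (\<Sum>l\<in>{..<n}-{i}. (cmod (T $$ (i,l)))\<^sup>2)"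
      using less by (intro sum.remove) auto
    ultimately have "(\<Sum>l\<in>{..<n}-{i}. (cmod (T $$ (i,l)))\<^sup>2) = 0" by simp
    thus ?case by (subst (asm) sum_nonneg_eq_0_iff) auto
  qed
  show "i < n \<Longrightarrow> j < n \<Longrightarrow> i \<noteq> j \<Longrightarrow> T $$ (i,j) = 0" using main by blast
qed

lemma normal_diagonalization:
  assumes A: "(A :: complex mat) \<in> carrier_mat n n" and nrm: "A * adj A = adj A * A"
  shows "\<exists>U f. unitary n U \<and> A = U * mat_diag n f * adj U"
proof -
  from unitary_triangularization[OF A] obtain U where
    U: "unitary n U" and ut: "upper_triangular (adj U * A * U)" by auto
  note Uc = unitaryD(1)[OF U]
  define T where "T = adj U * A * U"
  have T: "T \<in> carrier_mat n n" using A Uc by (auto simp: T_def)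
  have aT: "adj T = adj U * adj A * U"
    unfolding T_def using A Uc by (simp add: adj_mult[of _ n n _ n] mat_assoc[of _ n])
  have "T * adj T = adj U * (A * adj A) * U" "adj T * T = adj U * (adj A * A) * U"
    unfolding aT unfolding T_def
    using unitary_conj_mult[OF unitary_adj[OF U], of A "adj A"]
      unitary_conj_mult[OF unitary_adj[OF U], of "adj A" A] A by simp_all
  hence "T * adj T = adj T * T" using nrm by simp
  from upper_triangular_normal_diagonal[OF T ut[folded T_def] this]
  have "T = mat_diag n (\<lambda>i. T $$ (i,i))" using T by (intro eq_matI) auto
  moreover have "A = U * T * adj U" unfolding T_def using unitary_conj_inverse(1)[OF U A] by simp
  ultimately show ?thesis using U by metis
qed

lemma sum_mult_delta:
  fixes f :: "nat \<Rightarrow> 'a::comm_semiring_1"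
  assumes "i < n"
  shows "(\<Sum>l<n. f l * (if l = i then c else 0)) = f i * c" "(\<Sum>l<n. (if l = i then c else 0) * f l) = c * f i"
proof -
  have "(\<Sum>l<n. f l * (if l = i then c else 0)) = (\<Sum>l<n. if l = i then f l * c else 0)" by (intro sum.cong) auto
  thus "(\<Sum>l<n. f l * (if l = i then c else 0)) = f i * c" using assms by simp
  thus "(\<Sum>l<n. (if l = i then c else 0) * f l) = c * f i" by (simp add: mult.commute)
qed

lemma mult_carrier_sq:
  "A \<in> carrier_mat n n \<Longrightarrow> B \<in> carrier_mat n n \<Longrightarrow> A * B \<in> carrier_mat n n"
  by (rule mult_carrier_mat)

lemma cinner_mult_vec:
  assumes "A \<in> carrier_mat n n" "v \<in> carrier_vec n"
  shows "cinner v (A *\<^sub>v v) = (\<Sum>i<n. \<Sum>j<n. cnj (v $ i) * A $$ (i,j) * v $ j)"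
  unfolding cinner_def using assms
  by (auto simp: mult_vec_index[OF assms] sum_distrib_left mult.assoc simp del: index_mult_mat_vec intro!: sum.cong)

lemma cinner_adj:
  assumes B: "B \<in> carrier_mat n m" and v: "v \<in> carrier_vec m" and w: "w \<in> carrier_vec n"
  shows "cinner v (adj B *\<^sub>v w) = cinner (B *\<^sub>v v) w"
proof -
  have "cinner v (adj B *\<^sub>v w) = (\<Sum>i<m. \<Sum>j<n. cnj (v $ i) * (cnj (B $$ (j,i)) * w $ j))"
    unfolding cinner_def using assms
    by (auto simp: mult_vec_index[OF adj_carrier[OF B] w] sum_distrib_left simp del: index_mult_mat_vec intro!: sum.cong)
  also have "\<dots> = (\<Sum>j<n. \<Sum>i<m. cnj (v $ i) * (cnj (B $$ (j,i)) * w $ j))" by (rule sum.swap)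
  also have "\<dots> = cinner (B *\<^sub>v v) w"
    unfolding cinner_def using assms
    by (auto simp: mult_vec_index[OF B v] sum_distrib_left sum_distrib_right algebra_simps simp del: index_mult_mat_vec intro!: sum.cong)
  finally show ?thesis .
qed

lemma psdD:
  assumes "psd n A"
  shows "A \<in> carrier_mat n n" "\<And>v. v \<in> carrier_vec n \<Longrightarrow> Im (cinner v (A *\<^sub>v v)) = 0"
    "\<And>v. v \<in> carrier_vec n \<Longrightarrow> Re (cinner v (A *\<^sub>v v)) \<ge> 0"
  using assms by (auto simp: psd_def)

text \<open>\<open>psd\<close> only asks for a real nonnegative form. Over the complex numbers a
  real form forces self-adjointness, by polarisation at the vectors e_i + c e_j with c = 1, -1, i,
  -i.\<close>

lemma psd_hermitian:
  assumes "psd n A" shows "adj A = A"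
proof (rule eq_matI)
  note A = psdD(1)[OF assms]
  fix i j assume "i < dim_row A" "j < dim_col A"
  hence ij: "i < n" "j < n" using A by auto
  \<comment> \<open>The two indicators are added, so that the identity also covers i = j.\<close>
  have form: "cinner v (A *\<^sub>v v) = A $$ (i,i) + c * A $$ (i,j) + cnj c * A $$ (j,i) + cnj c * c * A $$ (j,j)"
    if v: "v = vec n (\<lambda>k. (if k = i then 1 else 0) + (if k = j then c else 0))" for v c
  proof -
    have vc: "v \<in> carrier_vec n" using v by simp
    have "cinner v (A *\<^sub>v v) = (\<Sum>k<n. \<Sum>l<n. ((if k = i then 1 else 0) + (if k = j then cnj c else 0)) * A $$ (k,l) * ((if l = i then 1 else 0) + (if l = j then c else 0)))"
      unfolding cinner_mult_vec[OF A vc] by (intro sum.cong) (auto simp: v)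
    also have "\<dots> = (\<Sum>k<n. ((if k = i then 1 else 0) + (if k = j then cnj c else 0)) * (A $$ (k,i) + c * A $$ (k,j)))"
      using ij by (intro sum.cong refl) (simp only: distrib_left sum.distrib sum_mult_delta, simp add: algebra_simps)
    also have "\<dots> = A $$ (i,i) + c * A $$ (i,j) + cnj c * A $$ (j,i) + cnj c * c * A $$ (j,j)"
      using ij by (simp only: distrib_right[of "if _ then _ else _"] sum.distrib sum_mult_delta, simp add: algebra_simps)
    finally show ?thesis .
  qed
  have Im0: "Im (A $$ (i,i) + c * A $$ (i,j) + cnj c * A $$ (j,i) + cnj c * c * A $$ (j,j)) = 0" for c
    using psdD(2)[OF assms, of "vec n (\<lambda>k. (if k = i then 1 else 0) + (if k = j then c else 0))"]
    by (subst form[symmetric]) auto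
  have "Im (A $$ (i,j)) + Im (A $$ (j,i)) = 0" using Im0[of 1] Im0[of "-1"] by simp
  moreover have "Re (A $$ (i,j)) - Re (A $$ (j,i)) = 0" using Im0[of "\<i>"] Im0[of "-\<i>"] by simp
  ultimately show "adj A $$ (i,j) = A $$ (i,j)" using ij A by (auto simp: complex_eq_iff)
qed (use psdD(1)[OF assms] in auto)

lemma psd_conj:
  assumes A: "psd n A" and B: "B \<in> carrier_mat n m"
  shows "psd m (adj B * A * B)"
proof -
  note Ac = psdD(1)[OF A]
  have "cinner v (adj B * A * B *\<^sub>v v) = cinner (B *\<^sub>v v) (A *\<^sub>v (B *\<^sub>v v))" if v: "v \<in> carrier_vec m" for v
  proof -
    have "adj B * A * B *\<^sub>v v = (adj B * A) *\<^sub>v (B *\<^sub>v v)"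
      using Ac B v by (intro assoc_mult_mat_vec[of _ m n _ m]) auto
    also have "\<dots> = adj B *\<^sub>v (A *\<^sub>v (B *\<^sub>v v))"
      using Ac B v by (intro assoc_mult_mat_vec[of _ m n _ n]) auto
    finally have "adj B * A * B *\<^sub>v v = adj B *\<^sub>v (A *\<^sub>v (B *\<^sub>v v))" .
    thus ?thesis using cinner_adj[OF B v, of "A *\<^sub>v (B *\<^sub>v v)"] Ac B v by simp
  qed
  thus ?thesis using psdD[OF A] B unfolding psd_def by auto
qed

lemma psd_rdiag:
  assumes "\<And>i. i < n \<Longrightarrow> f i \<ge> 0" shows "psd n (rdiag n f)"
proof -
  have "cinner v (rdiag n f *\<^sub>v v) = complex_of_real (\<Sum>i<n. f i * (cmod (v $ i))\<^sup>2)" if v: "v \<in> carrier_vec n" for v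
  proof -
    have "cinner v (rdiag n f *\<^sub>v v) = (\<Sum>i<n. \<Sum>j<n. if j = i then cnj (v $ i) * complex_of_real (f i) * v $ i else 0)"
      by (subst cinner_mult_vec[of _ n], simp, simp add: v, intro sum.cong refl) auto
    also have "\<dots> = complex_of_real (\<Sum>i<n. f i * (cmod (v $ i))\<^sup>2)"
      by (auto simp: cmod_sq[symmetric] algebra_simps intro!: sum.cong)
    finally show ?thesis .
  qed
  thus ?thesis using assms by (auto simp: psd_def intro!: sum_nonneg)
qed

lemma psd_one: "psd n (1\<^sub>m n)"
  using psd_rdiag[of n "\<lambda>_. 1"] by simp

lemma spectral_psd:
  assumes "unitary n U" "\<And>i. i < n \<Longrightarrow> f i \<ge> 0" shows "psd n (U * rdiag n f * adj U)"
  using psd_conj[OF psd_rdiag[of n f, OF assms(2)], of "adj U" n] unitaryD[OF assms(1)] by simp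

lemma psd_gram: "B \<in> carrier_mat n m \<Longrightarrow> psd m (adj B * B)"
  using psd_conj[OF psd_one, of B n m] by simp

lemma psd_add:
  assumes "psd n A" "psd n B" shows "psd n (A + B)"
proof -
  note c = psdD(1)[OF assms(1)] psdD(1)[OF assms(2)]
  have "cinner v ((A + B) *\<^sub>v v) = cinner v (A *\<^sub>v v) + cinner v (B *\<^sub>v v)" if v: "v \<in> carrier_vec n" for v
    using c v unfolding cinner_mult_vec[OF c(1) v] cinner_mult_vec[OF c(2) v] cinner_mult_vec[OF add_carrier_mat[OF c(2)] v]
    by (simp add: distrib_left distrib_right sum.distrib)
  thus ?thesis using psdD[OF assms(1)] psdD[OF assms(2)] by (auto simp: psd_def)
qed

lemma psd_smult:
  assumes "psd n A" "c \<ge> 0" shows "psd n (complex_of_real c \<cdot>\<^sub>m A)"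
proof -
  note A = psdD(1)[OF assms(1)]
  have "cinner v (complex_of_real c \<cdot>\<^sub>m A *\<^sub>v v) = complex_of_real c * cinner v (A *\<^sub>v v)" if v: "v \<in> carrier_vec n" for v
    using A v by (subst (1 2) cinner_mult_vec[of _ n]) (auto simp: sum_distrib_left algebra_simps intro!: sum.cong)
  thus ?thesis using psdD[OF assms(1)] assms(2) by (auto simp: psd_def)
qed

lemma psd_diag_entry:
  assumes "psd n A" "i < n" shows "A $$ (i,i) = complex_of_real (Re (A $$ (i,i)))" "Re (A $$ (i,i)) \<ge> 0"
proof -
  note A = psdD(1)[OF assms(1)]
  have "cinner (unit_vec n i) (A *\<^sub>v unit_vec n i) = (\<Sum>k<n. \<Sum>l<n. if l = i then (if k = i then A $$ (k,l) else 0) else 0)"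
    by (subst cinner_mult_vec[OF A], simp, intro sum.cong refl) (auto simp: unit_vec_def)
  also have "\<dots> = A $$ (i,i)" using assms(2) by simp
  finally show "A $$ (i,i) = complex_of_real (Re (A $$ (i,i)))" "Re (A $$ (i,i)) \<ge> 0"
    using psdD(2,3)[OF assms(1), of "unit_vec n i"] by (auto simp: complex_eq_iff)
qed

text \<open>For commuting self-adjoint A and B the matrix A + i B is normal. One unitary
  diagonalises it, and the real and imaginary parts of its eigenvalues belong to A and B.\<close>

lemma joint_diagonalization:
  assumes A: "A \<in> carrier_mat n n" "adj A = A" and B: "B \<in> carrier_mat n n" "adj B = B"
    and comm: "A * B = B * A"
  shows "\<exists>U f g. unitary n U \<and> A = U * rdiag n f * adj U \<and> B = U * rdiag n g * adj U"
proof -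
  define C where "C = A + \<i> \<cdot>\<^sub>m B"
  have C: "C \<in> carrier_mat n n" using A B by (auto simp: C_def)
  have aC: "adj C = A + (-\<i>) \<cdot>\<^sub>m B"
    using A(1) B(1) by (intro eq_matI) (auto simp: C_def arg_cong[OF A(2), of "\<lambda>M. M $$ _", symmetric] arg_cong[OF B(2), of "\<lambda>M. M $$ _", symmetric] simp del: adj_index, auto)
  have e1: "C * adj C = A * A + B * B" "adj C * C = A * A + B * B"
    unfolding aC unfolding C_def using A(1) B(1) comm
    by (auto simp: add_mult_distrib_mat[of _ n n _ _ n] mult_add_distrib_mat[of _ n n _ n]
        mult_smult_distrib[of _ n n _ n] mult_smult_assoc_mat[of _ n n _ n] algebra_simps intro!: eq_matI)
  hence "C * adj C = adj C * C" by simp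
  from normal_diagonalization[OF C this] obtain U h where
    U: "unitary n U" and Ch: "C = U * mat_diag n h * adj U" by auto
  note Uc = unitaryD[OF U]
  define A' where "A' = adj U * A * U"
  define B' where "B' = adj U * B * U"
  have A'c: "A' \<in> carrier_mat n n" and B'c: "B' \<in> carrier_mat n n" using A B Uc by (auto simp: A'_def B'_def)
  have "adj U * C * U = mat_diag n h" unfolding Ch by (rule unitary_conj_inverse(2)[OF U]) auto
  moreover have "adj U * C * U = A' + \<i> \<cdot>\<^sub>m B'"
    unfolding C_def A'_def B'_def using A(1) B(1) Uc
    by (simp add: add_mult_distrib_mat[of _ n n _ _ n] mult_add_distrib_mat[of _ n n _ n]
        mult_smult_distrib[of _ n n _ n] mult_smult_assoc_mat[of _ n n _ n] mult_carrier_sq[of _ n])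
  ultimately have D: "A' + \<i> \<cdot>\<^sub>m B' = mat_diag n h" by simp
  have A'h: "adj A' = A'" and B'h: "adj B' = B'"
    unfolding A'_def B'_def using A B Uc by (auto simp: adj_mult[of _ n n _ n] mat_assoc[of _ n])
  have ent: "A' $$ (i,j) + \<i> * B' $$ (i,j) = (if i = j then h i else 0)" if "i < n" "j < n" for i j
    using arg_cong[OF D, of "\<lambda>M. M $$ (i,j)"] that A'c B'c by auto
  have cA: "cnj (A' $$ (j,i)) = A' $$ (i,j)" and cB: "cnj (B' $$ (j,i)) = B' $$ (i,j)" if "i < n" "j < n" for i j
    using arg_cong[OF A'h, of "\<lambda>M. M $$ (i,j)"] arg_cong[OF B'h, of "\<lambda>M. M $$ (i,j)"] that A'c B'c by auto
  \<comment> \<open>The adjoint of the same equation; the sum and the difference of the two separate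
    A' from B'.\<close>
  have ent2: "A' $$ (i,j) - \<i> * B' $$ (i,j) = (if i = j then cnj (h i) else 0)" if "i < n" "j < n" for i j
    using arg_cong[OF ent[OF that(2,1)], of cnj] cA[OF that] cB[OF that] by (auto split: if_splits)
  have "A' $$ (i,j) = (if i = j then complex_of_real (Re (h i)) else 0)"
       "B' $$ (i,j) = (if i = j then complex_of_real (Im (h i)) else 0)" if "i < n" "j < n" for i j
    using ent[OF that] ent2[OF that] by (auto simp: complex_eq_iff split: if_splits)
  hence "A' = rdiag n (\<lambda>i. Re (h i))" "B' = rdiag n (\<lambda>i. Im (h i))"
    using A'c B'c by (auto intro!: eq_matI)
  hence "A = U * rdiag n (\<lambda>i. Re (h i)) * adj U" "B = U * rdiag n (\<lambda>i. Im (h i)) * adj U"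
    using unitary_conj_inverse(1)[OF U A(1)] unitary_conj_inverse(1)[OF U B(1)]
    by (auto simp: A'_def B'_def)
  thus ?thesis using U
    by (intro exI[of _ U] exI[of _ "\<lambda>i. Re (h i)"] exI[of _ "\<lambda>i. Im (h i)"]) simp
qed

lemma psd_spectral:
  assumes "psd n A" obtains U f where "unitary n U" "\<And>i. f i \<ge> 0" "A = U * rdiag n f * adj U"
proof -
  note A = psdD(1)[OF assms] psd_hermitian[OF assms]
  from joint_diagonalization[OF A A refl] obtain U f where
    U: "unitary n U" and Af: "A = U * rdiag n f * adj U" by auto
  note Uc = unitaryD[OF U]
  have "psd n (adj U * A * U)" by (rule psd_conj[OF assms Uc(1)])
  moreover have "adj U * A * U = rdiag n f" unfolding Af by (rule unitary_conj_inverse(2)[OF U]) auto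
  ultimately have "psd n (rdiag n f)" by simp
  from psd_diag_entry(2)[OF this] have "f i \<ge> 0" if "i < n" for i using that by auto
  \<comment> \<open>Values at indices beyond n do not affect the matrix; resetting them to 0 makes
    nonnegativity hold for every index.\<close>
  moreover have "rdiag n f = rdiag n (\<lambda>i. if i < n then f i else 0)" by (rule eq_matI) auto
  ultimately show ?thesis using that[of U "\<lambda>i. if i < n then f i else 0"] U Af by auto
qed

text \<open>\<open>adj W * U\<close> intertwines the two diagonal matrices, so a nonzero entry can
  only link equal eigenvalues. This is behind both the independence of \<open>mat_fun\<close> from
  the diagonalisation and the comparison of spectra.\<close>

lemma spectral_intertwine:
  assumes U: "unitary n U" and W: "unitary n W"
    and e: "U * rdiag n f * adj U = W * rdiag n g * adj W" and ij: "i < n" "j < n"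
    and nz: "(adj W * U) $$ (i,j) \<noteq> 0"
  shows "f j = g i"
proof -
  define Z where "Z = adj W * U"
  note c = unitaryD[OF U] unitaryD[OF W]
  have Z: "Z \<in> carrier_mat n n" using c by (auto simp: Z_def)
  have "adj W * (U * rdiag n f * adj U) * U = Z * rdiag n f"
    unfolding Z_def using c by (simp add: mat_assoc[of _ n] mult_carrier_sq[of _ n])
  moreover have "adj W * (W * rdiag n g * adj W) * U = rdiag n g * Z"
    unfolding Z_def using c by (simp add: mat_assoc[of _ n] mult_carrier_sq[of _ n] unitary_cancel[OF W])
  ultimately have "Z * rdiag n f = rdiag n g * Z" using e by simp
  from arg_cong[OF this, of "\<lambda>M. M $$ (i,j)"] have "Z $$ (i,j) * complex_of_real (f j) = complex_of_real (g i) * Z $$ (i,j)"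
    using ij Z by (simp add: mat_diag_mult_left[OF Z] mat_diag_mult_right[OF Z])
  thus ?thesis using nz unfolding Z_def[symmetric] by (simp add: mult.commute)
qed

text \<open>The choice operator in \<open>mat_fun\<close> is harmless: since
  \<open>adj W * U\<close> only links equal eigenvalues, it also intertwines their images under h,
  so every diagonalisation gives the same matrix.\<close>

lemma mat_fun_eq:
  assumes U: "unitary n U" and A: "A = U * rdiag n f * adj U"
  shows "mat_fun h A = U * rdiag n (\<lambda>i. h (f i)) * adj U"
proof -
  note c = unitaryD[OF U]
  have dim: "dim_row A = n" using c A by auto
  have uniq: "W * rdiag n (\<lambda>i. h (g i)) * adj W = U * rdiag n (\<lambda>i. h (f i)) * adj U"
    if W: "unitary n W" and Ag: "A = W * rdiag n g * adj W" for W g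
  proof -
    note d = unitaryD[OF W]
    define Z where "Z = adj W * U"
    have Z: "Z \<in> carrier_mat n n" using c d by (auto simp: Z_def)
    have "Z * rdiag n (\<lambda>i. h (f i)) = rdiag n (\<lambda>i. h (g i)) * Z"
      unfolding mat_diag_mult_left[OF Z] mat_diag_mult_right[OF Z]
      using spectral_intertwine[OF U W A[symmetric, unfolded Ag]] unfolding Z_def[symmetric]
      by (intro eq_matI) (auto, metis)
    hence "W * (Z * rdiag n (\<lambda>i. h (f i))) * adj U = W * (rdiag n (\<lambda>i. h (g i)) * Z) * adj U" by simp
    moreover have "W * (Z * rdiag n (\<lambda>i. h (f i))) * adj U = U * rdiag n (\<lambda>i. h (f i)) * adj U"
      unfolding Z_def using c d by (simp add: mat_assoc[of _ n] mult_carrier_sq[of _ n] unitary_cancel[OF W])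
    moreover have "W * (rdiag n (\<lambda>i. h (g i)) * Z) * adj U = W * rdiag n (\<lambda>i. h (g i)) * adj W"
      unfolding Z_def using c d by (simp add: mat_assoc[of _ n] mult_carrier_sq[of _ n])
    ultimately show ?thesis by simp
  qed
  show ?thesis unfolding mat_fun_def dim
    by (rule some_equality) (use U A uniq in blast)+
qed

lemma mat_fun_psd_cong:
  assumes "psd n A" "\<And>x. x \<ge> 0 \<Longrightarrow> h x = k x" shows "mat_fun h A = mat_fun k A"
proof -
  from psd_spectral[OF assms(1)] obtain U f where "unitary n U" "\<And>i. f i \<ge> 0" "A = U * rdiag n f * adj U" by blast
  thus ?thesis using assms(2) by (simp add: mat_fun_eq)
qed

section \<open>Traces, powers and square roots\<close>

lemma mtrace_mult_comm:
  assumes "A \<in> carrier_mat n m" "B \<in> carrier_mat m n" shows "mtrace (A * B) = mtrace (B * A)"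
proof -
  have "mtrace (A * B) = (\<Sum>i<n. \<Sum>j<m. A $$ (i,j) * B $$ (j,i))"
    unfolding mtrace_def using assms by (auto simp: mult_mat_index[OF assms] simp del: index_mult_mat(1) intro!: sum.cong)
  also have "\<dots> = (\<Sum>j<m. \<Sum>i<n. A $$ (i,j) * B $$ (j,i))" by (rule sum.swap)
  also have "\<dots> = mtrace (B * A)"
    unfolding mtrace_def using assms by (auto simp: mult_mat_index[OF assms(2,1)] mult.commute simp del: index_mult_mat(1) intro!: sum.cong)
  finally show ?thesis .
qed

lemma mtrace_rdiag: "mtrace (rdiag n f) = complex_of_real (\<Sum>i<n. f i)"
  by (simp add: mtrace_def)

lemma mtrace_unitary_conj:
  assumes U: "unitary n U" and X: "X \<in> carrier_mat n n"
  shows "mtrace (U * X * adj U) = mtrace X" "mtrace (adj U * X * U) = mtrace X"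
proof -
  note c = unitaryD[OF U]
  have "mtrace (U * X * adj U) = mtrace (adj U * (U * X))" using c X by (intro mtrace_mult_comm[of _ n n]) auto
  thus "mtrace (U * X * adj U) = mtrace X" using unitary_cancel[OF U X] by simp
  have "mtrace (adj U * X * U) = mtrace (U * (adj U * X))" using c X by (intro mtrace_mult_comm[of _ n n]) auto
  thus "mtrace (adj U * X * U) = mtrace X" using unitary_cancel[OF U X] by simp
qed

lemma mtrace_add: "A \<in> carrier_mat n n \<Longrightarrow> B \<in> carrier_mat n n \<Longrightarrow> mtrace (A + B) = mtrace A + mtrace B"
  by (auto simp: mtrace_def sum.distrib)

lemma mtrace_smult: "mtrace (c \<cdot>\<^sub>m A) = c * mtrace A" if "A \<in> carrier_mat n n"
  using that by (auto simp: mtrace_def sum_distrib_left)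

lemma mpow_eq:
  assumes "unitary n U" "A = U * rdiag n f * adj U"
  shows "mpow A p = U * rdiag n (\<lambda>i. f i powr p) * adj U"
  unfolding mpow_def by (rule mat_fun_eq[OF assms])

lemma msqrt_eq:
  assumes "unitary n U" "A = U * rdiag n f * adj U"
  shows "msqrt A = U * rdiag n (\<lambda>i. sqrt (f i)) * adj U"
  unfolding msqrt_def by (rule mat_fun_eq[OF assms])

lemma mpow_psd: assumes "psd n A" shows "psd n (mpow A p)"
proof -
  from psd_spectral[OF assms] obtain U f where "unitary n U" "\<And>i. f i \<ge> 0" "A = U * rdiag n f * adj U" by blast
  thus ?thesis by (simp add: mpow_eq spectral_psd)
qed

lemma msqrt_psd: assumes "psd n A" shows "psd n (msqrt A)"
proof -
  from psd_spectral[OF assms] obtain U f where "unitary n U" "\<And>i. f i \<ge> 0" "A = U * rdiag n f * adj U" by blast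
  thus ?thesis by (simp add: msqrt_eq spectral_psd)
qed

lemma msqrt_mult_self: assumes "psd n A" shows "msqrt A * msqrt A = A"
proof -
  from psd_spectral[OF assms] obtain U f where
    U: "unitary n U" and f: "\<And>i. f i \<ge> 0" and A: "A = U * rdiag n f * adj U" by blast
  have "complex_of_real (sqrt (f i)) * complex_of_real (sqrt (f i)) = complex_of_real (f i)" for i
    using f[of i] by (simp flip: of_real_mult)
  thus ?thesis unfolding msqrt_eq[OF U A] using A
    by (subst unitary_conj_mult[OF U]) auto
qed

lemma msqrt_eq_mpow: assumes "psd n A" shows "msqrt A = mpow A (1/2)"
  unfolding msqrt_def mpow_def by (rule mat_fun_psd_cong[OF assms]) (simp add: powr_half_sqrt)

section \<open>Tensor powers\<close>

lemma sum_div_mod: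
  fixes f :: "nat \<Rightarrow> nat \<Rightarrow> 'a::comm_monoid_add"
  shows "(\<Sum>k<a*c. f (k div c) (k mod c)) = (\<Sum>x<a. \<Sum>y<c. f x y)"
proof -
  have "(\<Sum>k<a*c. f (k div c) (k mod c)) = (\<Sum>x<a. \<Sum>k=x*c..<x*c+c. f (k div c) (k mod c))"
    by (rule sum.nat_group[symmetric])
  also have "\<dots> = (\<Sum>x<a. \<Sum>y<c. f x y)"
  proof (rule sum.cong[OF refl])
    fix x
    have "(\<Sum>k=x*c..<x*c+c. f (k div c) (k mod c)) = (\<Sum>k=0+x*c..<c+x*c. f (k div c) (k mod c))"
      by (simp add: add.commute)
    also have "\<dots> = (\<Sum>k=0..<c. f ((k+x*c) div c) ((k+x*c) mod c))" by (rule sum.shift_bounds_nat_ivl)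
    also have "\<dots> = (\<Sum>y<c. f x y)" by (intro sum.cong) auto
    finally show "(\<Sum>k=x*c..<x*c+c. f (k div c) (k mod c)) = (\<Sum>y<c. f x y)" .
  qed
  finally show ?thesis .
qed

lemma div_mod_bounds:
  assumes "(i::nat) < a * c" shows "i div c < a" "i mod c < c" "0 < c"
  using assms by (auto simp: less_mult_imp_div_less intro!: mod_less_divisor intro: Nat.gr0I)

lemma div_mod_eqI: "(i::nat) div c = j div c \<Longrightarrow> i mod c = j mod c \<Longrightarrow> i = j"
  by (metis div_mult_mod_eq)

lemma kron_carrier [simp]:
  "A \<in> carrier_mat a b \<Longrightarrow> B \<in> carrier_mat c d \<Longrightarrow> kron A B \<in> carrier_mat (a*c) (b*d)"
  by (auto simp: kron_def)

lemma kron_dims [simp]: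
  "dim_row (kron A B) = dim_row A * dim_row B" "dim_col (kron A B) = dim_col A * dim_col B"
  by (auto simp: kron_def)

lemma kron_index:
  assumes "A \<in> carrier_mat a b" "B \<in> carrier_mat c d" "i < a*c" "j < b*d"
  shows "kron A B $$ (i,j) = A $$ (i div c, j div d) * B $$ (i mod c, j mod d)"
  using assms by (auto simp: kron_def)

lemma kron_mult:
  assumes A: "A \<in> carrier_mat a b" and B: "B \<in> carrier_mat c d"
    and A': "A' \<in> carrier_mat b e" and B': "B' \<in> carrier_mat d f"
  shows "kron A B * kron A' B' = kron (A * A') (B * B')"
proof (rule eq_matI)
  fix i j assume "i < dim_row (kron (A * A') (B * B'))" "j < dim_col (kron (A * A') (B * B'))"
  hence ij: "i < a*c" "j < e*f" using assms by auto
  note bi = div_mod_bounds[OF ij(1)] div_mod_bounds[OF ij(2)]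
  have "(kron A B * kron A' B') $$ (i,j) = (\<Sum>l<b*d. kron A B $$ (i,l) * kron A' B' $$ (l,j))"
    using assms ij by (intro mult_mat_index) auto
  also have "\<dots> = (\<Sum>l<b*d. (\<lambda>x y. A $$ (i div c, x) * B $$ (i mod c, y) * (A' $$ (x, j div f) * B' $$ (y, j mod f))) (l div d) (l mod d))"
    using ij by (intro sum.cong refl) (simp add: kron_index[OF A B] kron_index[OF A' B'])
  also have "\<dots> = (\<Sum>x<b. \<Sum>y<d. A $$ (i div c, x) * B $$ (i mod c, y) * (A' $$ (x, j div f) * B' $$ (y, j mod f)))"
    by (rule sum_div_mod)
  also have "\<dots> = (\<Sum>x<b. A $$ (i div c, x) * A' $$ (x, j div f)) * (\<Sum>y<d. B $$ (i mod c, y) * B' $$ (y, j mod f))"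
    by (simp add: sum_product mult_ac)
  also have "\<dots> = kron (A * A') (B * B') $$ (i,j)"
    using assms ij bi
    by (simp add: kron_index[of _ a e _ c f] mult_mat_index[OF A A'] mult_mat_index[OF B B'] del: index_mult_mat(1))
  finally show "(kron A B * kron A' B') $$ (i,j) = kron (A * A') (B * B') $$ (i,j)" .
qed (use assms in auto)

lemma adj_kron: "adj (kron A B) = kron (adj A) (adj B)"
proof (rule eq_matI)
  fix i j assume ij: "i < dim_row (kron (adj A) (adj B))" "j < dim_col (kron (adj A) (adj B))"
  hence ij': "i < dim_col A * dim_col B" "j < dim_row A * dim_row B" by auto
  show "adj (kron A B) $$ (i,j) = kron (adj A) (adj B) $$ (i,j)"
    using ij' div_mod_bounds[OF ij'(1)] div_mod_bounds[OF ij'(2)] by (simp add: kron_def)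
qed auto

lemma kron_rdiag:
  "kron (rdiag a f) (rdiag c g) = rdiag (a*c) (\<lambda>i. f (i div c) * g (i mod c))"
proof (rule eq_matI)
  fix i j assume ij: "i < dim_row (rdiag (a*c) (\<lambda>i. f (i div c) * g (i mod c)))" "j < dim_col (rdiag (a*c) (\<lambda>i. f (i div c) * g (i mod c)))"
  hence ij': "i < a * c" "j < a * c" by auto
  show "kron (rdiag a f) (rdiag c g) $$ (i,j) = rdiag (a*c) (\<lambda>i. f (i div c) * g (i mod c)) $$ (i,j)"
    using ij' div_mod_bounds[OF ij'(1)] div_mod_bounds[OF ij'(2)] div_mod_eqI[of i c j] by (auto simp: kron_def)
qed auto

lemma kron_one: "kron (1\<^sub>m a) (1\<^sub>m c) = 1\<^sub>m (a*c)"
  using kron_rdiag[of a "\<lambda>_. 1" c "\<lambda>_. 1"] by simp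

lemma mtrace_kron:
  assumes A: "A \<in> carrier_mat a a" and B: "B \<in> carrier_mat c c"
  shows "mtrace (kron A B) = mtrace A * mtrace B"
proof -
  have "mtrace (kron A B) = (\<Sum>i<a*c. (\<lambda>x y. A $$ (x,x) * B $$ (y,y)) (i div c) (i mod c))"
    using assms by (auto simp: mtrace_def kron_index[OF A B] intro!: sum.cong)
  also have "\<dots> = (\<Sum>x<a. \<Sum>y<c. A $$ (x,x) * B $$ (y,y))" by (rule sum_div_mod)
  finally show ?thesis using assms by (simp add: mtrace_def sum_product)
qed

lemma div_mod_assoc:
  fixes k b c :: nat
  shows "k div c div b = k div (b * c)" "k div c mod b = k mod (b * c) div c" "k mod (b * c) mod c = k mod c"
proof -
  show "k div c div b = k div (b * c)" by (simp only: mult.commute[of b c] div_mult2_eq)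
  show "k mod (b * c) mod c = k mod c" by (rule mod_mod_cancel) simp
  have e: "k mod (b * c) = k mod c + (k div c mod b) * c"
    by (simp only: mult.commute[of b c] mod_mult2_eq) simp
  show "k div c mod b = k mod (b * c) div c"
  proof (cases "c = 0")
    case False
    thus ?thesis unfolding e by (subst div_mult_self1) simp_all
  qed simp
qed

lemma kron_assoc: "kron (kron A B) C = kron A (kron B C)"
proof (rule eq_matI)
  let ?a = "dim_row A" and ?a' = "dim_col A" and ?b = "dim_row B" and ?b' = "dim_col B"
    and ?c = "dim_row C" and ?c' = "dim_col C"
  have c: "A \<in> carrier_mat ?a ?a'" "B \<in> carrier_mat ?b ?b'" "C \<in> carrier_mat ?c ?c'" by auto
  fix i j assume "i < dim_row (kron A (kron B C))" "j < dim_col (kron A (kron B C))"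
  hence ij: "i < ?a * (?b * ?c)" "j < ?a' * (?b' * ?c')" by auto
  hence ij': "i < ?a * ?b * ?c" "j < ?a' * ?b' * ?c'" by (auto simp: mult.assoc)
  have "kron (kron A B) C $$ (i,j)
      = A $$ (i div ?c div ?b, j div ?c' div ?b') * B $$ (i div ?c mod ?b, j div ?c' mod ?b') * C $$ (i mod ?c, j mod ?c')"
    by (simp only: kron_index[OF kron_carrier[OF c(1,2)] c(3) ij']
        kron_index[OF c(1,2) div_mod_bounds(1)[OF ij'(1)] div_mod_bounds(1)[OF ij'(2)]])
  moreover have "kron A (kron B C) $$ (i,j)
      = A $$ (i div (?b * ?c), j div (?b' * ?c')) * (B $$ (i mod (?b * ?c) div ?c, j mod (?b' * ?c') div ?c')
          * C $$ (i mod (?b * ?c) mod ?c, j mod (?b' * ?c') mod ?c'))"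
    by (simp only: kron_index[OF c(1) kron_carrier[OF c(2,3)] ij]
        kron_index[OF c(2,3) div_mod_bounds(2)[OF ij(1)] div_mod_bounds(2)[OF ij(2)]])
  ultimately show "kron (kron A B) C $$ (i,j) = kron A (kron B C) $$ (i,j)"
    by (simp only: div_mod_assoc mult.assoc)
qed (auto simp: mult.assoc)

lemma kron_one1: "kron (1\<^sub>m 1) A = A" "kron A (1\<^sub>m 1) = A"
  by (rule eq_matI; simp add: kron_def)+

lemma unitary_kron:
  assumes "unitary a U" "unitary c V" shows "unitary (a*c) (kron U V)"
  using unitaryD[OF assms(1)] unitaryD[OF assms(2)]
  by (auto simp: unitary_def adj_kron kron_one kron_mult[of _ a a _ c c _ a _ c])

lemma kron_spectral:
  assumes "unitary a U" "unitary c V"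
  shows "kron (U * rdiag a f * adj U) (V * rdiag c g * adj V)
    = kron U V * rdiag (a*c) (\<lambda>i. f (i div c) * g (i mod c)) * adj (kron U V)"
proof -
  note u = unitaryD[OF assms(1)] and v = unitaryD[OF assms(2)]
  have "kron U V * kron (rdiag a f) (rdiag c g) = kron (U * rdiag a f) (V * rdiag c g)"
    using u v by (intro kron_mult) auto
  moreover have "kron (U * rdiag a f) (V * rdiag c g) * kron (adj U) (adj V) = kron (U * rdiag a f * adj U) (V * rdiag c g * adj V)"
    using u v by (intro kron_mult[of _ a a _ c c]) auto
  ultimately show ?thesis by (simp add: kron_rdiag adj_kron)
qed

lemma psd_kron:
  assumes "psd a A" "psd c B" shows "psd (a*c) (kron A B)"
proof -
  from psd_spectral[OF assms(1)] obtain U f where U: "unitary a U" "\<And>i. f i \<ge> 0" "A = U * rdiag a f * adj U" by blast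
  from psd_spectral[OF assms(2)] obtain V g where V: "unitary c V" "\<And>i. g i \<ge> 0" "B = V * rdiag c g * adj V" by blast
  show ?thesis unfolding U(3) V(3) kron_spectral[OF U(1) V(1)]
    using U(2) V(2) by (intro spectral_psd unitary_kron U(1) V(1)) auto
qed

lemma msqrt_kron:
  assumes "psd a A" "psd c B" shows "msqrt (kron A B) = kron (msqrt A) (msqrt B)"
proof -
  from psd_spectral[OF assms(1)] obtain U f where U: "unitary a U" "\<And>i. f i \<ge> 0" "A = U * rdiag a f * adj U" by blast
  from psd_spectral[OF assms(2)] obtain V g where V: "unitary c V" "\<And>i. g i \<ge> 0" "B = V * rdiag c g * adj V" by blast
  have "kron A B = kron U V * rdiag (a*c) (\<lambda>i. f (i div c) * g (i mod c)) * adj (kron U V)"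
    unfolding U(3) V(3) by (rule kron_spectral[OF U(1) V(1)])
  from msqrt_eq[OF unitary_kron[OF U(1) V(1)] this]
  show ?thesis unfolding msqrt_eq[OF U(1,3)] msqrt_eq[OF V(1,3)] kron_spectral[OF U(1) V(1)]
    by (simp add: real_sqrt_mult)
qed

lemma tpow_carrier [simp]: "A \<in> carrier_mat d d \<Longrightarrow> tpow A n \<in> carrier_mat (d^n) (d^n)"
  by (induction n) auto

lemma tpow_mult:
  assumes "A \<in> carrier_mat d d" "B \<in> carrier_mat d d" shows "tpow (A * B) n = tpow A n * tpow B n"
proof (induction n)
  case (Suc n)
  have "kron A (tpow A n) * kron B (tpow B n) = kron (A * B) (tpow A n * tpow B n)"
    using assms by (intro kron_mult[of _ d d _ "d^n" "d^n" _ d _ "d^n"]) auto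
  thus ?case using Suc by simp
qed simp

lemma adj_tpow: "adj (tpow A n) = tpow (adj A) n"
  by (induction n) (auto simp: adj_kron)

lemma unitary_tpow: "unitary d U \<Longrightarrow> unitary (d^n) (tpow U n)"
  by (induction n) (auto simp: unitary_kron, simp add: unitary_def)

lemma mtrace_tpow: "A \<in> carrier_mat d d \<Longrightarrow> mtrace (tpow A n) = mtrace A ^ n"
proof (induction n)
  case (Suc n) thus ?case using mtrace_kron[of A d "tpow A n" "d^n"] by simp
qed (simp add: mtrace_def)

lemma tpow_add: "tpow A (m + n) = kron (tpow A m) (tpow A n)"
  by (induction m) (simp_all only: tpow.simps add_0 add_Suc kron_one1 kron_assoc)

lemma tpow_tpow: "tpow (tpow A k) n = tpow A (k * n)"
  by (induction n) (auto simp: tpow_add)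

text \<open>The index x is read as a word of n digits in base d, and f is multiplied over the
  digits. Depending on f this is an eigenvalue of a tensor power or the probability of a word under
  a product law.\<close>

fun pweight :: "nat \<Rightarrow> (nat \<Rightarrow> real) \<Rightarrow> nat \<Rightarrow> nat \<Rightarrow> real" where
  "pweight d f 0 x = 1"
| "pweight d f (Suc n) x = f (x div d^n) * pweight d f n (x mod d^n)"

lemma pweight_nonneg: "(\<And>i. f i \<ge> 0) \<Longrightarrow> pweight d f n x \<ge> 0"
  by (induction n arbitrary: x) auto

lemma sum_pweight: "(\<Sum>x<d^n. pweight d f n x) = (\<Sum>a<d. f a) ^ n"
proof (induction n)
  case (Suc n)
  have "(\<Sum>x<d^Suc n. pweight d f (Suc n) x) = (\<Sum>x<d*d^n. (\<lambda>a b. f a * pweight d f n b) (x div d^n) (x mod d^n))" by simp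
  also have "\<dots> = (\<Sum>a<d. \<Sum>b<d^n. f a * pweight d f n b)" by (rule sum_div_mod)
  finally show ?case using Suc by (simp add: sum_distrib_left[symmetric] sum_distrib_right[symmetric])
qed simp

lemma tpow_rdiag: "tpow (rdiag d f) n = rdiag (d^n) (pweight d f n)"
proof (induction n)
  case 0 show ?case by (rule eq_matI) auto
qed (simp add: kron_rdiag)

lemma tpow_spectral:
  assumes "unitary d U"
  shows "tpow (U * rdiag d f * adj U) n = tpow U n * rdiag (d^n) (pweight d f n) * adj (tpow U n)"
  using unitaryD[OF assms] by (simp add: tpow_mult[of _ d] tpow_rdiag adj_tpow mult_carrier_sq[of _ d])

lemma psd_tpow: "psd d A \<Longrightarrow> psd (d^n) (tpow A n)"
proof (induction n)
  case 0 show ?case using psd_one[of 1] by simp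
qed (auto intro: psd_kron)

lemma density_tpow: "density d A \<Longrightarrow> density (d^n) (tpow A n)"
  by (auto simp: density_def psd_tpow mtrace_tpow[of _ d] psdD(1))

lemma pweight_powr: "(\<And>i. f i \<ge> 0) \<Longrightarrow> pweight d (\<lambda>i. f i powr p) n x = pweight d f n x powr p" if "d > 0" "x < d^n"
  using that(2)
proof (induction n arbitrary: x)
  case (Suc n)
  have "x mod d^n < d^n" using that(1) by simp
  thus ?case using Suc pweight_nonneg[of f d n] by (simp add: powr_mult)
qed simp

lemma mpow_tpow:
  assumes A: "psd d A" shows "mpow (tpow A n) p = tpow (mpow A p) n"
proof -
  from psd_spectral[OF A] obtain U f where U: "unitary d U" "\<And>i. f i \<ge> 0" "A = U * rdiag d f * adj U" by blast
  have "mpow (tpow A n) p = tpow U n * rdiag (d^n) (\<lambda>i. pweight d f n i powr p) * adj (tpow U n)"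
    unfolding U(3) by (rule mpow_eq[OF unitary_tpow[OF U(1)] tpow_spectral[OF U(1)]])
  also have "rdiag (d^n) (\<lambda>i. pweight d f n i powr p) = rdiag (d^n) (pweight d (\<lambda>i. f i powr p) n)"
  proof (rule eq_matI)
    fix i j assume "i < dim_row (rdiag (d^n) (pweight d (\<lambda>i. f i powr p) n))" "j < dim_col (rdiag (d^n) (pweight d (\<lambda>i. f i powr p) n))"
    hence ij: "i < d^n" "j < d^n" by auto
    show "rdiag (d^n) (\<lambda>i. pweight d f n i powr p) $$ (i,j) = rdiag (d^n) (pweight d (\<lambda>i. f i powr p) n) $$ (i,j)"
    proof (cases "d = 0")
      case True thus ?thesis using ij by (cases n) auto
    next
      case False thus ?thesis using ij pweight_powr[of d j n f] U(2) by auto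
    qed
  qed auto
  also have "tpow U n * \<dots> * adj (tpow U n) = tpow (mpow A p) n"
    unfolding mpow_eq[OF U(1,3)] tpow_spectral[OF U(1)] ..
  finally show ?thesis .
qed

lemma tpow_diag_entry:
  assumes R: "R \<in> carrier_mat d d" and p: "\<And>a. a < d \<Longrightarrow> R $$ (a,a) = complex_of_real (p a)"
  shows "x < d^n \<Longrightarrow> tpow R n $$ (x,x) = complex_of_real (pweight d p n x)"
proof (induction n arbitrary: x)
  case (Suc n)
  hence x: "x < d * d^n" by simp
  show ?case using Suc.IH[of "x mod d^n"] p[of "x div d^n"] div_mod_bounds[OF x]
    by (simp add: kron_index[OF R tpow_carrier[OF R] x x])
qed simp

text \<open>The weight of a word depends only on its type, the number of occurrences
  \<open>c a\<close> of each letter. Extensional functions are used so that the types form a finite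
  set that can be counted.\<close>

lemma pweight_monomial:
  "x < d^n \<Longrightarrow> \<exists>c \<in> {..<d} \<rightarrow>\<^sub>E {..n}. pweight d f n x = (\<Prod>a<d. f a ^ c a)"
proof (induction n arbitrary: x)
  case 0
  show ?case by (intro bexI[of _ "\<lambda>a\<in>{..<d}. 0"]) auto
next
  case (Suc n)
  hence x: "x < d * d^n" by simp
  note b = div_mod_bounds[OF x]
  from Suc.IH[OF b(2)] obtain c where c: "c \<in> {..<d} \<rightarrow>\<^sub>E {..n}" "pweight d f n (x mod d^n) = (\<Prod>a<d. f a ^ c a)" by auto
  define a0 where "a0 = x div d^n"
  define c' where "c' = c(a0 := Suc (c a0))"
  have a0: "a0 < d" using b by (simp add: a0_def)
  have "c' \<in> {..<d} \<rightarrow>\<^sub>E {..Suc n}" using c(1) a0 unfolding c'_def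
    by (auto simp: PiE_def extensional_def Pi_def le_Suc_eq)
  moreover have "(\<Prod>a<d. f a ^ c' a) = f a0 * (\<Prod>a<d. f a ^ c a)"
  proof -
    have "(\<Prod>a<d. f a ^ c' a) = f a0 ^ c' a0 * (\<Prod>a\<in>{..<d}-{a0}. f a ^ c' a)"
      using a0 by (intro prod.remove) auto
    also have "(\<Prod>a\<in>{..<d}-{a0}. f a ^ c' a) = (\<Prod>a\<in>{..<d}-{a0}. f a ^ c a)"
      by (intro prod.cong) (auto simp: c'_def)
    also have "f a0 ^ c' a0 * \<dots> = f a0 * (f a0 ^ c a0 * (\<Prod>a\<in>{..<d}-{a0}. f a ^ c a))" by (simp add: c'_def)
    also have "f a0 ^ c a0 * (\<Prod>a\<in>{..<d}-{a0}. f a ^ c a) = (\<Prod>a<d. f a ^ c a)"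
      using a0 by (intro prod.remove[symmetric]) auto
    finally show ?thesis .
  qed
  moreover have "pweight d f (Suc n) x = f a0 * (\<Prod>a<d. f a ^ c a)" using c(2) by (simp add: a0_def)
  ultimately show ?case by metis
qed

text \<open>The number of types is polynomial in n. This count bounds the number of distinct
  eigenvalues of a tensor power and thereby every pinching cost.\<close>

lemma card_pweight_values: "card (pweight d f n ` {..<d^n}) \<le> Suc n ^ d"
proof -
  have "pweight d f n ` {..<d^n} \<subseteq> (\<lambda>c. \<Prod>a<d. f a ^ c a) ` ({..<d} \<rightarrow>\<^sub>E {..n})"
  proof
    fix y assume "y \<in> pweight d f n ` {..<d^n}"
    then obtain x where x: "x < d^n" "y = pweight d f n x" by auto
    from pweight_monomial[OF x(1), of f] obtain c where
      "c \<in> {..<d} \<rightarrow>\<^sub>E {..n}" "y = (\<Prod>a<d. f a ^ c a)" unfolding x(2) by blast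
    thus "y \<in> (\<lambda>c. \<Prod>a<d. f a ^ c a) ` ({..<d} \<rightarrow>\<^sub>E {..n})" by blast
  qed
  hence "card (pweight d f n ` {..<d^n}) \<le> card ({..<d} \<rightarrow>\<^sub>E {..n})"
    by (intro order.trans[OF card_mono card_image_le] finite_imageI finite_PiE) auto
  thus ?thesis by (simp add: card_PiE)
qed

text \<open>Each column of the unitary \<open>adj W * U\<close> has norm 1, hence a nonzero entry,
  and such an entry links a value of f to an equal value of g.\<close>

lemma spectral_values_subset:
  assumes U: "unitary n U" and W: "unitary n W" and e: "U * rdiag n f * adj U = W * rdiag n g * adj W"
  shows "f ` {..<n} \<subseteq> g ` {..<n}"
proof
  fix y assume "y \<in> f ` {..<n}"
  then obtain j where j: "j < n" "y = f j" by auto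
  have "unitary n (adj W * U)" by (intro unitary_mult unitary_adj U W)
  hence n1: "(\<Sum>l<n. (cmod ((adj W * U) $$ (l,j)))\<^sup>2) = 1" by (rule unitary_col_norm[OF _ j(1)])
  have "\<exists>i<n. (adj W * U) $$ (i,j) \<noteq> 0"
  proof (rule ccontr)
    assume "\<not> ?thesis"
    hence "(\<Sum>l<n. (cmod ((adj W * U) $$ (l,j)))\<^sup>2) = 0" by (intro sum.neutral) auto
    thus False using n1 by simp
  qed
  then obtain i where i: "i < n" "(adj W * U) $$ (i,j) \<noteq> 0" by auto
  show "y \<in> g ` {..<n}" unfolding j(2) spectral_intertwine[OF U W e i(1) j(1) i(2)] using i by blast
qed

section \<open>Power inequalities\<close>

lemma weighted_am_gm:
  fixes a b t :: real
  assumes "a \<ge> 0" "b \<ge> 0" "0 \<le> t" "t \<le> 1"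
  shows "a powr t * b powr (1 - t) \<le> t * a + (1 - t) * b"
proof (cases "a = 0 \<or> b = 0")
  case True thus ?thesis using assms by auto
next
  case False
  hence ab: "a > 0" "b > 0" using assms by auto
  have "exp ((1 - t) * ln b + t * ln a) \<le> (1 - t) * exp (ln b) + t * exp (ln a)"
    using convex_onD[OF exp_convex, of t "ln b" "ln a"] assms by simp
  thus ?thesis using ab by (simp add: powr_def exp_add[symmetric] algebra_simps)
qed

text \<open>Bernoulli's inequality for real exponents, obtained from the weighted mean inequality
  with weight 1 / \<beta>.\<close>

lemma powr_tangent:
  fixes u \<beta> :: real
  assumes "u \<ge> 0" "\<beta> \<ge> 1"
  shows "1 + \<beta> * (u - 1) \<le> u powr \<beta>"
proof (cases "u = 0")
  case False
  hence u: "u > 0" using assms by simp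
  have "(u powr \<beta>) powr (1/\<beta>) * 1 powr (1 - 1/\<beta>) \<le> 1/\<beta> * u powr \<beta> + (1 - 1/\<beta>) * 1"
    using assms by (intro weighted_am_gm) auto
  moreover have "(u powr \<beta>) powr (1/\<beta>) = u" using u assms by (simp add: powr_powr)
  ultimately have "u \<le> 1/\<beta> * u powr \<beta> + (1 - 1/\<beta>)" by simp
  hence "\<beta> * u \<le> \<beta> * (1/\<beta> * u powr \<beta> + (1 - 1/\<beta>))" using assms by (intro mult_left_mono) auto
  also have "\<dots> = u powr \<beta> + (\<beta> - 1)" using assms by (simp add: field_simps)
  finally show ?thesis by (simp add: algebra_simps)
qed (use assms in auto)

text \<open>The tangent at the mean c is averaged. Total weight below 1 is allowed because the
  weights will come from partial isometries; as 1 - \<beta> \<le> 0, missing mass only increases the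
  coefficient of \<open>c powr \<beta>\<close> in the lower bound.\<close>

lemma jensen_powr:
  fixes w x :: "'a \<Rightarrow> real"
  assumes fin: "finite I" and w: "\<And>i. i \<in> I \<Longrightarrow> w i \<ge> 0" "sum w I \<le> 1"
    and x: "\<And>i. i \<in> I \<Longrightarrow> x i \<ge> 0" and b: "\<beta> \<ge> 1"
  shows "(\<Sum>i\<in>I. w i * x i) powr \<beta> \<le> (\<Sum>i\<in>I. w i * x i powr \<beta>)"
proof -
  define c where "c = (\<Sum>i\<in>I. w i * x i)"
  have c0: "c \<ge> 0" using w x by (auto simp: c_def intro!: sum_nonneg)
  show ?thesis
  proof (cases "c = 0")
    case True
    thus ?thesis using w x unfolding c_def[symmetric] by (auto intro!: sum_nonneg)
  next
    case False
    hence c: "c > 0" using c0 by simp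
    have "c powr \<beta> * (1 + \<beta> * (x i / c - 1)) \<le> x i powr \<beta>" if "i \<in> I" for i
    proof -
      have "c powr \<beta> * (1 + \<beta> * (x i / c - 1)) \<le> c powr \<beta> * (x i / c) powr \<beta>"
        using powr_tangent[of "x i / c" \<beta>] x[OF that] c b by (intro mult_left_mono) auto
      also have "\<dots> = x i powr \<beta>" using x[OF that] c by (simp add: powr_divide)
      finally show ?thesis .
    qed
    hence "(\<Sum>i\<in>I. w i * (c powr \<beta> * (1 + \<beta> * (x i / c - 1)))) \<le> (\<Sum>i\<in>I. w i * x i powr \<beta>)"
      using w by (intro sum_mono mult_left_mono) auto
    also have "(\<Sum>i\<in>I. w i * (c powr \<beta> * (1 + \<beta> * (x i / c - 1))))
        = (\<Sum>i\<in>I. (c powr \<beta> * (1 - \<beta>)) * w i + (c powr \<beta> * \<beta> / c) * (w i * x i))"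
      using c by (intro sum.cong refl) (simp add: field_simps)
    also have "\<dots> = c powr \<beta> * (1 - \<beta>) * sum w I + c powr \<beta> * \<beta>"
    proof -
      have "(\<Sum>i\<in>I. (c powr \<beta> * \<beta> / c) * (w i * x i)) = (c powr \<beta> * \<beta> / c) * c"
        unfolding c_def by (rule sum_distrib_left[symmetric])
      thus ?thesis using c by (simp add: sum.distrib sum_distrib_left[symmetric])
    qed
    finally have "c powr \<beta> * ((1 - \<beta>) * sum w I + \<beta>) \<le> (\<Sum>i\<in>I. w i * x i powr \<beta>)"
      by (simp add: algebra_simps)
    moreover have "1 \<le> (1 - \<beta>) * sum w I + \<beta>"
    proof -
      have "(\<beta> - 1) * sum w I \<le> (\<beta> - 1) * 1" using w b by (intro mult_left_mono) auto
      thus ?thesis by (simp add: algebra_simps)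
    qed
    hence "c powr \<beta> * 1 \<le> c powr \<beta> * ((1 - \<beta>) * sum w I + \<beta>)" by (intro mult_left_mono) auto
    ultimately show ?thesis unfolding c_def[symmetric] by simp
  qed
qed

text \<open>The convex case with exponent 1 / \<alpha>, applied to the values
  \<open>x i powr \<alpha>\<close>.\<close>

lemma jensen_powr_concave:
  fixes w x :: "'a \<Rightarrow> real"
  assumes fin: "finite I" and w: "\<And>i. i \<in> I \<Longrightarrow> w i \<ge> 0" "sum w I \<le> 1"
    and x: "\<And>i. i \<in> I \<Longrightarrow> x i \<ge> 0" and a: "0 < \<alpha>" "\<alpha> \<le> 1"
  shows "(\<Sum>i\<in>I. w i * x i powr \<alpha>) \<le> (\<Sum>i\<in>I. w i * x i) powr \<alpha>"
proof -
  let ?s = "\<Sum>i\<in>I. w i * x i powr \<alpha>"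
  have s0: "?s \<ge> 0" using w by (auto intro!: sum_nonneg)
  have "?s powr (1/\<alpha>) \<le> (\<Sum>i\<in>I. w i * (x i powr \<alpha>) powr (1/\<alpha>))"
    using assms by (intro jensen_powr) auto
  also have "\<dots> = (\<Sum>i\<in>I. w i * x i)" using a x by (intro sum.cong) (auto simp: powr_powr)
  finally have "(?s powr (1/\<alpha>)) powr \<alpha> \<le> (\<Sum>i\<in>I. w i * x i) powr \<alpha>" using a by (intro powr_mono2) auto
  thus ?thesis using a s0 by (simp add: powr_powr)
qed

text \<open>Both families are divided by their sums and the weighted mean inequality is applied to
  each term.\<close>

lemma holder_powr:
  fixes a b :: "'a \<Rightarrow> real"
  assumes fin: "finite I" and ab: "\<And>i. i \<in> I \<Longrightarrow> a i \<ge> 0" "\<And>i. i \<in> I \<Longrightarrow> b i \<ge> 0"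
    and t: "0 < t" "t < 1"
  shows "(\<Sum>i\<in>I. a i powr t * b i powr (1 - t)) \<le> sum a I powr t * sum b I powr (1 - t)"
proof -
  let ?A = "sum a I" and ?B = "sum b I"
  have AB: "?A \<ge> 0" "?B \<ge> 0" using ab by (auto intro!: sum_nonneg)
  show ?thesis
  proof (cases "?A = 0 \<or> ?B = 0")
    case True
    hence "\<And>i. i \<in> I \<Longrightarrow> a i = 0 \<or> b i = 0"
      using sum_nonneg_eq_0_iff[OF fin, of a] sum_nonneg_eq_0_iff[OF fin, of b] ab by auto
    hence "(\<Sum>i\<in>I. a i powr t * b i powr (1 - t)) = 0" by (intro sum.neutral) auto
    thus ?thesis by simp
  next
    case False
    hence pos: "?A > 0" "?B > 0" using AB by auto
    have "a i powr t * b i powr (1 - t) \<le> ?A powr t * ?B powr (1 - t) * (t * (a i / ?A) + (1 - t) * (b i / ?B))"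
      if "i \<in> I" for i
    proof -
      have "a i powr t * b i powr (1 - t) = ?A powr t * ?B powr (1 - t) * ((a i / ?A) powr t * (b i / ?B) powr (1 - t))"
        using pos ab[OF that] by (simp add: powr_divide)
      also have "\<dots> \<le> ?A powr t * ?B powr (1 - t) * (t * (a i / ?A) + (1 - t) * (b i / ?B))"
        using pos ab[OF that] t by (intro mult_left_mono weighted_am_gm) auto
      finally show ?thesis .
    qed
    hence "(\<Sum>i\<in>I. a i powr t * b i powr (1 - t)) \<le> (\<Sum>i\<in>I. ?A powr t * ?B powr (1 - t) * (t * (a i / ?A) + (1 - t) * (b i / ?B)))"
      by (rule sum_mono)
    also have "\<dots> = ?A powr t * ?B powr (1 - t) * (t * (?A / ?A) + (1 - t) * (?B / ?B))"
      by (simp add: sum_distrib_left[symmetric] sum.distrib sum_divide_distrib[symmetric])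
    also have "\<dots> = ?A powr t * ?B powr (1 - t)" using pos by simp
    finally show ?thesis .
  qed
qed

text \<open>The bound on sums over i permits Jensen's inequality for each a; the bound on sums over
  a then controls the total.\<close>

lemma substochastic_convex:
  fixes w :: "'a \<Rightarrow> 'b \<Rightarrow> real"
  assumes fin: "finite I" "finite J" and w: "\<And>a i. a \<in> J \<Longrightarrow> i \<in> I \<Longrightarrow> w a i \<ge> 0"
    "\<And>a. a \<in> J \<Longrightarrow> (\<Sum>i\<in>I. w a i) \<le> 1" "\<And>i. i \<in> I \<Longrightarrow> (\<Sum>a\<in>J. w a i) \<le> 1"
    and x: "\<And>i. i \<in> I \<Longrightarrow> x i \<ge> 0" and b: "\<beta> \<ge> 1"
  shows "(\<Sum>a\<in>J. (\<Sum>i\<in>I. w a i * x i) powr \<beta>) \<le> (\<Sum>i\<in>I. x i powr \<beta>)"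
proof -
  have "(\<Sum>a\<in>J. (\<Sum>i\<in>I. w a i * x i) powr \<beta>) \<le> (\<Sum>a\<in>J. \<Sum>i\<in>I. w a i * x i powr \<beta>)"
    using assms by (intro sum_mono jensen_powr) auto
  also have "\<dots> = (\<Sum>i\<in>I. (\<Sum>a\<in>J. w a i) * x i powr \<beta>)"
    by (subst sum.swap) (simp add: sum_distrib_right)
  also have "\<dots> \<le> (\<Sum>i\<in>I. 1 * x i powr \<beta>)" using w by (intro sum_mono mult_right_mono) auto
  finally show ?thesis by simp
qed

text \<open>The weights are inserted on the smaller side, so their sum over a has to be exactly 1;
  the sum over i may stay below 1.\<close>

lemma stochastic_concave:
  fixes w :: "'a \<Rightarrow> 'b \<Rightarrow> real"
  assumes fin: "finite I" "finite J" and w: "\<And>a i. a \<in> J \<Longrightarrow> i \<in> I \<Longrightarrow> w a i \<ge> 0"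
    "\<And>a. a \<in> J \<Longrightarrow> (\<Sum>i\<in>I. w a i) \<le> 1" "\<And>i. i \<in> I \<Longrightarrow> (\<Sum>a\<in>J. w a i) = 1"
    and x: "\<And>i. i \<in> I \<Longrightarrow> x i \<ge> 0" and a: "0 < \<alpha>" "\<alpha> \<le> 1"
  shows "(\<Sum>i\<in>I. x i powr \<alpha>) \<le> (\<Sum>a\<in>J. (\<Sum>i\<in>I. w a i * x i) powr \<alpha>)"
proof -
  have "(\<Sum>i\<in>I. x i powr \<alpha>) = (\<Sum>i\<in>I. (\<Sum>a\<in>J. w a i) * x i powr \<alpha>)" using w by simp
  also have "\<dots> = (\<Sum>a\<in>J. \<Sum>i\<in>I. w a i * x i powr \<alpha>)"
    by (subst sum.swap) (simp add: sum_distrib_right)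
  also have "\<dots> \<le> (\<Sum>a\<in>J. (\<Sum>i\<in>I. w a i * x i) powr \<alpha>)"
    using assms by (intro sum_mono jensen_powr_concave) auto
  finally show ?thesis .
qed

text \<open>Joint convexity of p^\<beta> q^(1-\<beta>): Jensen's inequality for the ratios p / q
  with weights w q / Q. Absolute continuity guarantees that no mass of p is lost where q =
  0.\<close>

lemma perspective_powr:
  fixes w p q :: "'a \<Rightarrow> real"
  assumes fin: "finite I" and w: "\<And>i. i \<in> I \<Longrightarrow> w i \<ge> 0"
    and p: "\<And>i. i \<in> I \<Longrightarrow> p i \<ge> 0" and q: "\<And>i. i \<in> I \<Longrightarrow> q i \<ge> 0"
    and ac: "\<And>i. i \<in> I \<Longrightarrow> q i = 0 \<Longrightarrow> p i = 0" and b: "\<beta> \<ge> 1"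
  shows "(\<Sum>i\<in>I. w i * p i) powr \<beta> * (\<Sum>i\<in>I. w i * q i) powr (1 - \<beta>)
    \<le> (\<Sum>i\<in>I. w i * (p i powr \<beta> * q i powr (1 - \<beta>)))"
proof -
  let ?Q = "\<Sum>i\<in>I. w i * q i"
  have Q0: "?Q \<ge> 0" using w q by (auto intro!: sum_nonneg)
  show ?thesis
  proof (cases "?Q = 0")
    case True thus ?thesis using w by (auto intro!: sum_nonneg)
  next
    case False
    hence Q: "?Q > 0" using Q0 by simp
    have "(\<Sum>i\<in>I. (w i * q i / ?Q) * (p i / q i)) powr \<beta> \<le> (\<Sum>i\<in>I. (w i * q i / ?Q) * (p i / q i) powr \<beta>)"
      using w p q Q b fin by (intro jensen_powr) (auto simp: sum_divide_distrib[symmetric])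
    also have "(\<Sum>i\<in>I. (w i * q i / ?Q) * (p i / q i)) = (\<Sum>i\<in>I. w i * p i) / ?Q"
      unfolding sum_divide_distrib using ac by (intro sum.cong refl) auto
    also have "(\<Sum>i\<in>I. (w i * q i / ?Q) * (p i / q i) powr \<beta>) = (\<Sum>i\<in>I. w i * (p i powr \<beta> * q i powr (1 - \<beta>))) / ?Q"
      unfolding sum_divide_distrib
    proof (intro sum.cong refl)
      fix i assume i: "i \<in> I"
      show "(w i * q i / ?Q) * (p i / q i) powr \<beta> = w i * (p i powr \<beta> * q i powr (1 - \<beta>)) / ?Q"
        using p[OF i] q[OF i] by (cases "q i = 0") (auto simp: powr_divide powr_diff field_simps)
    qed
    finally have "((\<Sum>i\<in>I. w i * p i) / ?Q) powr \<beta> * ?Q \<le> (\<Sum>i\<in>I. w i * (p i powr \<beta> * q i powr (1 - \<beta>)))"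
      using Q by (simp add: pos_le_divide_eq)
    moreover have "((\<Sum>i\<in>I. w i * p i) / ?Q) powr \<beta> * ?Q = (\<Sum>i\<in>I. w i * p i) powr \<beta> * ?Q powr (1 - \<beta>)"
      using Q w p by (simp add: powr_divide powr_diff sum_nonneg)
    ultimately show ?thesis by simp
  qed
qed

section \<open>Trace powers and diagonal entries\<close>

definition trp :: "complex mat \<Rightarrow> real \<Rightarrow> real" where
  "trp X a = Re (mtrace (mpow X a))"

lemma trp_spectral:
  assumes "unitary n U" "X = U * rdiag n f * adj U"
  shows "trp X a = (\<Sum>i<n. f i powr a)"
  unfolding trp_def mpow_eq[OF assms] mtrace_unitary_conj(1)[OF assms(1) mat_diag_dim] mtrace_rdiag by simp

lemma trp_unitary_conj:
  assumes V: "unitary n V" and X: "psd n X"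
  shows "trp (adj V * X * V) a = trp X a"
proof -
  from psd_spectral[OF X] obtain U f where U: "unitary n U" "X = U * rdiag n f * adj U" by blast
  note c = unitaryD[OF V] unitaryD[OF U(1)]
  have "adj V * X * V = (adj V * U) * rdiag n f * adj (adj V * U)"
    unfolding U(2) using c by (simp add: adj_mult[of _ n n _ n] mat_assoc[of _ n] mult_carrier_sq[of _ n])
  from trp_spectral[OF unitary_mult[OF unitary_adj[OF V] U(1)] this]
  show ?thesis using trp_spectral[OF U] by simp
qed

lemma trp_nonneg: assumes "psd n X" shows "trp X a \<ge> 0"
proof -
  from psd_spectral[OF assms] obtain U f where U: "unitary n U" "X = U * rdiag n f * adj U" by blast
  show ?thesis unfolding trp_spectral[OF U] by (intro sum_nonneg) auto
qed

lemma trp_zero_iff: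
  assumes X: "psd n X" and z: "trp X a = 0" shows "X = 0\<^sub>m n n"
proof -
  from psd_spectral[OF X] obtain U f where U: "unitary n U" "\<And>i. f i \<ge> 0" "X = U * rdiag n f * adj U" by blast
  have "\<forall>i\<in>{..<n}. f i powr a = 0"
    using z trp_spectral[OF U(1,3)] by (subst sum_nonneg_eq_0_iff[symmetric]) auto
  hence "rdiag n f = 0\<^sub>m n n" by (intro eq_matI) auto
  thus ?thesis unfolding U(3) using unitaryD[OF U(1)] by simp
qed

lemma diag_factor_entry:
  assumes "F \<in> carrier_mat n n" "E \<in> carrier_mat n n" "a < n" "b < n"
  shows "(F * rdiag n l * adj E) $$ (a,b) = (\<Sum>i<n. F $$ (a,i) * complex_of_real (l i) * cnj (E $$ (b,i)))"
  using assms by (subst mult_mat_index[of _ n n _ n]) (auto simp: mat_diag_mult_right[OF assms(1)])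

lemma spectral_diag_entry:
  assumes "unitary n U" "a < n"
  shows "(U * rdiag n f * adj U) $$ (a,a) = complex_of_real (\<Sum>i<n. (cmod (U $$ (a,i)))\<^sup>2 * f i)"
proof -
  note c = unitaryD(1)[OF assms(1)]
  show ?thesis unfolding diag_factor_entry[OF c c assms(2,2)] of_real_sum
  proof (rule sum.cong[OF refl])
    fix i
    have "U $$ (a,i) * complex_of_real (f i) * cnj (U $$ (a,i)) = U $$ (a,i) * cnj (U $$ (a,i)) * complex_of_real (f i)" by simp
    thus "U $$ (a,i) * complex_of_real (f i) * cnj (U $$ (a,i)) = complex_of_real ((cmod (U $$ (a,i)))\<^sup>2 * f i)"
      unfolding cmod_sq by simp
  qed
qed

lemma gram_diag_entry:
  assumes "G \<in> carrier_mat n m" "i < m"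
  shows "(adj G * G) $$ (i,i) = complex_of_real (\<Sum>a<n. (cmod (G $$ (a,i)))\<^sup>2)"
  unfolding mult_mat_index[OF adj_carrier[OF assms(1)] assms(1,2,2)] of_real_sum
  by (rule sum.cong) (use assms in \<open>auto simp: cmod_sq\<close>)

lemma cogram_diag_entry:
  assumes "G \<in> carrier_mat n m" "i < n"
  shows "(G * adj G) $$ (i,i) = complex_of_real (\<Sum>a<m. (cmod (G $$ (i,a)))\<^sup>2)"
  unfolding mult_mat_index[OF assms(1) adj_carrier[OF assms(1)] assms(2,2)] of_real_sum
  by (rule sum.cong) (use assms in \<open>auto simp: cmod_sq\<close>)

text \<open>Schur's majorisation: the diagonal arises from the spectrum by the doubly stochastic
  matrix of squared moduli of a unitary.\<close>

lemma diag_powr_le_trp: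
  assumes X: "psd n X" and b: "\<beta> \<ge> 1"
  shows "(\<Sum>a<n. Re (X $$ (a,a)) powr \<beta>) \<le> trp X \<beta>"
proof -
  from psd_spectral[OF X] obtain U f where U: "unitary n U" "\<And>i. f i \<ge> 0" "X = U * rdiag n f * adj U" by blast
  have "(\<Sum>a<n. Re (X $$ (a,a)) powr \<beta>) = (\<Sum>a<n. (\<Sum>i<n. (cmod (U $$ (a,i)))\<^sup>2 * f i) powr \<beta>)"
    unfolding U(3) by (intro sum.cong refl) (simp add: spectral_diag_entry[OF U(1)])
  also have "\<dots> \<le> (\<Sum>i<n. f i powr \<beta>)"
    using U(2) b unitary_row_norm[OF U(1)] unitary_col_norm[OF U(1)] by (intro substochastic_convex) auto
  finally show ?thesis using trp_spectral[OF U(1,3)] by simp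
qed

lemma trp_le_diag_powr:
  assumes X: "psd n X" and a: "0 < \<alpha>" "\<alpha> \<le> 1"
  shows "trp X \<alpha> \<le> (\<Sum>a<n. Re (X $$ (a,a)) powr \<alpha>)"
proof -
  from psd_spectral[OF X] obtain U f where U: "unitary n U" "\<And>i. f i \<ge> 0" "X = U * rdiag n f * adj U" by blast
  have "(\<Sum>a<n. Re (X $$ (a,a)) powr \<alpha>) = (\<Sum>a<n. (\<Sum>i<n. (cmod (U $$ (a,i)))\<^sup>2 * f i) powr \<alpha>)"
    unfolding U(3) by (intro sum.cong refl) (simp add: spectral_diag_entry[OF U(1)])
  moreover have "(\<Sum>i<n. f i powr \<alpha>) \<le> \<dots>"
    using U(2) a unitary_row_norm[OF U(1)] unitary_col_norm[OF U(1)] by (intro stochastic_concave) auto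
  ultimately show ?thesis using trp_spectral[OF U(1,3)] by simp
qed

text \<open>In an eigenbasis of Y the diagonal of X lies below the spectrum of Y, and in every basis
  the diagonal powers of X bound its trace power from above. This yields monotonicity under the
  trace without operator monotone functions.\<close>

lemma trp_mono_concave:
  assumes X: "psd n X" and Y: "psd n Y" and YX: "psd n (Y - X)" and a: "0 < \<alpha>" "\<alpha> \<le> 1"
  shows "trp X \<alpha> \<le> trp Y \<alpha>"
proof -
  from psd_spectral[OF Y] obtain U f where U: "unitary n U" "\<And>i. f i \<ge> 0" "Y = U * rdiag n f * adj U" by blast
  note c = unitaryD[OF U(1)] psdD(1)[OF X] psdD(1)[OF Y]
  have XU: "psd n (adj U * X * U)" by (rule psd_conj[OF X c(1)])
  have d: "Re ((adj U * X * U) $$ (a,a)) \<le> f a" if "a < n" for a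
  proof -
    have "adj U * (Y - X) * U = adj U * Y * U - adj U * X * U"
      using c by (simp add: mult_minus_distrib_mat[of _ n n _ n] minus_mult_distrib_mat[of _ n n _ _ n] mult_carrier_sq[of _ n])
    also have "adj U * Y * U = rdiag n f" unfolding U(3) by (rule unitary_conj_inverse(2)[OF U(1)]) auto
    finally have p: "psd n (rdiag n f - adj U * X * U)" using psd_conj[OF YX c(1)] by simp
    have m: "adj U * X * U \<in> carrier_mat n n" by (rule psdD(1)[OF XU])
    have "(rdiag n f - adj U * X * U) $$ (a,a) = complex_of_real (f a) - (adj U * X * U) $$ (a,a)"
      using that m by (simp only: index_minus_mat carrier_matD) simp
    thus ?thesis using psd_diag_entry(2)[OF p that] by simp
  qed
  have "trp X \<alpha> = trp (adj U * X * U) \<alpha>" using trp_unitary_conj[OF U(1) X] by simp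
  also have "\<dots> \<le> (\<Sum>a<n. Re ((adj U * X * U) $$ (a,a)) powr \<alpha>)" by (rule trp_le_diag_powr[OF XU a])
  also have "\<dots> \<le> (\<Sum>a<n. f a powr \<alpha>)"
    using d psd_diag_entry(2)[OF XU] a by (intro sum_mono powr_mono2) auto
  finally show ?thesis using trp_spectral[OF U(1,3)] by simp
qed

subsection \<open>Pinching\<close>

lemma cmod_sum_sq_le:
  assumes "finite K" shows "(cmod (\<Sum>k\<in>K. z k))\<^sup>2 \<le> real (card K) * (\<Sum>k\<in>K. (cmod (z k))\<^sup>2)"
proof -
  have "(cmod (\<Sum>k\<in>K. z k))\<^sup>2 \<le> (\<Sum>k\<in>K. 1 * cmod (z k))\<^sup>2" by (intro power_mono) (auto simp: norm_sum)
  also have "\<dots> \<le> (\<Sum>k\<in>K. 1\<^sup>2) * (\<Sum>k\<in>K. (cmod (z k))\<^sup>2)" by (rule Cauchy_Schwarz_ineq_sum)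
  finally show ?thesis by simp
qed

text \<open>The pinching inequality as a bound on quadratic forms. Splitting e into its class
  components and applying Cauchy-Schwarz costs the number of classes; inside a class X is diagonal,
  so only diagonal entries survive.\<close>

lemma pinching_form_le:
  fixes cl :: "nat \<Rightarrow> 'c"
  assumes X: "psd n X" and cl: "\<And>a b. a < n \<Longrightarrow> b < n \<Longrightarrow> a \<noteq> b \<Longrightarrow> cl a = cl b \<Longrightarrow> X $$ (a,b) = 0"
  shows "Re (\<Sum>a<n. \<Sum>b<n. cnj (e a) * X $$ (a,b) * e b)
    \<le> real (card (cl ` {..<n})) * (\<Sum>a<n. (cmod (e a))\<^sup>2 * Re (X $$ (a,a)))"
proof -
  define S where "S = msqrt X"
  have S: "S \<in> carrier_mat n n" "adj S = S" "S * S = X"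
    unfolding S_def using psdD(1)[OF msqrt_psd[OF X]] psd_hermitian[OF msqrt_psd[OF X]] msqrt_mult_self[OF X] by auto
  have Xe: "X $$ (a,b) = (\<Sum>k<n. cnj (S $$ (k,a)) * S $$ (k,b))" if "a < n" "b < n" for a b
  proof -
    have "X $$ (a,b) = (adj S * S) $$ (a,b)" using S by simp
    also have "\<dots> = (\<Sum>k<n. adj S $$ (a,k) * S $$ (k,b))"
      by (rule mult_mat_index[OF adj_carrier[OF S(1)] S(1) that])
    finally show ?thesis using that S(1) by simp
  qed
  \<comment> \<open>With X = \<open>adj S * S\<close> the form over any set of indices becomes a sum
    of squares, to which the splitting into classes applies.\<close>
  have form: "(\<Sum>a\<in>A. \<Sum>b\<in>A. cnj (e a) * X $$ (a,b) * e b)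
      = complex_of_real (\<Sum>k<n. (cmod (\<Sum>a\<in>A. S $$ (k,a) * e a))\<^sup>2)" if A: "A \<subseteq> {..<n}" for A
  proof -
    have "(\<Sum>a\<in>A. \<Sum>b\<in>A. cnj (e a) * X $$ (a,b) * e b)
        = (\<Sum>a\<in>A. \<Sum>b\<in>A. \<Sum>k<n. cnj (S $$ (k,a) * e a) * (S $$ (k,b) * e b))"
      using A by (intro sum.cong refl) (subst Xe, auto simp: sum_distrib_left sum_distrib_right mult_ac)
    also have "\<dots> = (\<Sum>a\<in>A. \<Sum>k<n. \<Sum>b\<in>A. cnj (S $$ (k,a) * e a) * (S $$ (k,b) * e b))"
      by (intro sum.cong refl sum.swap)
    also have "\<dots> = (\<Sum>k<n. \<Sum>a\<in>A. \<Sum>b\<in>A. cnj (S $$ (k,a) * e a) * (S $$ (k,b) * e b))"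
      by (rule sum.swap)
    also have "\<dots> = (\<Sum>k<n. cnj (\<Sum>a\<in>A. S $$ (k,a) * e a) * (\<Sum>a\<in>A. S $$ (k,a) * e a))"
      by (simp add: sum_product)
    finally show ?thesis unfolding cmod_sq by simp
  qed
  define K where "K = cl ` {..<n}"
  define B where "B c = {a\<in>{..<n}. cl a = c}" for c
  have fin: "finite K" "\<And>c. finite (B c)" by (auto simp: K_def B_def)
  have split: "(\<Sum>a<n. h a) = (\<Sum>c\<in>K. \<Sum>a\<in>B c. h a)" for h :: "nat \<Rightarrow> 'd::comm_monoid_add"
    unfolding K_def B_def by (rule sum.image_gen) auto
  have "Re (\<Sum>a<n. \<Sum>b<n. cnj (e a) * X $$ (a,b) * e b) = (\<Sum>k<n. (cmod (\<Sum>a<n. S $$ (k,a) * e a))\<^sup>2)"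
    unfolding form[OF subset_refl] by simp
  also have "\<dots> = (\<Sum>k<n. (cmod (\<Sum>c\<in>K. \<Sum>a\<in>B c. S $$ (k,a) * e a))\<^sup>2)" unfolding split ..
  also have "\<dots> \<le> (\<Sum>k<n. real (card K) * (\<Sum>c\<in>K. (cmod (\<Sum>a\<in>B c. S $$ (k,a) * e a))\<^sup>2))"
    by (intro sum_mono cmod_sum_sq_le fin)
  also have "\<dots> = real (card K) * (\<Sum>c\<in>K. \<Sum>k<n. (cmod (\<Sum>a\<in>B c. S $$ (k,a) * e a))\<^sup>2)"
    by (subst sum.swap) (simp add: sum_distrib_left)
  also have "(\<Sum>c\<in>K. \<Sum>k<n. (cmod (\<Sum>a\<in>B c. S $$ (k,a) * e a))\<^sup>2)
      = (\<Sum>c\<in>K. \<Sum>a\<in>B c. (cmod (e a))\<^sup>2 * Re (X $$ (a,a)))"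
  proof (rule sum.cong[OF refl])
    fix c
    have Bn: "B c \<subseteq> {..<n}" by (auto simp: B_def)
    have "complex_of_real (\<Sum>k<n. (cmod (\<Sum>a\<in>B c. S $$ (k,a) * e a))\<^sup>2)
        = (\<Sum>a\<in>B c. \<Sum>b\<in>B c. cnj (e a) * X $$ (a,b) * e b)" by (rule form[OF Bn, symmetric])
    also have "\<dots> = (\<Sum>a\<in>B c. \<Sum>b\<in>B c. if b = a then cnj (e a) * X $$ (a,a) * e a else 0)"
      by (intro sum.cong refl) (auto simp: B_def intro: cl)
    also have "\<dots> = (\<Sum>a\<in>B c. cnj (e a) * X $$ (a,a) * e a)" using fin by simp
    also have "\<dots> = (\<Sum>a\<in>B c. complex_of_real ((cmod (e a))\<^sup>2 * Re (X $$ (a,a))))"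
    proof (rule sum.cong[OF refl])
      fix a assume a: "a \<in> B c"
      have "cnj (e a) * X $$ (a,a) * e a = (cnj (e a) * e a) * X $$ (a,a)" by simp
      thus "cnj (e a) * X $$ (a,a) * e a = complex_of_real ((cmod (e a))\<^sup>2 * Re (X $$ (a,a)))"
        unfolding cmod_sq using psd_diag_entry(1)[OF X, of a] a by (auto simp: B_def)
    qed
    finally show "(\<Sum>k<n. (cmod (\<Sum>a\<in>B c. S $$ (k,a) * e a))\<^sup>2) = (\<Sum>a\<in>B c. (cmod (e a))\<^sup>2 * Re (X $$ (a,a)))"
      unfolding of_real_sum[symmetric] of_real_eq_iff .
  qed
  also have "\<dots> = (\<Sum>a<n. (cmod (e a))\<^sup>2 * Re (X $$ (a,a)))" by (rule split[symmetric])
  finally show ?thesis by (simp add: K_def)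
qed

text \<open>An eigenvalue is the form of X at a column of U, hence at most the number of classes
  times a doubly stochastic average of the diagonal; convexity sums the powers.\<close>

lemma trp_le_pinched:
  fixes cl :: "nat \<Rightarrow> 'c"
  assumes X: "psd n X" and cl: "\<And>a b. a < n \<Longrightarrow> b < n \<Longrightarrow> a \<noteq> b \<Longrightarrow> cl a = cl b \<Longrightarrow> X $$ (a,b) = 0"
    and b: "\<beta> \<ge> 1"
  shows "trp X \<beta> \<le> real (card (cl ` {..<n})) powr \<beta> * (\<Sum>a<n. Re (X $$ (a,a)) powr \<beta>)"
proof -
  from psd_spectral[OF X] obtain U f where U: "unitary n U" "\<And>i. f i \<ge> 0" "X = U * rdiag n f * adj U" by blast
  note c = unitaryD[OF U(1)] psdD(1)[OF X]
  let ?v = "real (card (cl ` {..<n}))"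
  have fi: "f i \<le> ?v * (\<Sum>a<n. (cmod (U $$ (a,i)))\<^sup>2 * Re (X $$ (a,a)))" if i: "i < n" for i
  proof -
    have "adj U * X * U = rdiag n f" unfolding U(3) by (rule unitary_conj_inverse(2)[OF U(1)]) auto
    hence "complex_of_real (f i) = (adj U * X * U) $$ (i,i)" using i by simp
    also have "\<dots> = (adj U * (X * U)) $$ (i,i)" using c by (simp add: mat_assoc[of _ n])
    also have "\<dots> = (\<Sum>a<n. adj U $$ (i,a) * (X * U) $$ (a,i))"
      using c i by (intro mult_mat_index[of _ n n _ n]) auto
    also have "\<dots> = (\<Sum>a<n. \<Sum>b<n. cnj (U $$ (a,i)) * X $$ (a,b) * U $$ (b,i))"
      using c i by (intro sum.cong refl) (auto simp: mult_mat_index[OF c(7,1)] sum_distrib_left mult.assoc simp del: index_mult_mat(1))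
    finally have "f i = Re (\<Sum>a<n. \<Sum>b<n. cnj (U $$ (a,i)) * X $$ (a,b) * U $$ (b,i))"
      by (metis Re_complex_of_real)
    also have "\<dots> \<le> ?v * (\<Sum>a<n. (cmod (U $$ (a,i)))\<^sup>2 * Re (X $$ (a,a)))" by (rule pinching_form_le[OF X cl])
    finally show ?thesis .
  qed
  have "trp X \<beta> = (\<Sum>i<n. f i powr \<beta>)" by (rule trp_spectral[OF U(1,3)])
  also have "\<dots> \<le> (\<Sum>i<n. (?v * (\<Sum>a<n. (cmod (U $$ (a,i)))\<^sup>2 * Re (X $$ (a,a)))) powr \<beta>)"
    using fi U(2) b by (intro sum_mono powr_mono2) auto
  also have "\<dots> = ?v powr \<beta> * (\<Sum>i<n. (\<Sum>a<n. (cmod (U $$ (a,i)))\<^sup>2 * Re (X $$ (a,a))) powr \<beta>)"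
    unfolding sum_distrib_left[of "?v powr \<beta>"]
    using psd_diag_entry(2)[OF X] by (intro sum.cong refl powr_mult)
  also have "\<dots> \<le> ?v powr \<beta> * (\<Sum>a<n. Re (X $$ (a,a)) powr \<beta>)"
    using psd_diag_entry(2)[OF X] b unitary_row_norm[OF U(1)] unitary_col_norm[OF U(1)]
    by (intro mult_left_mono substochastic_convex) auto
  finally show ?thesis .
qed

subsection \<open>Partial isometries and singular values\<close>

text \<open>A partial isometry in coordinates: the columns marked by \<chi> are orthonormal and all
  others vanish.\<close>

definition subiso :: "nat \<Rightarrow> complex mat \<Rightarrow> (nat \<Rightarrow> bool) \<Rightarrow> bool" where
  "subiso n G \<chi> \<longleftrightarrow> G \<in> carrier_mat n n \<and> adj G * G = rdiag n (\<lambda>i. if \<chi> i then 1 else 0)"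

lemma subiso_unitary: "unitary n U \<Longrightarrow> subiso n U (\<lambda>_. True)"
  by (auto simp: subiso_def dest: unitaryD)

lemma subiso_unitary_mult:
  assumes "unitary n V" "subiso n G \<chi>" shows "subiso n (adj V * G) \<chi>"
proof -
  have G: "G \<in> carrier_mat n n" using assms(2) by (simp add: subiso_def)
  note c = unitaryD[OF assms(1)] adj_carrier[OF G]
  have "adj (adj V * G) * (adj V * G) = adj G * (V * (adj V * G))"
    using c G by (simp add: adj_mult[of _ n n _ n] mat_assoc[of _ n] mult_carrier_sq[of _ n])
  thus ?thesis using assms(2) unitary_cancel[OF assms(1) G] c G by (simp add: subiso_def mult_carrier_sq[of _ n])
qed

text \<open>Bessel's inequality, by expanding the squared norm of the residual of X after
  subtracting its component in the range of G.\<close>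

lemma subiso_bessel:
  assumes G: "subiso n G \<chi>" and X: "X \<in> carrier_mat n n" and y: "y < n"
  shows "(\<Sum>i<n. (cmod ((adj G * X) $$ (i,y)))\<^sup>2) \<le> (\<Sum>z<n. (cmod (X $$ (z,y)))\<^sup>2)"
proof -
  have Gc: "G \<in> carrier_mat n n" and GG: "adj G * G = rdiag n (\<lambda>i. if \<chi> i then 1 else 0)"
    using G by (auto simp: subiso_def)
  define Y where "Y = adj G * X"
  have Y: "Y \<in> carrier_mat n n" using Gc X by (simp add: Y_def mult_carrier_sq[of _ n])
  define B where "B = X - G * Y"
  have B: "B \<in> carrier_mat n n" using Gc X Y by (simp add: B_def mult_carrier_sq[of _ n] minus_carrier_mat)
  note c = Gc X Y adj_carrier[OF Gc] adj_carrier[OF X] adj_carrier[OF Y]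
  have aB: "adj B = adj X - adj Y * adj G"
    unfolding B_def adj_mult[OF Gc Y, symmetric] using c by (intro eq_matI) auto
  have XG: "adj X * G = adj Y" unfolding Y_def using c by (simp add: adj_mult[of _ n n _ n])
  \<comment> \<open>The last bracket measures the mass of Y outside \<chi>, which is
    nonnegative.\<close>
  have "adj B * B = adj X * X - adj Y * Y - (adj Y * Y - adj Y * (adj G * G) * Y)"
  proof -
    have "adj B * B = adj X * X - adj X * (G * Y) - (adj Y * adj G * X - adj Y * adj G * (G * Y))"
      unfolding aB unfolding B_def
      by (simp only: minus_mult_distrib_mat[OF c(5) mult_carrier_sq[OF c(6,4)] minus_carrier_mat[OF mult_carrier_sq[OF c(1,3)]]]
          mult_minus_distrib_mat[OF c(5) c(2) mult_carrier_sq[OF c(1,3)]]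
          mult_minus_distrib_mat[OF mult_carrier_sq[OF c(6,4)] c(2) mult_carrier_sq[OF c(1,3)]])
    moreover have "adj X * (G * Y) = adj Y * Y" unfolding XG[symmetric] using c by (simp add: mat_assoc[of _ n])
    moreover have "adj Y * adj G * X = adj Y * Y" unfolding Y_def using c by (simp add: mat_assoc[of _ n] mult_carrier_sq[of _ n])
    moreover have "adj Y * adj G * (G * Y) = adj Y * (adj G * G) * Y" using c by (simp add: mat_assoc[of _ n] mult_carrier_sq[of _ n])
    ultimately show ?thesis by simp
  qed
  hence "(adj B * B) $$ (y,y) = (adj X * X) $$ (y,y) - (adj Y * Y) $$ (y,y) - ((adj Y * Y) $$ (y,y) - (adj Y * (adj G * G) * Y) $$ (y,y))"
    using y c by (simp del: index_mult_mat(1) add: mult_carrier_sq[of _ n])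
  moreover have "(adj Y * (adj G * G) * Y) $$ (y,y) = complex_of_real (\<Sum>i<n. (cmod (Y $$ (i,y)))\<^sup>2 * (if \<chi> i then 1 else 0))"
  proof -
    have "adj Y * (adj G * G) * Y = adj Y * rdiag n (\<lambda>i. if \<chi> i then 1 else 0) * adj (adj Y)" by (simp add: GG)
    also have "\<dots> $$ (y,y) = (\<Sum>i<n. adj Y $$ (y,i) * complex_of_real (if \<chi> i then 1 else 0) * cnj (adj Y $$ (y,i)))"
      by (rule diag_factor_entry[OF c(6,6) y y])
    also have "\<dots> = complex_of_real (\<Sum>i<n. (cmod (Y $$ (i,y)))\<^sup>2 * (if \<chi> i then 1 else 0))"
      unfolding of_real_sum by (rule sum.cong) (use y Y in \<open>auto simp: cmod_sq\<close>)
    finally show ?thesis .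
  qed
  ultimately have "complex_of_real (\<Sum>a<n. (cmod (B $$ (a,y)))\<^sup>2)
     = complex_of_real ((\<Sum>z<n. (cmod (X $$ (z,y)))\<^sup>2) - (\<Sum>i<n. (cmod (Y $$ (i,y)))\<^sup>2)
       - ((\<Sum>i<n. (cmod (Y $$ (i,y)))\<^sup>2) - (\<Sum>i<n. (cmod (Y $$ (i,y)))\<^sup>2 * (if \<chi> i then 1 else 0))))"
    unfolding gram_diag_entry[OF B y] gram_diag_entry[OF X y] gram_diag_entry[OF Y y] by simp
  hence "(\<Sum>a<n. (cmod (B $$ (a,y)))\<^sup>2)
     = ((\<Sum>z<n. (cmod (X $$ (z,y)))\<^sup>2) - (\<Sum>i<n. (cmod (Y $$ (i,y)))\<^sup>2)
       - ((\<Sum>i<n. (cmod (Y $$ (i,y)))\<^sup>2) - (\<Sum>i<n. (cmod (Y $$ (i,y)))\<^sup>2 * (if \<chi> i then 1 else 0))))"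
    unfolding of_real_eq_iff .
  moreover have "(\<Sum>a<n. (cmod (B $$ (a,y)))\<^sup>2) \<ge> 0" by (intro sum_nonneg) auto
  moreover have "(\<Sum>i<n. (cmod (Y $$ (i,y)))\<^sup>2 * (if \<chi> i then 1 else 0)) \<le> (\<Sum>i<n. (cmod (Y $$ (i,y)))\<^sup>2)"
    by (intro sum_mono) auto
  ultimately show ?thesis unfolding Y_def[symmetric] by linarith
qed

lemma subiso_col:
  assumes "subiso n G \<chi>" "i < n" shows "(\<Sum>a<n. (cmod (G $$ (a,i)))\<^sup>2) \<le> 1"
proof -
  have G: "G \<in> carrier_mat n n" using assms by (simp add: subiso_def)
  have "complex_of_real (\<Sum>a<n. (cmod (G $$ (a,i)))\<^sup>2) = complex_of_real (if \<chi> i then 1 else 0)"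
    using gram_diag_entry[OF G assms(2)] assms by (simp add: subiso_def)
  thus ?thesis unfolding of_real_eq_iff by simp
qed

text \<open>Bessel's inequality at the identity matrix turns the column relations into a bound on
  the rows.\<close>

lemma subiso_row:
  assumes "subiso n G \<chi>" "a < n" shows "(\<Sum>i<n. (cmod (G $$ (a,i)))\<^sup>2) \<le> 1"
proof -
  have G: "G \<in> carrier_mat n n" using assms by (simp add: subiso_def)
  have "(\<Sum>i<n. (cmod ((adj G * 1\<^sub>m n) $$ (i,a)))\<^sup>2) \<le> (\<Sum>z<n. (cmod (1\<^sub>m n $$ (z,a)))\<^sup>2)"
    by (rule subiso_bessel[OF assms(1) _ assms(2)]) simp
  also have "(\<Sum>z<n. (cmod (1\<^sub>m n $$ (z,a)))\<^sup>2) = (\<Sum>z<n. if z = a then 1 else 0)"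
    using assms by (intro sum.cong) auto
  also have "\<dots> = 1" using assms by simp
  finally show ?thesis using G assms right_mult_one_mat[OF adj_carrier[OF G]] by simp
qed

text \<open>E diagonalises \<open>adj A * A\<close>, l holds the roots of its eigenvalues, and F is
  A E divided by l. Since \<open>inverse 0 = 0\<close>, columns of F at vanishing singular values
  become 0, which makes F a partial isometry.\<close>

lemma svd:
  assumes A: "A \<in> carrier_mat n n"
  obtains E F l where "unitary n E" "subiso n F (\<lambda>i. l i \<noteq> 0)" "\<And>i. l i \<ge> 0"
    "A = F * rdiag n l * adj E" "trace_norm A = (\<Sum>i<n. l i)"
proof -
  have G: "psd n (adj A * A)" by (rule psd_gram[OF A])
  from psd_spectral[OF G] obtain E f where E: "unitary n E" "\<And>i. f i \<ge> 0" "adj A * A = E * rdiag n f * adj E" by blast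
  note c = unitaryD[OF E(1)] adj_carrier[OF A]
  define l where "l i = sqrt (f i)" for i
  have l: "l i \<ge> 0" "f i = l i * l i" for i using E(2) by (auto simp: l_def)
  define F where "F = A * E * rdiag n (\<lambda>i. inverse (l i))"
  have F: "F \<in> carrier_mat n n" using A c by (simp add: F_def mult_carrier_sq[of _ n])
  have AE: "adj (A * E) * (A * E) = rdiag n f"
  proof -
    have "adj (A * E) * (A * E) = adj E * (adj A * A) * E"
      using A c by (simp add: adj_mult[of _ n n _ n] mat_assoc[of _ n] mult_carrier_sq[of _ n])
    also have "\<dots> = rdiag n f" unfolding E(3) by (rule unitary_conj_inverse(2)[OF E(1)]) auto
    finally show ?thesis .
  qed
  have AEc: "A * E \<in> carrier_mat n n" using A c by (simp add: mult_carrier_sq[of _ n])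
  have "adj F * F = rdiag n (\<lambda>i. inverse (l i)) * (adj (A * E) * (A * E)) * rdiag n (\<lambda>i. inverse (l i))"
    unfolding F_def adj_mult[OF AEc mat_diag_dim] adj_rdiag using AEc adj_carrier[OF AEc]
    by (simp only: mat_assoc[of _ n] mult_carrier_sq[of _ n] mat_diag_dim)
  also have "\<dots> = rdiag n (\<lambda>i. if l i \<noteq> 0 then 1 else 0)"
    unfolding AE by (simp, intro eq_matI) (auto simp: l field_simps)
  finally have sF: "subiso n F (\<lambda>i. l i \<noteq> 0)" using F by (simp add: subiso_def)
  have "F * rdiag n l = A * E"
  proof (rule eq_matI)
    fix i j assume "i < dim_row (A * E)" "j < dim_col (A * E)"
    hence ij: "i < n" "j < n" using AEc by auto
    have "(F * rdiag n l) $$ (i,j) = (A * E) $$ (i,j) * complex_of_real (inverse (l j)) * complex_of_real (l j)"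
      unfolding mat_diag_mult_right[OF F] using ij by (simp add: F_def mat_diag_mult_right[OF AEc] del: index_mult_mat(1))
    also have "\<dots> = (A * E) $$ (i,j)"
    proof (cases "l j = 0")
      case True
      have "complex_of_real (\<Sum>a<n. (cmod ((A * E) $$ (a,j)))\<^sup>2) = complex_of_real 0"
        using gram_diag_entry[OF AEc ij(2)] ij True l(2)[of j] unfolding AE by simp
      hence "(\<Sum>a<n. (cmod ((A * E) $$ (a,j)))\<^sup>2) = 0" unfolding of_real_eq_iff .
      hence "\<forall>a\<in>{..<n}. (cmod ((A * E) $$ (a,j)))\<^sup>2 = 0" by (subst (asm) sum_nonneg_eq_0_iff) auto
      hence "(A * E) $$ (i,j) = 0" using ij by (auto simp del: index_mult_mat(1))
      thus ?thesis by (simp del: index_mult_mat(1))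
    qed (simp del: index_mult_mat(1) add: mult.assoc)
    finally show "(F * rdiag n l) $$ (i,j) = (A * E) $$ (i,j)" .
  qed (use F A c in auto)
  hence "F * rdiag n l * adj E = A" using A c by (simp add: mat_assoc[of _ n])
  moreover have "trace_norm A = (\<Sum>i<n. l i)"
    unfolding trace_norm_def msqrt_eq[OF E(1,3)] mtrace_unitary_conj(1)[OF E(1) mat_diag_dim] mtrace_rdiag by (simp add: l_def)
  ultimately show ?thesis using that[OF E(1) sF l(1)] by simp
qed

text \<open>The normalised adjoints of the orthogonal rows form a partial isometry G, and the row
  norms are diagonal entries of A G. Expanding A by its singular values bounds each row norm by a
  doubly substochastic average of them.\<close>

lemma orthogonal_rows_powr:
  assumes F: "subiso n F \<chi>" and E: "unitary n E" and l: "\<And>i. l i \<ge> 0"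
    and A: "A = F * rdiag n l * adj E" and C: "C \<subseteq> {..<n}"
    and orth: "\<And>a b. a \<in> C \<Longrightarrow> b \<in> C \<Longrightarrow> a \<noteq> b \<Longrightarrow> (A * adj A) $$ (a,b) = 0" and g: "\<gamma> \<ge> 1"
  shows "(\<Sum>a\<in>C. sqrt (Re ((A * adj A) $$ (a,a))) powr \<gamma>) \<le> (\<Sum>i<n. l i powr \<gamma>)"
proof -
  have Fc: "F \<in> carrier_mat n n" using F by (simp add: subiso_def)
  note c = Fc unitaryD[OF E]
  have Ac: "A \<in> carrier_mat n n" using c by (simp add: A mult_carrier_sq[of _ n])
  define N where "N a = sqrt (\<Sum>z<n. (cmod (A $$ (a,z)))\<^sup>2)" for a
  have N: "N a \<ge> 0" "N a * N a = (\<Sum>z<n. (cmod (A $$ (a,z)))\<^sup>2)" for a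
    by (auto simp: N_def sum_nonneg)
  have NA: "sqrt (Re ((A * adj A) $$ (a,a))) = N a" if "a < n" for a
    unfolding cogram_diag_entry[OF Ac that] N_def by simp
  define G where "G = Matrix.mat n n (\<lambda>(z,a). if a \<in> C then cnj (A $$ (a,z)) / complex_of_real (N a) else 0)"
  have Gc: "G \<in> carrier_mat n n" by (simp add: G_def)
  have "adj G * G = rdiag n (\<lambda>a. if a \<in> C \<and> N a \<noteq> 0 then 1 else 0)"
  proof (rule eq_matI)
    fix a b assume "a < dim_row (rdiag n (\<lambda>a. if a \<in> C \<and> N a \<noteq> 0 then 1 else 0))" "b < dim_col (rdiag n (\<lambda>a. if a \<in> C \<and> N a \<noteq> 0 then 1 else 0))"
    hence ab: "a < n" "b < n" by auto
    have "(adj G * G) $$ (a,b) = (\<Sum>z<n. adj G $$ (a,z) * G $$ (z,b))"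
      by (rule mult_mat_index[OF adj_carrier[OF Gc] Gc ab])
    also have "\<dots> = (\<Sum>z<n. if a \<in> C \<and> b \<in> C then A $$ (a,z) * adj A $$ (z,b) / (complex_of_real (N a) * complex_of_real (N b)) else 0)"
      using ab Gc Ac by (intro sum.cong refl) (auto simp: G_def)
    also have "\<dots> = (if a \<in> C \<and> b \<in> C then (A * adj A) $$ (a,b) / (complex_of_real (N a) * complex_of_real (N b)) else 0)"
      unfolding mult_mat_index[OF Ac adj_carrier[OF Ac] ab] sum_divide_distrib
      by (cases "a \<in> C \<and> b \<in> C") (auto intro!: sum.neutral)
    also have "\<dots> = rdiag n (\<lambda>a. if a \<in> C \<and> N a \<noteq> 0 then 1 else 0) $$ (a,b)"
    proof (cases "a = b")
      case True
      have "(A * adj A) $$ (a,a) = complex_of_real (N a) * complex_of_real (N a)"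
        unfolding cogram_diag_entry[OF Ac ab(1)] N(2)[symmetric] by simp
      thus ?thesis using True ab by (simp del: index_mult_mat(1))
    next
      case False thus ?thesis using orth ab by (auto simp del: index_mult_mat(1))
    qed
    finally show "(adj G * G) $$ (a,b) = rdiag n (\<lambda>a. if a \<in> C \<and> N a \<noteq> 0 then 1 else 0) $$ (a,b)" .
  qed (use Gc in auto)
  hence G: "subiso n G (\<lambda>a. a \<in> C \<and> N a \<noteq> 0)" using Gc by (simp add: subiso_def)
  define H where "H = adj E * G"
  have H: "subiso n H (\<lambda>a. a \<in> C \<and> N a \<noteq> 0)" unfolding H_def by (rule subiso_unitary_mult[OF E G])
  have Hc: "H \<in> carrier_mat n n" using H by (simp add: subiso_def)
  \<comment> \<open>By |x y| \<le> (|x|^2 + |y|^2) / 2 the coefficients are dominated by the mean of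
    two families whose row and column sums are all at most 1.\<close>
  define w where "w a i = ((cmod (F $$ (a,i)))\<^sup>2 + (cmod (H $$ (i,a)))\<^sup>2) / 2" for a i
  have Nw: "N a \<le> (\<Sum>i<n. w a i * l i)" if a: "a \<in> C" for a
  proof -
    have an: "a < n" using a C by auto
    have "(A * G) $$ (a,a) = (\<Sum>z<n. A $$ (a,z) * G $$ (z,a))" by (rule mult_mat_index[OF Ac Gc an an])
    also have "\<dots> = (\<Sum>z<n. complex_of_real ((cmod (A $$ (a,z)))\<^sup>2) / complex_of_real (N a))"
      using a an by (intro sum.cong refl) (auto simp: G_def cmod_sq)
    also have "\<dots> = complex_of_real (N a * N a / N a)"
      unfolding N(2) by (simp add: sum_divide_distrib)
    finally have AG: "(A * G) $$ (a,a) = complex_of_real (N a)" by simp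
    have "A * G = F * rdiag n l * H" unfolding A H_def using c Gc by (simp add: mat_assoc[of _ n] mult_carrier_sq[of _ n])
    also have "\<dots> $$ (a,a) = (\<Sum>i<n. (F * rdiag n l) $$ (a,i) * H $$ (i,a))"
      using c Hc an by (intro mult_mat_index[of _ n n _ n]) auto
    also have "\<dots> = (\<Sum>i<n. F $$ (a,i) * complex_of_real (l i) * H $$ (i,a))"
      using an by (intro sum.cong refl) (simp add: mat_diag_mult_right[OF Fc])
    finally have "N a = cmod (\<Sum>i<n. F $$ (a,i) * complex_of_real (l i) * H $$ (i,a))"
      using AG N(1)[of a] by (metis norm_of_real abs_of_nonneg)
    also have "\<dots> \<le> (\<Sum>i<n. cmod (F $$ (a,i) * complex_of_real (l i) * H $$ (i,a)))" by (rule norm_sum)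
    also have "\<dots> \<le> (\<Sum>i<n. w a i * l i)"
    proof (rule sum_mono)
      fix i
      have "0 \<le> (cmod (F $$ (a,i)) - cmod (H $$ (i,a)))\<^sup>2" by simp
      hence "cmod (F $$ (a,i)) * cmod (H $$ (i,a)) \<le> w a i" by (simp add: w_def power2_diff)
      hence "cmod (F $$ (a,i)) * cmod (H $$ (i,a)) * l i \<le> w a i * l i" using l by (intro mult_right_mono) auto
      thus "cmod (F $$ (a,i) * complex_of_real (l i) * H $$ (i,a)) \<le> w a i * l i"
        using l[of i] by (simp add: norm_mult mult_ac)
    qed
    finally show ?thesis .
  qed
  have finC: "finite C" using C finite_subset by blast
  have "(\<Sum>a\<in>C. sqrt (Re ((A * adj A) $$ (a,a))) powr \<gamma>) = (\<Sum>a\<in>C. N a powr \<gamma>)"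
    using C NA by (intro sum.cong refl) (auto simp del: index_mult_mat(1))
  also have "\<dots> \<le> (\<Sum>a\<in>C. (\<Sum>i<n. w a i * l i) powr \<gamma>)"
    using Nw N(1) g by (intro sum_mono powr_mono2) auto
  also have "\<dots> \<le> (\<Sum>i<n. l i powr \<gamma>)"
  proof (rule substochastic_convex)
    fix a assume a: "a \<in> C"
    show "(\<Sum>i<n. w a i) \<le> 1"
      using subiso_row[OF F, of a] subiso_col[OF H, of a] a C
      by (auto simp: w_def sum.distrib sum_divide_distrib[symmetric])
  next
    fix i assume i: "i \<in> {..<n}"
    have "(\<Sum>a\<in>C. w a i) \<le> (\<Sum>a<n. w a i)" using C by (intro sum_mono2) (auto simp: w_def)
    also have "\<dots> \<le> 1" using subiso_col[OF F, of i] subiso_row[OF H, of i] i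
      by (auto simp: w_def sum.distrib sum_divide_distrib[symmetric])
    finally show "(\<Sum>a\<in>C. w a i) \<le> 1" .
  qed (use l g finC in \<open>auto simp: w_def\<close>)
  finally show ?thesis .
qed

lemma sqrt_powr_double: "x \<ge> 0 \<Longrightarrow> sqrt x powr (2 * a) = x powr a"
  by (simp add: powr_half_sqrt[symmetric] powr_powr)

text \<open>The square root of X squares to X, so its rows in C are orthogonal with squared norms
  equal to the diagonal entries of X. The row norms carry the exponent 2\<alpha>, which must be at
  least 1; this is where \<alpha> \<ge> 1/2 comes from.\<close>

lemma class_powr_le_trp:
  assumes X: "psd n X" and C: "C \<subseteq> {..<n}"
    and orth: "\<And>a b. a \<in> C \<Longrightarrow> b \<in> C \<Longrightarrow> a \<noteq> b \<Longrightarrow> X $$ (a,b) = 0" and a: "\<alpha> \<ge> 1/2"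
  shows "(\<Sum>a\<in>C. Re (X $$ (a,a)) powr \<alpha>) \<le> trp X \<alpha>"
proof -
  from psd_spectral[OF X] obtain U f where U: "unitary n U" "\<And>i. f i \<ge> 0" "X = U * rdiag n f * adj U" by blast
  note S = msqrt_eq[OF U(1,3)]
  have SS: "msqrt X * adj (msqrt X) = X"
    using psd_hermitian[OF msqrt_psd[OF X]] msqrt_mult_self[OF X] by simp
  have "(\<Sum>a\<in>C. sqrt (Re ((msqrt X * adj (msqrt X)) $$ (a,a))) powr (2 * \<alpha>)) \<le> (\<Sum>i<n. sqrt (f i) powr (2 * \<alpha>))"
    using orthogonal_rows_powr[OF subiso_unitary[OF U(1)] U(1) _ S C] U(2) orth a unfolding SS by auto
  moreover have "(\<Sum>a\<in>C. sqrt (Re (X $$ (a,a))) powr (2 * \<alpha>)) = (\<Sum>a\<in>C. Re (X $$ (a,a)) powr \<alpha>)"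
    using C psd_diag_entry(2)[OF X] by (intro sum.cong refl sqrt_powr_double) auto
  ultimately show ?thesis unfolding SS trp_spectral[OF U(1,3)] using U(2) by (simp add: sqrt_powr_double)
qed

lemma sum_classes:
  fixes cl :: "nat \<Rightarrow> 'c" and h :: "nat \<Rightarrow> real"
  assumes "\<And>c. c \<in> cl ` {..<n} \<Longrightarrow> (\<Sum>a\<in>{a\<in>{..<n}. cl a = c}. h a) \<le> B"
  shows "(\<Sum>a<n. h a) \<le> real (card (cl ` {..<n})) * B"
proof -
  have "(\<Sum>a<n. h a) = (\<Sum>c\<in>cl ` {..<n}. \<Sum>a\<in>{a\<in>{..<n}. cl a = c}. h a)"
    by (rule sum.image_gen) auto
  also have "\<dots> \<le> (\<Sum>c\<in>cl ` {..<n}. B)" by (intro sum_mono assms)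
  finally show ?thesis by simp
qed

text \<open>The bound for a single class summed over all classes. For \<alpha> \<le> 1 it reverses
  the concave diagonal bound up to the number of classes.\<close>

lemma diag_powr_le_classes:
  fixes cl :: "nat \<Rightarrow> 'c"
  assumes X: "psd n X" and cl: "\<And>a b. a < n \<Longrightarrow> b < n \<Longrightarrow> a \<noteq> b \<Longrightarrow> cl a = cl b \<Longrightarrow> X $$ (a,b) = 0"
    and a: "\<alpha> \<ge> 1/2"
  shows "(\<Sum>a<n. Re (X $$ (a,a)) powr \<alpha>) \<le> real (card (cl ` {..<n})) * trp X \<alpha>"
  by (rule sum_classes, rule class_powr_le_trp[OF X _ _ a]) (auto intro: cl)

section \<open>Fidelity\<close>

lemma fidelity_eq_trp:
  assumes t: "psd n \<tau>" and r: "psd n \<rho>"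
  shows "fidelity \<tau> \<rho> = trp (msqrt \<rho> * \<tau> * msqrt \<rho>) (1/2)" "psd n (msqrt \<rho> * \<tau> * msqrt \<rho>)"
proof -
  note c = psdD(1)[OF msqrt_psd[OF t]] psdD(1)[OF msqrt_psd[OF r]]
  have "adj (msqrt \<tau> * msqrt \<rho>) * (msqrt \<tau> * msqrt \<rho>) = msqrt \<rho> * (msqrt \<tau> * msqrt \<tau>) * msqrt \<rho>"
    using c by (simp add: adj_mult[of _ n n _ n] psd_hermitian[OF msqrt_psd[OF t]] psd_hermitian[OF msqrt_psd[OF r]]
        mat_assoc[of _ n] mult_carrier_sq[of _ n])
  hence e: "adj (msqrt \<tau> * msqrt \<rho>) * (msqrt \<tau> * msqrt \<rho>) = msqrt \<rho> * \<tau> * msqrt \<rho>"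
    by (simp add: msqrt_mult_self[OF t])
  show p: "psd n (msqrt \<rho> * \<tau> * msqrt \<rho>)" unfolding e[symmetric] by (rule psd_gram[OF mult_carrier_sq[OF c]])
  show "fidelity \<tau> \<rho> = trp (msqrt \<rho> * \<tau> * msqrt \<rho>) (1/2)"
    unfolding fidelity_def trace_norm_def e trp_def msqrt_eq_mpow[OF p] ..
qed

lemma fidelity_nonneg:
  assumes "psd n \<tau>" "psd n \<rho>" shows "fidelity \<tau> \<rho> \<ge> 0"
  unfolding fidelity_eq_trp(1)[OF assms] by (rule trp_nonneg[OF fidelity_eq_trp(2)[OF assms]])

lemma cauchy_schwarz_sqrt:
  fixes a b :: "'a \<Rightarrow> real"
  shows "(\<Sum>i\<in>I. a i * b i) \<le> sqrt (\<Sum>i\<in>I. (a i)\<^sup>2) * sqrt (\<Sum>i\<in>I. (b i)\<^sup>2)"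
  unfolding real_sqrt_mult[symmetric] by (intro real_le_rsqrt Cauchy_Schwarz_ineq_sum)

text \<open>A measurement cannot decrease the fidelity: \<open>V * adj V\<close> is inserted into
  the trace that computes the trace norm, and Cauchy-Schwarz is applied for each outcome y.\<close>

lemma fidelity_le_measured:
  assumes t: "psd n \<tau>" and r: "psd n \<rho>" and V: "unitary n V"
  shows "fidelity \<tau> \<rho> \<le> (\<Sum>y<n. sqrt (Re ((adj V * \<tau> * V) $$ (y,y)) * Re ((adj V * \<rho> * V) $$ (y,y))))"
proof -
  define T where "T = msqrt \<tau>"
  define R where "R = msqrt \<rho>"
  have T: "T \<in> carrier_mat n n" "adj T = T" "T * T = \<tau>"
    using psdD(1)[OF msqrt_psd[OF t]] psd_hermitian[OF msqrt_psd[OF t]] msqrt_mult_self[OF t] by (auto simp: T_def)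
  have R: "R \<in> carrier_mat n n" "adj R = R" "R * R = \<rho>"
    using psdD(1)[OF msqrt_psd[OF r]] psd_hermitian[OF msqrt_psd[OF r]] msqrt_mult_self[OF r] by (auto simp: R_def)
  note v = unitaryD[OF V]
  have TR: "T * R \<in> carrier_mat n n" by (rule mult_carrier_sq[OF T(1) R(1)])
  obtain F E l where E: "unitary n E" and F: "subiso n F (\<lambda>i. l i \<noteq> 0)" and l: "\<And>i. l i \<ge> 0"
    and A: "T * R = F * rdiag n l * adj E" and tn: "trace_norm (T * R) = (\<Sum>i<n. l i)" by (rule svd[OF TR]) (rule that)
  note e = unitaryD[OF E]
  have Fc: "F \<in> carrier_mat n n" and FF: "adj F * F = rdiag n (\<lambda>i. if l i \<noteq> 0 then 1 else 0)" using F by (auto simp: subiso_def)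
  define M1 where "M1 = adj F * (T * V)"
  define M2 where "M2 = adj V * (R * E)"
  have M1: "M1 \<in> carrier_mat n n" and M2: "M2 \<in> carrier_mat n n"
    using Fc T R v e by (auto simp: M1_def M2_def mult_carrier_sq[of _ n])
  have "M1 * M2 = adj F * (T * (V * (adj V * (R * E))))"
    unfolding M1_def M2_def using Fc T(1) R(1) v e by (simp add: mat_assoc[of _ n] mult_carrier_sq[of _ n])
  also have "\<dots> = adj F * (T * R * E)"
    using Fc T(1) R(1) v e by (simp add: mat_assoc[of _ n] mult_carrier_sq[of _ n] unitary_cancel[OF V])
  also have "\<dots> = (adj F * F) * rdiag n l"
    unfolding A using Fc T(1) R(1) v e by (simp add: mat_assoc[of _ n] mult_carrier_sq[of _ n])
  also have "\<dots> = rdiag n l" unfolding FF by (simp, intro eq_matI) auto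
  finally have M: "M1 * M2 = rdiag n l" .
  have "complex_of_real (\<Sum>i<n. l i) = mtrace (M2 * M1)"
    unfolding mtrace_mult_comm[OF M2 M1] M mtrace_rdiag ..
  also have "\<dots> = (\<Sum>y<n. \<Sum>i<n. M2 $$ (y,i) * M1 $$ (i,y))"
    unfolding mtrace_def using M1 M2 by (auto simp: mult_mat_index[OF M2 M1] simp del: index_mult_mat(1) intro!: sum.cong)
  finally have "(\<Sum>i<n. l i) = cmod (\<Sum>y<n. \<Sum>i<n. M2 $$ (y,i) * M1 $$ (i,y))"
    using l by (metis abs_of_nonneg norm_of_real sum_nonneg)
  also have "\<dots> \<le> (\<Sum>y<n. \<Sum>i<n. cmod (M2 $$ (y,i)) * cmod (M1 $$ (i,y)))"
    by (intro order.trans[OF norm_sum] sum_mono) (simp add: norm_mult)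
  also have "\<dots> \<le> (\<Sum>y<n. sqrt (\<Sum>i<n. (cmod (M2 $$ (y,i)))\<^sup>2) * sqrt (\<Sum>i<n. (cmod (M1 $$ (i,y)))\<^sup>2))"
    by (intro sum_mono cauchy_schwarz_sqrt)
  also have "\<dots> \<le> (\<Sum>y<n. sqrt (Re ((adj V * \<tau> * V) $$ (y,y)) * Re ((adj V * \<rho> * V) $$ (y,y))))"
  proof (rule sum_mono)
    fix y assume "y \<in> {..<n}" hence y: "y < n" by simp
    have "M2 * adj M2 = adj V * (R * (E * (adj E * (R * V))))"
      unfolding M2_def using R v e by (simp add: adj_mult[of _ n n _ n] mat_assoc[of _ n] mult_carrier_sq[of _ n])
    also have "\<dots> = adj V * (R * R) * V"
      using R(1) v by (simp add: mat_assoc[of _ n] mult_carrier_sq[of _ n] unitary_cancel[OF E])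
    finally have "M2 * adj M2 = adj V * \<rho> * V" by (simp add: R)
    with cogram_diag_entry[OF M2 y] have 2: "(\<Sum>i<n. (cmod (M2 $$ (y,i)))\<^sup>2) = Re ((adj V * \<rho> * V) $$ (y,y))"
      by (metis Re_complex_of_real)
    \<comment> \<open>F is only a partial isometry, so Bessel's inequality is used on this side; the
      side of M2 is exact because E is unitary.\<close>
    have "(\<Sum>i<n. (cmod (M1 $$ (i,y)))\<^sup>2) \<le> (\<Sum>z<n. (cmod ((T * V) $$ (z,y)))\<^sup>2)"
      unfolding M1_def by (rule subiso_bessel[OF F mult_carrier_sq[OF T(1) v(1)] y])
    moreover have "adj (T * V) * (T * V) = adj V * \<tau> * V"
      unfolding T(3)[symmetric] using T(1,2) v by (simp add: adj_mult[of _ n n _ n] mat_assoc[of _ n] mult_carrier_sq[of _ n])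
    with gram_diag_entry[OF mult_carrier_sq[OF T(1) v(1)] y]
    have "(\<Sum>z<n. (cmod ((T * V) $$ (z,y)))\<^sup>2) = Re ((adj V * \<tau> * V) $$ (y,y))" by (metis Re_complex_of_real)
    ultimately have 1: "(\<Sum>i<n. (cmod (M1 $$ (i,y)))\<^sup>2) \<le> Re ((adj V * \<tau> * V) $$ (y,y))" by simp
    have "Re ((adj V * \<rho> * V) $$ (y,y)) \<ge> 0" using 2 by (metis sum_nonneg zero_le_power2)
    thus "sqrt (\<Sum>i<n. (cmod (M2 $$ (y,i)))\<^sup>2) * sqrt (\<Sum>i<n. (cmod (M1 $$ (i,y)))\<^sup>2)
      \<le> sqrt (Re ((adj V * \<tau> * V) $$ (y,y)) * Re ((adj V * \<rho> * V) $$ (y,y)))"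
      unfolding 2 using 1 by (simp add: real_sqrt_mult mult.commute mult_left_mono)
  qed
  finally show ?thesis using tn by (simp add: fidelity_def T_def R_def)
qed

text \<open>In the basis W the Gram matrix of the rows of the product of the two roots is that of
  \<rho> weighted by the roots of t, so rows of one class are orthogonal. Their norms over one class
  sum to at most the trace norm, and the classes are added up.\<close>

lemma fidelity_ge_classes:
  fixes cl :: "nat \<Rightarrow> 'c"
  assumes W: "unitary n W" and t: "\<And>a. t a \<ge> 0" and r: "psd n \<rho>"
    and cl: "\<And>a b. a < n \<Longrightarrow> b < n \<Longrightarrow> a \<noteq> b \<Longrightarrow> cl a = cl b \<Longrightarrow> (adj W * \<rho> * W) $$ (a,b) = 0"
  shows "(\<Sum>a<n. sqrt (t a * Re ((adj W * \<rho> * W) $$ (a,a))))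
    \<le> real (card (cl ` {..<n})) * fidelity (W * rdiag n t * adj W) \<rho>"
proof -
  define \<omega> where "\<omega> = W * rdiag n t * adj W"
  define R where "R = msqrt \<rho>"
  have R: "R \<in> carrier_mat n n" "adj R = R" "R * R = \<rho>"
    using psdD(1)[OF msqrt_psd[OF r]] psd_hermitian[OF msqrt_psd[OF r]] msqrt_mult_self[OF r] by (auto simp: R_def)
  note w = unitaryD[OF W]
  define S where "S = W * rdiag n (\<lambda>i. sqrt (t i)) * adj W"
  have S: "msqrt \<omega> = S" unfolding S_def by (rule msqrt_eq[OF W \<omega>_def])
  have Sc: "S \<in> carrier_mat n n" using w by (simp add: S_def mult_carrier_sq[of _ n])
  obtain F E l where E: "unitary n E" and F: "subiso n F (\<lambda>i. l i \<noteq> 0)"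
    and l: "\<And>i. l i \<ge> 0" and A: "S * R = F * rdiag n l * adj E" and tn: "trace_norm (S * R) = (\<Sum>i<n. l i)"
    by (rule svd[OF mult_carrier_sq[OF Sc R(1)]]) (rule that)
  have Fc: "F \<in> carrier_mat n n" using F by (simp add: subiso_def)
  note e = unitaryD[OF E]
  define A where "A = adj W * F * rdiag n l * adj E"
  define M where "M = adj W * \<rho> * W"
  have Mc: "M \<in> carrier_mat n n" using w psdD(1)[OF r] by (simp add: M_def mult_carrier_sq[of _ n])
  have A2: "A = rdiag n (\<lambda>i. sqrt (t i)) * (adj W * R)"
  proof -
    have "A = adj W * (S * R)" unfolding A_def A using w Fc e by (simp add: mat_assoc[of _ n] mult_carrier_sq[of _ n])
    thus ?thesis unfolding S_def using w R(1) by (simp add: mat_assoc[of _ n] mult_carrier_sq[of _ n] unitary_cancel[OF W])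
  qed
  have "A * adj A = rdiag n (\<lambda>i. sqrt (t i)) * (adj W * (R * (R * W))) * rdiag n (\<lambda>i. sqrt (t i))"
    unfolding A2 using w R by (simp add: adj_mult[of _ n n _ n] mat_assoc[of _ n] mult_carrier_sq[of _ n])
  also have "adj W * (R * (R * W)) = M"
    unfolding M_def R(3)[symmetric] using w R(1) by (simp add: mat_assoc[of _ n] mult_carrier_sq[of _ n])
  finally have AA: "(A * adj A) $$ (a,b) = complex_of_real (sqrt (t a)) * M $$ (a,b) * complex_of_real (sqrt (t b))"
    if "a < n" "b < n" for a b
    using that Mc by (simp add: mat_diag_mult_left[OF Mc] mat_diag_mult_right[of _ n])
  have psdM: "psd n M" unfolding M_def by (rule psd_conj[OF r w(1)])
  have "(\<Sum>a<n. sqrt (t a * Re (M $$ (a,a)))) \<le> real (card (cl ` {..<n})) * (\<Sum>i<n. l i powr 1)"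
  proof (rule sum_classes)
    fix c
    let ?C = "{a\<in>{..<n}. cl a = c}"
    have "(\<Sum>a\<in>?C. sqrt (Re ((A * adj A) $$ (a,a))) powr 1) \<le> (\<Sum>i<n. l i powr 1)"
    proof (rule orthogonal_rows_powr[OF subiso_unitary_mult[OF W F] E l A_def])
      show "(A * adj A) $$ (a,b) = 0" if "a \<in> ?C" "b \<in> ?C" "a \<noteq> b" for a b
        using that AA[of a b] cl[of a b] by (auto simp: M_def)
    qed auto
    moreover have "sqrt (Re ((A * adj A) $$ (a,a))) powr 1 = sqrt (t a * Re (M $$ (a,a)))" if "a < n" for a
    proof -
      have "Re ((A * adj A) $$ (a,a)) = t a * Re (M $$ (a,a))"
        unfolding AA[OF that that] using t[of a]
        by (subst psd_diag_entry(1)[OF psdM that]) (simp add: mult_ac)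
      thus ?thesis using t psd_diag_entry(2)[OF psdM that] by simp
    qed
    ultimately show "(\<Sum>a\<in>?C. sqrt (t a * Re (M $$ (a,a)))) \<le> (\<Sum>i<n. l i powr 1)" by simp
  qed
  also have "(\<Sum>i<n. l i powr 1) = fidelity \<omega> \<rho>"
    using tn l unfolding fidelity_def S R_def by simp
  finally show ?thesis unfolding M_def \<omega>_def .
qed

section \<open>Monotonicity, bounds and multiplicativity of the fidelity\<close>

lemma trp_smult:
  assumes X: "psd n X" and c: "c \<ge> 0" shows "trp (complex_of_real c \<cdot>\<^sub>m X) a = c powr a * trp X a"
proof -
  from psd_spectral[OF X] obtain U f where U: "unitary n U" "\<And>i. f i \<ge> 0" "X = U * rdiag n f * adj U" by blast
  note u = unitaryD[OF U(1)]
  have "complex_of_real c \<cdot>\<^sub>m X = U * (complex_of_real c \<cdot>\<^sub>m rdiag n f) * adj U"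
    unfolding U(3) using u by (simp add: mult_smult_distrib[of _ n n _ n] mult_smult_assoc_mat[of _ n n _ n] mult_carrier_sq[of _ n])
  also have "complex_of_real c \<cdot>\<^sub>m rdiag n f = rdiag n (\<lambda>i. c * f i)" by (intro eq_matI) auto
  finally have e: "complex_of_real c \<cdot>\<^sub>m X = U * rdiag n (\<lambda>i. c * f i) * adj U" .
  show ?thesis unfolding trp_spectral[OF U(1) e] trp_spectral[OF U(1,3)] sum_distrib_left
    using U(2) c by (intro sum.cong refl powr_mult)
qed

text \<open>The fidelity is the trace of the root of a sandwiched state. Trace monotonicity at
  exponent 1/2 applies to it, and the scalar c comes out as its square root.\<close>

lemma fidelity_sq_mono:
  assumes w: "psd n \<omega>" and t: "psd n \<tau>" and r: "psd n \<rho>" and c: "c \<ge> 0"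
    and d: "psd n (\<tau> - complex_of_real c \<cdot>\<^sub>m \<omega>)"
  shows "c * (fidelity \<omega> \<rho>)\<^sup>2 \<le> (fidelity \<tau> \<rho>)\<^sup>2"
proof -
  define R where "R = msqrt \<rho>"
  have R: "R \<in> carrier_mat n n" "adj R = R"
    using psdD(1)[OF msqrt_psd[OF r]] psd_hermitian[OF msqrt_psd[OF r]] by (auto simp: R_def)
  note k = psdD(1)[OF w] psdD(1)[OF t] R(1)
  have "R * (\<tau> - complex_of_real c \<cdot>\<^sub>m \<omega>) * R = R * \<tau> * R - complex_of_real c \<cdot>\<^sub>m (R * \<omega> * R)"
    using k by (simp add: mult_minus_distrib_mat[of _ n n _ n] minus_mult_distrib_mat[of _ n n _ _ n]
        mult_smult_distrib[of _ n n _ n] mult_smult_assoc_mat[of _ n n _ n] mult_carrier_sq[of _ n])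
  hence d': "psd n (R * \<tau> * R - complex_of_real c \<cdot>\<^sub>m (R * \<omega> * R))"
    using psd_conj[OF d R(1)] R(2) by simp
  have "sqrt c * fidelity \<omega> \<rho> = trp (complex_of_real c \<cdot>\<^sub>m (R * \<omega> * R)) (1/2)"
    unfolding fidelity_eq_trp(1)[OF w r] R_def trp_smult[OF fidelity_eq_trp(2)[OF w r] c] using c
    by (simp add: powr_half_sqrt)
  also have "\<dots> \<le> trp (R * \<tau> * R) (1/2)"
    by (rule trp_mono_concave[OF psd_smult[OF fidelity_eq_trp(2)[OF w r, folded R_def] c] fidelity_eq_trp(2)[OF t r, folded R_def] d']) auto
  also have "\<dots> = fidelity \<tau> \<rho>" unfolding fidelity_eq_trp(1)[OF t r] R_def ..
  finally have "(sqrt c * fidelity \<omega> \<rho>)\<^sup>2 \<le> (fidelity \<tau> \<rho>)\<^sup>2"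
    using c fidelity_nonneg[OF w r] by (intro power_mono) auto
  thus ?thesis using c by (simp add: power_mult_distrib)
qed

lemma density_trace_re:
  assumes "density n \<rho>" "unitary n V" shows "(\<Sum>y<n. Re ((adj V * \<rho> * V) $$ (y,y))) = 1"
proof -
  have c: "\<rho> \<in> carrier_mat n n" "mtrace \<rho> = 1" using assms psdD(1) by (auto simp: density_def)
  have "mtrace (adj V * \<rho> * V) = 1" using mtrace_unitary_conj(2)[OF assms(2) c(1)] c by simp
  hence "Re (mtrace (adj V * \<rho> * V)) = 1" by simp
  moreover have "dim_row (adj V * \<rho> * V) = n" using unitaryD[OF assms(2)] by simp
  ultimately show ?thesis unfolding mtrace_def by (simp only: Re_sum)
qed

text \<open>Measurement in the standard basis, then Cauchy-Schwarz for the two outcome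
  distributions.\<close>

lemma fidelity_le_1:
  assumes t: "density n \<tau>" and r: "density n \<rho>" shows "fidelity \<tau> \<rho> \<le> 1"
proof -
  have p: "psd n \<tau>" "psd n \<rho>" using t r by (auto simp: density_def)
  have V: "unitary n (1\<^sub>m n)" by (simp add: unitary_def)
  let ?t = "\<lambda>y. Re ((adj (1\<^sub>m n) * \<tau> * 1\<^sub>m n) $$ (y,y))" and ?r = "\<lambda>y. Re ((adj (1\<^sub>m n) * \<rho> * 1\<^sub>m n) $$ (y,y))"
  have nn: "?t y \<ge> 0" "?r y \<ge> 0" if "y < n" for y
    using psd_diag_entry(2)[OF psd_conj[OF p(1) unitaryD(1)[OF V]] that] psd_diag_entry(2)[OF psd_conj[OF p(2) unitaryD(1)[OF V]] that] by auto
  have "fidelity \<tau> \<rho> \<le> (\<Sum>y<n. sqrt (?t y * ?r y))" by (rule fidelity_le_measured[OF p V])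
  also have "\<dots> = (\<Sum>y<n. sqrt (?t y) * sqrt (?r y))" by (simp add: real_sqrt_mult)
  also have "\<dots> \<le> sqrt (\<Sum>y<n. (sqrt (?t y))\<^sup>2) * sqrt (\<Sum>y<n. (sqrt (?r y))\<^sup>2)" by (rule cauchy_schwarz_sqrt)
  also have "(\<Sum>y<n. (sqrt (?t y))\<^sup>2) = (\<Sum>y<n. ?t y)" using nn by (intro sum.cong) auto
  also have "(\<Sum>y<n. (sqrt (?r y))\<^sup>2) = (\<Sum>y<n. ?r y)" using nn by (intro sum.cong) auto
  finally show ?thesis unfolding density_trace_re[OF t V] density_trace_re[OF r V] by simp
qed

lemma fidelity_self:
  assumes "density n \<rho>" shows "fidelity \<rho> \<rho> = 1"
proof -
  have r: "psd n \<rho>" using assms by (simp add: density_def)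
  from psd_spectral[OF r] obtain U f where U: "unitary n U" "\<And>i. f i \<ge> 0" "\<rho> = U * rdiag n f * adj U" by blast
  have "adj (msqrt \<rho> * msqrt \<rho>) * (msqrt \<rho> * msqrt \<rho>) = U * rdiag n (\<lambda>i. f i * f i) * adj U"
    unfolding msqrt_mult_self[OF r] psd_hermitian[OF r] unfolding U(3)
    by (subst unitary_conj_mult[OF U(1)]) auto
  from msqrt_eq[OF U(1) this] have "fidelity \<rho> \<rho> = (\<Sum>i<n. f i)"
    unfolding fidelity_def trace_norm_def using U(2)
    by (simp add: mtrace_unitary_conj(1)[OF U(1) mat_diag_dim] mtrace_rdiag)
  moreover have "mtrace \<rho> = complex_of_real (\<Sum>i<n. f i)"
    unfolding U(3) mtrace_unitary_conj(1)[OF U(1) mat_diag_dim] mtrace_rdiag ..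
  ultimately show ?thesis using assms by (metis density_def of_real_eq_1_iff)
qed

lemma fidelity_kron:
  assumes a: "psd a A" "psd a B" and c: "psd c C" "psd c D"
  shows "fidelity (kron A C) (kron B D) = fidelity A B * fidelity C D"
proof -
  note k = psdD(1)[OF msqrt_psd[OF a(1)]] psdD(1)[OF msqrt_psd[OF a(2)]] psdD(1)[OF msqrt_psd[OF c(1)]] psdD(1)[OF msqrt_psd[OF c(2)]]
  define X where "X = msqrt A * msqrt B"
  define Y where "Y = msqrt C * msqrt D"
  have XY: "X \<in> carrier_mat a a" "Y \<in> carrier_mat c c" using k by (auto simp: X_def Y_def mult_carrier_sq[of _ a] mult_carrier_sq[of _ c])
  have "adj (kron X Y) * kron X Y = kron (adj X * X) (adj Y * Y)"
    unfolding adj_kron using XY by (intro kron_mult) auto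
  hence "msqrt (adj (kron X Y) * kron X Y) = kron (msqrt (adj X * X)) (msqrt (adj Y * Y))"
    by (simp add: msqrt_kron[OF psd_gram[OF XY(1)] psd_gram[OF XY(2)]])
  moreover have "mtrace M = complex_of_real (Re (mtrace M))" if "psd m M" for M m
    using psd_diag_entry(1)[OF that] psdD(1)[OF that] by (auto simp: mtrace_def complex_eq_iff simp del: of_real_sum)
  note re = this[OF msqrt_psd[OF psd_gram[OF XY(1)]]] this[OF msqrt_psd[OF psd_gram[OF XY(2)]]]
  ultimately have "trace_norm (kron X Y) = trace_norm X * trace_norm Y"
    unfolding trace_norm_def
    using mtrace_kron[OF psdD(1)[OF msqrt_psd[OF psd_gram[OF XY(1)]]] psdD(1)[OF msqrt_psd[OF psd_gram[OF XY(2)]]]] re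
    by (metis Re_complex_of_real of_real_mult)
  moreover have "msqrt (kron A C) * msqrt (kron B D) = kron X Y"
    unfolding msqrt_kron[OF a(1) c(1)] msqrt_kron[OF a(2) c(2)] X_def Y_def using k by (intro kron_mult) auto
  ultimately show ?thesis unfolding fidelity_def X_def Y_def by simp
qed

lemma fidelity_tpow:
  assumes "psd d A" "psd d B" shows "fidelity (tpow A n) (tpow B n) = fidelity A B ^ n"
proof (induction n)
  case 0
  have "density 1 (1\<^sub>m 1)" using psd_one[of 1] by (simp add: density_def mtrace_def)
  thus ?case using fidelity_self by simp
next
  case (Suc n)
  thus ?case using fidelity_kron[OF assms psd_tpow[OF assms(1)] psd_tpow[OF assms(2)]] by simp
qed

section \<open>Pinched frames\<close>

text \<open>A frame diagonalises \<open>\<sigma>\<close> and the pinching of \<open>\<rho>\<close> by \<open>\<sigma>\<close>; in it the sandwiched quantities of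
  \<open>(\<rho>, \<sigma>)\<close> agree with the classical ones of \<open>(p, q)\<close> up to powers of the number of distinct eigenvalues.\<close>

definition frame :: "nat \<Rightarrow> complex mat \<Rightarrow> complex mat \<Rightarrow> complex mat \<Rightarrow> (nat \<Rightarrow> real) \<Rightarrow> (nat \<Rightarrow> real) \<Rightarrow> bool" where
  "frame n \<rho> \<sigma> V p q \<longleftrightarrow> unitary n V \<and> \<sigma> = V * rdiag n q * adj V \<and> (\<forall>a. 0 \<le> p a) \<and> (\<forall>a. 0 \<le> q a)
     \<and> (\<forall>a<n. (adj V * \<rho> * V) $$ (a,a) = complex_of_real (p a))
     \<and> (\<forall>a<n. \<forall>b<n. a \<noteq> b \<longrightarrow> q a = q b \<longrightarrow> (adj V * \<rho> * V) $$ (a,b) = 0)"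

lemma frameD:
  assumes "frame n \<rho> \<sigma> V p q"
  shows "unitary n V" "\<sigma> = V * rdiag n q * adj V" "\<And>a. 0 \<le> p a" "\<And>a. 0 \<le> q a"
    "\<And>a. a < n \<Longrightarrow> (adj V * \<rho> * V) $$ (a,a) = complex_of_real (p a)"
    "\<And>a b. a < n \<Longrightarrow> b < n \<Longrightarrow> a \<noteq> b \<Longrightarrow> q a = q b \<Longrightarrow> (adj V * \<rho> * V) $$ (a,b) = 0"
  using assms by (auto simp: frame_def)

lemma conj_entry:
  assumes "U \<in> carrier_mat n n" "R \<in> carrier_mat n n" "a < n" "b < n"
  shows "(adj U * R * U) $$ (a,b) = (\<Sum>i<n. \<Sum>j<n. cnj (U $$ (i,a)) * R $$ (i,j) * U $$ (j,b))"
proof -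
  have "(adj U * R * U) $$ (a,b) = (adj U * (R * U)) $$ (a,b)"
    by (rule arg_cong[of _ _ "\<lambda>M. M $$ (a,b)"], rule mat_assoc[of _ n]) (use assms in auto)
  also have "\<dots> = (\<Sum>i<n. adj U $$ (a,i) * (R * U) $$ (i,b))"
    by (rule mult_mat_index[OF adj_carrier[OF assms(1)] mult_carrier_sq[OF assms(2,1)] assms(3,4)])
  also have "\<dots> = (\<Sum>i<n. \<Sum>j<n. cnj (U $$ (i,a)) * R $$ (i,j) * U $$ (j,b))"
    using assms by (intro sum.cong refl) (simp add: mult_mat_index[OF assms(2,1) _ assms(4)] sum_distrib_left mult.assoc del: index_mult_mat(1))
  finally show ?thesis .
qed

text \<open>Deleting the entries of \<rho> between different eigenvalues of \<sigma> gives a matrix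
  that commutes with \<sigma>, and joint diagonalisation supplies the basis. In that basis \<rho>
  may keep entries between different eigenspaces, but has none off the diagonal inside one.\<close>

lemma frame_exists:
  assumes r: "psd n \<rho>" and s: "psd n \<sigma>" shows "\<exists>V p q. frame n \<rho> \<sigma> V p q"
proof -
  obtain W g where W: "unitary n W" "\<And>i. g i \<ge> 0" "\<sigma> = W * rdiag n g * adj W"
    using psd_spectral[OF s] by metis
  note w = unitaryD[OF W(1)] and rc = psdD(1)[OF r]
  define R where "R = adj W * \<rho> * W"
  have Rp: "psd n R" unfolding R_def by (rule psd_conj[OF r w(1)])
  note Rc = psdD(1)[OF Rp]
  define R' where "R' = Matrix.mat n n (\<lambda>(i,j). if g i = g j then R $$ (i,j) else 0)"
  have R'c: "R' \<in> carrier_mat n n" by (simp add: R'_def)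
  have "cnj (R $$ (j,i)) = R $$ (i,j)" if "i < n" "j < n" for i j
    using arg_cong[OF psd_hermitian[OF Rp], of "\<lambda>M. M $$ (i,j)"] that Rc by simp
  hence R'h: "adj R' = R'" by (intro eq_matI) (auto simp: R'_def)
  have comm: "rdiag n g * R' = R' * rdiag n g"
    unfolding mat_diag_mult_left[OF R'c] mat_diag_mult_right[OF R'c] by (intro eq_matI) (auto simp: R'_def)
  from joint_diagonalization[OF mat_diag_dim adj_rdiag R'c R'h comm] obtain U q p where
    U: "unitary n U" and gq: "rdiag n g = U * rdiag n q * adj U" and Rp': "R' = U * rdiag n p * adj U" by auto
  note u = unitaryD[OF U]
  define V where "V = W * U"
  have V: "unitary n V" unfolding V_def by (rule unitary_mult[OF W(1) U])
  note v = unitaryD[OF V]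
  have VR: "adj V * \<rho> * V = adj U * R * U"
    unfolding V_def R_def using w u rc by (simp add: adj_mult[of _ n n _ n] mat_assoc[of _ n] mult_carrier_sq[of _ n])
  have Vs: "\<sigma> = V * rdiag n q * adj V"
    unfolding W(3) gq V_def using w u by (simp add: adj_mult[of _ n n _ n] mat_assoc[of _ n] mult_carrier_sq[of _ n])
  \<comment> \<open>U mixes only indices with the same eigenvalue of \<sigma>, so for
    \<open>q a = q b\<close> only entries kept in R' contribute.\<close>
  have gU: "U $$ (i,a) = 0 \<or> g i = q a" if "i < n" "a < n" for i a
  proof -
    have "rdiag n g * U = U * rdiag n q"
      unfolding gq using u by (simp add: mat_assoc[of _ n] mult_carrier_sq[of _ n])
    from arg_cong[OF this, of "\<lambda>M. M $$ (i,a)"] show ?thesis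
      using that unfolding mat_diag_mult_left[OF u(1)] mat_diag_mult_right[OF u(1)] by auto
  qed
  have ent: "(adj V * \<rho> * V) $$ (a,b) = (if a = b then complex_of_real (p a) else 0)" if ab: "a < n" "b < n" "q a = q b" for a b
  proof -
    have "(adj V * \<rho> * V) $$ (a,b) = (\<Sum>i<n. \<Sum>j<n. cnj (U $$ (i,a)) * R $$ (i,j) * U $$ (j,b))"
      unfolding VR by (rule conj_entry[OF u(1) Rc ab(1,2)])
    also have "\<dots> = (\<Sum>i<n. \<Sum>j<n. cnj (U $$ (i,a)) * R' $$ (i,j) * U $$ (j,b))"
    proof (intro sum.cong refl)
      fix i j assume "i \<in> {..<n}" "j \<in> {..<n}"
      thus "cnj (U $$ (i,a)) * R $$ (i,j) * U $$ (j,b) = cnj (U $$ (i,a)) * R' $$ (i,j) * U $$ (j,b)"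
        using gU[of i a] gU[of j b] ab by (auto simp: R'_def)
    qed
    also have "\<dots> = (adj U * R' * U) $$ (a,b)" by (rule conj_entry[OF u(1) R'c ab(1,2), symmetric])
    also have "adj U * R' * U = rdiag n p" unfolding Rp' by (rule unitary_conj_inverse(2)[OF U]) simp
    finally show ?thesis using ab by simp
  qed
  define p' where "p' a = (if a < n then p a else 0)" for a
  define q' where "q' a = (if a < n then q a else 0)" for a
  have p0: "p a \<ge> 0" if "a < n" for a
    using psd_diag_entry(2)[OF psd_conj[OF r v(1)] that] ent[OF that that refl] by (simp del: index_mult_mat(1))
  have "adj V * \<sigma> * V = rdiag n q" unfolding Vs by (rule unitary_conj_inverse(2)[OF V]) simp
  hence q0: "q a \<ge> 0" if "a < n" for a
    using psd_diag_entry(2)[OF psd_conj[OF s v(1)] that] that by simp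
  have "rdiag n q = rdiag n q'" by (intro eq_matI) (auto simp: q'_def)
  hence "frame n \<rho> \<sigma> V p' q'"
    unfolding frame_def using V Vs p0 q0 ent by (auto simp: p'_def q'_def simp del: index_mult_mat(1))
  thus ?thesis by blast
qed

text \<open>The trace inside the sandwiched divergence: for a \<noteq> 1 and outside the infinite
  case, the divergence is \<open>log 2 (sQ a \<rho> \<sigma>) / (a - 1)\<close>.\<close>

definition sQ :: "real \<Rightarrow> complex mat \<Rightarrow> complex mat \<Rightarrow> real" where
  "sQ a \<rho> \<sigma> = trp (mpow \<sigma> ((1 - a) / (2 * a)) * \<rho> * mpow \<sigma> ((1 - a) / (2 * a))) a"

text \<open>Since 0 to any power is 0 here, a letter with q x = 0 contributes nothing even for a >
  1; absolute continuity has to be carried as a separate hypothesis.\<close>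

definition cQ :: "real \<Rightarrow> nat \<Rightarrow> (nat \<Rightarrow> real) \<Rightarrow> (nat \<Rightarrow> real) \<Rightarrow> real" where
  "cQ a n p q = (\<Sum>x<n. p x powr a * q x powr (1 - a))"

lemma cQ_nonneg: "cQ a n p q \<ge> 0"
  by (auto simp: cQ_def intro!: sum_nonneg)

lemma sandwich_psd:
  assumes r: "psd n \<rho>" and s: "psd n \<sigma>" shows "psd n (mpow \<sigma> c * \<rho> * mpow \<sigma> c)"
  using psd_conj[OF r psdD(1)[OF mpow_psd[OF s]]] psd_hermitian[OF mpow_psd[OF s]] by simp

lemma sQ_nonneg: "psd n \<rho> \<Longrightarrow> psd n \<sigma> \<Longrightarrow> sQ a \<rho> \<sigma> \<ge> 0"
  unfolding sQ_def by (rule trp_nonneg[OF sandwich_psd])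

lemma sandwich_frame_entry:
  assumes f: "frame n \<rho> \<sigma> V p q" and r: "psd n \<rho>" and ab: "a < n" "b < n"
  shows "(adj V * (mpow \<sigma> c * \<rho> * mpow \<sigma> c) * V) $$ (a,b)
    = complex_of_real (q a powr c) * (adj V * \<rho> * V) $$ (a,b) * complex_of_real (q b powr c)"
proof -
  note V = frameD(1)[OF f] note v = unitaryD[OF V] note rc = psdD(1)[OF r]
  define D where "D = rdiag n (\<lambda>i. q i powr c)"
  define M where "M = adj V * \<rho> * V"
  have Dc: "D \<in> carrier_mat n n" and Mc: "M \<in> carrier_mat n n" using v rc by (auto simp: D_def M_def mult_carrier_sq[of _ n])
  have mp: "mpow \<sigma> c = V * D * adj V" unfolding D_def by (rule mpow_eq[OF V frameD(2)[OF f]])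
  have "adj V * (mpow \<sigma> c * \<rho> * mpow \<sigma> c) * V = adj V * (V * (D * (adj V * (\<rho> * (V * (D * (adj V * V)))))))"
    unfolding mp using v rc Dc by (simp add: mat_assoc[of _ n] mult_carrier_sq[of _ n])
  also have "\<dots> = D * M * D"
    unfolding M_def using v rc Dc by (simp add: mat_assoc[of _ n] mult_carrier_sq[of _ n] unitary_cancel[OF V])
  finally show ?thesis unfolding M_def[symmetric] using ab Mc unfolding D_def
    by (simp add: mat_diag_mult_left[OF Mc] mat_diag_mult_right[of _ n])
qed

lemma sandwich_frame_power:
  assumes p: "(p::real) \<ge> 0" and q: "q \<ge> 0" and a: "a > 0"
  shows "(q powr ((1 - a) / (2 * a)) * p * q powr ((1 - a) / (2 * a))) powr a = p powr a * q powr (1 - a)"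
proof -
  have "(q powr ((1 - a) / (2 * a)) * p * q powr ((1 - a) / (2 * a))) powr a
      = p powr a * (q powr ((1 - a) / (2 * a) * a) * q powr ((1 - a) / (2 * a) * a))"
    using p by (simp add: powr_mult powr_powr)
  also have "q powr ((1 - a) / (2 * a) * a) * q powr ((1 - a) / (2 * a) * a) = q powr (1 - a)"
  proof -
    have "(1 - a) / (2 * a) * a = (1 - a) / 2" using a by simp
    thus ?thesis by (simp only: powr_add[symmetric] field_sum_of_halves)
  qed
  finally show ?thesis .
qed

text \<open>In the frame the sandwiched matrix has the diagonal
  \<open>q powr c * p * q powr c\<close>, whose a-th powers are the classical summands, and it has
  no off-diagonal entries where q agrees. Hence q itself serves as class label, and the diagonal
  bounds for trace powers compare both quantities in both directions.\<close>

lemma frame_sandwich_bounds: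
  assumes f: "frame n \<rho> \<sigma> V p q" and r: "psd n \<rho>" and s: "psd n \<sigma>"
  shows "0 < a \<Longrightarrow> a \<le> 1 \<Longrightarrow> sQ a \<rho> \<sigma> \<le> cQ a n p q"
    and "1/2 \<le> a \<Longrightarrow> cQ a n p q \<le> real (card (q ` {..<n})) * sQ a \<rho> \<sigma>"
    and "1 \<le> a \<Longrightarrow> cQ a n p q \<le> sQ a \<rho> \<sigma>"
    and "1 \<le> a \<Longrightarrow> sQ a \<rho> \<sigma> \<le> real (card (q ` {..<n})) powr a * cQ a n p q"
proof -
  define c where "c = (1 - a) / (2 * a)"
  define X where "X = adj V * (mpow \<sigma> c * \<rho> * mpow \<sigma> c) * V"
  note V = frameD(1)[OF f]
  have X: "psd n X" unfolding X_def by (rule psd_conj[OF sandwich_psd[OF r s] unitaryD(1)[OF V]])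
  have sQ: "sQ a \<rho> \<sigma> = trp X a"
    unfolding sQ_def X_def c_def trp_unitary_conj[OF V sandwich_psd[OF r s]] ..
  note ent = sandwich_frame_entry[OF f r, of _ _ c, folded X_def]
  have cQ: "(\<Sum>x<n. Re (X $$ (x,x)) powr a) = cQ a n p q" if "a > 0"
    unfolding cQ_def
  proof (rule sum.cong[OF refl])
    fix x assume "x \<in> {..<n}" hence x: "x < n" by simp
    have "Re (X $$ (x,x)) = q x powr c * p x * q x powr c" unfolding ent[OF x x] frameD(5)[OF f x] by simp
    thus "Re (X $$ (x,x)) powr a = p x powr a * q x powr (1 - a)"
      using sandwich_frame_power[OF frameD(3,4)[OF f] that] unfolding c_def by simp
  qed
  have cl: "X $$ (x,y) = 0" if "x < n" "y < n" "x \<noteq> y" "q x = q y" for x y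
    unfolding ent[OF that(1,2)] frameD(6)[OF f that] by simp
  show "0 < a \<Longrightarrow> a \<le> 1 \<Longrightarrow> sQ a \<rho> \<sigma> \<le> cQ a n p q"
    using trp_le_diag_powr[OF X, of a] cQ unfolding sQ by simp
  show "1/2 \<le> a \<Longrightarrow> cQ a n p q \<le> real (card (q ` {..<n})) * sQ a \<rho> \<sigma>"
    using diag_powr_le_classes[OF X cl, where \<alpha>=a] cQ unfolding sQ by simp
  show "1 \<le> a \<Longrightarrow> cQ a n p q \<le> sQ a \<rho> \<sigma>"
    using diag_powr_le_trp[OF X, of a] cQ unfolding sQ by simp
  show "1 \<le> a \<Longrightarrow> sQ a \<rho> \<sigma> \<le> real (card (q ` {..<n})) powr a * cQ a n p q"
    using trp_le_pinched[OF X cl, where \<beta>=a] cQ unfolding sQ by simp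
qed

lemma sQ_tpow:
  assumes r: "psd d \<rho>" and s: "psd d \<sigma>" shows "sQ a (tpow \<rho> n) (tpow \<sigma> n) = sQ a \<rho> \<sigma> ^ n"
proof -
  define c where "c = (1 - a) / (2 * a)"
  define X where "X = mpow \<sigma> c * \<rho> * mpow \<sigma> c"
  have X: "psd d X" unfolding X_def by (rule sandwich_psd[OF r s])
  note k = psdD(1)[OF r] psdD(1)[OF mpow_psd[OF s]]
  have "mpow (tpow \<sigma> n) c * tpow \<rho> n * mpow (tpow \<sigma> n) c = tpow X n"
    unfolding X_def mpow_tpow[OF s] tpow_mult[OF mult_carrier_sq[OF k(2,1)] k(2)] tpow_mult[OF k(2,1)] ..
  hence "sQ a (tpow \<rho> n) (tpow \<sigma> n) = Re (mtrace (mpow X a) ^ n)"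
    unfolding sQ_def c_def[symmetric] by (simp add: trp_def mpow_tpow[OF X] mtrace_tpow[OF psdD(1)[OF mpow_psd[OF X]]])
  moreover have "mtrace (mpow X a) = complex_of_real (sQ a \<rho> \<sigma>)"
  proof -
    obtain U f where U: "unitary d U" "X = U * rdiag d f * adj U" using psd_spectral[OF X] by metis
    have "mtrace (mpow X a) = complex_of_real (\<Sum>i<d. f i powr a)"
      unfolding mpow_eq[OF U] mtrace_unitary_conj(1)[OF U(1) mat_diag_dim] mtrace_rdiag ..
    thus ?thesis unfolding sQ_def c_def[symmetric] X_def[symmetric] trp_spectral[OF U] .
  qed
  ultimately show ?thesis by (simp flip: of_real_power)
qed

text \<open>Whatever frame is chosen, its q lists eigenvalues of the tensor power of \<sigma>, so
  the count of types applies.\<close>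

lemma frame_card:
  assumes s: "psd d \<sigma>" and f: "frame (d^n) \<rho> (tpow \<sigma> n) V p q"
  shows "card (q ` {..<d^n}) \<le> Suc n ^ d"
proof -
  obtain U g where U: "unitary d U" "\<sigma> = U * rdiag d g * adj U" using psd_spectral[OF s] by metis
  have "q ` {..<d^n} \<subseteq> pweight d g n ` {..<d^n}"
    by (rule spectral_values_subset[OF frameD(1)[OF f] unitary_tpow[OF U(1)]])
       (simp only: frameD(2)[OF f, symmetric] tpow_spectral[OF U(1), symmetric] U(2)[symmetric])
  hence "card (q ` {..<d^n}) \<le> card (pweight d g n ` {..<d^n})" by (intro card_mono) auto
  thus ?thesis using card_pweight_values[of d g n] by linarith
qed

lemma frame_sums:
  assumes f: "frame n \<rho> \<sigma> V p q" and r: "density n \<rho>" and s: "density n \<sigma>"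
  shows "(\<Sum>x<n. p x) = 1" "(\<Sum>x<n. q x) = 1"
proof -
  note V = frameD(1)[OF f]
  show "(\<Sum>x<n. p x) = 1" using density_trace_re[OF r V] frameD(5)[OF f] by (simp del: index_mult_mat(1))
  have "adj V * \<sigma> * V = rdiag n q" unfolding frameD(2)[OF f] by (rule unitary_conj_inverse(2)[OF V]) simp
  thus "(\<Sum>x<n. q x) = 1" using density_trace_re[OF s V] by simp
qed

text \<open>\<open>mpow \<sigma> 0\<close> is the support projection because
  \<open>0 powr 0 = 0\<close>. Support inclusion thus becomes a matrix equation, which passes easily
  to frames and to tensor powers.\<close>

lemma frame_support:
  assumes f: "frame n \<rho> \<sigma> V p q" and r: "psd n \<rho>" and sup: "mpow \<sigma> 0 * \<rho> = \<rho>" and a: "a < n" "q a = 0"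
  shows "p a = 0"
proof -
  note V = frameD(1)[OF f] note v = unitaryD[OF V] note rc = psdD(1)[OF r]
  define D where "D = rdiag n (\<lambda>i. q i powr 0)"
  define M where "M = adj V * \<rho> * V"
  have Dc: "D \<in> carrier_mat n n" and Mc: "M \<in> carrier_mat n n" using v rc by (auto simp: D_def M_def mult_carrier_sq[of _ n])
  have mp: "mpow \<sigma> 0 = V * D * adj V" unfolding D_def by (rule mpow_eq[OF V frameD(2)[OF f]])
  have "M = adj V * (V * D * adj V * \<rho>) * V" unfolding M_def mp[symmetric] sup ..
  also have "\<dots> = D * M" unfolding M_def using v rc Dc
    by (simp add: mat_assoc[of _ n] mult_carrier_sq[of _ n] unitary_cancel[OF V])
  finally have "M $$ (a,a) = (D * M) $$ (a,a)" by simp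
  also have "\<dots> = 0" unfolding D_def mat_diag_mult_left[OF Mc] using a by simp
  finally show ?thesis using frameD(5)[OF f a(1)] unfolding M_def by simp
qed

text \<open>The projection is \<sigma> times its pseudo-inverse \<open>mpow \<sigma> (-1)\<close>,
  so what it fixes lies in the range of \<sigma>; conversely it fixes \<sigma> and therefore that
  range.\<close>

lemma supp_mpow_0:
  assumes r: "psd n \<rho>" and s: "psd n \<sigma>"
  shows "supp \<rho> \<subseteq> supp \<sigma> \<longleftrightarrow> mpow \<sigma> 0 * \<rho> = \<rho>"
proof
  note rc = psdD(1)[OF r] and sc = psdD(1)[OF s] and mc = psdD(1)[OF mpow_psd[OF s]]
  obtain U f where U: "unitary n U" "\<And>i. f i \<ge> 0" "\<sigma> = U * rdiag n f * adj U" using psd_spectral[OF s] by metis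
  note u = unitaryD[OF U(1)]
  have ps: "mpow \<sigma> 0 * \<sigma> = \<sigma>"
  proof -
    have "rdiag n (\<lambda>i. f i powr 0) * rdiag n f = rdiag n f" by (simp, intro eq_matI) auto
    thus ?thesis unfolding mpow_eq[OF U(1,3)] by (subst (1 2) U(3)) (simp add: unitary_conj_mult[OF U(1)])
  qed
  have pinv: "mpow \<sigma> 0 = \<sigma> * mpow \<sigma> (-1)"
  proof -
    have "rdiag n f * rdiag n (\<lambda>i. f i powr (-1)) = rdiag n (\<lambda>i. f i powr 0)"
    proof -
      have "f i * f i powr (-1) = f i powr 0" for i using U(2)[of i] by (cases "f i = 0") (auto simp: powr_minus)
      hence "(\<lambda>i. complex_of_real (f i) * complex_of_real (f i powr (-1))) = (\<lambda>i. complex_of_real (f i powr 0))"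
        by (simp only: of_real_mult[symmetric])
      thus ?thesis by (simp only: mat_diag_diag)
    qed
    thus ?thesis unfolding mpow_eq[OF U(1,3)] by (subst U(3)) (simp add: unitary_conj_mult[OF U(1)])
  qed
  {
    assume sub: "supp \<rho> \<subseteq> supp \<sigma>"
    show "mpow \<sigma> 0 * \<rho> = \<rho>"
    proof (rule mat_col_eqI)
      fix j assume "j < dim_col \<rho>"
      hence j: "j < n" using rc by auto
      have "\<rho> *\<^sub>v unit_vec n j = col \<rho> j" using rc j by (intro eq_vecI) auto
      hence "col \<rho> j \<in> supp \<rho>" unfolding supp_def using rc unit_vec_carrier by (metis (mono_tags, lifting) carrier_matD(2) mem_Collect_eq)
      then obtain x where x: "x \<in> carrier_vec n" "col \<rho> j = \<sigma> *\<^sub>v x" using sub sc by (auto simp: supp_def)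
      have "col (mpow \<sigma> 0 * \<rho>) j = mpow \<sigma> 0 *\<^sub>v col \<rho> j" using mc rc j by (intro col_mult2) auto
      also have "\<dots> = (mpow \<sigma> 0 * \<sigma>) *\<^sub>v x" unfolding x(2) using mc sc x by (intro assoc_mult_mat_vec[symmetric]) auto
      finally show "col (mpow \<sigma> 0 * \<rho>) j = col \<rho> j" unfolding ps x(2) .
    qed (use mc rc in auto)
  next
    assume e: "mpow \<sigma> 0 * \<rho> = \<rho>"
    show "supp \<rho> \<subseteq> supp \<sigma>"
    proof
      fix y assume "y \<in> supp \<rho>"
      then obtain x where x: "x \<in> carrier_vec n" "y = \<rho> *\<^sub>v x" using rc by (auto simp: supp_def)
      note ic = psdD(1)[OF mpow_psd[OF s, of "-1"]]
      have "y = (\<sigma> * mpow \<sigma> (-1) * \<rho>) *\<^sub>v x" unfolding x(2) pinv[symmetric] e ..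
      also have "\<dots> = (\<sigma> * (mpow \<sigma> (-1) * \<rho>)) *\<^sub>v x" using mat_assoc[OF sc ic rc] by simp
      also have "\<dots> = \<sigma> *\<^sub>v ((mpow \<sigma> (-1) * \<rho>) *\<^sub>v x)"
        by (rule assoc_mult_mat_vec[OF sc mult_carrier_sq[OF ic rc] x(1)])
      finally have "y = \<sigma> *\<^sub>v ((mpow \<sigma> (-1) * \<rho>) *\<^sub>v x)" .
      moreover have "(mpow \<sigma> (-1) * \<rho>) *\<^sub>v x \<in> carrier_vec (dim_col \<sigma>)" using ic rc sc x by auto
      ultimately show "y \<in> supp \<sigma>" unfolding supp_def by blast
    qed
  }
qed

lemma supp_tpow:
  assumes r: "psd d \<rho>" and s: "psd d \<sigma>" and e: "mpow \<sigma> 0 * \<rho> = \<rho>"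
  shows "mpow (tpow \<sigma> n) 0 * tpow \<rho> n = tpow \<rho> n"
  unfolding mpow_tpow[OF s] tpow_mult[OF psdD(1)[OF mpow_psd[OF s]] psdD(1)[OF r], symmetric] e ..

lemma mult_unit_vec: "(A :: complex mat) \<in> carrier_mat n n \<Longrightarrow> j < n \<Longrightarrow> A *\<^sub>v unit_vec n j = col A j"
  by (intro eq_vecI) auto

text \<open>Both sides say that \<rho> \<sigma> = 0. If the sandwich vanishes, p or q vanishes at
  every index of a frame, and in a positive matrix a zero diagonal entry empties its whole
  column.\<close>

lemma supp_perp_iff:
  assumes r: "psd n \<rho>" and s: "psd n \<sigma>" and a: "0 < a"
  shows "supp_perp \<rho> \<sigma> \<longleftrightarrow> sQ a \<rho> \<sigma> = 0"
proof -
  note rc = psdD(1)[OF r] and sc = psdD(1)[OF s]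
  have inner: "cinner (\<rho> *\<^sub>v x) (\<sigma> *\<^sub>v y) = cinner x ((\<rho> * \<sigma>) *\<^sub>v y)" if "x \<in> carrier_vec n" "y \<in> carrier_vec n" for x y
  proof -
    have "cinner (\<rho> *\<^sub>v x) (\<sigma> *\<^sub>v y) = cinner x (adj \<rho> *\<^sub>v (\<sigma> *\<^sub>v y))"
      using cinner_adj[OF rc that(1), of "\<sigma> *\<^sub>v y"] sc that by simp
    thus ?thesis unfolding psd_hermitian[OF r] using rc sc that by (simp add: assoc_mult_mat_vec[of _ n n _ n])
  qed
  have perp: "supp_perp \<rho> \<sigma> \<longleftrightarrow> \<rho> * \<sigma> = 0\<^sub>m n n"
  proof
    assume p: "supp_perp \<rho> \<sigma>"
    show "\<rho> * \<sigma> = 0\<^sub>m n n"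
    proof (rule eq_matI)
      fix i j assume "i < dim_row (0\<^sub>m n n :: complex mat)" "j < dim_col (0\<^sub>m n n :: complex mat)"
      hence ij: "i < n" "j < n" by auto
      have "cinner (\<rho> *\<^sub>v unit_vec n i) (\<sigma> *\<^sub>v unit_vec n j) = 0"
      proof -
        have "\<rho> *\<^sub>v unit_vec n i \<in> supp \<rho>" "\<sigma> *\<^sub>v unit_vec n j \<in> supp \<sigma>"
          unfolding supp_def using rc sc by (auto intro!: exI[of _ "unit_vec n _"])
        thus ?thesis using p unfolding supp_perp_def by blast
      qed
      hence 0: "cinner (unit_vec n i) ((\<rho> * \<sigma>) *\<^sub>v unit_vec n j) = 0" by (subst (asm) inner) auto
      define P where "P = \<rho> * \<sigma>"
      have P: "P \<in> carrier_mat n n" unfolding P_def by (rule mult_carrier_sq[OF rc sc])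
      have "cinner (unit_vec n i) (P *\<^sub>v unit_vec n j) = (\<Sum>k<n. (if k = i then 1 else 0) * P $$ (k,j))"
        unfolding cinner_def mult_unit_vec[OF P ij(2)] using P ij by (auto simp: unit_vec_def intro!: sum.cong)
      also have "\<dots> = P $$ (i,j)" using ij by (simp add: sum_mult_delta)
      finally show "(\<rho> * \<sigma>) $$ (i,j) = 0\<^sub>m n n $$ (i,j)" using ij 0 unfolding P_def by simp
    qed (use rc sc in auto)
  next
    assume z: "\<rho> * \<sigma> = 0\<^sub>m n n"
    show "supp_perp \<rho> \<sigma>" unfolding supp_perp_def supp_def
      using inner rc sc unfolding z by (auto simp: cinner_def)
  qed
  from frame_exists[OF r s] obtain V p q where f: "frame n \<rho> \<sigma> V p q" by auto
  note V = frameD(1)[OF f] note v = unitaryD[OF V]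
  define c where "c = (1 - a) / (2 * a)"
  define M where "M = adj V * \<rho> * V"
  have Mp: "psd n M" unfolding M_def by (rule psd_conj[OF r v(1)])
  note Mc = psdD(1)[OF Mp]
  show ?thesis
  proof
    assume "supp_perp \<rho> \<sigma>"
    hence z: "\<rho> * \<sigma> = 0\<^sub>m n n" using perp by simp
    have "M * rdiag n q = adj V * (\<rho> * \<sigma>) * V"
      unfolding M_def using v rc by (subst frameD(2)[OF f]) (simp add: mat_assoc[of _ n] mult_carrier_sq[of _ n])
    also have "\<dots> = 0\<^sub>m n n" unfolding z using v by simp
    finally have Mq0: "Matrix.mat n n (\<lambda>(i,j). M $$ (i,j) * complex_of_real (q j)) = 0\<^sub>m n n"
      unfolding mat_diag_mult_right[OF Mc] .
    have Mq: "M $$ (x,y) * complex_of_real (q y) = 0" if "x < n" "y < n" for x y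
      using arg_cong[OF Mq0, of "\<lambda>A. A $$ (x,y)"] that by simp
    have "adj V * (mpow \<sigma> c * \<rho> * mpow \<sigma> c) * V = 0\<^sub>m n n"
    proof (rule eq_matI)
      fix x y assume "x < dim_row (0\<^sub>m n n :: complex mat)" "y < dim_col (0\<^sub>m n n :: complex mat)"
      hence xy: "x < n" "y < n" by auto
      show "(adj V * (mpow \<sigma> c * \<rho> * mpow \<sigma> c) * V) $$ (x,y) = 0\<^sub>m n n $$ (x,y)"
        unfolding sandwich_frame_entry[OF f r xy] M_def[symmetric] using Mq[OF xy] xy by auto
    qed (use v in auto)
    moreover have "trp (0\<^sub>m n n) a = 0"
    proof -
      have "0\<^sub>m n n = V * rdiag n (\<lambda>_. 0) * adj V"
      proof -
        have "rdiag n (\<lambda>_. 0) = 0\<^sub>m n n" by (intro eq_matI) auto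
        thus ?thesis using v by simp
      qed
      from trp_spectral[OF V this] show ?thesis by simp
    qed
    ultimately show "sQ a \<rho> \<sigma> = 0"
      unfolding sQ_def c_def[symmetric] trp_unitary_conj[OF V sandwich_psd[OF r s], symmetric] by simp
  next
    assume "sQ a \<rho> \<sigma> = 0"
    hence z: "mpow \<sigma> c * \<rho> * mpow \<sigma> c = 0\<^sub>m n n"
      unfolding sQ_def c_def[symmetric] by (rule trp_zero_iff[OF sandwich_psd[OF r s]])
    have e0: "complex_of_real (q x powr c) * M $$ (x,y) * complex_of_real (q y powr c) = 0" if "x < n" "y < n" for x y
      using sandwich_frame_entry[OF f r that, of c] that v unfolding z M_def by simp
    have pq: "p x = 0 \<or> q x = 0" if "x < n" for x
      using e0[OF that that] frameD(5)[OF f that] unfolding M_def by auto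
    have Mz: "M $$ (x,y) = 0" if xy: "x < n" "y < n" and "p y = 0" for x y
    proof -
      define S where "S = msqrt M"
      have S: "S \<in> carrier_mat n n" "adj S = S" "S * S = M"
        using psdD(1)[OF msqrt_psd[OF Mp]] psd_hermitian[OF msqrt_psd[OF Mp]] msqrt_mult_self[OF Mp] by (auto simp: S_def)
      have "complex_of_real (\<Sum>k<n. (cmod (S $$ (k,y)))\<^sup>2) = M $$ (y,y)"
        using gram_diag_entry[OF S(1) xy(2)] S by simp
      also have "\<dots> = complex_of_real 0" using frameD(5)[OF f xy(2)] that unfolding M_def by simp
      finally have "(\<Sum>k<n. (cmod (S $$ (k,y)))\<^sup>2) = 0" unfolding of_real_eq_iff .
      hence "\<forall>k\<in>{..<n}. (cmod (S $$ (k,y)))\<^sup>2 = 0" by (subst (asm) sum_nonneg_eq_0_iff) auto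
      hence "S $$ (k,y) = 0" if "k < n" for k using that by auto
      moreover have "M $$ (x,y) = (\<Sum>k<n. S $$ (x,k) * S $$ (k,y))"
        unfolding S(3)[symmetric] by (rule mult_mat_index[OF S(1) S(1) xy])
      ultimately show ?thesis by simp
    qed
    have "M * rdiag n q = 0\<^sub>m n n" unfolding mat_diag_mult_right[OF Mc]
      using pq Mz by (intro eq_matI) auto
    moreover have "\<rho> * \<sigma> = V * (M * rdiag n q) * adj V"
      unfolding M_def using v rc by (subst frameD(2)[OF f]) (simp add: mat_assoc[of _ n] mult_carrier_sq[of _ n] unitary_cancel[OF V])
    ultimately have "\<rho> * \<sigma> = 0\<^sub>m n n" using v by simp
    thus "supp_perp \<rho> \<sigma>" using perp by simp
  qed
qed

section \<open>Channels and the converse bound\<close>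

lemma channelD:
  assumes "channel n m E"
  shows "\<And>X. X \<in> carrier_mat n n \<Longrightarrow> E X \<in> carrier_mat m m"
    "\<And>X Y c. X \<in> carrier_mat n n \<Longrightarrow> Y \<in> carrier_mat n n \<Longrightarrow> E (c \<cdot>\<^sub>m X + Y) = c \<cdot>\<^sub>m E X + E Y"
    "\<And>X. X \<in> carrier_mat n n \<Longrightarrow> mtrace (E X) = mtrace X"
    "\<And>k X. psd (k * n) X \<Longrightarrow> psd (k * m) (ampliate k n m E X)"
  using assms unfolding channel_def by auto

lemma channel_psd:
  assumes E: "channel n m E" and X: "psd n X" shows "psd m (E X)"
proof -
  note c = psdD(1)[OF X]
  have "block n X 0 0 = X" using c by (intro eq_matI) (auto simp: block_def)
  hence "ampliate 1 n m E X = E X"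
    using channelD(1)[OF E c] by (intro eq_matI) (auto simp: ampliate_def)
  moreover have "psd (1 * m) (ampliate 1 n m E X)" by (rule channelD(4)[OF E]) (use X in simp)
  ultimately show ?thesis by simp
qed

lemma channel_density: "channel n m E \<Longrightarrow> density n X \<Longrightarrow> density m (E X)"
  using channel_psd channelD(3) psdD(1) unfolding density_def by metis

lemma channel_zero:
  assumes E: "channel n m E" shows "E (0\<^sub>m n n) = 0\<^sub>m m m"
proof -
  have c: "E (0\<^sub>m n n) \<in> carrier_mat m m" by (rule channelD(1)[OF E]) simp
  have "1 \<cdot>\<^sub>m 0\<^sub>m n n + 0\<^sub>m n n = (0\<^sub>m n n :: complex mat)" by (intro eq_matI) auto
  hence e: "E (0\<^sub>m n n) = 1 \<cdot>\<^sub>m E (0\<^sub>m n n) + E (0\<^sub>m n n)"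
    using channelD(2)[OF E, of "0\<^sub>m n n" "0\<^sub>m n n" 1] by simp
  show ?thesis
  proof (rule eq_matI)
    fix i j assume "i < dim_row (0\<^sub>m m m :: complex mat)" "j < dim_col (0\<^sub>m m m :: complex mat)"
    hence ij: "i < m" "j < m" by auto
    have "E (0\<^sub>m n n) $$ (i,j) = (1 \<cdot>\<^sub>m E (0\<^sub>m n n) + E (0\<^sub>m n n)) $$ (i,j)" using e by simp
    also have "\<dots> = E (0\<^sub>m n n) $$ (i,j) + E (0\<^sub>m n n) $$ (i,j)" using c ij by (subst index_add_mat) auto
    finally show "E (0\<^sub>m n n) $$ (i,j) = 0\<^sub>m m m $$ (i,j)" using ij by simp
  qed (use c in auto)
qed

lemma channel_smult:
  assumes E: "channel n m E" and X: "X \<in> carrier_mat n n" shows "E (c \<cdot>\<^sub>m X) = c \<cdot>\<^sub>m E X"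
proof -
  have "c \<cdot>\<^sub>m X + 0\<^sub>m n n = c \<cdot>\<^sub>m X" using X by simp
  thus ?thesis using channelD(2)[OF E X, of "0\<^sub>m n n" c] channel_zero[OF E] channelD(1)[OF E X] by simp
qed

text \<open>The classical channel induced by E: the probability of outcome y in the basis W when
  basis state x of V is sent.\<close>

definition ckernel :: "nat \<Rightarrow> (complex mat \<Rightarrow> complex mat) \<Rightarrow> complex mat \<Rightarrow> complex mat \<Rightarrow> nat \<Rightarrow> nat \<Rightarrow> real" where
  "ckernel n E V W y x = Re ((adj W * E (V * rdiag n (\<lambda>i. if i = x then 1 else 0) * adj V) * W) $$ (y,y))"

text \<open>Linearity reduces the claim to basis projections; the diagonal is built up entry by
  entry through the truncations \<open>g k\<close>.\<close>

lemma channel_diag: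
  assumes E: "channel n m E" and V: "unitary n V" and W: "unitary m W" and y: "y < m"
  shows "Re ((adj W * E (V * rdiag n f * adj V) * W) $$ (y,y)) = (\<Sum>x<n. ckernel n E V W y x * f x)"
proof -
  note v = unitaryD[OF V] and w = unitaryD[OF W]
  define g where "g k = (\<lambda>i. if i < k then f i else 0)" for k :: nat
  have c: "V * rdiag n h * adj V \<in> carrier_mat n n" for h using v by (simp add: mult_carrier_sq[of _ n])
  have ec: "E (V * rdiag n h * adj V) \<in> carrier_mat m m" for h by (rule channelD(1)[OF E c])
  have "Re ((adj W * E (V * rdiag n (g k) * adj V) * W) $$ (y,y)) = (\<Sum>x<k. ckernel n E V W y x * f x)" for k
  proof (induction k)
    case 0
    have "rdiag n (g 0) = 0\<^sub>m n n" by (intro eq_matI) (auto simp: g_def)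
    hence "adj W * E (V * rdiag n (g 0) * adj V) * W = 0\<^sub>m m m" using v w channel_zero[OF E] by simp
    thus ?case using y by simp
  next
    case (Suc k)
    let ?d = "rdiag n (\<lambda>i. if i = k then 1 else 0)"
    have "rdiag n (g (Suc k)) = complex_of_real (f k) \<cdot>\<^sub>m ?d + rdiag n (g k)"
      by (intro eq_matI) (auto simp: g_def less_Suc_eq)
    hence "V * rdiag n (g (Suc k)) * adj V = complex_of_real (f k) \<cdot>\<^sub>m (V * ?d * adj V) + V * rdiag n (g k) * adj V"
      using v by (simp add: mult_add_distrib_mat[of _ n n _ n] add_mult_distrib_mat[of _ n n _ _ n] mult_smult_distrib[of _ n n _ n]
          mult_smult_assoc_mat[of _ n n _ n] mult_carrier_sq[of _ n])
    hence "E (V * rdiag n (g (Suc k)) * adj V) = complex_of_real (f k) \<cdot>\<^sub>m E (V * ?d * adj V) + E (V * rdiag n (g k) * adj V)"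
      using channelD(2)[OF E c c] by simp
    hence "adj W * E (V * rdiag n (g (Suc k)) * adj V) * W
        = complex_of_real (f k) \<cdot>\<^sub>m (adj W * E (V * ?d * adj V) * W) + adj W * E (V * rdiag n (g k) * adj V) * W"
      using w ec by (simp add: mult_add_distrib_mat[of _ m m _ m] add_mult_distrib_mat[of _ m m _ _ m] mult_smult_distrib[of _ m m _ m]
          mult_smult_assoc_mat[of _ m m _ m] mult_carrier_sq[of _ m])
    hence "(adj W * E (V * rdiag n (g (Suc k)) * adj V) * W) $$ (y,y)
        = complex_of_real (f k) * (adj W * E (V * ?d * adj V) * W) $$ (y,y) + (adj W * E (V * rdiag n (g k) * adj V) * W) $$ (y,y)"
      using w ec y by (simp del: index_mult_mat(1) add: mult_carrier_sq[of _ m])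
    thus ?case using Suc by (simp add: ckernel_def mult.commute del: index_mult_mat(1))
  qed
  from this[of n] have "Re ((adj W * E (V * rdiag n (g n) * adj V) * W) $$ (y,y)) = (\<Sum>x<n. ckernel n E V W y x * f x)" .
  moreover have "rdiag n (g n) = rdiag n f" by (intro eq_matI) (auto simp: g_def)
  ultimately show ?thesis by simp
qed

lemma ckernel_nonneg:
  assumes E: "channel n m E" and V: "unitary n V" and W: "unitary m W" and y: "y < m"
  shows "ckernel n E V W y x \<ge> 0"
  unfolding ckernel_def
  by (rule psd_diag_entry(2)[OF psd_conj[OF channel_psd[OF E spectral_psd[OF V]] unitaryD(1)[OF W]] y]) auto

lemma ckernel_sum:
  assumes E: "channel n m E" and V: "unitary n V" and W: "unitary m W" and x: "x < n"
  shows "(\<Sum>y<m. ckernel n E V W y x) = 1"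
proof -
  let ?d = "rdiag n (\<lambda>i. if i = x then 1 else 0)"
  have c: "V * ?d * adj V \<in> carrier_mat n n" using unitaryD[OF V] by (simp add: mult_carrier_sq[of _ n])
  have "mtrace (V * ?d * adj V) = 1" unfolding mtrace_unitary_conj(1)[OF V mat_diag_dim] mtrace_rdiag using x by simp
  hence "density n (V * ?d * adj V)" using spectral_psd[OF V, of "\<lambda>i. if i = x then 1 else 0"] by (auto simp: density_def)
  from density_trace_re[OF channel_density[OF E this] W] show ?thesis unfolding ckernel_def .
qed

text \<open>The form bound in the frame, conjugated back. It is an operator inequality so that a
  channel can be applied to it.\<close>

lemma frame_pinching:
  assumes f: "frame n \<rho> \<sigma> V p q" and r: "psd n \<rho>"
  shows "psd n (complex_of_real (real (card (q ` {..<n}))) \<cdot>\<^sub>m (V * rdiag n p * adj V) - \<rho>)"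
proof -
  note V = frameD(1)[OF f] note v = unitaryD[OF V] note rc = psdD(1)[OF r]
  let ?v = "real (card (q ` {..<n}))"
  define M where "M = adj V * \<rho> * V"
  have Mp: "psd n M" unfolding M_def by (rule psd_conj[OF r v(1)])
  note Mc = psdD(1)[OF Mp]
  have D: "psd n (rdiag n (\<lambda>i. ?v * p i) - M)"
    unfolding psd_def
  proof (intro conjI ballI)
    show "rdiag n (\<lambda>i. ?v * p i) - M \<in> carrier_mat n n" using Mc by (rule minus_carrier_mat)
    fix x :: "complex vec" assume x: "x \<in> carrier_vec n"
    have e: "cinner x ((rdiag n (\<lambda>i. ?v * p i) - M) *\<^sub>v x) = cinner x (rdiag n (\<lambda>i. ?v * p i) *\<^sub>v x) - cinner x (M *\<^sub>v x)"
      unfolding cinner_mult_vec[OF minus_carrier_mat[OF Mc] x] cinner_mult_vec[OF mat_diag_dim x] cinner_mult_vec[OF Mc x]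
        sum_subtractf[symmetric] using Mc by (intro sum.cong refl) (simp add: algebra_simps)
    have d: "cinner x (rdiag n (\<lambda>i. ?v * p i) *\<^sub>v x) = complex_of_real (?v * (\<Sum>a<n. (cmod (x $ a))\<^sup>2 * p a))"
    proof -
      have "cinner x (rdiag n (\<lambda>i. ?v * p i) *\<^sub>v x) = (\<Sum>a<n. \<Sum>b<n. if b = a then cnj (x $ a) * complex_of_real (?v * p a) * x $ a else 0)"
        unfolding cinner_mult_vec[OF mat_diag_dim x] by (intro sum.cong refl) auto
      also have "\<dots> = (\<Sum>a<n. complex_of_real (?v * ((cmod (x $ a))\<^sup>2 * p a)))"
      proof (rule sum.cong[OF refl])
        fix a assume "a \<in> {..<n}"
        have "cnj (x $ a) * complex_of_real (?v * p a) * x $ a = cnj (x $ a) * x $ a * complex_of_real (?v * p a)" by simp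
        also have "\<dots> = complex_of_real (?v * ((cmod (x $ a))\<^sup>2 * p a))" unfolding cmod_sq by simp
        finally show "(\<Sum>b<n. if b = a then cnj (x $ a) * complex_of_real (?v * p a) * x $ a else 0) = complex_of_real (?v * ((cmod (x $ a))\<^sup>2 * p a))"
          using \<open>a \<in> {..<n}\<close> by simp
      qed
      finally show ?thesis by (simp add: sum_distrib_left)
    qed
    have "Re (cinner x (M *\<^sub>v x)) \<le> ?v * (\<Sum>a<n. (cmod (x $ a))\<^sup>2 * Re (M $$ (a,a)))"
      unfolding cinner_mult_vec[OF Mc x]
      by (rule pinching_form_le[OF Mp]) (use frameD(6)[OF f] in \<open>auto simp: M_def simp del: index_mult_mat(1)\<close>)
    also have "\<dots> = ?v * (\<Sum>a<n. (cmod (x $ a))\<^sup>2 * p a)"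
      using frameD(5)[OF f] by (simp add: M_def del: index_mult_mat(1))
    finally show "Re (cinner x ((rdiag n (\<lambda>i. ?v * p i) - M) *\<^sub>v x)) \<ge> 0" unfolding e d by simp
    show "Im (cinner x ((rdiag n (\<lambda>i. ?v * p i) - M) *\<^sub>v x)) = 0" unfolding e d using psdD(2)[OF Mp x] by simp
  qed
  have "V * (rdiag n (\<lambda>i. ?v * p i) - M) * adj V = V * rdiag n (\<lambda>i. ?v * p i) * adj V - V * M * adj V"
    using v Mc by (simp add: mult_minus_distrib_mat[of _ n n _ n] minus_mult_distrib_mat[of _ n n _ _ n] mult_carrier_sq[of _ n])
  also have "V * M * adj V = \<rho>" unfolding M_def by (rule unitary_conj_inverse(1)[OF V rc])
  also have "V * rdiag n (\<lambda>i. ?v * p i) * adj V = complex_of_real ?v \<cdot>\<^sub>m (V * rdiag n p * adj V)"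
  proof -
    have "rdiag n (\<lambda>i. ?v * p i) = complex_of_real ?v \<cdot>\<^sub>m rdiag n p" by (intro eq_matI) auto
    thus ?thesis
      using v by (simp add: mult_smult_distrib[of _ n n _ n] mult_smult_assoc_mat[of _ n n _ n] mult_carrier_sq[of _ n])
  qed
  finally show ?thesis using psd_conj[OF D v(6)] by (simp only: adj_adj)
qed

lemma smult_minus_index:
  fixes A B :: "complex mat"
  assumes "A \<in> carrier_mat m m" "B \<in> carrier_mat m m" "y < m"
  shows "(c \<cdot>\<^sub>m A - B) $$ (y,y) = c * A $$ (y,y) - B $$ (y,y)"
  using assms by simp

text \<open>Coherences of \<rho> between eigenspaces of \<sigma> keep E \<rho> from being described
  by the kernel. Applying E to the operator form of the pinching inequality still bounds its
  diagonal by the kernel output of p, at the price of the number of eigenvalues.\<close>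

lemma channel_frame_bound:
  assumes E: "channel n m E" and f: "frame n \<rho> \<sigma> V p q" and r: "psd n \<rho>" and W: "unitary m W" and y: "y < m"
  shows "Re ((adj W * E \<rho> * W) $$ (y,y)) \<le> real (card (q ` {..<n})) * (\<Sum>x<n. ckernel n E V W y x * p x)"
proof -
  note V = frameD(1)[OF f] note v = unitaryD[OF V] note w = unitaryD[OF W] note rc = psdD(1)[OF r]
  let ?v = "real (card (q ` {..<n}))"
  define P where "P = V * rdiag n p * adj V"
  have Pc: "P \<in> carrier_mat n n" using v by (simp add: P_def mult_carrier_sq[of _ n])
  define X where "X = complex_of_real ?v \<cdot>\<^sub>m P - \<rho>"
  have X: "psd n X" unfolding X_def P_def by (rule frame_pinching[OF f r])
  have "1 \<cdot>\<^sub>m X + \<rho> = complex_of_real ?v \<cdot>\<^sub>m P" using Pc rc by (intro eq_matI) (auto simp: X_def)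
  hence "complex_of_real ?v \<cdot>\<^sub>m E P = 1 \<cdot>\<^sub>m E X + E \<rho>"
    using channelD(2)[OF E psdD(1)[OF X] rc, of 1] channel_smult[OF E Pc] by simp
  hence "E X = complex_of_real ?v \<cdot>\<^sub>m E P - E \<rho>"
    using channelD(1)[OF E psdD(1)[OF X]] channelD(1)[OF E rc] channelD(1)[OF E Pc]
    by (intro eq_matI) auto
  hence "adj W * E X * W = complex_of_real ?v \<cdot>\<^sub>m (adj W * E P * W) - adj W * E \<rho> * W"
    using w channelD(1)[OF E rc] channelD(1)[OF E Pc]
    by (simp add: mult_minus_distrib_mat[of _ m m _ m] minus_mult_distrib_mat[of _ m m _ _ m] mult_smult_distrib[of _ m m _ m]
          mult_smult_assoc_mat[of _ m m _ m] mult_carrier_sq[of _ m])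
  hence "(adj W * E X * W) $$ (y,y) = complex_of_real ?v * (adj W * E P * W) $$ (y,y) - (adj W * E \<rho> * W) $$ (y,y)"
    using smult_minus_index[OF mult_carrier_sq[OF mult_carrier_sq[OF w(6) channelD(1)[OF E Pc]] w(1)]
        mult_carrier_sq[OF mult_carrier_sq[OF w(6) channelD(1)[OF E rc]] w(1)] y] by simp
  moreover have "Re ((adj W * E X * W) $$ (y,y)) \<ge> 0"
    by (rule psd_diag_entry(2)[OF psd_conj[OF channel_psd[OF E X] w(1)] y])
  ultimately show ?thesis using channel_diag[OF E V W y, of p] unfolding P_def[symmetric] by simp
qed

lemma classical_dpi:
  fixes K :: "nat \<Rightarrow> nat \<Rightarrow> real"
  assumes K: "\<And>y x. y < m \<Longrightarrow> x < n \<Longrightarrow> K y x \<ge> 0" "\<And>x. x < n \<Longrightarrow> (\<Sum>y<m. K y x) = 1"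
    and p: "\<And>x. p x \<ge> 0" and q: "\<And>x. q x \<ge> 0" and ac: "\<And>x. x < n \<Longrightarrow> q x = 0 \<Longrightarrow> p x = 0" and b: "\<beta> \<ge> 1"
  shows "cQ \<beta> m (\<lambda>y. \<Sum>x<n. K y x * p x) (\<lambda>y. \<Sum>x<n. K y x * q x) \<le> cQ \<beta> n p q"
proof -
  have "cQ \<beta> m (\<lambda>y. \<Sum>x<n. K y x * p x) (\<lambda>y. \<Sum>x<n. K y x * q x) \<le> (\<Sum>y<m. \<Sum>x<n. K y x * (p x powr \<beta> * q x powr (1 - \<beta>)))"
    unfolding cQ_def using assms by (intro sum_mono perspective_powr) auto
  also have "\<dots> = (\<Sum>x<n. (\<Sum>y<m. K y x) * (p x powr \<beta> * q x powr (1 - \<beta>)))"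
    by (subst sum.swap) (simp add: sum_distrib_right)
  finally show ?thesis using K(2) by (simp add: cQ_def)
qed

text \<open>The weights 1 / (2\<beta>) and 1 / (2\<alpha>) add up to 1 and are such that the powers
  of q cancel, leaving the root of t p. Where q vanishes, absolute continuity makes t vanish
  too.\<close>

lemma bhattacharyya_holder:
  assumes t: "\<And>y. y < m \<Longrightarrow> t y \<ge> 0" and p: "\<And>y. p y \<ge> 0" and q: "\<And>y. y < m \<Longrightarrow> q y \<ge> 0"
    and ac: "\<And>y. y < m \<Longrightarrow> q y = 0 \<Longrightarrow> t y = 0"
    and ab: "0 < \<alpha>" "0 < \<beta>" "1 / (2 * \<alpha>) + 1 / (2 * \<beta>) = 1"
  shows "(\<Sum>y<m. sqrt (t y * p y)) \<le> cQ \<beta> m t q powr (1 / (2 * \<beta>)) * cQ \<alpha> m p q powr (1 / (2 * \<alpha>))"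
proof -
  define u where "u = 1 / (2 * \<beta>)"
  have u1: "1 - u = 1 / (2 * \<alpha>)" using ab(3) by (simp add: u_def)
  have "1 - u > 0" unfolding u1 using ab by simp
  hence u: "0 < u" "u < 1" using ab by (auto simp: u_def)
  have summand: "sqrt (t y * p y) = (t y powr \<beta> * q y powr (1 - \<beta>)) powr u * (p y powr \<alpha> * q y powr (1 - \<alpha>)) powr (1 - u)"
    if y: "y < m" for y
  proof (cases "q y = 0")
    case True thus ?thesis using ac[OF y] by simp
  next
    case False
    hence qy: "q y > 0" using q[OF y] by simp
    have e1: "(t y powr \<beta> * q y powr (1 - \<beta>)) powr u = t y powr (1/2) * q y powr ((1 - \<beta>) * u)"
      using ab by (simp add: powr_mult powr_powr u_def)
    have e2: "(p y powr \<alpha> * q y powr (1 - \<alpha>)) powr (1 - u) = p y powr (1/2) * q y powr ((1 - \<alpha>) * (1 - u))"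
      unfolding u1 using ab by (simp add: powr_mult powr_powr)
    have "(1 - \<beta>) * u + (1 - \<alpha>) * (1 - u) = u + (1 - u) - (\<beta> * u + \<alpha> * (1 - u))" by (simp add: algebra_simps)
    also have "\<dots> = 0" unfolding u1 using ab by (simp add: u_def)
    finally have q1: "q y powr ((1 - \<beta>) * u) * q y powr ((1 - \<alpha>) * (1 - u)) = 1" using qy by (simp add: powr_add[symmetric])
    have "(t y powr \<beta> * q y powr (1 - \<beta>)) powr u * (p y powr \<alpha> * q y powr (1 - \<alpha>)) powr (1 - u)
        = t y powr (1/2) * p y powr (1/2) * (q y powr ((1 - \<beta>) * u) * q y powr ((1 - \<alpha>) * (1 - u)))"
      unfolding e1 e2 by (simp only: mult_ac)
    hence "(t y powr \<beta> * q y powr (1 - \<beta>)) powr u * (p y powr \<alpha> * q y powr (1 - \<alpha>)) powr (1 - u) = t y powr (1/2) * p y powr (1/2)"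
      unfolding q1 by simp
    thus ?thesis using t[OF y] p[of y] by (simp add: powr_half_sqrt real_sqrt_mult)
  qed
  have "(\<Sum>y<m. sqrt (t y * p y)) = (\<Sum>y<m. (t y powr \<beta> * q y powr (1 - \<beta>)) powr u * (p y powr \<alpha> * q y powr (1 - \<alpha>)) powr (1 - u))"
    using summand by (intro sum.cong) auto
  also have "\<dots> \<le> (\<Sum>y<m. t y powr \<beta> * q y powr (1 - \<beta>)) powr u * (\<Sum>y<m. p y powr \<alpha> * q y powr (1 - \<alpha>)) powr (1 - u)"
    using u by (intro holder_powr) auto
  finally show ?thesis unfolding u1 unfolding cQ_def u_def .
qed

text \<open>\<sigma> is diagonal in its frame, so the kernel takes q exactly to q', whereas p is
  controlled only up to the pinching factor. The second bound is the limit case \<alpha> = 1/2 with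
  infinite dual order: a pointwise bound p \<le> \<Lambda> q passes through the kernel and replaces
  Hoelder's inequality.\<close>

lemma converse_frames:
  assumes E: "channel n m E" and f: "frame n \<rho> \<sigma> V p q" and f': "frame m \<rho>' \<sigma>' W p' q'"
    and r: "psd n \<rho>" and r': "psd m \<rho>'" and sup: "mpow \<sigma> 0 * \<rho> = \<rho>" and Es: "E \<sigma> = \<sigma>'"
  shows "0 < \<alpha> \<Longrightarrow> 1 \<le> \<beta> \<Longrightarrow> 1 / (2 * \<alpha>) + 1 / (2 * \<beta>) = 1 \<Longrightarrow>
      (fidelity (E \<rho>) \<rho>')\<^sup>2 \<le> real (card (q ` {..<n})) * cQ \<beta> n p q powr (1 / \<beta>) * cQ \<alpha> m p' q' powr (1 / \<alpha>)"
    and "0 \<le> \<Lambda> \<Longrightarrow> (\<And>x. x < n \<Longrightarrow> p x \<le> \<Lambda> * q x) \<Longrightarrow>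
      (fidelity (E \<rho>) \<rho>')\<^sup>2 \<le> real (card (q ` {..<n})) * \<Lambda> * (cQ (1/2) m p' q')\<^sup>2"
proof -
  note V = frameD(1)[OF f] and W = frameD(1)[OF f']
  let ?v = "real (card (q ` {..<n}))"
  define K where "K = ckernel n E V W"
  define t where "t y = (\<Sum>x<n. K y x * p x)" for y
  have K: "\<And>y x. y < m \<Longrightarrow> K y x \<ge> 0" "\<And>x. x < n \<Longrightarrow> (\<Sum>y<m. K y x) = 1"
    using ckernel_nonneg[OF E V W] ckernel_sum[OF E V W] by (auto simp: K_def)
  have t0: "t y \<ge> 0" if "y < m" for y using K(1)[OF that] frameD(3)[OF f] by (auto simp: t_def intro!: sum_nonneg)
  have ac: "\<And>x. x < n \<Longrightarrow> q x = 0 \<Longrightarrow> p x = 0" by (rule frame_support[OF f r sup])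
  have q': "q' y = (\<Sum>x<n. K y x * q x)" if y: "y < m" for y
  proof -
    have "adj W * E (V * rdiag n q * adj V) * W = rdiag m q'"
      unfolding frameD(2)[OF f, symmetric] Es unfolding frameD(2)[OF f'] by (rule unitary_conj_inverse(2)[OF W]) simp
    thus ?thesis using channel_diag[OF E V W y, of q] y by (simp add: K_def)
  qed
  \<comment> \<open>\<open>q' y = 0\<close> forces K y x = 0 wherever q x > 0, and elsewhere p x =
    0.\<close>
  have act: "t y = 0" if "y < m" "q' y = 0" for y
  proof -
    have "\<forall>x\<in>{..<n}. K y x * q x = 0"
      using q'[OF that(1)] that K(1)[OF that(1)] frameD(4)[OF f] by (subst sum_nonneg_eq_0_iff[symmetric]) auto
    thus ?thesis unfolding t_def using ac by (intro sum.neutral) auto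
  qed
  have F0: "fidelity (E \<rho>) \<rho>' \<ge> 0" by (rule fidelity_nonneg[OF channel_psd[OF E r] r'])
  have F: "fidelity (E \<rho>) \<rho>' \<le> sqrt ?v * (\<Sum>y<m. sqrt (t y * p' y))"
  proof -
    have "fidelity (E \<rho>) \<rho>' \<le> (\<Sum>y<m. sqrt (Re ((adj W * E \<rho> * W) $$ (y,y)) * Re ((adj W * \<rho>' * W) $$ (y,y))))"
      by (rule fidelity_le_measured[OF channel_psd[OF E r] r' W])
    also have "\<dots> \<le> (\<Sum>y<m. sqrt (?v * t y * p' y))"
    proof (rule sum_mono)
      fix y assume "y \<in> {..<m}" hence y: "y < m" by simp
      have "Re ((adj W * \<rho>' * W) $$ (y,y)) = p' y" using frameD(5)[OF f' y] by simp
      thus "sqrt (Re ((adj W * E \<rho> * W) $$ (y,y)) * Re ((adj W * \<rho>' * W) $$ (y,y))) \<le> sqrt (?v * t y * p' y)"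
        using channel_frame_bound[OF E f r W y] frameD(3)[OF f', of y] unfolding t_def K_def
        by (intro real_sqrt_le_mono) (simp add: mult_right_mono del: index_mult_mat(1))
    qed
    also have "\<dots> = sqrt ?v * (\<Sum>y<m. sqrt (t y * p' y))" by (simp add: real_sqrt_mult mult.assoc sum_distrib_left)
    finally show ?thesis .
  qed
  {
    assume ab: "0 < \<alpha>" "1 \<le> \<beta>" "1 / (2 * \<alpha>) + 1 / (2 * \<beta>) = 1"
    let ?A = "cQ \<beta> n p q" and ?B = "cQ \<alpha> m p' q'"
    have "cQ \<beta> m t q' = cQ \<beta> m t (\<lambda>y. \<Sum>x<n. K y x * q x)" using q' by (simp add: cQ_def)
    also have "\<dots> \<le> ?A" unfolding t_def
      using K frameD(3,4)[OF f] ac ab by (intro classical_dpi) auto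
    finally have A: "cQ \<beta> m t q' \<le> ?A" .
    have "(\<Sum>y<m. sqrt (t y * p' y)) \<le> cQ \<beta> m t q' powr (1 / (2 * \<beta>)) * ?B powr (1 / (2 * \<alpha>))"
      using t0 act frameD(3,4)[OF f'] ab by (intro bhattacharyya_holder) auto
    also have "\<dots> \<le> ?A powr (1 / (2 * \<beta>)) * ?B powr (1 / (2 * \<alpha>))"
      using A cQ_nonneg ab by (intro mult_right_mono powr_mono2) auto
    finally have "fidelity (E \<rho>) \<rho>' \<le> sqrt ?v * (?A powr (1 / (2 * \<beta>)) * ?B powr (1 / (2 * \<alpha>)))"
      using F by (meson mult_left_mono order_trans real_sqrt_ge_zero of_nat_0_le_iff)
    hence "(fidelity (E \<rho>) \<rho>')\<^sup>2 \<le> (sqrt ?v * (?A powr (1 / (2 * \<beta>)) * ?B powr (1 / (2 * \<alpha>))))\<^sup>2"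
      using F0 by (intro power_mono)
    also have "\<dots> = ?v * ((?A powr (1 / (2 * \<beta>)))\<^sup>2 * (?B powr (1 / (2 * \<alpha>)))\<^sup>2)"
      by (simp add: power_mult_distrib)
    also have "(?A powr (1 / (2 * \<beta>)))\<^sup>2 = ?A powr (1 / \<beta>)" using ab by (simp add: power2_eq_square powr_add[symmetric])
    also have "(?B powr (1 / (2 * \<alpha>)))\<^sup>2 = ?B powr (1 / \<alpha>)" using ab by (simp add: power2_eq_square powr_add[symmetric])
    finally show "(fidelity (E \<rho>) \<rho>')\<^sup>2 \<le> ?v * ?A powr (1 / \<beta>) * ?B powr (1 / \<alpha>)" by (simp add: mult.assoc)
  next
    assume L: "0 \<le> \<Lambda>" "\<And>x. x < n \<Longrightarrow> p x \<le> \<Lambda> * q x"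
    have tq: "t y \<le> \<Lambda> * q' y" if y: "y < m" for y
    proof -
      have "t y \<le> (\<Sum>x<n. K y x * (\<Lambda> * q x))" unfolding t_def using L(2) K(1)[OF y] by (intro sum_mono mult_left_mono) auto
      thus ?thesis unfolding q'[OF y] by (simp add: sum_distrib_left mult_ac)
    qed
    have "(\<Sum>y<m. sqrt (t y * p' y)) \<le> (\<Sum>y<m. sqrt (\<Lambda> * q' y * p' y))"
      using tq frameD(3)[OF f'] by (intro sum_mono real_sqrt_le_mono mult_right_mono) auto
    also have "\<dots> = sqrt \<Lambda> * cQ (1/2) m p' q'"
      using frameD(3,4)[OF f'] by (simp add: cQ_def powr_half_sqrt real_sqrt_mult sum_distrib_left mult_ac)
    finally have "fidelity (E \<rho>) \<rho>' \<le> sqrt ?v * (sqrt \<Lambda> * cQ (1/2) m p' q')"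
      using F by (meson mult_left_mono order_trans real_sqrt_ge_zero of_nat_0_le_iff)
    hence "(fidelity (E \<rho>) \<rho>')\<^sup>2 \<le> (sqrt ?v * (sqrt \<Lambda> * cQ (1/2) m p' q'))\<^sup>2"
      using F0 by (intro power_mono)
    thus "(fidelity (E \<rho>) \<rho>')\<^sup>2 \<le> ?v * \<Lambda> * (cQ (1/2) m p' q')\<^sup>2" using L(1) by (simp add: power_mult_distrib mult.assoc)
  }
qed

section \<open>Classical achievability\<close>

definition pd :: "nat \<Rightarrow> (nat \<Rightarrow> real) \<Rightarrow> bool" where
  "pd D t \<longleftrightarrow> (\<forall>x. 0 \<le> t x) \<and> (\<Sum>x<D. t x) = 1"

definition abscont :: "nat \<Rightarrow> (nat \<Rightarrow> real) \<Rightarrow> (nat \<Rightarrow> real) \<Rightarrow> bool" where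
  "abscont D t p \<longleftrightarrow> (\<forall>x<D. p x = 0 \<longrightarrow> t x = 0)"

text \<open>Relative entropy in natural logarithms. It is used together with \<open>abscont\<close>,
  since a quotient by 0 is 0 and would hide the infinite case.\<close>

definition kl :: "nat \<Rightarrow> (nat \<Rightarrow> real) \<Rightarrow> (nat \<Rightarrow> real) \<Rightarrow> real" where
  "kl D t p = (\<Sum>x<D. t x * ln (t x / p x))"

subsection \<open>Typical sets\<close>

text \<open>The additive counterpart of \<open>pweight\<close>: l is summed over the digits of x, as
  for a log-likelihood ratio.\<close>

fun asum :: "nat \<Rightarrow> (nat \<Rightarrow> real) \<Rightarrow> nat \<Rightarrow> nat \<Rightarrow> real" where
  "asum D l 0 x = 0"
| "asum D l (Suc n) x = l (x div D^n) + asum D l n (x mod D^n)"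

lemma asum_shift: "asum D (\<lambda>a. l a - c) n x = asum D l n x - real n * c"
  by (induction n arbitrary: x) (auto simp: algebra_simps)

text \<open>Mean and variance of a sum of independent centred terms. Both are proved in one
  induction, since the cross term of the second moment vanishes by the first.\<close>

lemma sum_pweight_asum:
  assumes "pd D t" and m: "(\<Sum>a<D. t a * l a) = 0"
  shows "(\<Sum>x<D^n. pweight D t n x * asum D l n x) = 0"
    and "(\<Sum>x<D^n. pweight D t n x * (asum D l n x)\<^sup>2) = real n * (\<Sum>a<D. t a * (l a)\<^sup>2)"
proof -
  have t1: "(\<Sum>a<D. t a) = 1" using assms(1) by (simp add: pd_def)
  have "(\<Sum>x<D^n. pweight D t n x * asum D l n x) = 0 \<and>
    (\<Sum>x<D^n. pweight D t n x * (asum D l n x)\<^sup>2) = real n * (\<Sum>a<D. t a * (l a)\<^sup>2)"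
  proof (induction n)
    case (Suc n)
    let ?w = "pweight D t n" and ?s = "asum D l n"
    have w1: "(\<Sum>b<D^n. ?w b) = 1" unfolding sum_pweight t1 by simp
    have "(\<Sum>x<D^Suc n. pweight D t (Suc n) x * asum D l (Suc n) x)
        = (\<Sum>x<D*D^n. (\<lambda>a b. t a * ?w b * (l a + ?s b)) (x div D^n) (x mod D^n))" by simp
    also have "\<dots> = (\<Sum>a<D. \<Sum>b<D^n. t a * ?w b * (l a + ?s b))" by (rule sum_div_mod)
    also have "\<dots> = (\<Sum>a<D. \<Sum>b<D^n. (t a * l a) * ?w b + t a * (?w b * ?s b))"
      by (intro sum.cong refl) (simp add: algebra_simps)
    also have "\<dots> = (\<Sum>a<D. t a * l a) * (\<Sum>b<D^n. ?w b) + (\<Sum>a<D. t a) * (\<Sum>b<D^n. ?w b * ?s b)"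
      by (simp add: sum.distrib sum_product)
    finally have 1: "(\<Sum>x<D^Suc n. pweight D t (Suc n) x * asum D l (Suc n) x) = 0" using Suc m by simp
    have "(\<Sum>x<D^Suc n. pweight D t (Suc n) x * (asum D l (Suc n) x)\<^sup>2)
        = (\<Sum>x<D*D^n. (\<lambda>a b. t a * ?w b * (l a + ?s b)\<^sup>2) (x div D^n) (x mod D^n))" by simp
    also have "\<dots> = (\<Sum>a<D. \<Sum>b<D^n. t a * ?w b * (l a + ?s b)\<^sup>2)" by (rule sum_div_mod)
    also have "\<dots> = (\<Sum>a<D. \<Sum>b<D^n. (t a * (l a)\<^sup>2) * ?w b + (2 * (t a * l a)) * (?w b * ?s b) + t a * (?w b * (?s b)\<^sup>2))"
      by (intro sum.cong refl) (simp add: algebra_simps power2_eq_square)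
    also have "\<dots> = (\<Sum>a<D. t a * (l a)\<^sup>2) * (\<Sum>b<D^n. ?w b) + (\<Sum>a<D. 2 * (t a * l a)) * (\<Sum>b<D^n. ?w b * ?s b)
        + (\<Sum>a<D. t a) * (\<Sum>b<D^n. ?w b * (?s b)\<^sup>2)"
      by (simp add: sum.distrib sum_product)
    finally have "(\<Sum>x<D^Suc n. pweight D t (Suc n) x * (asum D l (Suc n) x)\<^sup>2) = real (Suc n) * (\<Sum>a<D. t a * (l a)\<^sup>2)"
      using Suc w1 t1 by (simp add: algebra_simps)
    thus ?case using 1 by blast
  qed simp
  thus "(\<Sum>x<D^n. pweight D t n x * asum D l n x) = 0"
    "(\<Sum>x<D^n. pweight D t n x * (asum D l n x)\<^sup>2) = real n * (\<Sum>a<D. t a * (l a)\<^sup>2)" by auto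
qed

lemma chebyshev_pweight:
  fixes l :: "nat \<Rightarrow> real"
  assumes t: "pd D t" and d: "\<delta> > 0" and n: "n > 0"
  defines "\<mu> \<equiv> \<Sum>a<D. t a * l a"
  shows "(\<Sum>x\<in>{x\<in>{..<D^n}. \<bar>asum D l n x - real n * \<mu>\<bar> \<ge> real n * \<delta>}. pweight D t n x)
    \<le> (\<Sum>a<D. t a * (l a - \<mu>)\<^sup>2) / (real n * \<delta>\<^sup>2)"
proof -
  let ?V = "\<Sum>a<D. t a * (l a - \<mu>)\<^sup>2"
  let ?B = "{x\<in>{..<D^n}. \<bar>asum D l n x - real n * \<mu>\<bar> \<ge> real n * \<delta>}"
  have t1: "(\<Sum>a<D. t a) = 1" and t0: "\<And>a. t a \<ge> 0" using t by (auto simp: pd_def)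
  have w0: "pweight D t n x \<ge> 0" for x by (rule pweight_nonneg[OF t0])
  have "(\<Sum>a<D. t a * (l a - \<mu>)) = (\<Sum>a<D. t a * l a) - (\<Sum>a<D. t a) * \<mu>"
    by (simp add: right_diff_distrib sum_subtractf sum_distrib_right)
  hence m0: "(\<Sum>a<D. t a * (l a - \<mu>)) = 0" using t1 by (simp add: \<mu>_def)
  have "(real n * \<delta>)\<^sup>2 * (\<Sum>x\<in>?B. pweight D t n x) = (\<Sum>x\<in>?B. pweight D t n x * (real n * \<delta>)\<^sup>2)"
    by (simp add: sum_distrib_left mult.commute)
  also have "\<dots> \<le> (\<Sum>x\<in>?B. pweight D t n x * (asum D l n x - real n * \<mu>)\<^sup>2)"
  proof (intro sum_mono mult_left_mono w0)
    fix x assume "x \<in> ?B"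
    hence "(real n * \<delta>)\<^sup>2 \<le> \<bar>asum D l n x - real n * \<mu>\<bar>\<^sup>2" using d by (intro power_mono) auto
    thus "(real n * \<delta>)\<^sup>2 \<le> (asum D l n x - real n * \<mu>)\<^sup>2" by simp
  qed
  also have "\<dots> \<le> (\<Sum>x<D^n. pweight D t n x * (asum D l n x - real n * \<mu>)\<^sup>2)"
    using w0 by (intro sum_mono2) auto
  also have "\<dots> = real n * ?V"
    using sum_pweight_asum(2)[OF t m0, of n] by (simp add: asum_shift)
  finally have "(real n * \<delta>)\<^sup>2 * (\<Sum>x\<in>?B. pweight D t n x) \<le> real n * ?V" .
  hence "(\<Sum>x\<in>?B. pweight D t n x) \<le> real n * ?V / (real n * \<delta>)\<^sup>2"
    using d n by (simp add: pos_le_divide_eq mult.commute)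
  also have "\<dots> = ?V / (real n * \<delta>\<^sup>2)" using n by (simp add: power2_eq_square)
  finally show ?thesis .
qed

text \<open>Chebyshev's inequality for two statistics at once, and a union bound that also discards
  words of weight 0. Probability 1/2 suffices, because constant factors do not change
  exponents.\<close>

lemma typical_set:
  assumes t: "pd D t" and d: "\<delta> > 0"
  shows "\<exists>N0. \<forall>n\<ge>N0. (\<Sum>x\<in>{x\<in>{..<D^n}. pweight D t n x > 0 \<and>
      \<bar>asum D l n x - real n * (\<Sum>a<D. t a * l a)\<bar> < real n * \<delta> \<and>
      \<bar>asum D k n x - real n * (\<Sum>a<D. t a * k a)\<bar> < real n * \<delta>}. pweight D t n x) \<ge> 1/2"
proof -
  define V where "V = (\<Sum>a<D. t a * (l a - (\<Sum>a<D. t a * l a))\<^sup>2) + (\<Sum>a<D. t a * (k a - (\<Sum>a<D. t a * k a))\<^sup>2)"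
  \<comment> \<open>Beyond this threshold the two Chebyshev terms together are at most 1/2.\<close>
  obtain N1 :: nat where N1: "2 * V / \<delta>\<^sup>2 < real N1" using reals_Archimedean2 by blast
  show ?thesis
  proof (intro exI allI impI)
    fix n assume n: "n \<ge> Suc N1"
    have t0: "\<And>a. t a \<ge> 0" and t1: "(\<Sum>a<D. t a) = 1" using t by (auto simp: pd_def)
    have w0: "pweight D t n x \<ge> 0" for x by (rule pweight_nonneg[OF t0])
    let ?A = "{x\<in>{..<D^n}. \<bar>asum D l n x - real n * (\<Sum>a<D. t a * l a)\<bar> \<ge> real n * \<delta>}"
    let ?B = "{x\<in>{..<D^n}. \<bar>asum D k n x - real n * (\<Sum>a<D. t a * k a)\<bar> \<ge> real n * \<delta>}"
    let ?Z = "{x\<in>{..<D^n}. pweight D t n x = 0}"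
    let ?T = "{x\<in>{..<D^n}. pweight D t n x > 0 \<and>
      \<bar>asum D l n x - real n * (\<Sum>a<D. t a * l a)\<bar> < real n * \<delta> \<and>
      \<bar>asum D k n x - real n * (\<Sum>a<D. t a * k a)\<bar> < real n * \<delta>}"
    have sub: "{..<D^n} \<subseteq> ?T \<union> (?A \<union> (?B \<union> ?Z))"
    proof
      fix x assume x: "x \<in> {..<D^n}"
      have "pweight D t n x > 0 \<or> pweight D t n x = 0" using w0[of x] by linarith
      thus "x \<in> ?T \<union> (?A \<union> (?B \<union> ?Z))" using x by (simp only: Un_iff mem_Collect_eq linorder_not_less[symmetric]) blast
    qed
    have "1 = (\<Sum>x<D^n. pweight D t n x)" unfolding sum_pweight t1 by simp
    also have "\<dots> \<le> (\<Sum>x\<in>?T \<union> (?A \<union> (?B \<union> ?Z)). pweight D t n x)"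
      using sub w0 by (intro sum_mono2) auto
    also have "\<dots> \<le> sum (pweight D t n) ?T + (sum (pweight D t n) ?A + (sum (pweight D t n) ?B + sum (pweight D t n) ?Z))"
    proof -
      have u: "sum (pweight D t n) (X \<union> Y) \<le> sum (pweight D t n) X + sum (pweight D t n) Y" if "finite X" "finite Y" for X Y
      proof -
        have "0 \<le> sum (pweight D t n) (X \<inter> Y)" using w0 by (intro sum_nonneg) auto
        thus ?thesis using sum.union_inter[OF that, of "pweight D t n"] by linarith
      qed
      show ?thesis
        by (intro order.trans[OF u] add_mono order.refl order.trans[OF u]) auto
    qed
    also have "sum (pweight D t n) ?Z = 0" by (intro sum.neutral) auto
    also have "sum (pweight D t n) ?A \<le> (\<Sum>a<D. t a * (l a - (\<Sum>a<D. t a * l a))\<^sup>2) / (real n * \<delta>\<^sup>2)"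
      by (rule chebyshev_pweight[OF t d]) (use n in simp)
    also have "sum (pweight D t n) ?B \<le> (\<Sum>a<D. t a * (k a - (\<Sum>a<D. t a * k a))\<^sup>2) / (real n * \<delta>\<^sup>2)"
      by (rule chebyshev_pweight[OF t d]) (use n in simp)
    finally have "1 \<le> sum (pweight D t n) ?T + V / (real n * \<delta>\<^sup>2)"
      by (simp add: V_def add_divide_distrib)
    moreover have "V / (real n * \<delta>\<^sup>2) \<le> 1/2"
    proof -
      have "2 * V / \<delta>\<^sup>2 \<le> real n" using N1 n by linarith
      hence "2 * V \<le> real n * \<delta>\<^sup>2" using d by (simp add: pos_divide_le_eq)
      thus ?thesis using d n by (simp add: pos_divide_le_eq)
    qed
    ultimately show "sum (pweight D t n) ?T \<ge> 1/2" by linarith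
  qed
qed

lemma pweight_likelihood:
  assumes t0: "\<And>a. t a \<ge> 0" and p0: "\<And>a. p a \<ge> 0" and ac: "abscont D t p"
  shows "x < D^n \<Longrightarrow> pweight D t n x > 0 \<Longrightarrow>
    pweight D t n x = pweight D p n x * exp (asum D (\<lambda>a. ln (t a / p a)) n x)"
proof (induction n arbitrary: x)
  case (Suc n)
  hence x: "x < D * D^n" by simp
  note b = div_mod_bounds[OF x]
  let ?a = "x div D^n"
  have w0: "pweight D t n (x mod D^n) \<ge> 0" by (rule pweight_nonneg[OF t0])
  have pos: "t ?a > 0" "pweight D t n (x mod D^n) > 0"
    using Suc.prems(2) t0[of ?a] w0 by (auto simp: zero_less_mult_iff)
  hence "p ?a > 0" using ac b(1) p0[of ?a] by (fastforce simp: abscont_def less_le)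
  hence "t ?a = p ?a * exp (ln (t ?a / p ?a))" using pos by simp
  thus ?case using Suc.IH[OF b(2) pos(2)] by (simp add: exp_add)
qed simp

text \<open>Change of measure: on the typical set of t the likelihood ratios to p and to q are
  constant up to exp (n \<delta>), so the probabilities of this set under p and q are governed by
  the two relative entropies.\<close>

lemma typical_test:
  assumes t: "pd D t" and p0: "\<And>a. p a \<ge> 0" and q0: "\<And>a. q a \<ge> 0"
    and ac: "abscont D t p" "abscont D t q" and d: "\<delta> > 0"
  shows "\<exists>N0. \<forall>n\<ge>N0. \<exists>T\<subseteq>{..<D^n}. (\<Sum>x\<in>T. pweight D p n x) \<ge> 1/2 * exp (- real n * (kl D t p + \<delta>))
    \<and> (\<Sum>x\<in>T. pweight D q n x) \<le> exp (- real n * (kl D t q - \<delta>))"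
proof -
  have t0: "\<And>a. t a \<ge> 0" and t1: "(\<Sum>a<D. t a) = 1" using t by (auto simp: pd_def)
  let ?l = "\<lambda>a. ln (t a / p a)" and ?k = "\<lambda>a. ln (t a / q a)"
  obtain N0 where N0: "\<And>n. n \<ge> N0 \<Longrightarrow> (\<Sum>x\<in>{x\<in>{..<D^n}. pweight D t n x > 0 \<and>
      \<bar>asum D ?l n x - real n * (\<Sum>a<D. t a * ?l a)\<bar> < real n * \<delta> \<and>
      \<bar>asum D ?k n x - real n * (\<Sum>a<D. t a * ?k a)\<bar> < real n * \<delta>}. pweight D t n x) \<ge> 1/2"
    using typical_set[OF t d, of ?l ?k] by auto
  show ?thesis
  proof (intro exI[of _ N0] allI impI)
    fix n assume n: "n \<ge> N0"
    define T where "T = {x\<in>{..<D^n}. pweight D t n x > 0 \<and>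
      \<bar>asum D ?l n x - real n * (\<Sum>a<D. t a * ?l a)\<bar> < real n * \<delta> \<and>
      \<bar>asum D ?k n x - real n * (\<Sum>a<D. t a * ?k a)\<bar> < real n * \<delta>}"
    have T: "T \<subseteq> {..<D^n}" "(\<Sum>x\<in>T. pweight D t n x) \<ge> 1/2" using N0[OF n] by (auto simp: T_def)
    have w0: "pweight D t n x \<ge> 0" for x by (rule pweight_nonneg[OF t0])
    have "1/2 * exp (- real n * (kl D t p + \<delta>)) \<le> (\<Sum>x\<in>T. pweight D t n x) * exp (- real n * (kl D t p + \<delta>))"
      using T(2) by (intro mult_right_mono) auto
    also have "\<dots> \<le> (\<Sum>x\<in>T. pweight D p n x)"
      unfolding sum_distrib_right
    proof (rule sum_mono)
      fix x assume x: "x \<in> T"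
      have e: "pweight D t n x = pweight D p n x * exp (asum D ?l n x)"
        using x by (intro pweight_likelihood[OF t0 p0 ac(1)]) (auto simp: T_def)
      have "asum D ?l n x + (- real n * (kl D t p + \<delta>)) \<le> 0" using x by (auto simp: T_def kl_def abs_less_iff algebra_simps)
      hence "exp (asum D ?l n x) * exp (- real n * (kl D t p + \<delta>)) \<le> 1" by (simp add: exp_add[symmetric])
      hence "pweight D p n x * (exp (asum D ?l n x) * exp (- real n * (kl D t p + \<delta>))) \<le> pweight D p n x * 1"
        using pweight_nonneg[OF p0] by (intro mult_left_mono) auto
      thus "pweight D t n x * exp (- real n * (kl D t p + \<delta>)) \<le> pweight D p n x" unfolding e by (simp add: mult.assoc)
    qed
    finally have 1: "(\<Sum>x\<in>T. pweight D p n x) \<ge> 1/2 * exp (- real n * (kl D t p + \<delta>))" .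
    have "(\<Sum>x\<in>T. pweight D q n x) \<le> (\<Sum>x\<in>T. pweight D t n x * exp (- real n * (kl D t q - \<delta>)))"
    proof (rule sum_mono)
      fix x assume x: "x \<in> T"
      have e: "pweight D t n x = pweight D q n x * exp (asum D ?k n x)"
        using x by (intro pweight_likelihood[OF t0 q0 ac(2)]) (auto simp: T_def)
      have "asum D ?k n x + (- real n * (kl D t q - \<delta>)) \<ge> 0" using x by (auto simp: T_def kl_def abs_less_iff algebra_simps)
      hence "exp (asum D ?k n x) * exp (- real n * (kl D t q - \<delta>)) \<ge> 1" by (simp add: exp_add[symmetric])
      hence "pweight D q n x * (exp (asum D ?k n x) * exp (- real n * (kl D t q - \<delta>))) \<ge> pweight D q n x * 1"
        using pweight_nonneg[OF q0] by (intro mult_left_mono) auto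
      thus "pweight D q n x \<le> pweight D t n x * exp (- real n * (kl D t q - \<delta>))" unfolding e by (simp add: mult.assoc)
    qed
    also have "\<dots> = (\<Sum>x\<in>T. pweight D t n x) * exp (- real n * (kl D t q - \<delta>))" by (simp add: sum_distrib_right)
    also have "\<dots> \<le> 1 * exp (- real n * (kl D t q - \<delta>))"
    proof (rule mult_right_mono)
      have "(\<Sum>x\<in>T. pweight D t n x) \<le> (\<Sum>x<D^n. pweight D t n x)" using T(1) w0 by (intro sum_mono2) auto
      thus "(\<Sum>x\<in>T. pweight D t n x) \<le> 1" unfolding sum_pweight t1 by simp
    qed simp
    finally have "(\<Sum>x\<in>T. pweight D q n x) \<le> exp (- real n * (kl D t q - \<delta>))" by simp
    thus "\<exists>T\<subseteq>{..<D^n}. (\<Sum>x\<in>T. pweight D p n x) \<ge> 1/2 * exp (- real n * (kl D t p + \<delta>))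
      \<and> (\<Sum>x\<in>T. pweight D q n x) \<le> exp (- real n * (kl D t q - \<delta>))" using T(1) 1 by blast
  qed
qed

text \<open>The product law of t is conditioned on its typical set. Conditioning at most doubles the
  weights, which is the factor 2, and turns typicality into a pointwise bound against q.\<close>

lemma typical_state:
  assumes t: "pd D t" and p0: "\<And>a. p a \<ge> 0" and q0: "\<And>a. q a \<ge> 0"
    and ac: "abscont D t p" "abscont D t q" and d: "\<delta> > 0"
  shows "\<exists>N0. \<forall>n\<ge>N0. \<exists>w. (\<forall>y. 0 \<le> w y) \<and> (\<Sum>y<D^n. w y) = 1
    \<and> (\<forall>y<D^n. w y \<le> 2 * exp (real n * (kl D t q + \<delta>)) * pweight D q n y)
    \<and> (\<Sum>y<D^n. sqrt (w y * pweight D p n y)) \<ge> 1/2 * exp (- real n * (kl D t p + \<delta>) / 2)"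
proof -
  have t0: "\<And>a. t a \<ge> 0" and t1: "(\<Sum>a<D. t a) = 1" using t by (auto simp: pd_def)
  let ?l = "\<lambda>a. ln (t a / p a)" and ?k = "\<lambda>a. ln (t a / q a)"
  obtain N0 where N0: "\<And>n. n \<ge> N0 \<Longrightarrow> (\<Sum>x\<in>{x\<in>{..<D^n}. pweight D t n x > 0 \<and>
      \<bar>asum D ?l n x - real n * (\<Sum>a<D. t a * ?l a)\<bar> < real n * \<delta> \<and>
      \<bar>asum D ?k n x - real n * (\<Sum>a<D. t a * ?k a)\<bar> < real n * \<delta>}. pweight D t n x) \<ge> 1/2"
    using typical_set[OF t d, of ?l ?k] by auto
  show ?thesis
  proof (intro exI[of _ N0] allI impI)
    fix n assume n: "n \<ge> N0"
    define T where "T = {x\<in>{..<D^n}. pweight D t n x > 0 \<and>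
      \<bar>asum D ?l n x - real n * (\<Sum>a<D. t a * ?l a)\<bar> < real n * \<delta> \<and>
      \<bar>asum D ?k n x - real n * (\<Sum>a<D. t a * ?k a)\<bar> < real n * \<delta>}"
    define c where "c = (\<Sum>x\<in>T. pweight D t n x)"
    have T: "T \<subseteq> {..<D^n}" and c: "c \<ge> 1/2" using N0[OF n] by (auto simp: T_def c_def)
    have w0: "pweight D t n x \<ge> 0" for x by (rule pweight_nonneg[OF t0])
    have pw0: "pweight D p n x \<ge> 0" "pweight D q n x \<ge> 0" for x using pweight_nonneg p0 q0 by auto
    have "c \<le> (\<Sum>x<D^n. pweight D t n x)" unfolding c_def using T w0 by (intro sum_mono2) auto
    hence c1: "c \<le> 1" unfolding sum_pweight t1 by simp
    define w where "w y = (if y \<in> T then pweight D t n y / c else 0)" for y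
    have wT: "sum h {..<D^n} = sum h T" if "\<And>y. y \<notin> T \<Longrightarrow> h y = 0" for h :: "nat \<Rightarrow> real"
      using T that by (intro sum.mono_neutral_right) auto
    have "(\<Sum>y<D^n. w y) = (\<Sum>y\<in>T. pweight D t n y / c)" by (subst wT) (auto simp: w_def)
    hence s1: "(\<Sum>y<D^n. w y) = 1" using c unfolding sum_divide_distrib[symmetric] c_def[symmetric] by simp
    have b: "w y \<le> 2 * exp (real n * (kl D t q + \<delta>)) * pweight D q n y" if "y < D^n" for y
    proof (cases "y \<in> T")
      case True
      have e: "pweight D t n y = pweight D q n y * exp (asum D ?k n y)"
        using True by (intro pweight_likelihood[OF t0 q0 ac(2)]) (auto simp: T_def)
      have "asum D ?k n y \<le> real n * (kl D t q + \<delta>)" using True by (auto simp: T_def kl_def abs_less_iff algebra_simps)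
      hence "pweight D t n y \<le> pweight D q n y * exp (real n * (kl D t q + \<delta>))"
        unfolding e using pw0 by (intro mult_left_mono) auto
      moreover have "pweight D t n y / c \<le> pweight D t n y / (1/2)" using c w0 by (intro divide_left_mono) auto
      ultimately show ?thesis using True by (simp add: w_def mult_ac)
    qed (use pw0 in \<open>auto simp: w_def\<close>)
    have "1/2 * exp (- real n * (kl D t p + \<delta>) / 2) \<le> c * exp (- real n * (kl D t p + \<delta>) / 2)"
      using c by (intro mult_right_mono) auto
    also have "\<dots> = (\<Sum>y\<in>T. pweight D t n y * exp (- real n * (kl D t p + \<delta>) / 2))" by (simp add: c_def sum_distrib_right)
    \<comment> \<open>On T the weight w is at least that of t, and the weight of p is at least that
      of t times exp (-n (kl + \<delta>)); the square root of the product halves this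
      exponent.\<close>
    also have "\<dots> \<le> (\<Sum>y\<in>T. sqrt (w y * pweight D p n y))"
    proof (rule sum_mono)
      fix y assume y: "y \<in> T"
      let ?x = "exp (- real n * (kl D t p + \<delta>))"
      have e: "pweight D t n y = pweight D p n y * exp (asum D ?l n y)"
        using y by (intro pweight_likelihood[OF t0 p0 ac(1)]) (auto simp: T_def)
      have "asum D ?l n y + (- real n * (kl D t p + \<delta>)) \<le> 0" using y by (auto simp: T_def kl_def abs_less_iff algebra_simps)
      hence "exp (asum D ?l n y) * ?x \<le> 1" by (simp add: exp_add[symmetric])
      hence "pweight D p n y * (exp (asum D ?l n y) * ?x) \<le> pweight D p n y * 1" using pw0 by (intro mult_left_mono) auto
      hence pp: "pweight D t n y * ?x \<le> pweight D p n y" unfolding e by (simp add: mult.assoc)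
      have "pweight D t n y \<le> w y"
        using y c c1 w0[of y] by (simp add: w_def pos_le_divide_eq mult_left_le)
      hence "pweight D t n y * (pweight D t n y * ?x) \<le> w y * pweight D p n y"
        using pp w0[of y] order.trans[OF w0[of y] \<open>pweight D t n y \<le> w y\<close>] by (intro mult_mono) auto
      moreover have "(pweight D t n y * exp (- real n * (kl D t p + \<delta>) / 2))\<^sup>2 = pweight D t n y * (pweight D t n y * ?x)"
        by (simp add: power_mult_distrib power2_eq_square exp_add[symmetric])
      ultimately show "pweight D t n y * exp (- real n * (kl D t p + \<delta>) / 2) \<le> sqrt (w y * pweight D p n y)"
        by (intro real_le_rsqrt) simp
    qed
    also have "\<dots> = (\<Sum>y<D^n. sqrt (w y * pweight D p n y))" by (subst wT) (auto simp: w_def)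
    finally have s2: "(\<Sum>y<D^n. sqrt (w y * pweight D p n y)) \<ge> 1/2 * exp (- real n * (kl D t p + \<delta>) / 2)" .
    show "\<exists>w. (\<forall>y. 0 \<le> w y) \<and> (\<Sum>y<D^n. w y) = 1
      \<and> (\<forall>y<D^n. w y \<le> 2 * exp (real n * (kl D t q + \<delta>)) * pweight D q n y)
      \<and> (\<Sum>y<D^n. sqrt (w y * pweight D p n y)) \<ge> 1/2 * exp (- real n * (kl D t p + \<delta>) / 2)"
      using s1 s2 b w0 c by (intro exI[of _ w]) (auto simp: w_def)
  qed
qed

subsection \<open>Tilting and minimax\<close>

text \<open>The tilted law attains the variational expression of the Renyi quantity. The identity
  holds letter by letter, because ln t is affine in ln p and ln q.\<close>

lemma tilted_kl:
  assumes p0: "\<And>x. p x \<ge> 0" and q0: "\<And>x. q x \<ge> 0" and a: "a > 0" and Q: "cQ a D p q > 0"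
  defines "t \<equiv> \<lambda>x. p x powr a * q x powr (1 - a) / cQ a D p q"
  shows "pd D t" "abscont D t p" "abscont D t q"
    "kl D t p + (1 / a - 1) * kl D t q = - (1 / a) * ln (cQ a D p q)"
proof -
  have t1: "(\<Sum>x<D. t x) = 1" using Q by (simp add: t_def sum_divide_distrib[symmetric] cQ_def[symmetric])
  show "pd D t" using t1 Q by (simp add: pd_def t_def)
  show "abscont D t p" "abscont D t q" by (auto simp: abscont_def t_def)
  have "kl D t p + (1 / a - 1) * kl D t q = (\<Sum>x<D. t x * ln (t x / p x) + (1 / a - 1) * (t x * ln (t x / q x)))"
    by (simp add: kl_def sum.distrib sum_distrib_left)
  also have "\<dots> = (\<Sum>x<D. t x * (- (1 / a) * ln (cQ a D p q)))"
  proof (rule sum.cong[OF refl])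
    fix x
    show "t x * ln (t x / p x) + (1 / a - 1) * (t x * ln (t x / q x)) = t x * (- (1 / a) * ln (cQ a D p q))"
    proof (cases "p x = 0 \<or> q x = 0")
      case True thus ?thesis by (auto simp: t_def)
    next
      case False
      hence pos: "p x > 0" "q x > 0" using p0[of x] q0[of x] by auto
      have tp: "t x > 0" using pos Q by (simp add: t_def)
      have lt: "ln (t x) = a * ln (p x) + (1 - a) * ln (q x) - ln (cQ a D p q)"
        using pos Q by (simp add: t_def ln_div ln_mult ln_powr)
      have "ln (t x / p x) + (1 / a - 1) * ln (t x / q x) = 1 / a * ln (t x) - ln (p x) - (1 / a - 1) * ln (q x)"
        using pos tp by (simp add: ln_div algebra_simps)
      also have "\<dots> = - (1 / a) * ln (cQ a D p q)" unfolding lt using a by (simp add: field_simps)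
      finally have "t x * (ln (t x / p x) + (1 / a - 1) * ln (t x / q x)) = t x * (- (1 / a) * ln (cQ a D p q))" by simp
      thus ?thesis by (simp add: algebra_simps)
    qed
  qed
  also have "\<dots> = (\<Sum>x<D. t x) * (- (1 / a) * ln (cQ a D p q))" by (rule sum_distrib_right[symmetric])
  finally show "kl D t p + (1 / a - 1) * kl D t q = - (1 / a) * ln (cQ a D p q)" using t1 by simp
qed

text \<open>The tangent at the mean w, in the form z ln (w / p) + z - w, lies below z ln (z / p) by
  ln x \<le> x - 1; it is averaged with the weights u and v.\<close>

lemma xlogx_convex:
  fixes p u v z z' :: real
  assumes p: "p > 0" and uv: "u \<ge> 0" "v \<ge> 0" "u + v = 1" and z: "z \<ge> 0" "z' \<ge> 0"
  shows "(u * z + v * z') * ln ((u * z + v * z') / p) \<le> u * (z * ln (z / p)) + v * (z' * ln (z' / p))"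
proof -
  define w where "w = u * z + v * z'"
  have w0: "w \<ge> 0" using uv z by (simp add: w_def)
  have tangent: "z * ln (w / p) + z - w \<le> z * ln (z / p)" if "w > 0" "z \<ge> 0" for z
  proof (cases "z = 0")
    case False
    hence zp: "z > 0" using that by simp
    have "ln (w / z) \<le> w / z - 1" using that zp by (intro ln_le_minus_one) auto
    hence "z * ln (w / z) \<le> z * (w / z - 1)" using zp by (intro mult_left_mono) auto
    also have "z * (w / z - 1) = w - z" using zp by (simp add: right_diff_distrib)
    finally have "z * ln (w / z) \<le> w - z" .
    thus ?thesis using that zp p by (simp add: ln_div algebra_simps)
  qed (use that in auto)
  show ?thesis
  proof (cases "w = 0")
    case True
    have "u * z \<ge> 0" "v * z' \<ge> 0" using uv z by auto
    hence "u * z = 0" "v * z' = 0" using True unfolding w_def by linarith+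
    thus ?thesis by auto
  next
    case False
    hence wp: "w > 0" using w0 by simp
    have "u * (z * ln (w / p) + z - w) + v * (z' * ln (w / p) + z' - w) \<le> u * (z * ln (z / p)) + v * (z' * ln (z' / p))"
      using tangent[OF wp] uv z by (intro add_mono mult_left_mono) auto
    also have "u * (z * ln (w / p) + z - w) + v * (z' * ln (w / p) + z' - w) = w * ln (w / p) + w - (u + v) * w"
      by (simp add: w_def algebra_simps)
    finally show ?thesis using uv unfolding w_def[symmetric] by simp
  qed
qed

lemma kl_convex:
  assumes t: "pd D t" "pd D t'" and p0: "\<And>x. p x \<ge> 0" and ac: "abscont D t p" "abscont D t' p"
    and uv: "u \<ge> 0" "v \<ge> 0" "u + v = 1"
  shows "kl D (\<lambda>x. u * t x + v * t' x) p \<le> u * kl D t p + v * kl D t' p"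
proof -
  have "kl D (\<lambda>x. u * t x + v * t' x) p \<le> (\<Sum>x<D. u * (t x * ln (t x / p x)) + v * (t' x * ln (t' x / p x)))"
    unfolding kl_def
  proof (rule sum_mono)
    fix x assume "x \<in> {..<D}"
    thus "(u * t x + v * t' x) * ln ((u * t x + v * t' x) / p x) \<le> u * (t x * ln (t x / p x)) + v * (t' x * ln (t' x / p x))"
      using xlogx_convex[OF _ uv, of "p x" "t x" "t' x"] p0[of x] t ac
      by (cases "p x = 0") (auto simp: pd_def abscont_def)
  qed
  thus ?thesis by (simp add: kl_def sum.distrib sum_distrib_left)
qed

text \<open>The entropy of t cancels, so the difference is linear in t. This preserves convexity in
  the minimax argument, where one relative entropy occurs with a negative sign.\<close>

lemma kl_diff_linear:
  assumes "pd D t" and p0: "\<And>x. p x \<ge> 0" and q0: "\<And>x. q x \<ge> 0" and ac: "abscont D t p" "abscont D t q"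
  shows "kl D t p - kl D t q = (\<Sum>x<D. t x * (ln (q x) - ln (p x)))"
  unfolding kl_def sum_subtractf[symmetric]
proof (rule sum.cong[OF refl])
  fix x assume x: "x \<in> {..<D}"
  show "t x * ln (t x / p x) - t x * ln (t x / q x) = t x * (ln (q x) - ln (p x))"
  proof (cases "t x = 0")
    case False
    hence "t x > 0" "p x > 0" "q x > 0" using assms x by (auto simp: pd_def abscont_def less_le)
    thus ?thesis by (simp add: ln_div algebra_simps)
  qed simp
qed

text \<open>If no point of \<open>C\<close> lies below \<open>(S, S)\<close>, the witnesses split \<open>[0,1]\<close> into two open sets according to which
  coordinate is below \<open>S\<close>; at a common \<open>s\<close> the segment joining two witnesses crosses the diagonal below \<open>S\<close>.\<close>

lemma minimax_plane:
  fixes C :: "(real \<times> real) set"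
  assumes conv: "convex C" and s: "\<And>s. 0 \<le> s \<Longrightarrow> s \<le> 1 \<Longrightarrow> \<exists>(a,b)\<in>C. (1 - s) * a + s * b < S"
  shows "\<exists>(a,b)\<in>C. a < S \<and> b < S"
proof (rule ccontr)
  assume n: "\<not> ?thesis"
  define U where "U = (\<Union>z\<in>{z\<in>C. fst z < S \<and> S \<le> snd z}. {s. (1 - s) * fst z + s * snd z < S})"
  define V where "V = (\<Union>z\<in>{z\<in>C. snd z < S \<and> S \<le> fst z}. {s. (1 - s) * fst z + s * snd z < S})"
  have op: "open U" "open V" unfolding U_def V_def by (intro open_UN ballI open_Collect_less continuous_intros)+
  have wit: "s \<in> U \<or> s \<in> V" if s01: "0 \<le> s" "s \<le> 1" for s
  proof -
    obtain a b where ab: "(a,b) \<in> C" "(1 - s) * a + s * b < S" using s[OF s01] by auto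
    have "a < S \<or> b < S"
    proof (rule ccontr)
      assume "\<not> ?thesis"
      hence "(1 - s) * S + s * S \<le> (1 - s) * a + s * b" using s01 by (intro add_mono mult_left_mono) auto
      thus False using ab(2) by (simp add: algebra_simps)
    qed
    moreover have "\<not> (a < S \<and> b < S)" using n ab(1) by auto
    ultimately show ?thesis using ab unfolding U_def V_def by force
  qed
  have "0 \<in> U" using wit[of 0] unfolding V_def by auto
  moreover have "1 \<in> V" using wit[of 1] unfolding U_def by auto
  moreover have "U \<inter> V \<inter> {0..1} = {} \<Longrightarrow> U \<inter> {0..1} = {} \<or> V \<inter> {0..1} = {}"
  proof (rule connectedD[OF connected_Icc op])
    show "{0..1} \<subseteq> U \<union> V"
    proof
      fix x :: real assume "x \<in> {0..1}" thus "x \<in> U \<union> V" using wit[of x] by auto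
    qed
  qed
  ultimately obtain s where sUV: "s \<in> U" "s \<in> V" by fastforce
  then obtain a b a' b' where z: "(a,b) \<in> C" "a < S" "S \<le> b" "(1 - s) * a + s * b < S"
      "(a',b') \<in> C" "b' < S" "S \<le> a'" "(1 - s) * a' + s * b' < S"
    unfolding U_def V_def by fastforce
  \<comment> \<open>The parameter at which the segment from (a,b), above the diagonal, to (a',b'),
    below it, meets the diagonal.\<close>
  define v where "v = (b - a) / ((b - a) + (a' - b'))"
  have den: "(b - a) + (a' - b') > 0" using z by linarith
  have v01: "0 \<le> v" "v \<le> 1" using z den by (auto simp: v_def)
  define c where "c = (1 - v) * a + v * a'"
  have "v * ((b - a) + (a' - b')) = b - a" using den by (simp add: v_def)
  hence cb: "c = (1 - v) * b + v * b'" unfolding c_def by (simp add: algebra_simps)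
  have "(1 - v) *\<^sub>R (a,b) + v *\<^sub>R (a',b') \<in> C" using conv z v01 by (intro convexD) auto
  hence cc: "(c,c) \<in> C" using cb by (simp add: c_def)
  have "c = (1 - s) * c + s * c" by (simp add: algebra_simps)
  also have "\<dots> = (1 - s) * ((1 - v) * a + v * a') + s * ((1 - v) * b + v * b')" using cb c_def by metis
  also have "\<dots> = (1 - v) * ((1 - s) * a + s * b) + v * ((1 - s) * a' + s * b')" by (simp add: algebra_simps)
  also have "\<dots> < S"
  proof (cases "v = 0")
    case False
    hence "v * ((1 - s) * a' + s * b') < v * S" using z v01 by (intro mult_strict_left_mono) auto
    moreover have "(1 - v) * ((1 - s) * a + s * b) \<le> (1 - v) * S" using z v01 by (intro mult_left_mono) auto
    ultimately show ?thesis by (simp add: algebra_simps)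
  qed (use z in simp)
  finally show False using n cc by auto
qed

lemma cQ_pos:
  assumes "x < D" "p x > 0" "q x > 0" shows "cQ a D p q > 0"
proof -
  have "0 < p x powr a * q x powr (1 - a)" using assms by simp
  also have "\<dots> \<le> cQ a D p q" unfolding cQ_def using assms by (intro member_le_sum) auto
  finally show ?thesis .
qed

text \<open>Summands with p x = 0 or q x = 0 are constantly 0, and all others are continuous in the
  order.\<close>

lemma cQ_tendsto:
  assumes a: "(a \<longlongrightarrow> b) F" and p: "\<And>x. p x \<ge> 0" and q: "\<And>x. q x \<ge> 0"
  shows "((\<lambda>s. cQ (a s) D p q) \<longlongrightarrow> cQ b D p q) F"
  unfolding cQ_def
proof (rule tendsto_sum)
  fix x
  show "((\<lambda>s. p x powr a s * q x powr (1 - a s)) \<longlongrightarrow> p x powr b * q x powr (1 - b)) F"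
  proof (cases "p x = 0 \<or> q x = 0")
    case False
    thus ?thesis by (intro tendsto_intros a) auto
  qed auto
qed

text \<open>A is the exponent of an undamped test, and B adds the excess of
  \<open>r * kl D2 t2 q2\<close> over \<open>kl D1 t1 q1\<close>, which is the cost of damping. For
  fixed s the mixture (1 - s) A + s B separates into the two pairs, and the tilts of orders 1 / (1 +
  s) and 1 / (1 - s) give it the value bounded by \<open>inner\<close>. The minimax in the plane
  then provides one choice that makes A and B small together.\<close>

lemma optimal_tilts:
  assumes p1: "pd D1 p1" and q1: "\<And>x. q1 x \<ge> 0" and ac1: "abscont D1 p1 q1"
    and p2: "\<And>x. p2 x \<ge> 0" and q2: "\<And>x. q2 x \<ge> 0" and ov: "y0 < D2" "p2 y0 > 0" "q2 y0 > 0" and r: "r > 0"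
    and inner: "\<And>s. 0 < s \<Longrightarrow> s < 1 \<Longrightarrow> - r * ((1 + s) * ln (cQ (1 / (1 + s)) D2 p2 q2)) - (1 - s) * ln (cQ (1 / (1 - s)) D1 p1 q1) \<le> S"
    and x0: "x0 < D1" "p1 x0 > 0" and edge: "- r * (2 * ln (cQ (1/2) D2 p2 q2)) - ln (p1 x0 / q1 x0) \<le> S"
    and d: "\<delta> > 0"
  shows "\<exists>t1 t2. pd D1 t1 \<and> abscont D1 t1 p1 \<and> abscont D1 t1 q1 \<and> pd D2 t2 \<and> abscont D2 t2 p2 \<and> abscont D2 t2 q2
    \<and> r * kl D2 t2 p2 + kl D1 t1 p1 < S + \<delta> \<and> r * kl D2 t2 p2 + kl D1 t1 p1 + (r * kl D2 t2 q2 - kl D1 t1 q1) < S + \<delta>"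
proof -
  have p10: "\<And>x. p1 x \<ge> 0" using p1 by (simp add: pd_def)
  have q1x: "q1 x0 > 0" using ac1 x0 q1[of x0] by (auto simp: abscont_def less_le)
  have c1: "cQ a D1 p1 q1 > 0" for a using cQ_pos[of x0 D1 p1 q1] x0 q1x by simp
  have c2: "cQ a D2 p2 q2 > 0" for a using cQ_pos[of y0 D2 p2 q2] ov by simp
  \<comment> \<open>At s = 0 both orders are 1, and the bound follows by continuity from the
    right.\<close>
  have inner0: "- r * ((1 + s) * ln (cQ (1 / (1 + s)) D2 p2 q2)) - (1 - s) * ln (cQ (1 / (1 - s)) D1 p1 q1) \<le> S"
    if s: "0 \<le> s" "s < 1" for s
  proof (cases "s = 0")
    case True
    let ?h = "\<lambda>s. - r * ((1 + s) * ln (cQ (1 / (1 + s)) D2 p2 q2)) - (1 - s) * ln (cQ (1 / (1 - s)) D1 p1 q1)"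
    have "((\<lambda>s. 1 / (1 + s)) \<longlongrightarrow> 1 / (1 + 0)) (at_right (0::real))" "((\<lambda>s. 1 / (1 - s)) \<longlongrightarrow> 1 / (1 - 0)) (at_right (0::real))"
      by (intro tendsto_intros; simp)+
    note a = cQ_tendsto[OF this(1), of p2 q2 D2] cQ_tendsto[OF this(2), of p1 q1 D1]
    have "(?h \<longlongrightarrow> - r * ((1 + 0) * ln (cQ (1 / (1 + 0)) D2 p2 q2)) - (1 - 0) * ln (cQ (1 / (1 - 0)) D1 p1 q1)) (at_right 0)"
      using c1 c2 a p2 q2 p10 q1 by (intro tendsto_intros) (auto simp: less_imp_neq[symmetric] dest: less_imp_neq)
    moreover have "\<forall>\<^sub>F s in at_right 0. ?h s \<le> S"
    proof -
      have "\<forall>\<^sub>F s in at_right (0::real). s \<in> {0<..<1}" by (rule eventually_at_right_real) simp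
      thus ?thesis by eventually_elim (use inner in auto)
    qed
    ultimately have "- r * ((1 + 0) * ln (cQ (1 / (1 + 0)) D2 p2 q2)) - (1 - 0) * ln (cQ (1 / (1 - 0)) D1 p1 q1) \<le> S"
      by (intro tendsto_upperbound) auto
    thus ?thesis using True by simp
  qed (use s inner in auto)
  define feas where "feas t1 t2 \<longleftrightarrow> pd D1 t1 \<and> abscont D1 t1 p1 \<and> abscont D1 t1 q1 \<and> pd D2 t2 \<and> abscont D2 t2 p2 \<and> abscont D2 t2 q2" for t1 t2
  define A where "A t1 t2 = r * kl D2 t2 p2 + kl D1 t1 p1" for t1 t2
  \<comment> \<open>The linear expression replaces the difference of relative entropies for the
    first pair, so that B is convex.\<close>
  define B where "B t1 t2 = r * kl D2 t2 p2 + r * kl D2 t2 q2 + (\<Sum>x<D1. t1 x * (ln (q1 x) - ln (p1 x)))" for t1 t2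
  have AB: "A t1 t2 + (r * kl D2 t2 q2 - kl D1 t1 q1) = B t1 t2" if "feas t1 t2" for t1 t2
    using kl_diff_linear[OF _ p10 q1, of D1 t1] that unfolding A_def B_def feas_def by auto
  \<comment> \<open>All points above (A, B) are included: A and B are only convex functions, so the
    set of their values alone might fail to be convex.\<close>
  define C where "C = {(a,b). \<exists>t1 t2. feas t1 t2 \<and> A t1 t2 \<le> a \<and> B t1 t2 \<le> b}"
  have "convex C"
  proof (rule convexI)
    fix z z' :: "real \<times> real" and u v :: real
    assume z: "z \<in> C" "z' \<in> C" and uv: "0 \<le> u" "0 \<le> v" "u + v = 1"
    obtain a b a' b' where ab: "z = (a,b)" "z' = (a',b')" by (cases z, cases z') auto
    from z obtain t1 t2 t1' t2' where f: "feas t1 t2" "A t1 t2 \<le> a" "B t1 t2 \<le> b" "feas t1' t2'" "A t1' t2' \<le> a'" "B t1' t2' \<le> b'"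
      unfolding C_def ab by auto
    define w1 where "w1 = (\<lambda>x. u * t1 x + v * t1' x)"
    define w2 where "w2 = (\<lambda>x. u * t2 x + v * t2' x)"
    have "feas w1 w2" using f(1,4) uv unfolding feas_def w1_def w2_def
      by (auto simp: pd_def abscont_def sum.distrib sum_distrib_left[symmetric])
    have k1: "kl D1 w1 p1 \<le> u * kl D1 t1 p1 + v * kl D1 t1' p1"
      unfolding w1_def using f(1,4) uv by (intro kl_convex) (auto simp: feas_def p10)
    have k2: "kl D2 w2 p2 \<le> u * kl D2 t2 p2 + v * kl D2 t2' p2" "kl D2 w2 q2 \<le> u * kl D2 t2 q2 + v * kl D2 t2' q2"
      unfolding w2_def using f(1,4) uv by (intro kl_convex; auto simp: feas_def p2 q2)+
    have lin: "(\<Sum>x<D1. w1 x * (ln (q1 x) - ln (p1 x))) = u * (\<Sum>x<D1. t1 x * (ln (q1 x) - ln (p1 x))) + v * (\<Sum>x<D1. t1' x * (ln (q1 x) - ln (p1 x)))"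
      unfolding w1_def sum_distrib_left sum.distrib[symmetric] by (intro sum.cong refl) (simp add: algebra_simps)
    have rk: "r * kl D2 w2 p2 \<le> r * (u * kl D2 t2 p2 + v * kl D2 t2' p2)" "r * kl D2 w2 q2 \<le> r * (u * kl D2 t2 q2 + v * kl D2 t2' q2)"
      using k2 r by (auto intro!: mult_left_mono)
    have "A w1 w2 \<le> u * A t1 t2 + v * A t1' t2'" using rk k1 unfolding A_def by (simp add: algebra_simps)
    also have "\<dots> \<le> u * a + v * a'" using f uv by (intro add_mono mult_left_mono) auto
    finally have a: "A w1 w2 \<le> u * a + v * a'" .
    have "B w1 w2 \<le> u * B t1 t2 + v * B t1' t2'" using rk lin unfolding B_def by (simp add: algebra_simps)
    also have "\<dots> \<le> u * b + v * b'" using f uv by (intro add_mono mult_left_mono) auto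
    finally have "B w1 w2 \<le> u * b + v * b'" .
    thus "u *\<^sub>R z + v *\<^sub>R z' \<in> C" unfolding ab C_def using a \<open>feas w1 w2\<close> by auto
  qed
  moreover have "\<exists>(a,b)\<in>C. (1 - s) * a + s * b < S + \<delta>" if s: "0 \<le> s" "s \<le> 1" for s
  proof -
    define t2 where "t2 = (\<lambda>x. p2 x powr (1 / (1 + s)) * q2 x powr (1 - 1 / (1 + s)) / cQ (1 / (1 + s)) D2 p2 q2)"
    have t2: "pd D2 t2" "abscont D2 t2 p2" "abscont D2 t2 q2"
      "kl D2 t2 p2 + s * kl D2 t2 q2 = - (1 + s) * ln (cQ (1 / (1 + s)) D2 p2 q2)"
      using tilted_kl[OF p2 q2 _ c2[of "1 / (1 + s)"]] s unfolding t2_def by auto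
    have "\<exists>t1. feas t1 t2 \<and> kl D1 t1 p1 - s * kl D1 t1 q1 - r * ((1 + s) * ln (cQ (1 / (1 + s)) D2 p2 q2)) \<le> S"
    proof (cases "s < 1")
      case True
      define t1 where "t1 = (\<lambda>x. p1 x powr (1 / (1 - s)) * q1 x powr (1 - 1 / (1 - s)) / cQ (1 / (1 - s)) D1 p1 q1)"
      have t1: "pd D1 t1" "abscont D1 t1 p1" "abscont D1 t1 q1"
        "kl D1 t1 p1 + (- s) * kl D1 t1 q1 = - (1 - s) * ln (cQ (1 / (1 - s)) D1 p1 q1)"
        using tilted_kl[OF p10 q1 _ c1[of "1 / (1 - s)"]] True s unfolding t1_def by auto
      show ?thesis using t1 t2 inner0[OF s(1) True] by (intro exI[of _ t1]) (auto simp: feas_def algebra_simps)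
    next
      case False
      hence s1: "s = 1" using s by simp
      \<comment> \<open>At s = 1 the order is infinite and the tilt degenerates to a point mass at
        x0, whose exponent is bounded by \<open>edge\<close>.\<close>
      define t1 where "t1 = (\<lambda>x. if x = x0 then 1 else 0 :: real)"
      have k: "kl D1 t1 h = - ln (h x0)" if "h x0 > 0" for h
      proof -
        have "kl D1 t1 h = (\<Sum>x<D1. if x = x0 then ln (1 / h x0) else 0)" unfolding kl_def by (intro sum.cong) (auto simp: t1_def)
        thus ?thesis using x0 that by (simp add: ln_div)
      qed
      have "feas t1 t2" using t2 x0 q1x unfolding feas_def by (auto simp: pd_def abscont_def t1_def)
      thus ?thesis using edge x0 q1x unfolding s1 by (intro exI[of _ t1]) (simp add: k ln_div)
    qed
    then obtain t1 where t1: "feas t1 t2" "kl D1 t1 p1 - s * kl D1 t1 q1 - r * ((1 + s) * ln (cQ (1 / (1 + s)) D2 p2 q2)) \<le> S" by auto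
    have "(1 - s) * A t1 t2 + s * B t1 t2 = A t1 t2 + s * (r * kl D2 t2 q2 - kl D1 t1 q1)"
      unfolding AB[OF t1(1), symmetric] by (simp add: algebra_simps)
    also have "\<dots> = r * (kl D2 t2 p2 + s * kl D2 t2 q2) + (kl D1 t1 p1 - s * kl D1 t1 q1)"
      by (simp add: A_def algebra_simps)
    also have "\<dots> \<le> S" unfolding t2(4) using t1(2) by (simp add: algebra_simps)
    finally have "(1 - s) * A t1 t2 + s * B t1 t2 < S + \<delta>" using d by simp
    moreover have "(A t1 t2, B t1 t2) \<in> C" using t1(1) unfolding C_def by auto
    ultimately show ?thesis by blast
  qed
  ultimately obtain a b where ab: "(a,b) \<in> C" "a < S + \<delta>" "b < S + \<delta>" using minimax_plane[of C "S + \<delta>"] by blast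
  then obtain t1 t2 where "feas t1 t2" "A t1 t2 \<le> a" "B t1 t2 \<le> b" unfolding C_def by auto
  thus ?thesis using ab AB[of t1 t2] unfolding feas_def A_def by (intro exI[of _ t1] exI[of _ t2]) auto
qed

section \<open>Measure-and-prepare channels\<close>

lemma mtrace_mult_entries:
  assumes "M \<in> carrier_mat n n" "Y \<in> carrier_mat n n"
  shows "mtrace (M * Y) = (\<Sum>l<n. \<Sum>l'<n. M $$ (l',l) * Y $$ (l,l'))"
proof -
  have "mtrace (M * Y) = (\<Sum>l'<n. \<Sum>l<n. M $$ (l',l) * Y $$ (l,l'))"
    unfolding mtrace_def using assms by (auto simp: mult_mat_index[OF assms] simp del: index_mult_mat(1) intro!: sum.cong)
  thus ?thesis by (subst sum.swap)
qed

lemma sum_div_mod_vec: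
  fixes f :: "nat \<Rightarrow> complex"
  shows "(\<Sum>i<k*m. f i) = (\<Sum>a<k. \<Sum>c<m. f (a*m+c))"
proof -
  have "(\<Sum>i<k*m. f i) = (\<Sum>i<k*m. (\<lambda>a c. f (a*m+c)) (i div m) (i mod m))" by simp
  also have "\<dots> = (\<Sum>a<k. \<Sum>c<m. f (a*m+c))" by (rule sum_div_mod)
  finally show ?thesis .
qed

lemma psd_factor_entry:
  assumes "psd n M" "i < n" "j < n"
  shows "M $$ (i,j) = (\<Sum>x<n. msqrt M $$ (i,x) * cnj (msqrt M $$ (j,x)))"
proof -
  define S where "S = msqrt M"
  have S: "S \<in> carrier_mat n n" "adj S = S" "S * S = M"
    using psdD(1)[OF msqrt_psd[OF assms(1)]] psd_hermitian[OF msqrt_psd[OF assms(1)]] msqrt_mult_self[OF assms(1)] by (auto simp: S_def)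
  have "M $$ (i,j) = (S * adj S) $$ (i,j)" using S by simp
  also have "\<dots> = (\<Sum>x<n. S $$ (i,x) * adj S $$ (x,j))" by (rule mult_mat_index[OF S(1) adj_carrier[OF S(1)] assms(2,3)])
  also have "\<dots> = (\<Sum>x<n. S $$ (i,x) * cnj (S $$ (j,x)))" using assms S(1) by (intro sum.cong) auto
  finally show ?thesis unfolding S_def .
qed

text \<open>Complete positivity through Kraus operators in disguise: with M and \<omega> factored by
  their roots S and T, the form at v is a sum of forms of X at vectors z x y, each built from v with
  a column of S and a column of T.\<close>

lemma ampliate_trace_prepare_psd:
  assumes M: "psd n M" and w: "psd m \<omega>" and X: "psd (k * n) X"
  shows "psd (k * m) (Matrix.mat (k * m) (k * m)
     (\<lambda>(i,j). mtrace (M * block n X (i div m) (j div m)) * \<omega> $$ (i mod m, j mod m)))" (is "psd _ ?P")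
proof -
  define S where "S = msqrt M"
  define T where "T = msqrt \<omega>"
  note Xc = psdD(1)[OF X] and Mc = psdD(1)[OF M]
  have bc: "block n X a b \<in> carrier_mat n n" for a b by (simp add: block_def)
  have Pc: "?P \<in> carrier_mat (k*m) (k*m)" by simp
  have key: "cinner v (?P *\<^sub>v v) = (\<Sum>x<n. \<Sum>y<m. cinner (z x y) (X *\<^sub>v z x y))"
    if v: "v \<in> carrier_vec (k*m)" and z: "z = (\<lambda>x y. vec (k*n) (\<lambda>i. S $$ (i mod n, x) * (\<Sum>d<m. v $ (i div n * m + d) * cnj (T $$ (d,y)))))" for v z
  proof -
    define u where "u a y = (\<Sum>d<m. v $ (a * m + d) * cnj (T $$ (d,y)))" for a y
    define Y where "Y a l b l' = X $$ (a * n + l, b * n + l')" for a l b l'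
    define G where "G a b = (\<Sum>l<n. \<Sum>l'<n. M $$ (l',l) * Y a l b l')" for a b
    define W where "W a b = (\<Sum>y<m. cnj (u a y) * u b y)" for a b
    have idx: "a * n + l < k * n" if "a < k" "l < n" for a l
    proof -
      have "a * n + l < (a + 1) * n" using that by simp
      also have "\<dots> \<le> k * n" using that by (intro mult_le_mono1) auto
      finally show ?thesis .
    qed
    have idm: "a * m + l < k * m" if "a < k" "l < m" for a l
    proof -
      have "a * m + l < (a + 1) * m" using that by simp
      also have "\<dots> \<le> k * m" using that by (intro mult_le_mono1) auto
      finally show ?thesis .
    qed
    have W: "W a b = (\<Sum>c<m. \<Sum>d<m. cnj (v $ (a*m+c)) * \<omega> $$ (c,d) * v $ (b*m+d))" for a b
    proof -
      have "W a b = (\<Sum>y<m. \<Sum>c<m. \<Sum>d<m. cnj (v $ (a*m+c)) * (T $$ (c,y) * cnj (T $$ (d,y))) * v $ (b*m+d))"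
        unfolding W_def u_def by (simp add: sum_product mult_ac)
      also have "\<dots> = (\<Sum>c<m. \<Sum>y<m. \<Sum>d<m. cnj (v $ (a*m+c)) * (T $$ (c,y) * cnj (T $$ (d,y))) * v $ (b*m+d))"
        by (rule sum.swap)
      also have "\<dots> = (\<Sum>c<m. \<Sum>d<m. \<Sum>y<m. cnj (v $ (a*m+c)) * (T $$ (c,y) * cnj (T $$ (d,y))) * v $ (b*m+d))"
        by (intro sum.cong refl sum.swap)
      also have "\<dots> = (\<Sum>c<m. \<Sum>d<m. cnj (v $ (a*m+c)) * \<omega> $$ (c,d) * v $ (b*m+d))"
        by (intro sum.cong refl) (simp add: psd_factor_entry[OF w] T_def sum_distrib_left sum_distrib_right)
      finally show ?thesis .
    qed
    have "cinner v (?P *\<^sub>v v) = (\<Sum>i<k*m. \<Sum>j<k*m. cnj (v $ i) * ?P $$ (i,j) * v $ j)"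
      by (rule cinner_mult_vec[OF Pc v])
    also have "\<dots> = (\<Sum>a<k. \<Sum>c<m. \<Sum>b<k. \<Sum>d<m. cnj (v $ (a*m+c)) * ?P $$ (a*m+c,b*m+d) * v $ (b*m+d))"
      by (simp only: sum_div_mod_vec)
    also have "\<dots> = (\<Sum>a<k. \<Sum>c<m. \<Sum>b<k. \<Sum>d<m. cnj (v $ (a*m+c)) * (G a b * \<omega> $$ (c,d)) * v $ (b*m+d))"
    proof (intro sum.cong refl)
      fix a c b d assume "a \<in> {..<k}" "c \<in> {..<m}" "b \<in> {..<k}" "d \<in> {..<m}"
      hence h: "a < k" "c < m" "b < k" "d < m" by auto
      have "mtrace (M * block n X a b) = G a b"
        unfolding mtrace_mult_entries[OF Mc bc] G_def Y_def by (intro sum.cong refl) (simp add: block_def)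
      hence "?P $$ (a*m+c,b*m+d) = G a b * \<omega> $$ (c,d)" using h idm[OF h(1,2)] idm[OF h(3,4)] by simp
      thus "cnj (v $ (a*m+c)) * ?P $$ (a*m+c,b*m+d) * v $ (b*m+d) = cnj (v $ (a*m+c)) * (G a b * \<omega> $$ (c,d)) * v $ (b*m+d)" by simp
    qed
    also have "\<dots> = (\<Sum>a<k. \<Sum>b<k. G a b * W a b)"
    proof (rule sum.cong[OF refl])
      fix a
      have "(\<Sum>c<m. \<Sum>b<k. \<Sum>d<m. cnj (v $ (a*m+c)) * (G a b * \<omega> $$ (c,d)) * v $ (b*m+d))
          = (\<Sum>b<k. \<Sum>c<m. \<Sum>d<m. cnj (v $ (a*m+c)) * (G a b * \<omega> $$ (c,d)) * v $ (b*m+d))" by (rule sum.swap)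
      also have "\<dots> = (\<Sum>b<k. G a b * W a b)" unfolding W sum_distrib_left by (intro sum.cong refl) (simp add: mult_ac)
      finally show "(\<Sum>c<m. \<Sum>b<k. \<Sum>d<m. cnj (v $ (a*m+c)) * (G a b * \<omega> $$ (c,d)) * v $ (b*m+d)) = (\<Sum>b<k. G a b * W a b)" .
    qed
    finally have L: "cinner v (?P *\<^sub>v v) = (\<Sum>a<k. \<Sum>b<k. G a b * W a b)" .
    have inner: "cinner (z x y) (X *\<^sub>v z x y) = (\<Sum>a<k. \<Sum>l<n. \<Sum>b<k. \<Sum>l'<n. cnj (S $$ (l,x) * u a y) * Y a l b l' * (S $$ (l',x) * u b y))" for x y
    proof -
      have zc: "z x y \<in> carrier_vec (k*n)" unfolding z by simp
      have zi: "z x y $ (a*n+l) = S $$ (l,x) * u a y" if "a < k" "l < n" for a l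
        using idx[OF that] that unfolding z u_def by simp
      have "cinner (z x y) (X *\<^sub>v z x y) = (\<Sum>a<k. \<Sum>l<n. \<Sum>b<k. \<Sum>l'<n. cnj (z x y $ (a*n+l)) * X $$ (a*n+l,b*n+l') * z x y $ (b*n+l'))"
        unfolding cinner_mult_vec[OF Xc zc] by (simp only: sum_div_mod_vec)
      also have "\<dots> = (\<Sum>a<k. \<Sum>l<n. \<Sum>b<k. \<Sum>l'<n. cnj (S $$ (l,x) * u a y) * Y a l b l' * (S $$ (l',x) * u b y))"
        by (intro sum.cong refl) (simp add: zi Y_def)
      finally show ?thesis .
    qed
    have "(\<Sum>x<n. \<Sum>y<m. cinner (z x y) (X *\<^sub>v z x y))
        = (\<Sum>x<n. \<Sum>y<m. \<Sum>a<k. \<Sum>l<n. \<Sum>b<k. \<Sum>l'<n. cnj (S $$ (l,x) * u a y) * Y a l b l' * (S $$ (l',x) * u b y))"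
      unfolding inner ..
    also have "\<dots> = (\<Sum>a<k. \<Sum>l<n. \<Sum>b<k. \<Sum>l'<n. \<Sum>x<n. \<Sum>y<m. cnj (S $$ (l,x) * u a y) * Y a l b l' * (S $$ (l',x) * u b y))"
    proof -
      have sw: "(\<Sum>x<n. \<Sum>y<m. \<Sum>i\<in>I. h x y i) = (\<Sum>i\<in>I. \<Sum>x<n. \<Sum>y<m. h x y i)" for I :: "nat set" and h :: "nat \<Rightarrow> nat \<Rightarrow> nat \<Rightarrow> complex"
      proof -
        have "(\<Sum>x<n. \<Sum>y<m. \<Sum>i\<in>I. h x y i) = (\<Sum>x<n. \<Sum>i\<in>I. \<Sum>y<m. h x y i)" by (intro sum.cong refl sum.swap)
        also have "\<dots> = (\<Sum>i\<in>I. \<Sum>x<n. \<Sum>y<m. h x y i)" by (rule sum.swap)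
        finally show ?thesis .
      qed
      show ?thesis by (simp only: sw)
    qed
    also have "\<dots> = (\<Sum>a<k. \<Sum>l<n. \<Sum>b<k. \<Sum>l'<n. M $$ (l',l) * Y a l b l' * W a b)"
    proof (intro sum.cong refl)
      fix a l b l' assume "l \<in> {..<n}" "l' \<in> {..<n}"
      hence ll: "l' < n" "l < n" by auto
      have "(\<Sum>x<n. \<Sum>y<m. cnj (S $$ (l,x) * u a y) * Y a l b l' * (S $$ (l',x) * u b y))
          = (\<Sum>x<n. \<Sum>y<m. (S $$ (l',x) * cnj (S $$ (l,x))) * (cnj (u a y) * u b y)) * Y a l b l'"
        unfolding sum_distrib_right by (intro sum.cong refl) (simp add: mult_ac)
      also have "(\<Sum>x<n. \<Sum>y<m. (S $$ (l',x) * cnj (S $$ (l,x))) * (cnj (u a y) * u b y)) = M $$ (l',l) * W a b"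
        unfolding psd_factor_entry[OF M ll] S_def[symmetric] W_def sum_product ..
      finally show "(\<Sum>x<n. \<Sum>y<m. cnj (S $$ (l,x) * u a y) * Y a l b l' * (S $$ (l',x) * u b y)) = M $$ (l',l) * Y a l b l' * W a b"
        by (simp add: mult_ac)
    qed
    also have "\<dots> = (\<Sum>a<k. \<Sum>b<k. G a b * W a b)"
    proof (rule sum.cong[OF refl])
      fix a
      have "(\<Sum>l<n. \<Sum>b<k. \<Sum>l'<n. M $$ (l',l) * Y a l b l' * W a b) = (\<Sum>b<k. \<Sum>l<n. \<Sum>l'<n. M $$ (l',l) * Y a l b l' * W a b)"
        by (rule sum.swap)
      thus "(\<Sum>l<n. \<Sum>b<k. \<Sum>l'<n. M $$ (l',l) * Y a l b l' * W a b) = (\<Sum>b<k. G a b * W a b)"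
        unfolding G_def sum_distrib_right .
    qed
    finally show ?thesis using L by simp
  qed
  show ?thesis unfolding psd_def
  proof (intro conjI ballI)
    show "?P \<in> carrier_mat (k*m) (k*m)" by simp
    fix v :: "complex vec" assume v: "v \<in> carrier_vec (k*m)"
    note K = key[OF v refl]
    show "Im (cinner v (?P *\<^sub>v v)) = 0" unfolding K Im_sum
      by (intro sum.neutral ballI psdD(2)[OF X]) auto
    show "Re (cinner v (?P *\<^sub>v v)) \<ge> 0" unfolding K Re_sum
      by (intro sum_nonneg psdD(3)[OF X]) auto
  qed
qed

definition measure_prepare :: "nat \<Rightarrow> complex mat \<Rightarrow> complex mat \<Rightarrow> complex mat \<Rightarrow> complex mat \<Rightarrow> complex mat" where
  "measure_prepare n M \<omega> \<omega>' X = mtrace (M * X) \<cdot>\<^sub>m \<omega> + mtrace ((1\<^sub>m n - M) * X) \<cdot>\<^sub>m \<omega>'"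

lemma measure_prepare_channel:
  assumes M: "psd n M" and M': "psd n (1\<^sub>m n - M)" and w: "density m \<omega>" and w': "density m \<omega>'"
  shows "channel n m (measure_prepare n M \<omega> \<omega>')"
proof -
  note Mc = psdD(1)[OF M] psdD(1)[OF M']
  have wp: "psd m \<omega>" "psd m \<omega>'" and wt: "mtrace \<omega> = 1" "mtrace \<omega>' = 1" using w w' by (auto simp: density_def)
  note wc = psdD(1)[OF wp(1)] psdD(1)[OF wp(2)]
  have lin: "mtrace (A * (c \<cdot>\<^sub>m X + Y)) = c * mtrace (A * X) + mtrace (A * Y)"
    if "A \<in> carrier_mat n n" "X \<in> carrier_mat n n" "Y \<in> carrier_mat n n" for A X Y c
  proof -
    have "A * (c \<cdot>\<^sub>m X + Y) = c \<cdot>\<^sub>m (A * X) + A * Y"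
      using that by (simp add: mult_add_distrib_mat[of _ n n _ n] mult_smult_distrib[of _ n n _ n])
    thus ?thesis using that mtrace_add[of "c \<cdot>\<^sub>m (A * X)" n "A * Y"] mtrace_smult[of "A * X" n c] by (simp add: mult_carrier_sq[of _ n])
  qed
  have tr: "mtrace (M * X) + mtrace ((1\<^sub>m n - M) * X) = mtrace X" if X: "X \<in> carrier_mat n n" for X
  proof -
    have "mtrace (M * X) + mtrace ((1\<^sub>m n - M) * X) = mtrace (M * X + (1\<^sub>m n - M) * X)"
      using Mc X by (intro mtrace_add[of _ n, symmetric]) (auto simp: mult_carrier_sq[of _ n])
    also have "M * X + (1\<^sub>m n - M) * X = (M + (1\<^sub>m n - M)) * X"
      using Mc X by (intro add_mult_distrib_mat[of _ n n, symmetric]) auto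
    also have "M + (1\<^sub>m n - M) = 1\<^sub>m n" using Mc by (intro eq_matI) auto
    finally show ?thesis using X by simp
  qed
  show ?thesis unfolding channel_def
  proof (intro conjI ballI allI impI)
    show "measure_prepare n M \<omega> \<omega>' X \<in> carrier_mat m m" for X using wc by (simp add: measure_prepare_def)
  next
    fix X Y :: "complex mat" and c :: complex assume XY: "X \<in> carrier_mat n n" "Y \<in> carrier_mat n n"
    show "measure_prepare n M \<omega> \<omega>' (c \<cdot>\<^sub>m X + Y) = c \<cdot>\<^sub>m measure_prepare n M \<omega> \<omega>' X + measure_prepare n M \<omega> \<omega>' Y"
      unfolding measure_prepare_def lin[OF Mc(1) XY] lin[OF Mc(2) XY]
      using wc by (intro eq_matI) (auto simp: algebra_simps)
  next
    fix X :: "complex mat" assume X: "X \<in> carrier_mat n n"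
    have "mtrace (measure_prepare n M \<omega> \<omega>' X) = mtrace (M * X) + mtrace ((1\<^sub>m n - M) * X)"
      unfolding measure_prepare_def using wc wt by (subst mtrace_add[of _ m]) (auto simp: mtrace_smult[of _ m])
    thus "mtrace (measure_prepare n M \<omega> \<omega>' X) = mtrace X" using tr[OF X] by simp
  next
    fix k X assume X: "psd (k * n) X"
    have "ampliate k n m (measure_prepare n M \<omega> \<omega>') X
      = Matrix.mat (k * m) (k * m) (\<lambda>(i,j). mtrace (M * block n X (i div m) (j div m)) * \<omega> $$ (i mod m, j mod m))
      + Matrix.mat (k * m) (k * m) (\<lambda>(i,j). mtrace ((1\<^sub>m n - M) * block n X (i div m) (j div m)) * \<omega>' $$ (i mod m, j mod m))"
    proof (rule eq_matI)
      fix i j assume "i < dim_row (Matrix.mat (k * m) (k * m) (\<lambda>(i,j). mtrace (M * block n X (i div m) (j div m)) * \<omega> $$ (i mod m, j mod m))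
      + Matrix.mat (k * m) (k * m) (\<lambda>(i,j). mtrace ((1\<^sub>m n - M) * block n X (i div m) (j div m)) * \<omega>' $$ (i mod m, j mod m)))"
        "j < dim_col (Matrix.mat (k * m) (k * m) (\<lambda>(i,j). mtrace (M * block n X (i div m) (j div m)) * \<omega> $$ (i mod m, j mod m))
      + Matrix.mat (k * m) (k * m) (\<lambda>(i,j). mtrace ((1\<^sub>m n - M) * block n X (i div m) (j div m)) * \<omega>' $$ (i mod m, j mod m)))"
      hence ij: "i < k * m" "j < k * m" by auto
      show "ampliate k n m (measure_prepare n M \<omega> \<omega>') X $$ (i,j) = (Matrix.mat (k * m) (k * m) (\<lambda>(i,j). mtrace (M * block n X (i div m) (j div m)) * \<omega> $$ (i mod m, j mod m))
      + Matrix.mat (k * m) (k * m) (\<lambda>(i,j). mtrace ((1\<^sub>m n - M) * block n X (i div m) (j div m)) * \<omega>' $$ (i mod m, j mod m))) $$ (i,j)"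
        using ij div_mod_bounds[OF ij(1)] div_mod_bounds[OF ij(2)] wc by (simp add: ampliate_def measure_prepare_def)
    qed (auto simp: ampliate_def)
    thus "psd (k * m) (ampliate k n m (measure_prepare n M \<omega> \<omega>') X)"
      using psd_add[OF ampliate_trace_prepare_psd[OF M wp(1) X] ampliate_trace_prepare_psd[OF M' wp(2) X]] by simp
  qed
qed

lemma mtrace_psd_mult:
  assumes A: "psd n A" and B: "psd n B" shows "mtrace (A * B) = complex_of_real (Re (mtrace (A * B)))" "Re (mtrace (A * B)) \<ge> 0"
proof -
  define S where "S = msqrt A"
  have S: "S \<in> carrier_mat n n" "adj S = S" "S * S = A"
    using psdD(1)[OF msqrt_psd[OF A]] psd_hermitian[OF msqrt_psd[OF A]] msqrt_mult_self[OF A] by (auto simp: S_def)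
  note Bc = psdD(1)[OF B]
  have "mtrace (A * B) = mtrace (S * (S * B))" unfolding S(3)[symmetric] using mat_assoc[OF S(1,1) Bc] by simp
  also have "\<dots> = mtrace (S * B * S)" by (rule mtrace_mult_comm[OF S(1) mult_carrier_sq[OF S(1) Bc]])
  finally have e: "mtrace (A * B) = mtrace (S * B * S)" .
  have p: "psd n (S * B * S)" using psd_conj[OF B S(1)] S(2) by simp
  have dm: "dim_row (S * B * S) = n" using psdD(1)[OF p] by blast
  have "mtrace (S * B * S) = complex_of_real (\<Sum>i<n. Re ((S * B * S) $$ (i,i)))"
    unfolding mtrace_def dm of_real_sum by (intro sum.cong refl psd_diag_entry(1)[OF p]) auto
  thus "mtrace (A * B) = complex_of_real (Re (mtrace (A * B)))" "Re (mtrace (A * B)) \<ge> 0"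
    unfolding e using psd_diag_entry(2)[OF p] by (auto simp del: index_mult_mat(1) intro!: sum_nonneg)
qed

text \<open>The hypothesis on \<sigma>' - b \<omega> is exactly the positivity of the failure state,
  and b < 1 permits its normalisation. The output on \<rho> then dominates a \<omega> as an
  operator, so the squared fidelity loses at most the factor a.\<close>

lemma oneshot_achievability:
  assumes r: "density n \<rho>" and s: "density n \<sigma>" and r': "density m \<rho>'" and s': "density m \<sigma>'" and w: "density m \<omega>"
    and M: "psd n M" and M': "psd n (1\<^sub>m n - M)" and a: "mtrace (M * \<rho>) = complex_of_real a" and b: "mtrace (M * \<sigma>) = complex_of_real b" "b < 1"
    and d: "psd m (\<sigma>' - complex_of_real b \<cdot>\<^sub>m \<omega>)"
  shows "\<exists>E. channel n m E \<and> E \<sigma> = \<sigma>' \<and> a * (fidelity \<omega> \<rho>')\<^sup>2 \<le> (fidelity (E \<rho>) \<rho>')\<^sup>2"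
proof -
  have p: "psd n \<rho>" "psd n \<sigma>" "psd m \<rho>'" "psd m \<sigma>'" "psd m \<omega>" using r s r' s' w by (auto simp: density_def)
  have t: "mtrace \<rho> = 1" "mtrace \<sigma> = 1" "mtrace \<sigma>' = 1" "mtrace \<omega> = 1" using r s r' s' w by (auto simp: density_def)
  note c = psdD(1)[OF p(1)] psdD(1)[OF p(2)] psdD(1)[OF p(3)] psdD(1)[OF p(4)] psdD(1)[OF p(5)] psdD(1)[OF M]
  define \<omega>' where "\<omega>' = complex_of_real (1 / (1 - b)) \<cdot>\<^sub>m (\<sigma>' - complex_of_real b \<cdot>\<^sub>m \<omega>)"
  have "mtrace (\<sigma>' - complex_of_real b \<cdot>\<^sub>m \<omega>) = mtrace \<sigma>' - complex_of_real b * mtrace \<omega>"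
    using c by (simp add: mtrace_def sum_subtractf sum_distrib_left)
  hence "mtrace \<omega>' = complex_of_real (1 / (1 - b)) * complex_of_real (1 - b)"
    unfolding \<omega>'_def mtrace_smult[OF psdD(1)[OF d]] using t by simp
  also have "\<dots> = 1" using b(2) by (simp flip: of_real_mult)
  finally have w': "density m \<omega>'" using psd_smult[OF d, of "1 / (1 - b)"] b(2) by (simp add: density_def \<omega>'_def)
  define E where "E = measure_prepare n M \<omega> \<omega>'"
  have E: "channel n m E" unfolding E_def by (rule measure_prepare_channel[OF M M' w w'])
  have comp: "mtrace ((1\<^sub>m n - M) * X) = mtrace X - mtrace (M * X)" if X: "X \<in> carrier_mat n n" for X
  proof -
    have "(1\<^sub>m n - M) * X = X - M * X" using c X by (simp add: minus_mult_distrib_mat[of _ n n _ _ n])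
    thus ?thesis using c X by (simp add: mtrace_def sum_subtractf del: index_mult_mat(1))
  qed
  have w'c: "\<omega>' \<in> carrier_mat m m" using w' psdD(1) by (auto simp: density_def)
  have "E \<sigma> = complex_of_real b \<cdot>\<^sub>m \<omega> + complex_of_real (1 - b) \<cdot>\<^sub>m \<omega>'"
    unfolding E_def measure_prepare_def comp[OF c(2)] b t by simp
  also have "complex_of_real (1 - b) \<cdot>\<^sub>m \<omega>' = \<sigma>' - complex_of_real b \<cdot>\<^sub>m \<omega>"
  proof -
    have "complex_of_real (1 - b) * complex_of_real (1 / (1 - b)) = 1" using b(2) by (simp flip: of_real_mult)
    thus ?thesis unfolding \<omega>'_def using c by (intro eq_matI) (auto simp flip: mult.assoc)
  qed
  also have "complex_of_real b \<cdot>\<^sub>m \<omega> + (\<sigma>' - complex_of_real b \<cdot>\<^sub>m \<omega>) = \<sigma>'" using c by (intro eq_matI) auto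
  finally have Es: "E \<sigma> = \<sigma>'" .
  have a0: "a \<ge> 0" using mtrace_psd_mult(2)[OF M p(1)] a by simp
  have a1: "1 - a \<ge> 0" using mtrace_psd_mult(2)[OF M' p(1)] comp[OF c(1)] a t by simp
  have "E \<rho> = complex_of_real a \<cdot>\<^sub>m \<omega> + complex_of_real (1 - a) \<cdot>\<^sub>m \<omega>'"
    unfolding E_def measure_prepare_def comp[OF c(1)] a t by simp
  hence "E \<rho> - complex_of_real a \<cdot>\<^sub>m \<omega> = complex_of_real (1 - a) \<cdot>\<^sub>m \<omega>'"
    using c w'c by (intro eq_matI) auto
  hence dd: "psd m (E \<rho> - complex_of_real a \<cdot>\<^sub>m \<omega>)"
    using psd_smult[OF _ a1, of m \<omega>'] w' by (simp add: density_def)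
  have "a * (fidelity \<omega> \<rho>')\<^sup>2 \<le> (fidelity (E \<rho>) \<rho>')\<^sup>2"
    by (rule fidelity_sq_mono[OF p(5) channel_psd[OF E p(1)] p(3) a0 dd])
  thus ?thesis using E Es by blast
qed

section \<open>Block codes\<close>

text \<open>The class label for words over a frame of one block. It keeps the q-value of every digit
  and not only their product: words with equal products may differ at digits of different q-value,
  where entries of the conjugated \<rho> can survive. The number of labels is exponential in the
  number of blocks, but small per copy for long blocks.\<close>

fun clist :: "nat \<Rightarrow> (nat \<Rightarrow> real) \<Rightarrow> nat \<Rightarrow> nat \<Rightarrow> real list" where
  "clist D q 0 x = []"
| "clist D q (Suc n) x = q (x div D^n) # clist D q n (x mod D^n)"

lemma card_clist: "card (clist D q n ` {..<D^n}) \<le> card (q ` {..<D}) ^ n"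
proof -
  have "clist D q n x \<in> {xs. set xs \<subseteq> q ` {..<D} \<and> length xs = n}" if "x < D^n" for x
    using that
  proof (induction n arbitrary: x)
    case (Suc n)
    hence x: "x < D * D^n" by simp
    show ?case using Suc.IH[OF div_mod_bounds(2)[OF x]] div_mod_bounds(1)[OF x] by auto
  qed simp
  hence "clist D q n ` {..<D^n} \<subseteq> {xs. set xs \<subseteq> q ` {..<D} \<and> length xs = n}" by auto
  hence "card (clist D q n ` {..<D^n}) \<le> card {xs. set xs \<subseteq> q ` {..<D} \<and> length xs = n}"
    by (intro card_mono finite_lists_length_eq) auto
  thus ?thesis by (simp add: card_lists_length_eq)
qed

text \<open>Distinct words with the same label differ at some digit between letters of equal q, and
  the factor of R at that digit is 0.\<close>

lemma tpow_offdiag_class: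
  assumes R: "R \<in> carrier_mat D D" and z: "\<And>a b. a < D \<Longrightarrow> b < D \<Longrightarrow> a \<noteq> b \<Longrightarrow> q a = q b \<Longrightarrow> R $$ (a,b) = 0"
  shows "x < D^n \<Longrightarrow> y < D^n \<Longrightarrow> x \<noteq> y \<Longrightarrow> clist D q n x = clist D q n y \<Longrightarrow> tpow R n $$ (x,y) = 0"
proof (induction n arbitrary: x y)
  case (Suc n)
  hence xy: "x < D * D^n" "y < D * D^n" by auto
  note b = div_mod_bounds[OF xy(1)] div_mod_bounds[OF xy(2)]
  have e: "tpow R (Suc n) $$ (x,y) = R $$ (x div D^n, y div D^n) * tpow R n $$ (x mod D^n, y mod D^n)"
    by (simp add: kron_index[OF R tpow_carrier[OF R] xy])
  show ?case
  proof (cases "x div D^n = y div D^n")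
    case False
    thus ?thesis unfolding e using z[OF b(1) b(4)] Suc.prems by simp
  next
    case True
    hence "x mod D^n \<noteq> y mod D^n" using Suc.prems(3) div_mod_eqI by blast
    thus ?thesis unfolding e using Suc.IH[OF b(2) b(5)] Suc.prems by simp
  qed
qed simp

lemma spectral_one_minus:
  assumes Z: "unitary n Z" shows "1\<^sub>m n - Z * rdiag n f * adj Z = Z * rdiag n (\<lambda>i. 1 - f i) * adj Z"
proof -
  note z = unitaryD[OF Z]
  have e: "rdiag n (\<lambda>i. 1 - f i) = 1\<^sub>m n - rdiag n f" by (intro eq_matI) auto
  have "Z * (1\<^sub>m n - rdiag n f) * adj Z = Z * 1\<^sub>m n * adj Z - Z * rdiag n f * adj Z"
    using z by (simp add: mult_minus_distrib_mat[of _ n n _ n] minus_mult_distrib_mat[of _ n n _ _ n] mult_carrier_sq[of _ n] del: right_mult_one_mat)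
  thus ?thesis unfolding e using z by simp
qed

lemma mtrace_spectral_mult:
  assumes Z: "unitary n Z" and A: "A \<in> carrier_mat n n"
  shows "mtrace ((Z * rdiag n f * adj Z) * A) = (\<Sum>x<n. complex_of_real (f x) * (adj Z * A * Z) $$ (x,x))"
proof -
  note z = unitaryD[OF Z]
  define B where "B = adj Z * A * Z"
  have B: "B \<in> carrier_mat n n" using z A by (simp add: B_def mult_carrier_sq[of _ n])
  have "(Z * rdiag n f * adj Z) * A = Z * (rdiag n f * (adj Z * A))"
    using z A by (simp add: mat_assoc[of _ n] mult_carrier_sq[of _ n])
  hence "mtrace ((Z * rdiag n f * adj Z) * A) = mtrace (rdiag n f * (adj Z * A) * Z)"
    using mtrace_mult_comm[of Z n n "rdiag n f * (adj Z * A)"] z A by (simp add: mult_carrier_sq[of _ n])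
  also have "rdiag n f * (adj Z * A) * Z = rdiag n f * B"
    unfolding B_def using z A by (simp add: mat_assoc[of _ n] mult_carrier_sq[of _ n])
  also have "mtrace \<dots> = (\<Sum>x<n. complex_of_real (f x) * B $$ (x,x))"
    unfolding mat_diag_mult_left[OF B] by (simp add: mtrace_def)
  finally show ?thesis unfolding B_def .
qed

lemma tpow_conj:
  assumes V: "V \<in> carrier_mat d d" and A: "A \<in> carrier_mat d d"
  shows "adj (tpow V n) * tpow A n * tpow V n = tpow (adj V * A * V) n"
  unfolding adj_tpow tpow_mult[OF mult_carrier_sq[OF adj_carrier[OF V] A] V] tpow_mult[OF adj_carrier[OF V] A] ..

text \<open>On the N complete blocks the test is w times the projection onto the words in T; on the
  l remaining copies it is the identity, which leaves the probabilities unchanged.\<close>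

lemma block_test:
  assumes r: "density d \<rho>" and s: "density d \<sigma>" and f: "frame (d^k) (tpow \<rho> k) (tpow \<sigma> k) V p q"
    and n: "n = k * N + l" and T: "T \<subseteq> {..<(d^k)^N}" and w: "0 \<le> w" "w \<le> 1"
  shows "\<exists>M. psd (d^n) M \<and> psd (d^n) (1\<^sub>m (d^n) - M)
    \<and> mtrace (M * tpow \<rho> n) = complex_of_real (w * (\<Sum>x\<in>T. pweight (d^k) p N x))
    \<and> mtrace (M * tpow \<sigma> n) = complex_of_real (w * (\<Sum>x\<in>T. pweight (d^k) q N x))"
proof -
  define D where "D = d^k"
  define Z where "Z = tpow V N"
  define g where "g x = (if x \<in> T then w else 0)" for x
  define M0 where "M0 = Z * rdiag (D^N) g * adj Z"
  define M where "M = kron M0 (1\<^sub>m (d^l))"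
  have dn: "d^n = D^N * d^l" unfolding n D_def by (simp add: power_add power_mult)
  note V = frameD(1)[OF f, folded D_def]
  have Z: "unitary (D^N) Z" unfolding Z_def by (rule unitary_tpow[OF V])
  have I: "unitary (d^l) (1\<^sub>m (d^l))" by (simp add: unitary_def)
  have M0c: "M0 \<in> carrier_mat (D^N) (D^N)" using unitaryD[OF Z] by (simp add: M0_def mult_carrier_sq[of _ "D^N"])
  have one: "1\<^sub>m (d^l) = 1\<^sub>m (d^l) * rdiag (d^l) (\<lambda>_. 1) * adj (1\<^sub>m (d^l))" by simp
  have M: "M = kron Z (1\<^sub>m (d^l)) * rdiag (D^N * d^l) (\<lambda>i. g (i div d^l) * 1) * adj (kron Z (1\<^sub>m (d^l)))"
    unfolding M_def M0_def by (subst one) (rule kron_spectral[OF Z I])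
  have ZI: "unitary (d^n) (kron Z (1\<^sub>m (d^l)))" unfolding dn by (rule unitary_kron[OF Z I])
  have p1: "psd (d^n) M" unfolding M dn[symmetric] using w by (intro spectral_psd[OF ZI]) (auto simp: g_def)
  have p2: "psd (d^n) (1\<^sub>m (d^n) - M)"
    unfolding M dn[symmetric] spectral_one_minus[OF ZI] using w by (intro spectral_psd[OF ZI]) (auto simp: g_def)
  have tr: "mtrace (M * tpow \<tau> n) = complex_of_real (w * (\<Sum>x\<in>T. pweight D h N x))"
    if t: "density d \<tau>" and h: "\<And>a. a < D \<Longrightarrow> (adj V * tpow \<tau> k * V) $$ (a,a) = complex_of_real (h a)" for \<tau> h
  proof -
    have tc: "\<tau> \<in> carrier_mat d d" "mtrace \<tau> = 1" using t psdD(1) by (auto simp: density_def)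
    have tk: "tpow \<tau> k \<in> carrier_mat D D" unfolding D_def by (rule tpow_carrier[OF tc(1)])
    have tn: "tpow \<tau> n = kron (tpow (tpow \<tau> k) N) (tpow \<tau> l)" unfolding n tpow_add tpow_tpow ..
    have "M * tpow \<tau> n = kron (M0 * tpow (tpow \<tau> k) N) (1\<^sub>m (d^l) * tpow \<tau> l)"
      unfolding M_def tn using M0c tk tc by (intro kron_mult[of _ "D^N" "D^N" _ "d^l" "d^l" _ "D^N" _ "d^l"]) auto
    hence "mtrace (M * tpow \<tau> n) = mtrace (M0 * tpow (tpow \<tau> k) N) * mtrace (tpow \<tau> l)"
      using mtrace_kron[OF mult_carrier_sq[OF M0c tpow_carrier[OF tk]] tpow_carrier[OF tc(1)]]
      left_mult_one_mat[OF tpow_carrier[OF tc(1)], of l] by simp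
    also have "mtrace (tpow \<tau> l) = 1" using mtrace_tpow[OF tc(1)] tc by simp
    also have "mtrace (M0 * tpow (tpow \<tau> k) N) = (\<Sum>x<D^N. complex_of_real (g x) * (adj Z * tpow (tpow \<tau> k) N * Z) $$ (x,x))"
      unfolding M0_def by (rule mtrace_spectral_mult[OF Z tpow_carrier[OF tk]])
    also have "\<dots> = (\<Sum>x<D^N. complex_of_real (if x \<in> T then w * pweight D h N x else 0))"
    proof (rule sum.cong[OF refl])
      fix x assume "x \<in> {..<D^N}" hence x: "x < D^N" by simp
      have "(adj Z * tpow (tpow \<tau> k) N * Z) $$ (x,x) = complex_of_real (pweight D h N x)"
        unfolding Z_def tpow_conj[OF unitaryD(1)[OF V] tk]
        by (rule tpow_diag_entry[OF mult_carrier_sq[OF mult_carrier_sq[OF unitaryD(6)[OF V] tk] unitaryD(1)[OF V]] h x])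
      thus "complex_of_real (g x) * (adj Z * tpow (tpow \<tau> k) N * Z) $$ (x,x) = complex_of_real (if x \<in> T then w * pweight D h N x else 0)"
        by (simp add: g_def)
    qed
    also have "\<dots> = complex_of_real (\<Sum>x<D^N. if x \<in> T then w * pweight D h N x else 0)" by simp
    also have "(\<Sum>x<D^N. if x \<in> T then w * pweight D h N x else 0) = w * (\<Sum>x\<in>T. pweight D h N x)"
    proof -
      have "{..<D^N} \<inter> T = T" using T unfolding D_def by auto
      thus ?thesis by (simp add: sum.inter_restrict[symmetric] sum_distrib_left)
    qed
    finally show ?thesis by simp
  qed
  have "adj V * tpow \<sigma> k * V = rdiag D q"
    using unitary_conj_inverse(2)[OF V, of "rdiag D q"] frameD(2)[OF f, folded D_def] by simp
  hence "mtrace (M * tpow \<sigma> n) = complex_of_real (w * (\<Sum>x\<in>T. pweight D q N x))" by (intro tr[OF s]) simp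
  moreover have "mtrace (M * tpow \<rho> n) = complex_of_real (w * (\<Sum>x\<in>T. pweight D p N x))"
    by (rule tr[OF r]) (rule frameD(5)[OF f, folded D_def])
  ultimately show ?thesis using p1 p2 unfolding D_def by blast
qed

lemma kron_left_diff:
  assumes "A \<in> carrier_mat a a" "B \<in> carrier_mat a a" "C \<in> carrier_mat c c"
  shows "kron A C - z \<cdot>\<^sub>m kron B C = kron (A - z \<cdot>\<^sub>m B) C"
proof (rule eq_matI)
  fix i j assume "i < dim_row (kron (A - z \<cdot>\<^sub>m B) C)" "j < dim_col (kron (A - z \<cdot>\<^sub>m B) C)"
  hence ij: "i < a * c" "j < a * c" using assms by auto
  show "(kron A C - z \<cdot>\<^sub>m kron B C) $$ (i,j) = kron (A - z \<cdot>\<^sub>m B) C $$ (i,j)"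
    using assms ij div_mod_bounds[OF ij(1)] div_mod_bounds[OF ij(2)]
    by (simp add: kron_def algebra_simps)
qed (use assms in auto)

text \<open>The complete blocks carry the weights t in the product frame. The l remaining copies
  carry \<sigma>, which keeps the operator bound against \<open>tpow \<sigma> m\<close> intact and
  costs the factor \<open>fidelity \<sigma> \<rho> ^ l\<close>.\<close>

lemma block_state:
  assumes r: "density d \<rho>" and s: "density d \<sigma>" and f: "frame (d^k) (tpow \<rho> k) (tpow \<sigma> k) W p q"
    and m: "m = k * N + l" and t: "\<And>y. 0 \<le> t y" "(\<Sum>y<(d^k)^N. t y) = 1"
    and b: "\<And>y. y < (d^k)^N \<Longrightarrow> b * t y \<le> pweight (d^k) q N y"
  shows "\<exists>\<omega>. density (d^m) \<omega> \<and> psd (d^m) (tpow \<sigma> m - complex_of_real b \<cdot>\<^sub>m \<omega>)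
    \<and> (\<Sum>y<(d^k)^N. sqrt (t y * pweight (d^k) p N y)) * fidelity \<sigma> \<rho> ^ l
      \<le> real (card (q ` {..<d^k}) ^ N) * fidelity \<omega> (tpow \<rho> m)"
proof -
  define D where "D = d^k"
  define Z where "Z = tpow W N"
  define w0 where "w0 = Z * rdiag (D^N) t * adj Z"
  define \<omega> where "\<omega> = kron w0 (tpow \<sigma> l)"
  have dm: "d^m = D^N * d^l" unfolding m D_def by (simp add: power_add power_mult)
  note W = frameD(1)[OF f, folded D_def]
  have Z: "unitary (D^N) Z" unfolding Z_def by (rule unitary_tpow[OF W])
  note z = unitaryD[OF Z]
  have rp: "psd d \<rho>" and sp: "psd d \<sigma>" using r s by (auto simp: density_def)
  have w0p: "psd (D^N) w0" unfolding w0_def using t by (intro spectral_psd[OF Z])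
  have "mtrace w0 = 1" unfolding w0_def mtrace_unitary_conj(1)[OF Z mat_diag_dim] mtrace_rdiag using t D_def by simp
  hence dens: "density (d^m) \<omega>"
    using psd_kron[OF w0p psd_tpow[OF sp]] mtrace_kron[OF psdD(1)[OF w0p] psdD(1)[OF psd_tpow[OF sp]]] density_tpow[OF s, of l]
    unfolding \<omega>_def dm density_def by simp
  have sk: "tpow (tpow \<sigma> k) N = Z * rdiag (D^N) (pweight D q N) * adj Z"
    unfolding Z_def by (subst frameD(2)[OF f, folded D_def]) (rule tpow_spectral[OF W])
  have sm: "tpow \<sigma> m = kron (tpow (tpow \<sigma> k) N) (tpow \<sigma> l)" unfolding m tpow_add tpow_tpow ..
  have "tpow (tpow \<sigma> k) N - complex_of_real b \<cdot>\<^sub>m w0 = Z * rdiag (D^N) (\<lambda>y. pweight D q N y - b * t y) * adj Z"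
  proof -
    have e: "rdiag (D^N) (\<lambda>y. pweight D q N y - b * t y) = rdiag (D^N) (pweight D q N) - complex_of_real b \<cdot>\<^sub>m rdiag (D^N) t"
      by (intro eq_matI) auto
    show ?thesis unfolding sk w0_def e using z
      by (simp add: mult_minus_distrib_mat[of _ "D^N" "D^N" _ "D^N"] minus_mult_distrib_mat[of _ "D^N" "D^N" _ _ "D^N"]
        mult_smult_distrib[of _ "D^N" "D^N" _ "D^N"] mult_smult_assoc_mat[of _ "D^N" "D^N" _ "D^N"] mult_carrier_sq[of _ "D^N"])
  qed
  moreover have "psd (D^N) (Z * rdiag (D^N) (\<lambda>y. pweight D q N y - b * t y) * adj Z)"
    using b unfolding D_def[symmetric] by (intro spectral_psd[OF Z]) simp
  ultimately have dp: "psd (D^N) (tpow (tpow \<sigma> k) N - complex_of_real b \<cdot>\<^sub>m w0)" by (simp only:)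
  have skc: "tpow (tpow \<sigma> k) N \<in> carrier_mat (D^N) (D^N)" unfolding D_def by (intro tpow_carrier psdD(1)[OF sp])
  have "tpow \<sigma> m - complex_of_real b \<cdot>\<^sub>m \<omega> = kron (tpow (tpow \<sigma> k) N - complex_of_real b \<cdot>\<^sub>m w0) (tpow \<sigma> l)"
    unfolding sm \<omega>_def by (rule kron_left_diff[OF skc psdD(1)[OF w0p] psdD(1)[OF psd_tpow[OF sp]]])
  hence diff: "psd (d^m) (tpow \<sigma> m - complex_of_real b \<cdot>\<^sub>m \<omega>)"
    unfolding dm using psd_kron[OF dp psd_tpow[OF sp]] by simp
  have rk: "psd D (tpow \<rho> k)" unfolding D_def by (rule psd_tpow[OF rp])
  have rm: "tpow \<rho> m = kron (tpow (tpow \<rho> k) N) (tpow \<rho> l)" unfolding m tpow_add tpow_tpow ..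
  have F: "fidelity \<omega> (tpow \<rho> m) = fidelity w0 (tpow (tpow \<rho> k) N) * fidelity \<sigma> \<rho> ^ l"
    unfolding \<omega>_def rm fidelity_kron[OF w0p psd_tpow[OF rk] psd_tpow[OF sp] psd_tpow[OF rp]] fidelity_tpow[OF sp rp] ..
  define R where "R = adj W * tpow \<rho> k * W"
  have Rc: "R \<in> carrier_mat D D" unfolding R_def
    by (rule mult_carrier_sq[OF mult_carrier_sq[OF unitaryD(6)[OF W] psdD(1)[OF rk]] unitaryD(1)[OF W]])
  have RN: "adj Z * tpow (tpow \<rho> k) N * Z = tpow R N"
    unfolding Z_def R_def by (rule tpow_conj[OF unitaryD(1)[OF W] psdD(1)[OF rk]])
  have "(\<Sum>y<D^N. sqrt (t y * pweight D p N y)) = (\<Sum>y<D^N. sqrt (t y * Re ((adj Z * tpow (tpow \<rho> k) N * Z) $$ (y,y))))"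
  proof (rule sum.cong[OF refl])
    fix y assume "y \<in> {..<D^N}" hence y: "y < D^N" by simp
    show "sqrt (t y * pweight D p N y) = sqrt (t y * Re ((adj Z * tpow (tpow \<rho> k) N * Z) $$ (y,y)))"
      unfolding RN using tpow_diag_entry[OF Rc _ y, of p] frameD(5)[OF f, folded D_def] by (simp add: R_def)
  qed
  also have "\<dots> \<le> real (card (clist D q N ` {..<D^N})) * fidelity w0 (tpow (tpow \<rho> k) N)"
    unfolding w0_def
  proof (rule fidelity_ge_classes[OF Z t(1) psd_tpow[OF rk]])
    fix a b assume ab: "a < D^N" "b < D^N" "a \<noteq> b" "clist D q N a = clist D q N b"
    show "(adj Z * tpow (tpow \<rho> k) N * Z) $$ (a,b) = 0"
      unfolding RN by (rule tpow_offdiag_class[OF Rc _ ab]) (use frameD(6)[OF f, folded D_def] in \<open>auto simp: R_def simp del: index_mult_mat(1)\<close>)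
  qed
  also have "\<dots> \<le> real (card (q ` {..<D}) ^ N) * fidelity w0 (tpow (tpow \<rho> k) N)"
    using card_clist[of D q N] fidelity_nonneg[OF w0p psd_tpow[OF rk]] by (intro mult_right_mono) (simp_all only: of_nat_le_iff)
  finally have "(\<Sum>y<D^N. sqrt (t y * pweight D p N y)) * fidelity \<sigma> \<rho> ^ l
      \<le> real (card (q ` {..<D}) ^ N) * fidelity w0 (tpow (tpow \<rho> k) N) * fidelity \<sigma> \<rho> ^ l"
    using fidelity_nonneg[OF sp rp] by (intro mult_right_mono) auto
  hence "(\<Sum>y<D^N. sqrt (t y * pweight D p N y)) * fidelity \<sigma> \<rho> ^ l \<le> real (card (q ` {..<D}) ^ N) * fidelity \<omega> (tpow \<rho> m)"
    unfolding F by (simp add: mult.assoc)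
  thus ?thesis using dens diff unfolding D_def by blast
qed

section \<open>The converse for tensor powers\<close>

text \<open>The factor \<open>Suc n ^ d1\<close> is the pinching cost on the input. The factor
  \<open>Suc m ^ d2\<close> arises because a classical quantity of order at least 1/2 may exceed the
  sandwiched one by the number of classes. In the second bound L stands for the divergence of
  infinite order in natural logarithms.\<close>

lemma converse_bound:
  assumes r1: "psd d1 \<rho>1" and s1: "psd d1 \<sigma>1" and r2: "psd d2 \<rho>2" and s2: "psd d2 \<sigma>2"
    and sup: "mpow \<sigma>1 0 * \<rho>1 = \<rho>1" and E: "channel (d1^n) (d2^m) E" and Es: "E (tpow \<sigma>1 n) = tpow \<sigma>2 m"
  shows "1/2 \<le> \<alpha> \<Longrightarrow> 1 \<le> \<beta> \<Longrightarrow> 1 / (2 * \<alpha>) + 1 / (2 * \<beta>) = 1 \<Longrightarrow>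
      (fidelity (E (tpow \<rho>1 n)) (tpow \<rho>2 m))\<^sup>2 \<le> real (Suc n ^ d1) * (sQ \<beta> \<rho>1 \<sigma>1 ^ n) powr (1 / \<beta>) * (real (Suc m ^ d2) * sQ \<alpha> \<rho>2 \<sigma>2 ^ m) powr (1 / \<alpha>)"
    and "(\<And>\<beta>. \<beta> > 1 \<Longrightarrow> sQ \<beta> \<rho>1 \<sigma>1 \<le> exp ((\<beta> - 1) * L)) \<Longrightarrow>
      (fidelity (E (tpow \<rho>1 n)) (tpow \<rho>2 m))\<^sup>2 \<le> real (Suc n ^ d1) * exp (real n * L) * (real (Suc m ^ d2) * sQ (1/2) \<rho>2 \<sigma>2 ^ m)\<^sup>2"
proof -
  note p = psd_tpow[OF r1, of n] psd_tpow[OF s1, of n] psd_tpow[OF r2, of m] psd_tpow[OF s2, of m]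
  obtain V p1 q1 where f1: "frame (d1^n) (tpow \<rho>1 n) (tpow \<sigma>1 n) V p1 q1" using frame_exists[OF p(1,2)] by blast
  obtain W p2 q2 where f2: "frame (d2^m) (tpow \<rho>2 m) (tpow \<sigma>2 m) W p2 q2" using frame_exists[OF p(3,4)] by blast
  let ?v1 = "real (card (q1 ` {..<d1^n}))"
  have v1: "?v1 \<le> real (Suc n ^ d1)" using frame_card[OF s1 f1] by (simp only: of_nat_le_iff)
  have v2: "real (card (q2 ` {..<d2^m})) \<le> real (Suc m ^ d2)" using frame_card[OF s2 f2] by (simp only: of_nat_le_iff)
  note conv = converse_frames[OF E f1 f2 p(1,3) supp_tpow[OF r1 s1 sup] Es]
  have B: "cQ a (d2^m) p2 q2 \<le> real (Suc m ^ d2) * sQ a \<rho>2 \<sigma>2 ^ m" if "1/2 \<le> a" for a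
  proof -
    have "cQ a (d2^m) p2 q2 \<le> real (card (q2 ` {..<d2^m})) * sQ a \<rho>2 \<sigma>2 ^ m"
      using frame_sandwich_bounds(2)[OF f2 p(3,4) that] unfolding sQ_tpow[OF r2 s2] .
    also have "\<dots> \<le> real (Suc m ^ d2) * sQ a \<rho>2 \<sigma>2 ^ m" using v2 sQ_nonneg[OF r2 s2] by (intro mult_right_mono) auto
    finally show ?thesis .
  qed
  have A: "cQ b (d1^n) p1 q1 \<le> sQ b \<rho>1 \<sigma>1 ^ n" if "1 \<le> b" for b
    using frame_sandwich_bounds(3)[OF f1 p(1,2) that] unfolding sQ_tpow[OF r1 s1] .
  {
    assume ab: "1/2 \<le> \<alpha>" "1 \<le> \<beta>" "1 / (2 * \<alpha>) + 1 / (2 * \<beta>) = 1"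
    have "(fidelity (E (tpow \<rho>1 n)) (tpow \<rho>2 m))\<^sup>2 \<le> ?v1 * cQ \<beta> (d1^n) p1 q1 powr (1 / \<beta>) * cQ \<alpha> (d2^m) p2 q2 powr (1 / \<alpha>)"
      using ab by (intro conv(1)) auto
    also have "\<dots> \<le> real (Suc n ^ d1) * (sQ \<beta> \<rho>1 \<sigma>1 ^ n) powr (1 / \<beta>) * (real (Suc m ^ d2) * sQ \<alpha> \<rho>2 \<sigma>2 ^ m) powr (1 / \<alpha>)"
      using ab v1 A B cQ_nonneg by (intro mult_mono powr_mono2) auto
    finally show "(fidelity (E (tpow \<rho>1 n)) (tpow \<rho>2 m))\<^sup>2 \<le> \<dots>" .
  next
    assume L: "\<And>\<beta>. \<beta> > 1 \<Longrightarrow> sQ \<beta> \<rho>1 \<sigma>1 \<le> exp ((\<beta> - 1) * L)"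
    have ratio: "p1 x \<le> exp (real n * L) * q1 x" if x: "x < d1^n" for x
    proof (cases "p1 x = 0")
      case True thus ?thesis using frameD(4)[OF f1] by simp
    next
      case False
      have px: "p1 x > 0" using False frameD(3)[OF f1, of x] by simp
      have qx: "q1 x > 0"
        using frame_support[OF f1 p(1) supp_tpow[OF r1 s1 sup] x] False frameD(4)[OF f1, of x] by (cases "q1 x = 0") auto
      \<comment> \<open>A single summand of the classical sum of order 1 + j is at most the whole
        sum; dividing by j and letting j grow isolates the likelihood ratio.\<close>
      have k: "ln (p1 x) / j + (ln (p1 x) - ln (q1 x)) \<le> real n * L" if j: "j > 0" for j
      proof -
        have "p1 x powr (1 + j) * q1 x powr (1 - (1 + j)) \<le> cQ (1 + j) (d1^n) p1 q1"
          unfolding cQ_def using x by (intro member_le_sum) auto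
        also have "\<dots> \<le> sQ (1 + j) \<rho>1 \<sigma>1 ^ n" using j by (intro A) auto
        also have "\<dots> \<le> exp (j * L) ^ n" using L[of "1 + j"] j sQ_nonneg[OF r1 s1] by (intro power_mono) auto
        also have "\<dots> = exp (real n * (j * L))" by (rule exp_of_nat_mult[symmetric])
        finally have "p1 x powr (1 + j) * q1 x powr (- j) \<le> exp (real n * (j * L))" by simp
        moreover have "0 < p1 x powr (1 + j) * q1 x powr (- j)" using px qx by simp
        ultimately have "ln (p1 x powr (1 + j) * q1 x powr (- j)) \<le> real n * (j * L)"
          by (metis exp_le_cancel_iff exp_ln)
        hence "(1 + j) * ln (p1 x) - j * ln (q1 x) \<le> real n * (j * L)" using px qx by (simp add: ln_mult ln_powr)
        hence "((1 + j) * ln (p1 x) - j * ln (q1 x)) / j \<le> real n * (j * L) / j" using j by (intro divide_right_mono) auto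
        thus ?thesis using j by (simp add: field_simps)
      qed
      have "ln (p1 x) - ln (q1 x) \<le> real n * L"
      proof (rule field_le_epsilon)
        fix e :: real assume e: "e > 0"
        \<comment> \<open>Large enough that |ln (p1 x)| / j is at most e.\<close>
        let ?j = "(\<bar>ln (p1 x)\<bar> + 1) / e"
        have j: "?j > 0" using e by (intro divide_pos_pos) auto
        have "- e \<le> ln (p1 x) / ?j"
        proof -
          have "\<bar>ln (p1 x) / ?j\<bar> = e * (\<bar>ln (p1 x)\<bar> / (\<bar>ln (p1 x)\<bar> + 1))" using e by (simp add: abs_divide abs_mult)
          also have "\<dots> \<le> e * 1" using e by (intro mult_left_mono) (auto simp: divide_le_eq)
          finally show ?thesis by linarith
        qed
        thus "ln (p1 x) - ln (q1 x) \<le> real n * L + e" using k[OF j] by linarith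
      qed
      hence "ln (p1 x / q1 x) \<le> real n * L" using px qx by (simp add: ln_div)
      hence "p1 x / q1 x \<le> exp (real n * L)" using px qx by (metis divide_pos_pos exp_ln exp_le_cancel_iff)
      thus ?thesis using qx by (simp add: pos_divide_le_eq)
    qed
    have "(fidelity (E (tpow \<rho>1 n)) (tpow \<rho>2 m))\<^sup>2 \<le> ?v1 * exp (real n * L) * (cQ (1/2) (d2^m) p2 q2)\<^sup>2"
      by (rule conv(2)[OF _ ratio]) auto
    also have "\<dots> \<le> real (Suc n ^ d1) * exp (real n * L) * (real (Suc m ^ d2) * sQ (1/2) \<rho>2 \<sigma>2 ^ m)\<^sup>2"
      using v1 B[of "1/2"] cQ_nonneg by (intro mult_mono power_mono) auto
    finally show "(fidelity (E (tpow \<rho>1 n)) (tpow \<rho>2 m))\<^sup>2 \<le> \<dots>" .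
  }
qed

section \<open>Asymptotic achievability\<close>

lemma ratio_tendsto:
  assumes "\<And>n. \<bar>f n - c * real n\<bar> \<le> K" shows "(\<lambda>n. f n / real n) \<longlonglongrightarrow> c"
proof -
  have "(\<lambda>n. f n / real n - c) \<longlonglongrightarrow> 0"
  proof (rule tendsto_0_le[OF lim_1_over_n])
    show "\<forall>\<^sub>F n in sequentially. norm (f n / real n - c) \<le> norm (1 / real n) * K"
      using eventually_gt_at_top[of 0]
    proof eventually_elim
      case (elim n)
      have "f n / real n - c = (f n - c * real n) / real n" using elim by (simp add: field_simps)
      hence "norm (f n / real n - c) = \<bar>f n - c * real n\<bar> / real n" using elim by (simp add: abs_divide)
      also have "\<dots> \<le> K / real n" using assms[of n] by (intro divide_right_mono) auto
      finally show ?case by simp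
    qed
  qed
  thus ?thesis by (simp add: LIM_zero_iff)
qed

lemma ln_Suc_over_n: "(\<lambda>n. ln (real (Suc n)) / real n) \<longlonglongrightarrow> 0"
proof -
  have "filterlim (\<lambda>n. real (Suc n)) at_top sequentially"
    by (rule filterlim_compose[OF filterlim_real_sequentially filterlim_Suc])
  from filterlim_compose[OF ln_x_over_x_tendsto_0 this]
  have "(\<lambda>n. ln (real (Suc n)) / real (Suc n)) \<longlonglongrightarrow> 0" .
  from tendsto_mult[OF this LIMSEQ_Suc_n_over_n[where 'a=real]]
  have l: "(\<lambda>n. ln (real (Suc n)) / real (Suc n) * (of_nat (Suc n) / of_nat n)) \<longlonglongrightarrow> 0" by simp
  have "ln (real (Suc n)) / real (Suc n) * (of_nat (Suc n) / of_nat n) = ln (real (Suc n)) / real n" for n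
    by (simp del: of_nat_Suc)
  thus ?thesis using l by (simp del: of_nat_Suc)
qed

lemma div_ratio: "k > 0 \<Longrightarrow> \<bar>real (m div k) - real m / real k\<bar> \<le> 1"
proof -
  assume k: "k > 0"
  have "real m = real (m div k) * real k + real (m mod k)" by (metis div_mult_mod_eq of_nat_add of_nat_mult)
  hence "real m / real k = real (m div k) + real (m mod k) / real k" using k by (simp add: add_divide_distrib)
  moreover have "0 \<le> real (m mod k) / real k" "real (m mod k) / real k \<le> 1" using k by (auto simp: divide_le_eq less_imp_le)
  ultimately show ?thesis by linarith
qed

lemma copies_ratio: "r > 0 \<Longrightarrow> \<bar>real (copies r n) - r * real n\<bar> \<le> 1"
  unfolding copies_def by (simp add: mult.commute) linarith

lemma copies_div_ratio:
  assumes "r > 0" "k > 0" shows "\<bar>real (copies r n div k) - (r / real k) * real n\<bar> \<le> 2"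
proof -
  have "\<bar>real (copies r n) / real k - (r / real k) * real n\<bar> = \<bar>real (copies r n) - r * real n\<bar> / real k"
    using assms by (simp add: abs_divide diff_divide_distrib[symmetric])
  also have "\<dots> \<le> 1 / 1" using copies_ratio[OF assms(1), of n] assms by (intro frac_le) auto
  finally show ?thesis using div_ratio[OF assms(2), of "copies r n"] by linarith
qed

lemma copies_at_top:
  assumes "r > 0" shows "filterlim (copies r) at_top sequentially"
proof -
  have "filterlim (\<lambda>n. real (copies r n)) at_top sequentially"
  proof (rule filterlim_at_top_mono)
    show "filterlim (\<lambda>n. r * real n + (-1)) at_top sequentially"
      by (subst add.commute)
         (intro filterlim_tendsto_add_at_top[OF tendsto_const] filterlim_tendsto_pos_mult_at_top[OF tendsto_const assms] filterlim_real_sequentially)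
    show "\<forall>\<^sub>F n in sequentially. r * real n + (-1) \<le> real (copies r n)"
    proof (rule always_eventually, rule allI)
      fix n show "r * real n + (-1) \<le> real (copies r n)" using copies_ratio[OF assms, of n] by linarith
    qed
  qed
  thus ?thesis by (simp add: filterlim_sequentially_iff_filterlim_real)
qed

text \<open>As a mean under p of a power of the likelihood ratio, the quantity is open to Jensen's
  inequality and to bounds by the largest ratio.\<close>

lemma cQ_as_mean:
  assumes "\<And>x. p x \<ge> 0" "\<And>x. q x \<ge> 0" "\<And>x. x < n \<Longrightarrow> q x = 0 \<Longrightarrow> p x = 0"
  shows "cQ b n p q = (\<Sum>x<n. p x * (p x / q x) powr (b - 1))"
  unfolding cQ_def
proof (rule sum.cong[OF refl])
  fix x assume "x \<in> {..<n}"
  show "p x powr b * q x powr (1 - b) = p x * (p x / q x) powr (b - 1)"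
  proof (cases "p x = 0")
    case False
    hence "p x > 0" "q x > 0" using assms \<open>x \<in> {..<n}\<close> by (auto simp: less_le)
    thus ?thesis by (simp add: powr_divide powr_diff)
  qed simp
qed

lemma sQ_pos_support:
  assumes r: "density d \<rho>" and s: "density d \<sigma>" and sup: "mpow \<sigma> 0 * \<rho> = \<rho>" and b: "b \<ge> 1"
  shows "sQ b \<rho> \<sigma> > 0"
proof -
  have p: "psd d \<rho>" "psd d \<sigma>" using r s by (auto simp: density_def)
  obtain V p q where f: "frame d \<rho> \<sigma> V p q" using frame_exists[OF p] by blast
  have "\<exists>x<d. p x > 0"
  proof (rule ccontr)
    assume "\<not> ?thesis"
    hence "p x = 0" if "x < d" for x using frameD(3)[OF f, of x] that by force
    hence "(\<Sum>x<d. p x) = 0" by simp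
    thus False using frame_sums(1)[OF f r s] by simp
  qed
  then obtain x where x: "x < d" "p x > 0" by auto
  hence "q x > 0" using frame_support[OF f p(1) sup x(1)] frameD(4)[OF f, of x] by (cases "q x = 0") auto
  hence "cQ b d p q > 0" using cQ_pos[of x d p q] x by simp
  thus ?thesis using frame_sandwich_bounds(3)[OF f p b] by linarith
qed

text \<open>For the second pair the classical quantity dominates the sandwiched one at orders up to
  1, so pinching is free there. For the first pair it costs \<open>ln (Suc k ^ d1)\<close>, once at
  finite orders and twice at s = 1. In c, the term k \<epsilon> pays for replacing L by a finite
  order and the last \<epsilon> for the strict inequalities.\<close>

lemma block_tilts:
  fixes k :: nat
  assumes r1: "density d1 \<rho>1" and s1: "density d1 \<sigma>1" and r2: "density d2 \<rho>2" and s2: "density d2 \<sigma>2"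
    and sup: "mpow \<sigma>1 0 * \<rho>1 = \<rho>1" and np: "\<not> supp_perp \<rho>2 \<sigma>2" and r: "r > 0"
    and inner: "\<And>s. 0 < s \<Longrightarrow> s < 1 \<Longrightarrow> - r * ((1 + s) * ln (sQ (1 / (1 + s)) \<rho>2 \<sigma>2)) - (1 - s) * ln (sQ (1 / (1 - s)) \<rho>1 \<sigma>1) \<le> S"
    and edge: "- r * (2 * ln (sQ (1/2) \<rho>2 \<sigma>2)) - L \<le> S"
    and Lsup: "\<And>e. e > 0 \<Longrightarrow> \<exists>b\<ge>2. (b - 1) * (L - e) \<le> ln (sQ b \<rho>1 \<sigma>1)" and e: "\<epsilon> > 0"
  defines "c \<equiv> real k * S + 2 * ln (real (Suc k ^ d1)) + real k * \<epsilon> + \<epsilon>"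
  shows "\<exists>V1 p1 q1 V2 p2 q2 t1 t2. frame (d1^k) (tpow \<rho>1 k) (tpow \<sigma>1 k) V1 p1 q1 \<and> frame (d2^k) (tpow \<rho>2 k) (tpow \<sigma>2 k) V2 p2 q2
    \<and> pd (d1^k) t1 \<and> abscont (d1^k) t1 p1 \<and> abscont (d1^k) t1 q1 \<and> pd (d2^k) t2 \<and> abscont (d2^k) t2 p2 \<and> abscont (d2^k) t2 q2
    \<and> r * kl (d2^k) t2 p2 + kl (d1^k) t1 p1 < c
    \<and> r * kl (d2^k) t2 p2 + kl (d1^k) t1 p1 + (r * kl (d2^k) t2 q2 - kl (d1^k) t1 q1) < c"
proof -
  have ps: "psd d1 \<rho>1" "psd d1 \<sigma>1" "psd d2 \<rho>2" "psd d2 \<sigma>2" using r1 s1 r2 s2 by (auto simp: density_def)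
  note p = psd_tpow[OF ps(1), of k] psd_tpow[OF ps(2), of k] psd_tpow[OF ps(3), of k] psd_tpow[OF ps(4), of k]
  note d = density_tpow[OF r1, of k] density_tpow[OF s1, of k] density_tpow[OF r2, of k] density_tpow[OF s2, of k]
  obtain V1 p1 q1 where f1: "frame (d1^k) (tpow \<rho>1 k) (tpow \<sigma>1 k) V1 p1 q1" using frame_exists[OF p(1,2)] by blast
  obtain V2 p2 q2 where f2: "frame (d2^k) (tpow \<rho>2 k) (tpow \<sigma>2 k) V2 p2 q2" using frame_exists[OF p(3,4)] by blast
  define v where "v = real (Suc k ^ d1)"
  have v1: "v \<ge> 1" unfolding v_def by (simp del: of_nat_Suc of_nat_power)
  have card: "real (card (q1 ` {..<d1^k})) \<le> v" using frame_card[OF ps(2) f1] unfolding v_def by (simp only: of_nat_le_iff)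
  have ac: "\<And>x. x < d1^k \<Longrightarrow> q1 x = 0 \<Longrightarrow> p1 x = 0" by (rule frame_support[OF f1 p(1) supp_tpow[OF ps(1,2) sup]])
  have pos2: "sQ a \<rho>2 \<sigma>2 > 0" if "a > 0" for a
    using np supp_perp_iff[OF ps(3,4) that] sQ_nonneg[OF ps(3,4), of a] by (auto simp: less_le)
  have Q2: "sQ a \<rho>2 \<sigma>2 ^ k \<le> cQ a (d2^k) p2 q2" if "0 < a" "a \<le> 1" for a
    using frame_sandwich_bounds(1)[OF f2 p(3,4) that] unfolding sQ_tpow[OF ps(3,4)] .
  have lnQ2: "real k * ln (sQ a \<rho>2 \<sigma>2) \<le> ln (cQ a (d2^k) p2 q2)" if "0 < a" "a \<le> 1" for a
  proof -
    have "ln (sQ a \<rho>2 \<sigma>2 ^ k) \<le> ln (cQ a (d2^k) p2 q2)" using Q2[OF that] pos2[OF that(1)] by (simp add: ln_mono)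
    thus ?thesis using pos2[OF that(1)] by (simp add: ln_realpow)
  qed
  have "\<exists>y<d2^k. p2 y > 0 \<and> q2 y > 0"
  proof (rule ccontr)
    assume "\<not> ?thesis"
    hence "p2 y = 0 \<or> q2 y = 0" if "y < d2^k" for y using that frameD(3,4)[OF f2, of y] by (auto simp: less_le)
    hence "cQ (1/2) (d2^k) p2 q2 = 0" unfolding cQ_def by (intro sum.neutral) auto
    moreover have "0 < sQ (1/2) \<rho>2 \<sigma>2 ^ k" using pos2[of "1/2"] by simp
    ultimately show False using Q2[of "1/2"] by simp
  qed
  then obtain y0 where y0: "y0 < d2^k" "p2 y0 > 0" "q2 y0 > 0" by auto
  have pos1: "sQ b \<rho>1 \<sigma>1 > 0" if "b \<ge> 1" for b by (rule sQ_pos_support[OF r1 s1 sup that])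
  have Q1: "sQ b \<rho>1 \<sigma>1 ^ k \<le> v powr b * cQ b (d1^k) p1 q1" if "b \<ge> 1" for b
  proof -
    have "sQ b \<rho>1 \<sigma>1 ^ k \<le> real (card (q1 ` {..<d1^k})) powr b * cQ b (d1^k) p1 q1"
      using frame_sandwich_bounds(4)[OF f1 p(1,2) that] unfolding sQ_tpow[OF ps(1,2)] .
    also have "\<dots> \<le> v powr b * cQ b (d1^k) p1 q1" using card that cQ_nonneg by (intro mult_right_mono powr_mono2) auto
    finally show ?thesis .
  qed
  have lnQ1: "real k * ln (sQ b \<rho>1 \<sigma>1) \<le> b * ln v + ln (cQ b (d1^k) p1 q1)" if "b \<ge> 1" for b
  proof -
    have l: "0 < sQ b \<rho>1 \<sigma>1 ^ k" using pos1[OF that] by simp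
    have "v powr b * cQ b (d1^k) p1 q1 > 0" using l Q1[OF that] by linarith
    hence c0: "cQ b (d1^k) p1 q1 > 0" using v1 by (simp add: zero_less_mult_iff)
    have "ln (sQ b \<rho>1 \<sigma>1 ^ k) \<le> ln (v powr b * cQ b (d1^k) p1 q1)" using Q1[OF that] l by (intro ln_mono) auto
    thus ?thesis using pos1[OF that] v1 c0 by (simp add: ln_realpow ln_mult ln_powr)
  qed
  define S' where "S' = real k * S + 2 * ln v + real k * \<epsilon>"
  have lnv: "ln v \<ge> 0" using v1 by simp
  have inner': "- r * ((1 + s) * ln (cQ (1 / (1 + s)) (d2^k) p2 q2)) - (1 - s) * ln (cQ (1 / (1 - s)) (d1^k) p1 q1) \<le> S'"
    if s: "0 < s" "s < 1" for s
  proof -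
    have "(r * (1 + s)) * (real k * ln (sQ (1 / (1 + s)) \<rho>2 \<sigma>2)) \<le> (r * (1 + s)) * ln (cQ (1 / (1 + s)) (d2^k) p2 q2)"
      using lnQ2[of "1 / (1 + s)"] s r by (intro mult_left_mono) auto
    moreover have "(1 - s) * (real k * ln (sQ (1 / (1 - s)) \<rho>1 \<sigma>1)) \<le> (1 - s) * (1 / (1 - s) * ln v + ln (cQ (1 / (1 - s)) (d1^k) p1 q1))"
      using lnQ1[of "1 / (1 - s)"] s by (intro mult_left_mono) auto
    moreover have "(1 - s) * (1 / (1 - s) * ln v + ln (cQ (1 / (1 - s)) (d1^k) p1 q1)) = ln v + (1 - s) * ln (cQ (1 / (1 - s)) (d1^k) p1 q1)"
      using s by (simp add: distrib_left)
    moreover have "real k * (- r * ((1 + s) * ln (sQ (1 / (1 + s)) \<rho>2 \<sigma>2)) - (1 - s) * ln (sQ (1 / (1 - s)) \<rho>1 \<sigma>1)) \<le> real k * S"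
      using inner[OF s] by (intro mult_left_mono) auto
    moreover have "real k * \<epsilon> \<ge> 0" using e by simp
    moreover have "real k * (- r * ((1 + s) * ln (sQ (1 / (1 + s)) \<rho>2 \<sigma>2)) - (1 - s) * ln (sQ (1 / (1 - s)) \<rho>1 \<sigma>1))
        = - ((r * (1 + s)) * (real k * ln (sQ (1 / (1 + s)) \<rho>2 \<sigma>2))) - (1 - s) * (real k * ln (sQ (1 / (1 - s)) \<rho>1 \<sigma>1))"
      by (simp add: algebra_simps)
    moreover have "- r * ((1 + s) * ln (cQ (1 / (1 + s)) (d2^k) p2 q2)) = - ((r * (1 + s)) * ln (cQ (1 / (1 + s)) (d2^k) p2 q2))" by simp
    ultimately show ?thesis using lnv unfolding S'_def by linarith
  qed
  have p1pd: "pd (d1^k) p1" using frame_sums(1)[OF f1 d(1,2)] frameD(3)[OF f1] by (simp add: pd_def)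
  let ?P = "{x\<in>{..<d1^k}. p1 x > 0}"
  have "?P \<noteq> {}"
  proof
    assume "?P = {}"
    hence "p1 x = 0" if "x < d1^k" for x using frameD(3)[OF f1, of x] that by force
    hence "(\<Sum>x<d1^k. p1 x) = 0" by simp
    thus False using p1pd by (simp add: pd_def)
  qed
  \<comment> \<open>The letter of largest likelihood ratio; the point mass there represents infinite
    order.\<close>
  then obtain x0 where x0: "x0 \<in> ?P" "\<And>x. x \<in> ?P \<Longrightarrow> p1 x / q1 x \<le> p1 x0 / q1 x0"
  proof -
    let ?I = "(\<lambda>x. p1 x / q1 x) ` ?P"
    have "finite ?I" by simp
    moreover from \<open>?P \<noteq> {}\<close> have "?I \<noteq> {}" by blast
    ultimately have "Max ?I \<in> ?I" "\<And>y. y \<in> ?I \<Longrightarrow> y \<le> Max ?I" by (rule Max_in, auto)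
    then obtain x0 where "x0 \<in> ?P" "Max ?I = p1 x0 / q1 x0" by auto
    thus ?thesis using \<open>\<And>y. y \<in> ?I \<Longrightarrow> y \<le> Max ?I\<close> that[of x0] by force
  qed
  define \<Lambda> where "\<Lambda> = p1 x0 / q1 x0"
  have q1x: "q1 x0 > 0" using ac[of x0] x0(1) frameD(4)[OF f1, of x0] by (cases "q1 x0 = 0") auto
  have Lpos: "\<Lambda> > 0" using x0(1) q1x by (simp add: \<Lambda>_def)
  have edge': "- r * (2 * ln (cQ (1/2) (d2^k) p2 q2)) - ln (p1 x0 / q1 x0) \<le> S'"
  proof -
    from Lsup[OF e] obtain b where b: "b \<ge> 2" "(b - 1) * (L - \<epsilon>) \<le> ln (sQ b \<rho>1 \<sigma>1)" by auto
    have "cQ b (d1^k) p1 q1 = (\<Sum>x<d1^k. p1 x * (p1 x / q1 x) powr (b - 1))"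
      using frameD(3,4)[OF f1] ac by (intro cQ_as_mean) auto
    also have "\<dots> \<le> (\<Sum>x<d1^k. p1 x * \<Lambda> powr (b - 1))"
    proof (rule sum_mono)
      fix x assume "x \<in> {..<d1^k}"
      show "p1 x * (p1 x / q1 x) powr (b - 1) \<le> p1 x * \<Lambda> powr (b - 1)"
      proof (cases "p1 x = 0")
        case False
        hence "x \<in> ?P" using \<open>x \<in> {..<d1^k}\<close> frameD(3)[OF f1, of x] by auto
        thus ?thesis using x0(2)[of x] frameD(3,4)[OF f1, of x] b unfolding \<Lambda>_def by (intro mult_left_mono powr_mono2) auto
      qed simp
    qed
    also have "\<dots> = \<Lambda> powr (b - 1)" using p1pd by (simp add: pd_def sum_distrib_right[symmetric])
    finally have cb: "cQ b (d1^k) p1 q1 \<le> \<Lambda> powr (b - 1)" .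
    have "cQ b (d1^k) p1 q1 > 0" using cQ_pos[of x0 "d1^k" p1 q1] x0(1) q1x by simp
    hence "ln (cQ b (d1^k) p1 q1) \<le> ln (\<Lambda> powr (b - 1))" using cb by (intro ln_mono) auto
    hence "real k * ln (sQ b \<rho>1 \<sigma>1) \<le> b * ln v + (b - 1) * ln \<Lambda>" using lnQ1[of b] b Lpos by (simp add: ln_powr)
    moreover have "real k * ((b - 1) * (L - \<epsilon>)) \<le> real k * ln (sQ b \<rho>1 \<sigma>1)" using b by (intro mult_left_mono) auto
    \<comment> \<open>From b \<ge> 2 comes b \<le> 2 (b - 1), the origin of the factor 2 before ln
      v.\<close>
    moreover have "b * ln v \<le> (2 * (b - 1)) * ln v" using b lnv by (intro mult_right_mono) auto
    ultimately have "(b - 1) * (real k * (L - \<epsilon>)) \<le> (b - 1) * (2 * ln v + ln \<Lambda>)" by (simp add: algebra_simps)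
    hence "real k * (L - \<epsilon>) \<le> 2 * ln v + ln \<Lambda>" using b by simp
    moreover have "(r * 2) * (real k * ln (sQ (1/2) \<rho>2 \<sigma>2)) \<le> (r * 2) * ln (cQ (1/2) (d2^k) p2 q2)"
      using lnQ2[of "1/2"] r by (intro mult_left_mono) auto
    moreover have "real k * (- r * (2 * ln (sQ (1/2) \<rho>2 \<sigma>2)) - L) \<le> real k * S" using edge by (intro mult_left_mono) auto
    ultimately show ?thesis unfolding S'_def \<Lambda>_def by (simp add: algebra_simps)
  qed
  have "\<exists>t1 t2. pd (d1^k) t1 \<and> abscont (d1^k) t1 p1 \<and> abscont (d1^k) t1 q1 \<and> pd (d2^k) t2 \<and> abscont (d2^k) t2 p2 \<and> abscont (d2^k) t2 q2
    \<and> r * kl (d2^k) t2 p2 + kl (d1^k) t1 p1 < S' + \<epsilon> \<and> r * kl (d2^k) t2 p2 + kl (d1^k) t1 p1 + (r * kl (d2^k) t2 q2 - kl (d1^k) t1 q1) < S' + \<epsilon>"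
    using x0(1) ac by (intro optimal_tilts[where ?y0.0=y0 and ?x0.0=x0, OF p1pd frameD(4)[OF f1] _ frameD(3)[OF f2] frameD(4)[OF f2] y0 r inner' _ _ edge' e])
      (auto simp: abscont_def)
  moreover have "S' + \<epsilon> = c" by (simp add: S'_def c_def v_def)
  ultimately show ?thesis using f1 f2 by metis
qed

text \<open>A1 and B1 are the exponents of the test under the two input states, A2 and B2 those of
  the overlap and of the pointwise bound of the prepared state. Damping by X = max 0 (ln 2 + B2 -
  B1) is just enough to keep b \<omega> below the target. The 16 collects four factors 1/2: one in
  w, one in the bound for T, and two from the squared overlap.\<close>

lemma block_achievability:
  assumes r1: "density d1 \<rho>1" and s1: "density d1 \<sigma>1" and r2: "density d2 \<rho>2" and s2: "density d2 \<sigma>2"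
    and f1: "frame (d1^k) (tpow \<rho>1 k) (tpow \<sigma>1 k) V1 p1 q1" and f2: "frame (d2^k) (tpow \<rho>2 k) (tpow \<sigma>2 k) V2 p2 q2"
    and n: "n = k * N + l" and m: "m = k * N' + l'" and l': "l' \<le> k" and f0: "fidelity \<sigma>2 \<rho>2 > 0"
    and T: "T \<subseteq> {..<(d1^k)^N}" "(\<Sum>x\<in>T. pweight (d1^k) p1 N x) \<ge> 1/2 * exp (- A1)" "(\<Sum>x\<in>T. pweight (d1^k) q1 N x) \<le> exp (- B1)"
    and t: "\<And>y. 0 \<le> t y" "(\<Sum>y<(d2^k)^N'. t y) = 1" "\<And>y. y < (d2^k)^N' \<Longrightarrow> t y \<le> 2 * exp B2 * pweight (d2^k) q2 N' y"
      "(\<Sum>y<(d2^k)^N'. sqrt (t y * pweight (d2^k) p2 N' y)) \<ge> 1/2 * exp (- A2 / 2)"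
  shows "\<exists>E. channel (d1^n) (d2^m) E \<and> E (tpow \<sigma>1 n) = tpow \<sigma>2 m
    \<and> exp (- (ln 16 + max 0 (ln 2 + B2 - B1) + A1 + A2 + 2 * real N' * ln (real (Suc k ^ d2)) - 2 * real k * ln (fidelity \<sigma>2 \<rho>2)))
      \<le> (fidelity (E (tpow \<rho>1 n)) (tpow \<rho>2 m))\<^sup>2"
proof -
  have ps: "psd d1 \<rho>1" "psd d1 \<sigma>1" "psd d2 \<rho>2" "psd d2 \<sigma>2" using r1 s1 r2 s2 by (auto simp: density_def)
  define X where "X = max 0 (ln 2 + B2 - B1)"
  \<comment> \<open>The factor 1/2 keeps b at most 1/2, so that the failure state can be
    normalised.\<close>
  define w where "w = 1/2 * exp (- X)"
  have X0: "X \<ge> 0" by (simp add: X_def)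
  have w: "0 < w" "w \<le> 1/2" using X0 by (auto simp: w_def)
  define P where "P = (\<Sum>x\<in>T. pweight (d1^k) p1 N x)"
  have P0: "P \<ge> 0" unfolding P_def by (intro sum_nonneg pweight_nonneg[OF frameD(3)[OF f1]])
  define Q where "Q = (\<Sum>x\<in>T. pweight (d1^k) q1 N x)"
  have q0: "pweight (d1^k) q1 N x \<ge> 0" for x by (rule pweight_nonneg[OF frameD(4)[OF f1]])
  have Q0: "Q \<ge> 0" unfolding Q_def by (intro sum_nonneg q0)
  have "Q \<le> (\<Sum>x<(d1^k)^N. pweight (d1^k) q1 N x)" unfolding Q_def using T(1) q0 by (intro sum_mono2) auto
  hence Q1: "Q \<le> 1" unfolding sum_pweight frame_sums(2)[OF f1 density_tpow[OF r1] density_tpow[OF s1]] by simp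
  define b where "b = w * Q"
  have b1: "b < 1" using w Q0 Q1 mult_mono[OF w(2) Q1] by (simp add: b_def)
  have b0: "b \<ge> 0" using w Q0 by (simp add: b_def)
  have bl: "b * (2 * exp B2) \<le> 1"
  proof -
    have "b * (2 * exp B2) \<le> (1/2 * exp (- X)) * exp (- B1) * (2 * exp B2)"
      unfolding b_def w_def using T(3) by (intro mult_right_mono mult_left_mono) (auto simp: Q_def)
    also have "\<dots> = exp (B2 - B1 - X)" by (simp add: exp_diff exp_minus exp_add field_simps)
    also have "\<dots> \<le> exp 0"
    proof -
      have "ln 2 + B2 - B1 \<le> X" by (simp add: X_def)
      moreover have "ln (2::real) \<ge> 0" by simp
      ultimately have "B2 - B1 - X \<le> 0" by linarith
      thus ?thesis by simp
    qed
    finally show ?thesis by simp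
  qed
  have bt: "b * t y \<le> pweight (d2^k) q2 N' y" if "y < (d2^k)^N'" for y
  proof -
    have "b * t y \<le> b * (2 * exp B2 * pweight (d2^k) q2 N' y)" using t(3)[OF that] b0 by (intro mult_left_mono)
    also have "\<dots> = (b * (2 * exp B2)) * pweight (d2^k) q2 N' y" by simp
    also have "\<dots> \<le> 1 * pweight (d2^k) q2 N' y" using bl pweight_nonneg[OF frameD(4)[OF f2]] by (intro mult_right_mono) auto
    finally show ?thesis by simp
  qed
  obtain M where M: "psd (d1^n) M" "psd (d1^n) (1\<^sub>m (d1^n) - M)" "mtrace (M * tpow \<rho>1 n) = complex_of_real (w * P)"
    "mtrace (M * tpow \<sigma>1 n) = complex_of_real b"
    using block_test[OF r1 s1 f1 n T(1), of w] w unfolding P_def Q_def b_def by auto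
  obtain \<omega> where om: "density (d2^m) \<omega>" "psd (d2^m) (tpow \<sigma>2 m - complex_of_real b \<cdot>\<^sub>m \<omega>)"
    "(\<Sum>y<(d2^k)^N'. sqrt (t y * pweight (d2^k) p2 N' y)) * fidelity \<sigma>2 \<rho>2 ^ l'
      \<le> real (card (q2 ` {..<d2^k}) ^ N') * fidelity \<omega> (tpow \<rho>2 m)"
    using block_state[OF r2 s2 f2 m t(1,2) bt] by auto
  obtain E where E: "channel (d1^n) (d2^m) E" "E (tpow \<sigma>1 n) = tpow \<sigma>2 m"
    "(w * P) * (fidelity \<omega> (tpow \<rho>2 m))\<^sup>2 \<le> (fidelity (E (tpow \<rho>1 n)) (tpow \<rho>2 m))\<^sup>2"
    using oneshot_achievability[OF density_tpow[OF r1] density_tpow[OF s1] density_tpow[OF r2] density_tpow[OF s2] om(1) M(1,2,3,4) b1 om(2)] by auto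
  define v where "v = real (Suc k ^ d2)"
  have v0: "v > 0" unfolding v_def by (simp del: of_nat_Suc of_nat_power)
  let ?f = "fidelity \<sigma>2 \<rho>2" and ?F = "fidelity \<omega> (tpow \<rho>2 m)"
  have F0: "?F \<ge> 0" using fidelity_nonneg[OF _ psd_tpow[OF ps(3)]] om(1) by (simp add: density_def)
  have f1': "?f \<le> 1" by (rule fidelity_le_1[OF s2 r2])
  have "1/2 * exp (- A2 / 2) * ?f ^ k \<le> (\<Sum>y<(d2^k)^N'. sqrt (t y * pweight (d2^k) p2 N' y)) * ?f ^ l'"
    using t(4) power_decreasing[OF l', of ?f] f0 f1'
    by (intro mult_mono) (auto intro: order.trans[of 0 "1/2 * exp (- A2 / 2)"])
  also have "\<dots> \<le> real (card (q2 ` {..<d2^k}) ^ N') * ?F" by (rule om(3))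
  also have "\<dots> \<le> v ^ N' * ?F"
  proof (rule mult_right_mono[OF _ F0])
    have "real (card (q2 ` {..<d2^k})) \<le> v" unfolding v_def using frame_card[OF ps(4) f2] by (simp only: of_nat_le_iff)
    thus "real (card (q2 ` {..<d2^k}) ^ N') \<le> v ^ N'" unfolding of_nat_power by (intro power_mono) auto
  qed
  finally have F: "1/2 * exp (- A2 / 2) * ?f ^ k / v ^ N' \<le> ?F" using v0 by (simp add: pos_divide_le_eq mult_ac)
  have "exp (- (ln 16 + X + A1 + A2 + 2 * real N' * ln v - 2 * real k * ln ?f))
      = (1/2 * exp (- X)) * (1/2 * exp (- A1)) * (1/2 * exp (- A2 / 2) * ?f ^ k / v ^ N')\<^sup>2"
  proof -
    have e1: "?f ^ k = exp (real k * ln ?f)" using f0 by (simp add: exp_of_nat_mult)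
    have e2: "v ^ N' = exp (real N' * ln v)" using v0 by (simp add: exp_of_nat_mult)
    have "(1/2 * exp (- A2 / 2) * ?f ^ k / v ^ N')\<^sup>2 = 1/4 * exp (- A2 + 2 * real k * ln ?f - 2 * real N' * ln v)"
      unfolding e1 e2 by (simp add: power2_eq_square exp_add[symmetric] exp_diff[symmetric] mult_exp_exp)
    hence "(1/2 * exp (- X)) * (1/2 * exp (- A1)) * (1/2 * exp (- A2 / 2) * ?f ^ k / v ^ N')\<^sup>2
        = 1/16 * (exp (- X) * (exp (- A1) * exp (- A2 + 2 * real k * ln ?f - 2 * real N' * ln v)))" by simp
    also have "(1/16 :: real) = exp (- ln 16)" by (simp add: exp_minus)
    finally show ?thesis unfolding mult_exp_exp by (simp add: algebra_simps)
  qed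
  also have "\<dots> \<le> w * P * ?F\<^sup>2"
    using T(2) F v0 f0 w P0 unfolding w_def[symmetric] P_def[symmetric]
    by (intro mult_mono power_mono) (auto intro!: mult_nonneg_nonneg simp: w_def)
  also have "\<dots> \<le> (fidelity (E (tpow \<rho>1 n)) (tpow \<rho>2 m))\<^sup>2" by (rule E(3))
  finally show ?thesis using E(1,2) unfolding X_def v_def by blast
qed

section \<open>Positivity of the fidelity for non-orthogonal supports\<close>

lemma cinner_swap: "dim_vec x = dim_vec y \<Longrightarrow> cinner x y = cnj (cinner y x)"
  by (simp add: cinner_def mult.commute)

lemma supp_perp_sym:
  assumes "A \<in> carrier_mat n n" "B \<in> carrier_mat n n" "supp_perp A B" shows "supp_perp B A"
  unfolding supp_perp_def
proof (intro ballI)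
  fix x y assume xy: "x \<in> supp B" "y \<in> supp A"
  hence "dim_vec x = dim_vec y" using assms by (auto simp: supp_def)
  moreover have "cinner y x = 0" using xy assms(3) by (auto simp: supp_perp_def)
  ultimately show "cinner x y = 0" by (simp add: cinner_swap[of x y])
qed

lemma fidelity_eq_sQ:
  assumes "psd n \<rho>" "psd n \<sigma>" shows "fidelity \<rho> \<sigma> = sQ (1/2) \<rho> \<sigma>"
  unfolding fidelity_eq_trp(1)[OF assms] sQ_def msqrt_eq_mpow[OF assms(2)] by simp

lemma fidelity_pos:
  assumes "psd n \<rho>" "psd n \<sigma>" "\<not> supp_perp \<rho> \<sigma>" shows "fidelity \<sigma> \<rho> > 0"
proof -
  have "\<not> supp_perp \<sigma> \<rho>" using assms supp_perp_sym[OF psdD(1)[OF assms(2)] psdD(1)[OF assms(1)]] by blast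
  hence "sQ (1/2) \<sigma> \<rho> \<noteq> 0" using supp_perp_iff[OF assms(2,1), of "1/2"] by simp
  thus ?thesis using sQ_nonneg[OF assms(2,1), of "1/2"] fidelity_eq_sQ[OF assms(2,1)] by simp
qed

text \<open>The tolerance \<eta> is spent in eighths: three on the tilts of one block, one on the
  slack \<delta> of typicality, and one on the classes of the second pair. Incomplete blocks
  contribute a constant that disappears after division by n.\<close>

lemma achievability_eventually:
  assumes r1: "density d1 \<rho>1" and s1: "density d1 \<sigma>1" and r2: "density d2 \<rho>2" and s2: "density d2 \<sigma>2"
    and sup: "mpow \<sigma>1 0 * \<rho>1 = \<rho>1" and np: "\<not> supp_perp \<rho>2 \<sigma>2" and r: "r > 0"
    and inner: "\<And>s. 0 < s \<Longrightarrow> s < 1 \<Longrightarrow> - r * ((1 + s) * ln (sQ (1 / (1 + s)) \<rho>2 \<sigma>2)) - (1 - s) * ln (sQ (1 / (1 - s)) \<rho>1 \<sigma>1) \<le> S"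
    and edge: "- r * (2 * ln (sQ (1/2) \<rho>2 \<sigma>2)) - L \<le> S"
    and Lsup: "\<And>e. e > 0 \<Longrightarrow> \<exists>b\<ge>2. (b - 1) * (L - e) \<le> ln (sQ b \<rho>1 \<sigma>1)" and h: "\<eta> > 0"
  shows "\<forall>\<^sub>F n in sequentially. \<exists>E. channel (d1^n) (d2^copies r n) E \<and> E (tpow \<sigma>1 n) = tpow \<sigma>2 (copies r n)
    \<and> exp (- (real n * (S + \<eta>))) \<le> (fidelity (E (tpow \<rho>1 n)) (tpow \<rho>2 (copies r n)))\<^sup>2"
proof -
  have ps: "psd d1 \<rho>1" "psd d1 \<sigma>1" "psd d2 \<rho>2" "psd d2 \<sigma>2" using r1 s1 r2 s2 by (auto simp: density_def)
  have "\<forall>\<^sub>F k in sequentially. 2 * (real d1 * (ln (real (Suc k)) / real k)) < \<eta> / 8 \<and> 2 * r * (real d2 * (ln (real (Suc k)) / real k)) < \<eta> / 8 \<and> k > 0"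
  proof (intro eventually_conj)
    have "(\<lambda>k. 2 * (real d1 * (ln (real (Suc k)) / real k))) \<longlonglongrightarrow> 2 * (real d1 * 0)"
      by (intro tendsto_intros ln_Suc_over_n)
    thus "\<forall>\<^sub>F k in sequentially. 2 * (real d1 * (ln (real (Suc k)) / real k)) < \<eta> / 8"
      using h by (intro order_tendstoD(2)) auto
    have "(\<lambda>k. 2 * r * (real d2 * (ln (real (Suc k)) / real k))) \<longlonglongrightarrow> 2 * r * (real d2 * 0)"
      by (intro tendsto_intros ln_Suc_over_n)
    thus "\<forall>\<^sub>F k in sequentially. 2 * r * (real d2 * (ln (real (Suc k)) / real k)) < \<eta> / 8"
      using h by (intro order_tendstoD(2)) auto
  qed (rule eventually_gt_at_top)
  then obtain k where k0: "2 * (real d1 * (ln (real (Suc k)) / real k)) < \<eta> / 8"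
    "2 * r * (real d2 * (ln (real (Suc k)) / real k)) < \<eta> / 8" "k > 0"
    by (auto simp: eventually_sequentially)
  define v1 where "v1 = ln (real (Suc k ^ d1))"
  define v2 where "v2 = ln (real (Suc k ^ d2))"
  have v: "v1 = real d1 * ln (real (Suc k))" "v2 = real d2 * ln (real (Suc k))"
    unfolding v1_def v2_def by (simp_all only: of_nat_power) (simp_all add: ln_realpow del: of_nat_Suc)
  have vk: "2 * v1 \<le> real k * (\<eta> / 8)" "2 * r * v2 \<le> real k * (\<eta> / 8)"
  proof -
    have "2 * (real d1 * (ln (real (Suc k)) / real k)) = 2 * v1 / real k" "2 * r * (real d2 * (ln (real (Suc k)) / real k)) = 2 * r * v2 / real k"
      by (simp_all add: v)
    thus "2 * v1 \<le> real k * (\<eta> / 8)" "2 * r * v2 \<le> real k * (\<eta> / 8)" using k0 by (auto simp: divide_less_eq mult.commute)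
  qed
  from block_tilts[OF r1 s1 r2 s2 sup np r inner edge Lsup, of "\<eta>/8" k] h
  obtain V1 p1 q1 V2 p2 q2 t1 t2 where
    f1: "frame (d1^k) (tpow \<rho>1 k) (tpow \<sigma>1 k) V1 p1 q1" and f2: "frame (d2^k) (tpow \<rho>2 k) (tpow \<sigma>2 k) V2 p2 q2"
    and t1: "pd (d1^k) t1" "abscont (d1^k) t1 p1" "abscont (d1^k) t1 q1"
    and t2: "pd (d2^k) t2" "abscont (d2^k) t2 p2" "abscont (d2^k) t2 q2"
    and AB0: "r * kl (d2^k) t2 p2 + kl (d1^k) t1 p1 < real k * S + 2 * v1 + real k * (\<eta>/8) + \<eta>/8"
      "r * kl (d2^k) t2 p2 + kl (d1^k) t1 p1 + (r * kl (d2^k) t2 q2 - kl (d1^k) t1 q1) < real k * S + 2 * v1 + real k * (\<eta>/8) + \<eta>/8"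
    unfolding v1_def by auto
  define K1p where "K1p = kl (d1^k) t1 p1"
  define K1q where "K1q = kl (d1^k) t1 q1"
  define K2p where "K2p = kl (d2^k) t2 p2"
  define K2q where "K2q = kl (d2^k) t2 q2"
  have kge: "real k \<ge> 1" using k0(3) by linarith
  have "\<eta>/8 \<le> real k * (\<eta>/8)" using kge h by (simp add: mult_le_cancel_right1)
  hence AB: "r * K2p + K1p < real k * (S + 3 * \<eta> / 8)" "r * K2p + K1p + (r * K2q - K1q) < real k * (S + 3 * \<eta> / 8)"
    using AB0 vk(1) unfolding K1p_def K1q_def K2p_def K2q_def by (simp_all add: algebra_simps)
  \<comment> \<open>Proportional to k since the entropies belong to blocks; the slack terms add up
    to 2 (1 + r) \<delta>, which is made equal to k \<eta> / 8.\<close>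
  define \<delta> where "\<delta> = real k * \<eta> / (16 * (1 + r))"
  have d0: "\<delta> > 0" using k0 h r by (simp add: \<delta>_def)
  have d2: "2 * (1 + r) * \<delta> = real k * (\<eta> / 8)" using r by (simp add: \<delta>_def field_simps)
  obtain N1 where N1: "\<And>n. n \<ge> N1 \<Longrightarrow> \<exists>T\<subseteq>{..<(d1^k)^n}. (\<Sum>x\<in>T. pweight (d1^k) p1 n x) \<ge> 1/2 * exp (- real n * (K1p + \<delta>))
    \<and> (\<Sum>x\<in>T. pweight (d1^k) q1 n x) \<le> exp (- real n * (K1q - \<delta>))"
    using typical_test[OF t1(1) frameD(3)[OF f1] frameD(4)[OF f1] t1(2,3) d0] unfolding K1p_def K1q_def by auto
  obtain N2 where N2: "\<And>n. n \<ge> N2 \<Longrightarrow> \<exists>w. (\<forall>y. 0 \<le> w y) \<and> (\<Sum>y<(d2^k)^n. w y) = 1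
    \<and> (\<forall>y<(d2^k)^n. w y \<le> 2 * exp (real n * (K2q + \<delta>)) * pweight (d2^k) q2 n y)
    \<and> (\<Sum>y<(d2^k)^n. sqrt (w y * pweight (d2^k) p2 n y)) \<ge> 1/2 * exp (- real n * (K2p + \<delta>) / 2)"
    using typical_state[OF t2(1) frameD(3)[OF f2] frameD(4)[OF f2] t2(2,3) d0] unfolding K2p_def K2q_def by auto
  define N where "N n = n div k" for n
  define M where "M n = copies r n div k" for n
  define c0 where "c0 = ln 16 - 2 * real k * ln (fidelity \<sigma>2 \<rho>2)"
  define R where "R n = ln 16 + max 0 (ln 2 + real (M n) * (K2q + \<delta>) - real (N n) * (K1q - \<delta>))
     + real (N n) * (K1p + \<delta>) + real (M n) * (K2p + \<delta>) + 2 * real (M n) * v2 - 2 * real k * ln (fidelity \<sigma>2 \<rho>2)" for n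
  \<comment> \<open>R n / n as a continuous expression in the block ratios, so that its limit can be
    read off term by term.\<close>
  define g where "g n = c0 * (1 / real n) + max 0 (ln 2 * (1 / real n) + real (M n) / real n * (K2q + \<delta>) - real (N n) / real n * (K1q - \<delta>))
     + real (N n) / real n * (K1p + \<delta>) + real (M n) / real n * (K2p + \<delta>) + 2 * (real (M n) / real n) * v2" for n
  have Rg: "R n = real n * g n" if "n > 0" for n
  proof -
    have x: "real n * (a * (1 / real n)) = a" "real n * (a / real n * b) = a * b" for a b using that by auto
    have "real n * max 0 (ln 2 * (1 / real n) + real (M n) / real n * (K2q + \<delta>) - real (N n) / real n * (K1q - \<delta>))
      = max (real n * 0) (real n * (ln 2 * (1 / real n) + real (M n) / real n * (K2q + \<delta>) - real (N n) / real n * (K1q - \<delta>)))"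
      by (simp add: max_mult_distrib_left)
    also have "\<dots> = max 0 (ln 2 + real (M n) * (K2q + \<delta>) - real (N n) * (K1q - \<delta>))"
      by (simp only: right_diff_distrib distrib_left x mult_zero_right)
    finally have mx: "real n * max 0 (ln 2 * (1 / real n) + real (M n) / real n * (K2q + \<delta>) - real (N n) / real n * (K1q - \<delta>))
      = max 0 (ln 2 + real (M n) * (K2q + \<delta>) - real (N n) * (K1q - \<delta>))" .
    have "real n * (2 * (real (M n) / real n) * v2) = 2 * real (M n) * v2" using that by simp
    moreover have "z * (a1 + a2 + a3 + a4 + a5) = z * a1 + z * a2 + z * a3 + z * a4 + z * a5" for z a1 a2 a3 a4 a5 :: real
      by (simp add: distrib_left)
    ultimately show ?thesis unfolding R_def g_def by (simp only: x mx) (simp add: c0_def)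
  qed
  have tN: "(\<lambda>n. real (N n) / real n) \<longlonglongrightarrow> 1 / real k"
    by (rule ratio_tendsto[of _ _ 1]) (use div_ratio[OF k0(3)] in \<open>simp add: N_def\<close>)
  have tM: "(\<lambda>n. real (M n) / real n) \<longlonglongrightarrow> r / real k"
    unfolding M_def by (rule ratio_tendsto[OF copies_div_ratio[OF r k0(3)]])
  have tg: "g \<longlonglongrightarrow> c0 * 0 + max 0 (ln 2 * 0 + r / real k * (K2q + \<delta>) - 1 / real k * (K1q - \<delta>))
     + 1 / real k * (K1p + \<delta>) + r / real k * (K2p + \<delta>) + 2 * (r / real k) * v2"
    unfolding g_def by (intro tendsto_intros lim_1_over_n tN tM)
  have "c0 * 0 + max 0 (ln 2 * 0 + r / real k * (K2q + \<delta>) - 1 / real k * (K1q - \<delta>))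
     + 1 / real k * (K1p + \<delta>) + r / real k * (K2p + \<delta>) + 2 * (r / real k) * v2 < S + \<eta>"
  proof -
    let ?a = "r * (K2q + \<delta>) - (K1q - \<delta>)"
    have "c0 * 0 + max 0 (ln 2 * 0 + r / real k * (K2q + \<delta>) - 1 / real k * (K1q - \<delta>))
     + 1 / real k * (K1p + \<delta>) + r / real k * (K2p + \<delta>) + 2 * (r / real k) * v2
     = (max 0 ?a + (K1p + \<delta>) + r * (K2p + \<delta>) + 2 * r * v2) / real k"
    proof -
      have "max 0 (r / real k * (K2q + \<delta>) - 1 / real k * (K1q - \<delta>)) = max 0 ?a / real k"
        using k0(3) by (simp add: max_divide_distrib_right diff_divide_distrib)
      thus ?thesis by (simp add: add_divide_distrib)
    qed
    also have "\<dots> < (real k * (S + 3 * \<eta> / 8) + real k * (\<eta> / 8) + real k * (\<eta> / 8)) / real k"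
    proof (rule divide_strict_right_mono)
      have "max 0 ?a + (K1p + \<delta>) + r * (K2p + \<delta>) < real k * (S + 3 * \<eta> / 8) + 2 * (1 + r) * \<delta>"
      \<comment> \<open>The two branches of the maximum are matched by the two inequalities obtained
        from the block tilts.\<close>
      proof (cases "?a \<le> 0")
        case True
        have "(1 + r) * \<delta> \<ge> 0" using r d0 by simp
        thus ?thesis using True AB(1) by (simp add: algebra_simps)
      next
        case False
        thus ?thesis using AB(2) by (simp add: algebra_simps)
      qed
      thus "max 0 ?a + (K1p + \<delta>) + r * (K2p + \<delta>) + 2 * r * v2 < real k * (S + 3 * \<eta> / 8) + real k * (\<eta> / 8) + real k * (\<eta> / 8)"
        using vk(2) unfolding d2 by linarith
    qed (use k0 in simp)
    also have "\<dots> = S + 5 * \<eta> / 8" using k0(3) by (simp add: field_simps)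
    also have "\<dots> < S + \<eta>" using h by simp
    finally show ?thesis .
  qed
  from order_tendstoD(2)[OF tg this] have ev1: "\<forall>\<^sub>F n in sequentially. g n < S + \<eta>" .
  have ev2: "\<forall>\<^sub>F n in sequentially. N n \<ge> N1"
    using eventually_ge_at_top[of "k * N1"]
  proof eventually_elim
    case (elim n)
    have "k * N1 div k \<le> n div k" using elim by (rule div_le_mono)
    thus ?case using k0(3) by (simp add: N_def)
  qed
  have "\<forall>\<^sub>F n in sequentially. copies r n \<ge> k * N2" using copies_at_top[OF r] by (simp add: filterlim_at_top)
  hence ev3: "\<forall>\<^sub>F n in sequentially. M n \<ge> N2"
  proof eventually_elim
    case (elim n)
    have "k * N2 div k \<le> copies r n div k" using elim by (rule div_le_mono)
    thus ?case using k0(3) by (simp add: M_def)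
  qed
  show ?thesis
    using ev1 ev2 ev3 eventually_gt_at_top[of 0]
  proof eventually_elim
    case (elim n)
    obtain T where T: "T \<subseteq> {..<(d1^k)^N n}" "(\<Sum>x\<in>T. pweight (d1^k) p1 (N n) x) \<ge> 1/2 * exp (- (real (N n) * (K1p + \<delta>)))"
      "(\<Sum>x\<in>T. pweight (d1^k) q1 (N n) x) \<le> exp (- (real (N n) * (K1q - \<delta>)))"
      using N1[OF elim(2)] by auto
    obtain w where w: "\<And>y. 0 \<le> w y" "(\<Sum>y<(d2^k)^M n. w y) = 1"
      "\<And>y. y < (d2^k)^M n \<Longrightarrow> w y \<le> 2 * exp (real (M n) * (K2q + \<delta>)) * pweight (d2^k) q2 (M n) y"
      "(\<Sum>y<(d2^k)^M n. sqrt (w y * pweight (d2^k) p2 (M n) y)) \<ge> 1/2 * exp (- (real (M n) * (K2p + \<delta>)) / 2)"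
      using N2[OF elim(3)] by auto
    have nk: "n = k * N n + n mod k" "copies r n = k * M n + copies r n mod k" by (simp_all add: N_def M_def)
    have lk: "copies r n mod k \<le> k" using k0(3) by (simp add: less_imp_le)
    from block_achievability[OF r1 s1 r2 s2 f1 f2 nk(1) nk(2) lk fidelity_pos[OF ps(3,4) np] T w] obtain E where
      E: "channel (d1^n) (d2^copies r n) E" "E (tpow \<sigma>1 n) = tpow \<sigma>2 (copies r n)"
      "exp (- R n) \<le> (fidelity (E (tpow \<rho>1 n)) (tpow \<rho>2 (copies r n)))\<^sup>2"
      unfolding R_def v2_def by blast
    have "R n \<le> real n * (S + \<eta>)" unfolding Rg[OF elim(4)] using elim(1) by (intro mult_left_mono) auto
    hence "exp (- (real n * (S + \<eta>))) \<le> exp (- R n)" by simp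
    thus ?case using E by (meson order.trans)
  qed
qed

section \<open>Monotonicity in the order and the limit of large order\<close>

text \<open>Monotonicity of the sandwiched divergence in its order. In a frame of the n-th power
  this is Jensen's inequality for a concave power of the likelihood ratio, and the polynomial
  pinching factor disappears after division by n.\<close>

lemma sQ_order_mono:
  assumes r: "density d \<rho>" and s: "density d \<sigma>" and sup: "mpow \<sigma> 0 * \<rho> = \<rho>" and b: "1 < b" "b \<le> b'"
  shows "ln (sQ b \<rho> \<sigma>) / (b - 1) \<le> ln (sQ b' \<rho> \<sigma>) / (b' - 1)"
proof -
  have ps: "psd d \<rho>" "psd d \<sigma>" using r s by (auto simp: density_def)
  define \<theta> where "\<theta> = (b - 1) / (b' - 1)"
  have th: "0 < \<theta>" "\<theta> \<le> 1" using b by (auto simp: \<theta>_def)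
  have pos: "sQ a \<rho> \<sigma> > 0" if "a \<ge> 1" for a by (rule sQ_pos_support[OF r s sup that])
  have key: "ln (sQ b \<rho> \<sigma>) - \<theta> * ln (sQ b' \<rho> \<sigma>) \<le> b * real d * (ln (real (Suc n)) / real n)" if n: "n > 0" for n
  proof -
    note p = psd_tpow[OF ps(1), of n] psd_tpow[OF ps(2), of n]
    obtain V p q where f: "frame (d^n) (tpow \<rho> n) (tpow \<sigma> n) V p q" using frame_exists[OF p] by blast
    have ac: "\<And>x. x < d^n \<Longrightarrow> q x = 0 \<Longrightarrow> p x = 0" by (rule frame_support[OF f p(1) supp_tpow[OF ps sup]])
    have mean: "cQ a (d^n) p q = (\<Sum>x<d^n. p x * (p x / q x) powr (a - 1))" for a
      by (rule cQ_as_mean) (use frameD(3,4)[OF f] ac in auto)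
    have "cQ b (d^n) p q = (\<Sum>x<d^n. p x * ((p x / q x) powr (b' - 1)) powr \<theta>)"
      unfolding mean using b by (simp add: powr_powr \<theta>_def)
    also have "\<dots> \<le> (\<Sum>x<d^n. p x * (p x / q x) powr (b' - 1)) powr \<theta>"
      using frameD(3)[OF f] frame_sums(1)[OF f density_tpow[OF r] density_tpow[OF s]] th by (intro jensen_powr_concave) auto
    also have "\<dots> = cQ b' (d^n) p q powr \<theta>" unfolding mean ..
    also have "\<dots> \<le> (sQ b' \<rho> \<sigma> ^ n) powr \<theta>"
      using frame_sandwich_bounds(3)[OF f p, of b'] b th cQ_nonneg unfolding sQ_tpow[OF ps] by (intro powr_mono2) auto
    finally have c: "cQ b (d^n) p q \<le> (sQ b' \<rho> \<sigma> ^ n) powr \<theta>" .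
    have "sQ b \<rho> \<sigma> ^ n \<le> real (card (q ` {..<d^n})) powr b * cQ b (d^n) p q"
      using frame_sandwich_bounds(4)[OF f p, of b] b unfolding sQ_tpow[OF ps] by simp
    also have "\<dots> \<le> real (Suc n ^ d) powr b * (sQ b' \<rho> \<sigma> ^ n) powr \<theta>"
      using c frame_card[OF ps(2) f] b cQ_nonneg by (intro mult_mono powr_mono2) (simp_all only: of_nat_le_iff, auto)
    finally have "ln (sQ b \<rho> \<sigma> ^ n) \<le> ln (real (Suc n ^ d) powr b * (sQ b' \<rho> \<sigma> ^ n) powr \<theta>)"
      using pos[of b] b by (intro ln_mono) auto
    also have "\<dots> = b * (real d * ln (real (Suc n))) + \<theta> * (real n * ln (sQ b' \<rho> \<sigma>))"
      using pos[of b'] b by (subst ln_mult) (simp_all add: ln_powr ln_realpow del: of_nat_Suc)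
    finally have "real n * ln (sQ b \<rho> \<sigma>) \<le> b * (real d * ln (real (Suc n))) + \<theta> * (real n * ln (sQ b' \<rho> \<sigma>))"
      using pos[of b] b by (simp add: ln_realpow)
    hence "real n * (ln (sQ b \<rho> \<sigma>) - \<theta> * ln (sQ b' \<rho> \<sigma>)) \<le> b * (real d * ln (real (Suc n)))" by (simp add: algebra_simps)
    hence "ln (sQ b \<rho> \<sigma>) - \<theta> * ln (sQ b' \<rho> \<sigma>) \<le> b * (real d * ln (real (Suc n))) / real n"
      using n by (simp add: pos_le_divide_eq mult.commute)
    thus ?thesis by simp
  qed
  have "(\<lambda>n. b * real d * (ln (real (Suc n)) / real n)) \<longlonglongrightarrow> b * real d * 0"
    by (intro tendsto_intros ln_Suc_over_n)
  hence "ln (sQ b \<rho> \<sigma>) - \<theta> * ln (sQ b' \<rho> \<sigma>) \<le> b * real d * 0"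
    by (rule LIMSEQ_le_const) (use key in \<open>auto intro!: exI[of _ 1]\<close>)
  hence "ln (sQ b \<rho> \<sigma>) \<le> \<theta> * ln (sQ b' \<rho> \<sigma>)" by simp
  hence "ln (sQ b \<rho> \<sigma>) / (b - 1) \<le> \<theta> * ln (sQ b' \<rho> \<sigma>) / (b - 1)" using b by (intro divide_right_mono) auto
  also have "\<dots> = ln (sQ b' \<rho> \<sigma>) / (b' - 1)" using b by (simp add: \<theta>_def)
  finally show ?thesis .
qed

text \<open>From order 2 on, the likelihood ratios in one frame give a bound. Near order 1 the
  pinching cost enters with the unbounded factor b / (b - 1), so there monotonicity is used
  instead.\<close>

lemma sQ_order_bounded:
  assumes r: "density d \<rho>" and s: "density d \<sigma>" and sup: "mpow \<sigma> 0 * \<rho> = \<rho>"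
  shows "\<exists>C. \<forall>b>1. ln (sQ b \<rho> \<sigma>) / (b - 1) \<le> C"
proof -
  have ps: "psd d \<rho>" "psd d \<sigma>" using r s by (auto simp: density_def)
  obtain V p q where f: "frame d \<rho> \<sigma> V p q" using frame_exists[OF ps] by blast
  have ac: "\<And>x. x < d \<Longrightarrow> q x = 0 \<Longrightarrow> p x = 0" by (rule frame_support[OF f ps(1) sup])
  define v where "v = real (card (q ` {..<d})) + 1"
  define \<Lambda> where "\<Lambda> = (\<Sum>x<d. p x / q x) + 1"
  have nn: "p x / q x \<ge> 0" for x using frameD(3,4)[OF f] by simp
  have L1: "\<Lambda> \<ge> 1" using nn by (auto simp: \<Lambda>_def intro!: sum_nonneg)
  have big: "ln (sQ b \<rho> \<sigma>) / (b - 1) \<le> 2 * ln v + ln \<Lambda>" if b: "b \<ge> 2" for b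
  proof -
    have "cQ b d p q = (\<Sum>x<d. p x * (p x / q x) powr (b - 1))" by (rule cQ_as_mean[OF frameD(3)[OF f] frameD(4)[OF f] ac])
    also have "\<dots> \<le> (\<Sum>x<d. p x * \<Lambda> powr (b - 1))"
    proof (intro sum_mono mult_left_mono powr_mono2)
      fix x assume "x \<in> {..<d}"
      hence "p x / q x \<le> (\<Sum>x<d. p x / q x)" using nn by (intro member_le_sum) auto
      thus "p x / q x \<le> \<Lambda>" by (simp add: \<Lambda>_def)
    qed (use b nn frameD(3)[OF f] in auto)
    also have "\<dots> = \<Lambda> powr (b - 1)" using frame_sums(1)[OF f r s] by (simp add: sum_distrib_right[symmetric])
    finally have c: "cQ b d p q \<le> \<Lambda> powr (b - 1)" .
    have "sQ b \<rho> \<sigma> \<le> real (card (q ` {..<d})) powr b * cQ b d p q" using frame_sandwich_bounds(4)[OF f ps, of b] b by simp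
    also have "\<dots> \<le> v powr b * \<Lambda> powr (b - 1)" using c b cQ_nonneg by (intro mult_mono powr_mono2) (auto simp: v_def)
    finally have "ln (sQ b \<rho> \<sigma>) \<le> ln (v powr b * \<Lambda> powr (b - 1))" using sQ_pos_support[OF r s sup, of b] b by (intro ln_mono) auto
    also have "\<dots> = b * ln v + (b - 1) * ln \<Lambda>"
    proof -
      have "v > 0" by (simp add: v_def)
      thus ?thesis using L1 by (subst ln_mult) (auto simp: ln_powr)
    qed
    also have "\<dots> \<le> (2 * (b - 1)) * ln v + (b - 1) * ln \<Lambda>" using b by (intro add_mono mult_right_mono order.refl) (auto simp: v_def)
    also have "\<dots> = (b - 1) * (2 * ln v + ln \<Lambda>)" by (simp add: algebra_simps)
    finally show ?thesis using b by (simp add: pos_divide_le_eq mult.commute)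
  qed
  have "ln (sQ b \<rho> \<sigma>) / (b - 1) \<le> 2 * ln v + ln \<Lambda>" if "b > 1" for b
    using sQ_order_mono[OF r s sup that, of "max b 2"] big[of "max b 2"] by linarith
  thus ?thesis by blast
qed

text \<open>A monotone bounded function converges to its supremum L, the divergence of infinite
  order in natural logarithms. The upper bound serves the converse, the approximation from below
  serves achievability.\<close>

lemma sQ_order_limit:
  assumes r: "density d \<rho>" and s: "density d \<sigma>" and sup: "mpow \<sigma> 0 * \<rho> = \<rho>"
  obtains L where "((\<lambda>b. ln (sQ b \<rho> \<sigma>) / (b - 1)) \<longlongrightarrow> L) at_top"
    "\<And>b. b > 1 \<Longrightarrow> sQ b \<rho> \<sigma> \<le> exp ((b - 1) * L)" "\<And>e. e > 0 \<Longrightarrow> \<exists>b\<ge>2. (b - 1) * (L - e) \<le> ln (sQ b \<rho> \<sigma>)"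
proof -
  define D where "D b = ln (sQ b \<rho> \<sigma>) / (b - 1)" for b
  have mono: "D b \<le> D b'" if "1 < b" "b \<le> b'" for b b' unfolding D_def by (rule sQ_order_mono[OF r s sup that])
  obtain C where C: "\<And>b. b > 1 \<Longrightarrow> D b \<le> C" using sQ_order_bounded[OF r s sup] unfolding D_def by blast
  define L where "L = (SUP b\<in>{1<..}. D b)"
  have bdd: "bdd_above (D ` {1<..})" using C by (intro bdd_aboveI[of _ C]) auto
  have up: "D b \<le> L" if "b > 1" for b unfolding L_def using bdd that by (intro cSUP_upper) auto
  have ex: "\<exists>b>1. y < D b" if "y < L" for y
  proof -
    have "{1::real<..} \<noteq> {}" by (auto intro!: exI[of _ 2])
    thus ?thesis using that less_cSUP_iff[OF _ bdd] unfolding L_def by auto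
  qed
  have "(D \<longlongrightarrow> L) at_top"
  proof (rule increasing_tendsto)
    show "\<forall>\<^sub>F b in at_top. D b \<le> L" using eventually_gt_at_top[of 1] by eventually_elim (rule up)
    fix y assume "y < L"
    then obtain b where b: "b > 1" "y < D b" using ex by blast
    show "\<forall>\<^sub>F b in at_top. y < D b" using eventually_ge_at_top[of b]
      by eventually_elim (use b mono in \<open>auto intro: less_le_trans\<close>)
  qed
  moreover have "sQ b \<rho> \<sigma> \<le> exp ((b - 1) * L)" if "b > 1" for b
  proof -
    have "ln (sQ b \<rho> \<sigma>) \<le> (b - 1) * L" using up[OF that] that by (simp add: D_def pos_divide_le_eq mult.commute)
    thus ?thesis using sQ_pos_support[OF r s sup, of b] that by (metis exp_le_cancel_iff exp_ln less_imp_le)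
  qed
  moreover have "\<exists>b\<ge>2. (b - 1) * (L - e) \<le> ln (sQ b \<rho> \<sigma>)" if "e > 0" for e
  proof -
    obtain b where b: "b > 1" "L - e < D b" using ex[of "L - e"] \<open>e > 0\<close> by auto
    have "L - e \<le> D (max b 2)" using b mono[OF b(1), of "max b 2"] by linarith
    hence "(max b 2 - 1) * (L - e) \<le> ln (sQ (max b 2) \<rho> \<sigma>)" by (simp add: D_def pos_le_divide_eq mult.commute)
    thus ?thesis by (intro exI[of _ "max b 2"]) auto
  qed
  ultimately show ?thesis using that unfolding D_def by blast
qed

section \<open>The strong converse exponent\<close>

text \<open>The trace is the squared Hilbert-Schmidt norm of the product of the two roots, so that
  product vanishes.\<close>

lemma psd_mult_eq_0:
  assumes A: "psd n A" and B: "psd n B" and z: "mtrace (A * B) = 0" shows "A * B = 0\<^sub>m n n"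
proof -
  define S where "S = msqrt A"
  define T where "T = msqrt B"
  have S: "S \<in> carrier_mat n n" "adj S = S" "S * S = A"
    using psdD(1)[OF msqrt_psd[OF A]] psd_hermitian[OF msqrt_psd[OF A]] msqrt_mult_self[OF A] by (auto simp: S_def)
  have T: "T \<in> carrier_mat n n" "adj T = T" "T * T = B"
    using psdD(1)[OF msqrt_psd[OF B]] psd_hermitian[OF msqrt_psd[OF B]] msqrt_mult_self[OF B] by (auto simp: T_def)
  define G where "G = S * T"
  have G: "G \<in> carrier_mat n n" unfolding G_def by (rule mult_carrier_sq[OF S(1) T(1)])
  have "adj G = T * S" unfolding G_def using adj_mult[OF S(1) T(1)] S(2) T(2) by simp
  hence "adj G * G = T * (A * T)" unfolding G_def S(3)[symmetric] using S(1) T(1)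
    by (simp add: mat_assoc[of _ n] mult_carrier_sq[of _ n])
  hence "mtrace (adj G * G) = mtrace (A * T * T)"
    using mtrace_mult_comm[OF T(1) mult_carrier_sq[OF psdD(1)[OF A] T(1)]] by simp
  also have "\<dots> = 0" using z unfolding T(3)[symmetric] using T(1) psdD(1)[OF A] by (simp add: mat_assoc[of _ n])
  finally have "complex_of_real (\<Sum>j<n. \<Sum>k<n. (cmod (G $$ (k,j)))\<^sup>2) = complex_of_real 0"
    unfolding mtrace_def of_real_sum[of _ "{..<n}"] using gram_diag_entry[OF G] psdD(1)[OF psd_gram[OF G]] G by simp
  hence "\<forall>j\<in>{..<n}. (\<Sum>k<n. (cmod (G $$ (k,j)))\<^sup>2) = 0"
    unfolding of_real_eq_iff by (subst (asm) sum_nonneg_eq_0_iff) (auto intro!: sum_nonneg)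
  hence "\<forall>j\<in>{..<n}. \<forall>k\<in>{..<n}. (cmod (G $$ (k,j)))\<^sup>2 = 0"
    by (subst (asm) sum_nonneg_eq_0_iff) auto
  hence G0: "G = 0\<^sub>m n n" using G by (intro eq_matI) auto
  have "A * B = S * G * T" unfolding G_def S(3)[symmetric] T(3)[symmetric] using S(1) T(1)
    by (simp add: mat_assoc[of _ n] mult_carrier_sq[of _ n])
  thus ?thesis unfolding G0 using S(1) T(1) by simp
qed

lemma psd_complement_mpow_0:
  assumes A: "psd n A" shows "psd n (1\<^sub>m n - mpow A 0)"
proof -
  from psd_spectral[OF A] obtain U f where U: "unitary n U" "\<And>i. f i \<ge> 0" "A = U * rdiag n f * adj U" by blast
  show ?thesis unfolding mpow_eq[OF U(1,3)] spectral_one_minus[OF U(1)] using U(1) by (intro spectral_psd) auto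
qed

lemma mtrace_complement_mult:
  assumes "P \<in> carrier_mat n n" "X \<in> carrier_mat n n"
  shows "mtrace ((1\<^sub>m n - P) * X) = mtrace X - mtrace (P * X)"
proof -
  have "(1\<^sub>m n - P) * X = X - P * X" using assms by (simp add: minus_mult_distrib_mat[of _ n n _ _ n])
  thus ?thesis using assms by (simp add: mtrace_def sum_subtractf)
qed

lemma sandwiched_eq_sQ:
  assumes "a \<noteq> 1"
  shows "sandwiched a \<rho> \<sigma> = (if (a > 1 \<and> supp \<rho> \<subseteq> supp \<sigma>) \<or> (a < 1 \<and> \<not> supp_perp \<rho> \<sigma>)
    then ereal (1 / (a - 1) * log 2 (sQ a \<rho> \<sigma>)) else \<infinity>)"
  using assms by (simp add: sandwiched_def sQ_def trp_def)

section \<open>From fidelities to rates\<close>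

locale dichotomy =
  fixes d1 d2 :: nat and \<rho>1 \<sigma>1 \<rho>2 \<sigma>2 :: "complex mat" and r :: real
  assumes r1: "density d1 \<rho>1" and s1: "density d1 \<sigma>1" and r2: "density d2 \<rho>2" and s2: "density d2 \<sigma>2" and r0: "r > 0"
begin

abbreviation "fid n E \<equiv> fidelity (E (tpow \<rho>1 n)) (tpow \<rho>2 (copies r n))"

definition valid :: "nat \<Rightarrow> (complex mat \<Rightarrow> complex mat) \<Rightarrow> bool" where
  "valid n E \<longleftrightarrow> channel (d1 ^ n) (d2 ^ copies r n) E \<and> E (tpow \<sigma>1 n) = tpow \<sigma>2 (copies r n)"

definition gap :: "nat \<Rightarrow> real" where
  "gap n = 1 - eps_P d1 d2 \<rho>1 \<sigma>1 \<rho>2 \<sigma>2 r n"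

lemma psds: "psd d1 \<rho>1" "psd d1 \<sigma>1" "psd d2 \<rho>2" "psd d2 \<sigma>2"
  using r1 s1 r2 s2 by (auto simp: density_def)

lemma fid_range: assumes "valid n E" shows "0 \<le> fid n E" "(fid n E)\<^sup>2 \<le> 1"
proof -
  have d: "density (d2 ^ copies r n) (E (tpow \<rho>1 n))"
    using channel_density[OF _ density_tpow[OF r1]] assms by (auto simp: valid_def)
  show "0 \<le> fid n E" using fidelity_nonneg[OF _ psd_tpow[OF psds(3)]] d by (auto simp: density_def)
  thus "(fid n E)\<^sup>2 \<le> 1" using fidelity_le_1[OF d density_tpow[OF r2]] by (simp add: power_le_one)
qed

text \<open>A test that never succeeds on \<sigma>_1 leaves the success branch free of the
  constraint, so \<rho>_2 itself can be prepared there.\<close>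

lemma valid_from_test:
  assumes M: "psd (d1^n) M" "psd (d1^n) (1\<^sub>m (d1^n) - M)" and a: "mtrace (M * tpow \<rho>1 n) = complex_of_real a"
    and b: "mtrace (M * tpow \<sigma>1 n) = complex_of_real 0"
  shows "\<exists>E. valid n E \<and> a \<le> (fid n E)\<^sup>2"
proof -
  let ?m = "copies r n"
  have sm: "tpow \<sigma>2 ?m - complex_of_real 0 \<cdot>\<^sub>m tpow \<rho>2 ?m = tpow \<sigma>2 ?m"
    using psdD(1)[OF psd_tpow[OF psds(3)], of ?m] psdD(1)[OF psd_tpow[OF psds(4)], of ?m] by (intro eq_matI) auto
  have "psd (d2^?m) (tpow \<sigma>2 ?m - complex_of_real 0 \<cdot>\<^sub>m tpow \<rho>2 ?m)" unfolding sm by (rule psd_tpow[OF psds(4)])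
  from oneshot_achievability[OF density_tpow[OF r1, of n] density_tpow[OF s1, of n] density_tpow[OF r2, of ?m] density_tpow[OF s2, of ?m]
      density_tpow[OF r2, of ?m] M a b _ this]
  show ?thesis using fidelity_self[OF density_tpow[OF r2]] unfolding valid_def by simp
qed

text \<open>The test M = 0 gives the channel that always outputs the target power of \<sigma>_2. The
  infimum in \<open>eps_P\<close> is therefore over a nonempty set.\<close>

lemma valid_exists: "\<exists>E. valid n E"
proof -
  have z: "0\<^sub>m (d1^n) (d1^n) = rdiag (d1^n) (\<lambda>_. 0)" by (intro eq_matI) auto
  have p: "psd (d1^n) (0\<^sub>m (d1^n) (d1^n))" unfolding z by (rule psd_rdiag) simp
  have "1\<^sub>m (d1^n) - 0\<^sub>m (d1^n) (d1^n) = (1\<^sub>m (d1^n) :: complex mat)" by (intro eq_matI) auto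
  hence p': "psd (d1^n) (1\<^sub>m (d1^n) - 0\<^sub>m (d1^n) (d1^n))" using psd_one by simp
  have m: "mtrace (0\<^sub>m (d1^n) (d1^n) * X) = complex_of_real 0" if "X \<in> carrier_mat (d1^n) (d1^n)" for X
    using left_mult_zero_mat[OF that, of "d1^n"] by (simp add: mtrace_def)
  show ?thesis using valid_from_test[OF p p' m[OF psdD(1)[OF psd_tpow[OF psds(1)]]] m[OF psdD(1)[OF psd_tpow[OF psds(2)]]]] by blast
qed

lemma eps_eq: "eps_P d1 d2 \<rho>1 \<sigma>1 \<rho>2 \<sigma>2 r n = Inf {sqrt (1 - (fid n E)\<^sup>2) | E. valid n E}"
  unfolding eps_P_def purified_distance_def valid_def ..

text \<open>With x the squared fidelity, sqrt (1 - x) \<ge> 1 - x on [0,1].\<close>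

lemma gap_le:
  assumes "\<And>E. valid n E \<Longrightarrow> (fid n E)\<^sup>2 \<le> B" shows "gap n \<le> B"
proof -
  have "1 - B \<le> eps_P d1 d2 \<rho>1 \<sigma>1 \<rho>2 \<sigma>2 r n" unfolding eps_eq
  proof (rule cInf_greatest)
    show "{sqrt (1 - (fid n E)\<^sup>2) | E. valid n E} \<noteq> {}" using valid_exists by auto
    fix x assume "x \<in> {sqrt (1 - (fid n E)\<^sup>2) | E. valid n E}"
    then obtain E where E: "valid n E" "x = sqrt (1 - (fid n E)\<^sup>2)" by auto
    have "(1 - (fid n E)\<^sup>2) \<le> sqrt (1 - (fid n E)\<^sup>2)"
      using fid_range(2)[OF E(1)] by (intro real_le_rsqrt) (simp add: power2_eq_square mult_left_le)
    thus "1 - B \<le> x" using assms[OF E(1)] E(2) by linarith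
  qed
  thus ?thesis by (simp add: gap_def)
qed

text \<open>With x the squared fidelity, sqrt (1 - x) \<le> 1 - x/2. Together with the upper bound
  this identifies the gap with the best squared fidelity up to a factor 2, and never asks whether
  the infimum is attained.\<close>

lemma gap_ge:
  assumes E: "valid n E" and b: "b \<le> (fid n E)\<^sup>2" shows "b / 2 \<le> gap n"
proof -
  have bdd: "bdd_below {sqrt (1 - (fid n E)\<^sup>2) | E. valid n E}"
    by (rule bdd_belowI[of _ 0]) (use fid_range(2) in auto)
  have "eps_P d1 d2 \<rho>1 \<sigma>1 \<rho>2 \<sigma>2 r n \<le> sqrt (1 - (fid n E)\<^sup>2)"
    unfolding eps_eq by (rule cInf_lower[OF _ bdd]) (use E in auto)
  also have "\<dots> \<le> 1 - (fid n E)\<^sup>2 / 2"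
  proof (rule real_le_lsqrt)
    show "0 \<le> 1 - (fid n E)\<^sup>2 / 2" using fid_range(2)[OF E] by auto
    show "1 - (fid n E)\<^sup>2 \<le> (1 - (fid n E)\<^sup>2 / 2)\<^sup>2" by (simp add: power2_diff)
  qed
  finally show ?thesis using b by (simp add: gap_def)
qed

lemma gap_range: "0 \<le> gap n" "gap n \<le> 1"
proof -
  obtain E where "valid n E" using valid_exists by blast
  from gap_ge[OF this, of 0] show "0 \<le> gap n" by simp
  show "gap n \<le> 1" by (rule gap_le) (rule fid_range(2))
qed

definition rate :: "nat \<Rightarrow> ereal" where
  "rate n = ereal (1 / real n) * - elog2 (gap n)"

lemma rate_ge:
  assumes n: "n > 0" and B: "gap n \<le> B" "B > 0" shows "ereal (- ln B / (real n * ln 2)) \<le> rate n"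
proof (cases "gap n = 0")
  case True thus ?thesis using n by (simp add: rate_def elog2_def)
next
  case False
  hence g: "gap n > 0" using gap_range[of n] by simp
  have "- ln B / (real n * ln 2) \<le> - ln (gap n) / (real n * ln 2)"
    using g B n by (intro divide_right_mono) auto
  thus ?thesis using False by (simp add: rate_def elog2_def log_def)
qed

lemma rate_le:
  assumes n: "n > 0" and b: "b \<le> gap n" "b > 0" shows "rate n \<le> ereal (- ln b / (real n * ln 2))"
proof -
  have "- ln (gap n) / (real n * ln 2) \<le> - ln b / (real n * ln 2)"
    using b n by (intro divide_right_mono) auto
  thus ?thesis using b by (simp add: rate_def elog2_def log_def)
qed

lemma rate_nonneg: "n > 0 \<Longrightarrow> 0 \<le> rate n"
  using rate_ge[of n 1] gap_range(2) by (simp add: zero_ereal_def)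

lemma rate_lower:
  assumes B: "\<And>n E. valid n E \<Longrightarrow> (fid n E)\<^sup>2 \<le> B n" "\<And>n. B n > 0"
    and lim: "(\<lambda>n. - ln (B n) / (real n * ln 2)) \<longlonglongrightarrow> c" and y: "y < ereal c"
  shows "\<forall>\<^sub>F n in sequentially. y < rate n"
proof -
  have "(\<lambda>n. ereal (- ln (B n) / (real n * ln 2))) \<longlonglongrightarrow> ereal c" using lim by simp
  from order_tendstoD(1)[OF this y] eventually_gt_at_top[of 0] show ?thesis
  proof eventually_elim
    case (elim n)
    have "gap n \<le> B n" by (rule gap_le) (rule B(1))
    from rate_ge[OF elim(2) this B(2)] elim(1) show ?case by (auto intro: less_le_trans)
  qed
qed

lemma ln_copies_over_n: "(\<lambda>n. ln (real (Suc (copies r n))) / real n) \<longlonglongrightarrow> 0"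
proof -
  have m: "(\<lambda>n. real (copies r n) / real n) \<longlonglongrightarrow> r" by (rule ratio_tendsto[OF copies_ratio[OF r0]])
  have "(\<lambda>n. ln (real (Suc (copies r n))) / real (copies r n) * (real (copies r n) / real n)) \<longlonglongrightarrow> 0 * r"
    by (intro tendsto_mult m filterlim_compose[OF ln_Suc_over_n copies_at_top[OF r0]])
  moreover have "\<forall>\<^sub>F n in sequentially. ln (real (Suc (copies r n))) / real (copies r n) * (real (copies r n) / real n) = ln (real (Suc (copies r n))) / real n"
  proof -
    have "\<forall>\<^sub>F n in sequentially. copies r n \<ge> 1" using copies_at_top[OF r0] by (simp add: filterlim_at_top)
    thus ?thesis by eventually_elim auto
  qed
  ultimately have "(\<lambda>n. ln (real (Suc (copies r n))) / real n) \<longlonglongrightarrow> 0 * r" by (rule Lim_transform_eventually)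
  thus ?thesis by simp
qed

text \<open>With \<alpha> = 1 / (1 + s) and \<beta> = 1 / (1 - s) the duality relation holds
  identically and the exponents 1 / \<alpha>, 1 / \<beta> become 1 + s and 1 - s. The polynomial
  factors vanish in the rate.\<close>

lemma converse_inner:
  assumes sup: "mpow \<sigma>1 0 * \<rho>1 = \<rho>1" and np: "\<not> supp_perp \<rho>2 \<sigma>2" and s: "0 < s" "s < 1"
    and y: "y < ereal ((- r * ((1 + s) * ln (sQ (1 / (1 + s)) \<rho>2 \<sigma>2)) - (1 - s) * ln (sQ (1 / (1 - s)) \<rho>1 \<sigma>1)) / ln 2)"
  shows "\<forall>\<^sub>F n in sequentially. y < rate n"
proof (rule rate_lower[OF _ _ _ y])
  let ?a = "1 / (1 + s)" and ?b = "1 / (1 - s)"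
  define Q1 where "Q1 = sQ ?b \<rho>1 \<sigma>1"
  define Q2 where "Q2 = sQ ?a \<rho>2 \<sigma>2"
  have Q1: "Q1 > 0" unfolding Q1_def using s by (intro sQ_pos_support[OF r1 s1 sup]) auto
  have Q2: "Q2 > 0" unfolding Q2_def
    using np supp_perp_iff[OF psds(3,4), of ?a] sQ_nonneg[OF psds(3,4), of ?a] s by (auto simp: less_le)
  define B where "B n = real (Suc n ^ d1) * (Q1 ^ n) powr (1 / ?b) * (real (Suc (copies r n) ^ d2) * Q2 ^ copies r n) powr (1 / ?a)" for n
  show "(fid n E)\<^sup>2 \<le> B n" if "valid n E" for n E
    unfolding B_def Q1_def Q2_def using that s
    by (intro converse_bound(1)[OF psds sup]) (auto simp: valid_def field_simps)
  show "B n > 0" for n unfolding B_def using Q1 Q2 by (simp del: of_nat_Suc)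
  have lnB: "- ln (B n) / (real n * ln 2) = - (real d1 * (ln (real (Suc n)) / real n) + (1 - s) * ln Q1
      + (1 + s) * (real d2 * (ln (real (Suc (copies r n))) / real n) + real (copies r n) / real n * ln Q2)) / ln 2" if n: "n > 0" for n
  proof -
    have p: "real (Suc (copies r n) ^ d2) * Q2 ^ copies r n > 0" using Q2 by (simp del: of_nat_Suc)
    have "ln (B n) = ln (real (Suc n ^ d1)) + (1 - s) * ln (Q1 ^ n) + (1 + s) * ln (real (Suc (copies r n) ^ d2) * Q2 ^ copies r n)"
    proof -
      have x: "real (Suc n ^ d1) > 0" "(Q1 ^ n) powr (1 / ?b) > 0" "(real (Suc (copies r n) ^ d2) * Q2 ^ copies r n) powr (1 / ?a) > 0"
        using Q1 Q2 p by (auto simp del: of_nat_Suc)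
      have "ln (B n) = ln (real (Suc n ^ d1)) + ln ((Q1 ^ n) powr (1 / ?b)) + ln ((real (Suc (copies r n) ^ d2) * Q2 ^ copies r n) powr (1 / ?a))"
        unfolding B_def using x by (simp only: ln_mult_pos mult_pos_pos)
      thus ?thesis using Q1 p by (simp only: ln_powr) simp
    qed
    also have "ln (real (Suc (copies r n) ^ d2) * Q2 ^ copies r n) = real d2 * ln (real (Suc (copies r n))) + real (copies r n) * ln Q2"
      using Q2 by (subst ln_mult_pos) (simp_all add: ln_realpow del: of_nat_Suc)
    also have "ln (real (Suc n ^ d1)) = real d1 * ln (real (Suc n))" by (simp add: ln_realpow del: of_nat_Suc)
    also have "ln (Q1 ^ n) = real n * ln Q1" using Q1 by (simp add: ln_realpow)
    finally have l: "ln (B n) = real d1 * ln (real (Suc n)) + (1 - s) * (real n * ln Q1) + (1 + s) * (real d2 * ln (real (Suc (copies r n))) + real (copies r n) * ln Q2)" .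
    have "ln (B n) / real n = real d1 * (ln (real (Suc n)) / real n) + (1 - s) * ln Q1
      + (1 + s) * (real d2 * (ln (real (Suc (copies r n))) / real n) + real (copies r n) / real n * ln Q2)"
      unfolding l using n by (simp add: add_divide_distrib distrib_left del: of_nat_Suc)
    thus ?thesis by (simp add: divide_divide_eq_left[symmetric])
  qed
  have m: "(\<lambda>n. real (copies r n) / real n) \<longlonglongrightarrow> r" by (rule ratio_tendsto[OF copies_ratio[OF r0]])
  have "(\<lambda>n. - (real d1 * (ln (real (Suc n)) / real n) + (1 - s) * ln Q1
      + (1 + s) * (real d2 * (ln (real (Suc (copies r n))) / real n) + real (copies r n) / real n * ln Q2)) / ln 2)
    \<longlonglongrightarrow> - (real d1 * 0 + (1 - s) * ln Q1 + (1 + s) * (real d2 * 0 + r * ln Q2)) / ln 2"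
    by (intro tendsto_intros ln_Suc_over_n ln_copies_over_n m) auto
  hence "(\<lambda>n. - ln (B n) / (real n * ln 2)) \<longlonglongrightarrow> - (real d1 * 0 + (1 - s) * ln Q1 + (1 + s) * (real d2 * 0 + r * ln Q2)) / ln 2"
    by (rule Lim_transform_eventually) (rule eventually_mono[OF eventually_gt_at_top[of 0] lnB[symmetric]])
  moreover have "- (real d1 * 0 + (1 - s) * ln Q1 + (1 + s) * (real d2 * 0 + r * ln Q2)) = - r * ((1 + s) * ln Q2) - (1 - s) * ln Q1"
    by (simp add: algebra_simps)
  ultimately show "(\<lambda>n. - ln (B n) / (real n * ln 2)) \<longlonglongrightarrow> (- r * ((1 + s) * ln (sQ ?a \<rho>2 \<sigma>2)) - (1 - s) * ln (sQ ?b \<rho>1 \<sigma>1)) / ln 2"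
    unfolding Q1_def[symmetric] Q2_def[symmetric] by (simp only:)
qed

lemma converse_edge:
  assumes sup: "mpow \<sigma>1 0 * \<rho>1 = \<rho>1" and np: "\<not> supp_perp \<rho>2 \<sigma>2"
    and L: "\<And>b. b > 1 \<Longrightarrow> sQ b \<rho>1 \<sigma>1 \<le> exp ((b - 1) * L)"
    and y: "y < ereal ((- r * (2 * ln (sQ (1/2) \<rho>2 \<sigma>2)) - L) / ln 2)"
  shows "\<forall>\<^sub>F n in sequentially. y < rate n"
proof (rule rate_lower[OF _ _ _ y])
  define Q2 where "Q2 = sQ (1/2) \<rho>2 \<sigma>2"
  have Q2: "Q2 > 0" unfolding Q2_def
    using np supp_perp_iff[OF psds(3,4), of "1/2"] sQ_nonneg[OF psds(3,4), of "1/2"] by (auto simp: less_le)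
  define B where "B n = real (Suc n ^ d1) * exp (real n * L) * (real (Suc (copies r n) ^ d2) * Q2 ^ copies r n)\<^sup>2" for n
  show "(fid n E)\<^sup>2 \<le> B n" if "valid n E" for n E
    unfolding B_def Q2_def using that by (intro converse_bound(2)[OF psds sup _ _ L]) (auto simp: valid_def)
  show "B n > 0" for n unfolding B_def using Q2 by (simp del: of_nat_Suc)
  have lnB: "- ln (B n) / (real n * ln 2) = - (real d1 * (ln (real (Suc n)) / real n) + L
      + 2 * (real d2 * (ln (real (Suc (copies r n))) / real n) + real (copies r n) / real n * ln Q2)) / ln 2" if n: "n > 0" for n
  proof -
    let ?C = "real (Suc (copies r n) ^ d2) * Q2 ^ copies r n"
    have p: "?C > 0" using Q2 by (simp del: of_nat_Suc)
    have x: "real (Suc n ^ d1) > 0" "?C\<^sup>2 > 0" using Q2 p by (auto simp del: of_nat_Suc)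
    have "ln (B n) = ln (real (Suc n ^ d1)) + ln (exp (real n * L)) + ln (?C\<^sup>2)"
      unfolding B_def using x by (simp only: ln_mult_pos mult_pos_pos exp_gt_zero)
    also have "ln (?C\<^sup>2) = 2 * ln ?C" using p by (simp add: ln_realpow)
    also have "ln ?C = real d2 * ln (real (Suc (copies r n))) + real (copies r n) * ln Q2"
      using Q2 by (subst ln_mult_pos) (simp_all add: ln_realpow del: of_nat_Suc)
    also have "ln (real (Suc n ^ d1)) = real d1 * ln (real (Suc n))" by (simp add: ln_realpow del: of_nat_Suc)
    finally have l: "ln (B n) = real d1 * ln (real (Suc n)) + real n * L + 2 * (real d2 * ln (real (Suc (copies r n))) + real (copies r n) * ln Q2)" by simp
    have "ln (B n) / real n = real d1 * (ln (real (Suc n)) / real n) + L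
      + 2 * (real d2 * (ln (real (Suc (copies r n))) / real n) + real (copies r n) / real n * ln Q2)"
      unfolding l using n by (simp add: add_divide_distrib distrib_left del: of_nat_Suc)
    thus ?thesis by (simp add: divide_divide_eq_left[symmetric])
  qed
  have m: "(\<lambda>n. real (copies r n) / real n) \<longlonglongrightarrow> r" by (rule ratio_tendsto[OF copies_ratio[OF r0]])
  have "(\<lambda>n. - (real d1 * (ln (real (Suc n)) / real n) + L
      + 2 * (real d2 * (ln (real (Suc (copies r n))) / real n) + real (copies r n) / real n * ln Q2)) / ln 2)
    \<longlonglongrightarrow> - (real d1 * 0 + L + 2 * (real d2 * 0 + r * ln Q2)) / ln 2"
    by (intro tendsto_intros ln_Suc_over_n ln_copies_over_n m) auto
  hence "(\<lambda>n. - ln (B n) / (real n * ln 2)) \<longlonglongrightarrow> - (real d1 * 0 + L + 2 * (real d2 * 0 + r * ln Q2)) / ln 2"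
    by (rule Lim_transform_eventually) (rule eventually_mono[OF eventually_gt_at_top[of 0] lnB[symmetric]])
  moreover have "- (real d1 * 0 + L + 2 * (real d2 * 0 + r * ln Q2)) = - r * (2 * ln Q2) - L" by (simp add: algebra_simps)
  ultimately show "(\<lambda>n. - ln (B n) / (real n * ln 2)) \<longlonglongrightarrow> (- r * (2 * ln (sQ (1/2) \<rho>2 \<sigma>2)) - L) / ln 2"
    unfolding Q2_def[symmetric] by (simp only:)
qed

lemma rate_upper:
  assumes ev: "\<And>\<eta>. \<eta> > 0 \<Longrightarrow> \<forall>\<^sub>F n in sequentially. \<exists>E. valid n E \<and> exp (- (real n * (S + \<eta>))) \<le> (fid n E)\<^sup>2"
    and y: "ereal (S / ln 2) < y"
  shows "\<forall>\<^sub>F n in sequentially. rate n < y"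
proof -
  obtain z where z: "ereal (S / ln 2) < ereal z" "ereal z < y" using ereal_dense2[OF y] by auto
  define \<eta> where "\<eta> = (z * ln 2 - S) / 2"
  have l2: "ln (2::real) > 0" by simp
  have h: "\<eta> > 0" using z(1) l2 by (simp add: \<eta>_def pos_divide_less_eq)
  have "(\<lambda>n. (S + \<eta>) / ln 2 + 1 / real n) \<longlonglongrightarrow> (S + \<eta>) / ln 2 + 0" by (intro tendsto_intros lim_1_over_n) simp
  moreover have "(S + \<eta>) / ln 2 + 0 < z"
  proof -
    have "S + \<eta> < z * ln 2" using h by (simp add: \<eta>_def field_simps)
    thus ?thesis using l2 by (simp add: pos_divide_less_eq)
  qed
  ultimately have "\<forall>\<^sub>F n in sequentially. (S + \<eta>) / ln 2 + 1 / real n < z" by (rule order_tendstoD(2))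
  with ev[OF h] eventually_gt_at_top[of 0] show ?thesis
  proof eventually_elim
    case (elim n)
    then obtain E where E: "valid n E" "exp (- (real n * (S + \<eta>))) \<le> (fid n E)\<^sup>2" by auto
    have "rate n \<le> ereal (- ln (exp (- (real n * (S + \<eta>))) / 2) / (real n * ln 2))"
      using gap_ge[OF E] elim(2) by (intro rate_le) auto
    \<comment> \<open>The summand 1 / n is the factor 2 between gap and squared fidelity, in base
      2.\<close>
    also have "- ln (exp (- (real n * (S + \<eta>))) / 2) / (real n * ln 2) = (S + \<eta>) / ln 2 + 1 / real n"
      using elim(2) l2 by (simp add: ln_div add_divide_distrib)
    also have "ereal \<dots> < ereal z" using elim(3) by simp
    finally show ?case using z(2) by simp
  qed
qed

section \<open>The limit in the three support cases\<close>

definition exponent :: "real \<Rightarrow> ereal" where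
  "exponent \<alpha> = ereal ((1 - \<alpha>) / \<alpha>) * (ereal r * sandwiched \<alpha> \<rho>2 \<sigma>2
     - (if \<alpha> = 1/2 then sandwiched_inf \<rho>1 \<sigma>1 else sandwiched (\<alpha> / (2 * \<alpha> - 1)) \<rho>1 \<sigma>1))"

text \<open>In \<open>ereal\<close> the product of 0 with an infinite value is 0, so infinite
  divergences at \<alpha> = 1 do no harm. This term makes the supremum nonnegative.\<close>

lemma exponent_1: "exponent 1 = 0"
  by (simp add: exponent_def)

lemma rate_gt_negative:
  assumes "y < 0" shows "\<forall>\<^sub>F n in sequentially. y < rate n"
  using eventually_gt_at_top[of 0] by eventually_elim (rule less_le_trans[OF assms rate_nonneg])

lemma dual_order: "1/2 < \<alpha> \<Longrightarrow> \<alpha> < 1 \<Longrightarrow> 1 < \<alpha> / (2 * \<alpha> - (1::real))"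
  by (simp add: pos_less_divide_eq)

text \<open>The rate is 0: projecting off the support of \<sigma>_1 is a test that never fires on
  \<sigma>_1 but fires on \<rho>_1 with some probability c > 0, so the squared fidelity stays above
  c for every n \<ge> 1. On the other side every term with \<alpha> < 1 is minus infinity.\<close>

lemma limit_unsupported:
  assumes ns: "\<not> supp \<rho>1 \<subseteq> supp \<sigma>1" and sup2: "supp \<rho>2 \<subseteq> supp \<sigma>2"
  shows "rate \<longlonglongrightarrow> (SUP \<alpha>\<in>{1/2..1}. exponent \<alpha>)"
proof -
  have np: "\<not> supp_perp \<rho>2 \<sigma>2"
    using sQ_pos_support[OF r2 s2, of 1] supp_perp_iff[OF psds(3,4), of 1] sup2 supp_mpow_0[OF psds(3,4)] by simp
  have inf: "sandwiched b \<rho>1 \<sigma>1 = \<infinity>" if "b > 1" for b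
    using that ns by (simp add: sandwiched_eq_sQ)
  have "\<forall>\<^sub>F b in at_top. sandwiched b \<rho>1 \<sigma>1 = \<infinity>"
    using eventually_gt_at_top[of 1] by eventually_elim (rule inf)
  hence "((\<lambda>b. sandwiched b \<rho>1 \<sigma>1) \<longlongrightarrow> \<infinity>) at_top" by (rule tendsto_eventually)
  hence inf': "sandwiched_inf \<rho>1 \<sigma>1 = \<infinity>" unfolding sandwiched_inf_def by (intro tendsto_Lim) simp
  \<comment> \<open>It matters that the divergence of the second pair is finite here, because
    infinity minus infinity is infinity in \<open>ereal\<close>.\<close>
  have ex: "exponent \<alpha> \<le> 0" if "\<alpha> \<in> {1/2..1}" for \<alpha>
  proof (cases "\<alpha> = 1")
    case False
    hence a: "1/2 \<le> \<alpha>" "\<alpha> < 1" using that by auto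
    have "(if \<alpha> = 1/2 then sandwiched_inf \<rho>1 \<sigma>1 else sandwiched (\<alpha> / (2 * \<alpha> - 1)) \<rho>1 \<sigma>1) = \<infinity>"
      using inf' inf[OF dual_order] a by auto
    thus ?thesis unfolding exponent_def using a np by (simp add: sandwiched_eq_sQ)
  qed (simp add: exponent_1)
  have SUP0: "(SUP \<alpha>\<in>{1/2..1}. exponent \<alpha>) = 0"
  proof (rule antisym)
    show "(SUP \<alpha>\<in>{1/2..1}. exponent \<alpha>) \<le> 0" by (rule SUP_least) (rule ex)
    show "0 \<le> (SUP \<alpha>\<in>{1/2..1}. exponent \<alpha>)" using SUP_upper[of 1 "{1/2..1}" exponent] by (simp add: exponent_1)
  qed
  define P where "P = mpow \<sigma>1 0"
  have P: "psd d1 P" unfolding P_def by (rule mpow_psd[OF psds(2)])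
  note Pc = psdD(1)[OF P] and rc = psdD(1)[OF psds(1)] and sc = psdD(1)[OF psds(2)]
  have N: "psd d1 (1\<^sub>m d1 - P)" unfolding P_def by (rule psd_complement_mpow_0[OF psds(2)])
  define c where "c = Re (mtrace ((1\<^sub>m d1 - P) * \<rho>1))"
  have cc: "mtrace ((1\<^sub>m d1 - P) * \<rho>1) = complex_of_real c" unfolding c_def by (rule mtrace_psd_mult(1)[OF N psds(1)])
  have Pr: "mtrace (P * \<rho>1) = complex_of_real (1 - c)"
    using mtrace_complement_mult[OF Pc rc] cc r1 by (simp add: density_def)
  have c1: "c \<le> 1" using mtrace_psd_mult(2)[OF P psds(1)] Pr by simp
  have c0: "c > 0"
  proof (rule ccontr)
    assume "\<not> c > 0"
    hence "c = 0" using mtrace_psd_mult(2)[OF N psds(1)] c_def by simp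
    hence "(1\<^sub>m d1 - P) * \<rho>1 = 0\<^sub>m d1 d1" using cc by (intro psd_mult_eq_0[OF N psds(1)]) simp
    hence z: "\<rho>1 - P * \<rho>1 = 0\<^sub>m d1 d1" using Pc rc by (simp add: minus_mult_distrib_mat[of _ d1 d1 _ _ d1])
    have "P * \<rho>1 = \<rho>1"
    proof (rule eq_matI)
      fix i j assume ij: "i < dim_row \<rho>1" "j < dim_col \<rho>1"
      have "(\<rho>1 - P * \<rho>1) $$ (i,j) = 0" unfolding z using ij rc by simp
      thus "(P * \<rho>1) $$ (i,j) = \<rho>1 $$ (i,j)" using ij rc Pc by (simp del: index_mult_mat(1))
    qed (use Pc rc in auto)
    thus False using ns supp_mpow_0[OF psds(1,2)] unfolding P_def by simp
  qed
  have ev: "\<exists>E. valid n E \<and> c \<le> (fid n E)\<^sup>2" if n: "n > 0" for n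
  proof -
    define M where "M = 1\<^sub>m (d1^n) - mpow (tpow \<sigma>1 n) 0"
    note tp = psd_tpow[OF psds(2), of n]
    have mp: "mpow (tpow \<sigma>1 n) 0 = tpow P n" unfolding P_def by (rule mpow_tpow[OF psds(2)])
    have tc: "tpow P n \<in> carrier_mat (d1^n) (d1^n)" by (rule psdD(1)[OF psd_tpow[OF P]])
    have M1: "psd (d1^n) M" unfolding M_def by (rule psd_complement_mpow_0[OF tp])
    have "1\<^sub>m (d1^n) - M = tpow P n" unfolding M_def mp using tc by (intro eq_matI) auto
    hence M2: "psd (d1^n) (1\<^sub>m (d1^n) - M)" using psd_tpow[OF P] by simp
    have "mtrace (M * tpow \<rho>1 n) = mtrace (tpow \<rho>1 n) - mtrace (tpow P n * tpow \<rho>1 n)"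
      unfolding M_def mp by (rule mtrace_complement_mult[OF tc psdD(1)[OF psd_tpow[OF psds(1)]]])
    also have "\<dots> = complex_of_real (1 - (1 - c) ^ n)"
      unfolding tpow_mult[OF Pc rc, symmetric] mtrace_tpow[OF mult_carrier_sq[OF Pc rc]] Pr
      using density_tpow[OF r1, of n] by (simp add: density_def)
    finally have a: "mtrace (M * tpow \<rho>1 n) = complex_of_real (1 - (1 - c) ^ n)" .
    have "mtrace (M * tpow \<sigma>1 n) = mtrace (tpow \<sigma>1 n) - mtrace (mpow (tpow \<sigma>1 n) 0 * tpow \<sigma>1 n)"
      unfolding M_def by (rule mtrace_complement_mult) (use mp tc psdD(1)[OF tp] in auto)
    also have "mpow (tpow \<sigma>1 n) 0 * tpow \<sigma>1 n = tpow \<sigma>1 n" using supp_mpow_0[OF tp tp] by simp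
    finally have b: "mtrace (M * tpow \<sigma>1 n) = complex_of_real 0" by simp
    have "(1 - c) ^ n \<le> (1 - c) ^ 1" using c0 c1 n by (intro power_decreasing) auto
    thus ?thesis using valid_from_test[OF M1 M2 a b] by force
  qed
  show ?thesis unfolding SUP0
  proof (rule order_tendstoI)
    fix y :: ereal assume "y < 0"
    thus "\<forall>\<^sub>F n in sequentially. y < rate n" by (rule rate_gt_negative)
  next
    fix y :: ereal assume "0 < y"
    hence y: "ereal (0 / ln 2) < y" by (simp add: zero_ereal_def)
    show "\<forall>\<^sub>F n in sequentially. rate n < y"
    proof (rule rate_upper[OF _ y])
      fix \<eta> :: real assume h: "\<eta> > 0"
      have "(\<lambda>n. exp (- \<eta>) ^ n) \<longlonglongrightarrow> 0" using h by (intro LIMSEQ_realpow_zero) auto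
      hence "\<forall>\<^sub>F n in sequentially. exp (- \<eta>) ^ n < c" using c0 by (rule order_tendstoD(2))
      thus "\<forall>\<^sub>F n in sequentially. \<exists>E. valid n E \<and> exp (- (real n * (0 + \<eta>))) \<le> (fid n E)\<^sup>2"
        using eventually_gt_at_top[of 0]
      proof eventually_elim
        case (elim n)
        have "exp (- (real n * (0 + \<eta>))) = exp (- \<eta>) ^ n" by (simp add: exp_of_nat_mult[symmetric])
        thus ?case using ev[OF elim(2)] elim(1) by force
      qed
    qed
  qed
qed

text \<open>For orthogonal supports the quantity of the second pair is 0 at every positive order, so
  the converse bound forces fidelity 0 as soon as one output copy is demanded, and the rate is
  infinite.\<close>

lemma limit_orthogonal:
  assumes sup: "supp \<rho>1 \<subseteq> supp \<sigma>1" and perp: "supp_perp \<rho>2 \<sigma>2"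
  shows "rate \<longlonglongrightarrow> (SUP \<alpha>\<in>{1/2..1}. exponent \<alpha>)"
proof -
  have sup': "mpow \<sigma>1 0 * \<rho>1 = \<rho>1" using supp_mpow_0[OF psds(1,2)] sup by simp
  \<comment> \<open>An interior order suffices: the dual order of 3/4 is 3/2, at which the support
    inclusion keeps the first divergence finite.\<close>
  have "exponent (3/4) = \<infinity>"
    unfolding exponent_def using perp sup r0 by (simp add: sandwiched_eq_sQ)
  hence S: "(SUP \<alpha>\<in>{1/2..1}. exponent \<alpha>) = \<infinity>" using SUP_upper[of "3/4" "{1/2..1}" exponent] by simp
  have "\<forall>\<^sub>F n in sequentially. copies r n \<ge> 1" using copies_at_top[OF r0] by (simp add: filterlim_at_top)
  hence "\<forall>\<^sub>F n in sequentially. rate n = \<infinity>" using eventually_gt_at_top[of 0]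
  proof eventually_elim
    case (elim n)
    have "gap n \<le> 0"
    proof (rule gap_le)
      fix E assume "valid n E"
      hence "channel (d1^n) (d2^copies r n) E" "E (tpow \<sigma>1 n) = tpow \<sigma>2 (copies r n)" by (auto simp: valid_def)
      from converse_bound(1)[OF psds sup' this, of "3/4" "3/2"]
      show "(fid n E)\<^sup>2 \<le> 0" using supp_perp_iff[OF psds(3,4), of "3/4"] perp elim(1) by (simp add: power_0_left)
    qed
    hence "gap n = 0" using gap_range(1)[of n] by simp
    thus ?case using elim(2) by (simp add: rate_def elog2_def)
  qed
  thus ?thesis unfolding S by (rule tendsto_eventually)
qed

text \<open>Here every exponent is finite. Each order separately gives a lower bound on the rate by
  the converse, while a real upper bound on all exponents is precisely what achievability takes as
  hypothesis.\<close>

lemma limit_regular: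
  assumes sup: "supp \<rho>1 \<subseteq> supp \<sigma>1" and np: "\<not> supp_perp \<rho>2 \<sigma>2"
  shows "rate \<longlonglongrightarrow> (SUP \<alpha>\<in>{1/2..1}. exponent \<alpha>)"
proof -
  have sup': "mpow \<sigma>1 0 * \<rho>1 = \<rho>1" using supp_mpow_0[OF psds(1,2)] sup by simp
  obtain L where L: "((\<lambda>b. ln (sQ b \<rho>1 \<sigma>1) / (b - 1)) \<longlongrightarrow> L) at_top"
    "\<And>b. b > 1 \<Longrightarrow> sQ b \<rho>1 \<sigma>1 \<le> exp ((b - 1) * L)" "\<And>e. e > 0 \<Longrightarrow> \<exists>b\<ge>2. (b - 1) * (L - e) \<le> ln (sQ b \<rho>1 \<sigma>1)"
    by (rule sQ_order_limit[OF r1 s1 sup']) blast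
  have sw: "sandwiched b \<rho>1 \<sigma>1 = ereal (ln (sQ b \<rho>1 \<sigma>1) / (b - 1) / ln 2)" if "b > 1" for b
    using that sup by (simp add: sandwiched_eq_sQ log_def)
  have sw2: "sandwiched a \<rho>2 \<sigma>2 = ereal (ln (sQ a \<rho>2 \<sigma>2) / (a - 1) / ln 2)" if "a < 1" for a
    using that np by (simp add: sandwiched_eq_sQ log_def)
  have "((\<lambda>b. ereal (ln (sQ b \<rho>1 \<sigma>1) / (b - 1) / ln 2)) \<longlongrightarrow> ereal (L / ln 2)) at_top"
    using L(1) by (intro tendsto_intros tendsto_ereal) auto
  moreover have "\<forall>\<^sub>F b in at_top. ereal (ln (sQ b \<rho>1 \<sigma>1) / (b - 1) / ln 2) = sandwiched b \<rho>1 \<sigma>1"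
    using eventually_gt_at_top[of 1] by eventually_elim (rule sw[symmetric])
  ultimately have "((\<lambda>b. sandwiched b \<rho>1 \<sigma>1) \<longlongrightarrow> ereal (L / ln 2)) at_top" by (rule Lim_transform_eventually)
  hence swi: "sandwiched_inf \<rho>1 \<sigma>1 = ereal (L / ln 2)" unfolding sandwiched_inf_def by (intro tendsto_Lim) simp
  define h where "h s = - r * ((1 + s) * ln (sQ (1 / (1 + s)) \<rho>2 \<sigma>2)) - (1 - s) * ln (sQ (1 / (1 - s)) \<rho>1 \<sigma>1)" for s
  define h1 where "h1 = - r * (2 * ln (sQ (1/2) \<rho>2 \<sigma>2)) - L"
  have half: "exponent (1/2) = ereal (h1 / ln 2)"
    unfolding exponent_def swi by (simp add: sw2 h1_def diff_divide_distrib)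
  have inner: "exponent (1 / (1 + s)) = ereal (h s / ln 2)" if s: "0 < s" "s < 1" for s
  proof -
    define x where "x = ln (sQ (1 / (1 + s)) \<rho>2 \<sigma>2)"
    define y where "y = ln (sQ (1 / (1 - s)) \<rho>1 \<sigma>1)"
    have a: "1 / (1 + s) \<noteq> 1 / 2" "1 / (1 + s) < 1" using s by (auto simp: field_simps)
    have b: "1 / (1 + s) / (2 * (1 / (1 + s)) - 1) = 1 / (1 - s)" "1 / (1 - s) > 1" using s by (auto simp: field_simps)
    have c: "(1 - 1 / (1 + s)) / (1 / (1 + s)) = s" using s by (simp add: field_simps)
    have d: "1 / (1 + s) - 1 = - s / (1 + s)" "1 / (1 - s) - 1 = s / (1 - s)" using s by (simp_all add: field_simps)
    have "exponent (1 / (1 + s)) = ereal (s * (r * (x / (- s / (1 + s)) / ln 2) - y / (s / (1 - s)) / ln 2))"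
      unfolding exponent_def b(1) c if_not_P[OF a(1)] sw[OF b(2)] sw2[OF a(2)] d x_def[symmetric] y_def[symmetric]
      by (simp only: times_ereal.simps ereal_minus(1))
    also have "s * (r * (x / (- s / (1 + s)) / ln 2) - y / (s / (1 - s)) / ln 2) = h s / ln 2"
      unfolding h_def x_def[symmetric] y_def[symmetric] using s by (simp add: field_simps)
    finally show ?thesis .
  qed
  have cases: "\<alpha> = 1 \<or> \<alpha> = 1/2 \<or> (\<exists>s. 0 < s \<and> s < 1 \<and> \<alpha> = 1 / (1 + s))" if "\<alpha> \<in> {1/2..1}" for \<alpha> :: real
  proof (cases "\<alpha> = 1 \<or> \<alpha> = 1/2")
    case False
    hence "1/2 < \<alpha>" "\<alpha> < 1" using that by auto
    hence "0 < (1 - \<alpha>) / \<alpha> \<and> (1 - \<alpha>) / \<alpha> < 1 \<and> \<alpha> = 1 / (1 + (1 - \<alpha>) / \<alpha>)" by (auto simp: field_simps)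
    thus ?thesis by blast
  qed auto
  let ?S = "SUP \<alpha>\<in>{1/2..1}. exponent \<alpha>"
  show ?thesis
  proof (rule order_tendstoI)
    fix y assume "y < ?S"
    then obtain \<alpha> where a: "\<alpha> \<in> {1/2..1}" "y < exponent \<alpha>" unfolding less_SUP_iff by auto
    from cases[OF a(1)] consider "\<alpha> = 1" | "\<alpha> = 1/2" | s where "0 < s" "s < 1" "\<alpha> = 1 / (1 + s)" by auto
    thus "\<forall>\<^sub>F n in sequentially. y < rate n"
    proof cases
      case 1
      hence "y < 0" using a(2) exponent_1 by simp
      thus ?thesis by (rule rate_gt_negative)
    next
      case 2
      show ?thesis by (rule converse_edge[OF sup' np L(2)]) (use a(2) 2 half in \<open>simp_all add: h1_def\<close>)
    next
      case (3 s)
      show ?thesis by (rule converse_inner[OF sup' np 3(1,2)]) (use a(2) inner[OF 3(1,2)] in \<open>simp only: 3(3) h_def\<close>)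
    qed
  next
    fix y assume y: "?S < y"
    have up: "exponent \<alpha> \<le> ?S" if "\<alpha> \<in> {1/2..1}" for \<alpha> using that by (rule SUP_upper)
    \<comment> \<open>The supremum is nonnegative and strictly below y, hence finite, and can serve
      as the real bound.\<close>
    have "0 \<le> ?S" using up[of 1] by (simp add: exponent_1)
    moreover have "?S \<noteq> \<infinity>" using y by auto
    ultimately obtain S where S: "?S = ereal S" by (cases ?S) auto
    have S': "ereal (S * ln 2 / ln 2) < y" using y S by simp
    have l2: "ln (2::real) > 0" by simp
    show "\<forall>\<^sub>F n in sequentially. rate n < y"
    proof (rule rate_upper[OF _ S'])
      fix \<eta> :: real assume "\<eta> > 0"
      show "\<forall>\<^sub>F n in sequentially. \<exists>E. valid n E \<and> exp (- (real n * (S * ln 2 + \<eta>))) \<le> (fid n E)\<^sup>2"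
        unfolding valid_def conj_assoc
      proof (rule achievability_eventually[OF r1 s1 r2 s2 sup' np r0 _ _ L(3) \<open>\<eta> > 0\<close>])
        fix s :: real assume s: "0 < s" "s < 1"
        have "exponent (1 / (1 + s)) \<le> ereal S" unfolding S[symmetric] using s by (intro up) (auto simp: field_simps)
        hence "h s / ln 2 \<le> S" unfolding inner[OF s] by simp
        thus "- r * ((1 + s) * ln (sQ (1 / (1 + s)) \<rho>2 \<sigma>2)) - (1 - s) * ln (sQ (1 / (1 - s)) \<rho>1 \<sigma>1) \<le> S * ln 2"
          unfolding h_def[symmetric] pos_divide_le_eq[OF l2] .
      next
        have "exponent (1 / 2) \<le> ereal S" unfolding S[symmetric] by (intro up) auto
        hence "h1 / ln 2 \<le> S" unfolding half by simp
        thus "- r * (2 * ln (sQ (1/2) \<rho>2 \<sigma>2)) - L \<le> S * ln 2"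
          unfolding h1_def[symmetric] pos_divide_le_eq[OF l2] .
      qed
    qed
  qed
qed

end

theorem mainTheorem1:
  fixes d1 d2 :: nat and \<rho>1 \<sigma>1 \<rho>2 \<sigma>2 :: "complex mat" and r :: real
  assumes "density d1 \<rho>1" and "density d1 \<sigma>1"
    and "density d2 \<rho>2" and "density d2 \<sigma>2"
    and "supp \<rho>1 \<subseteq> supp \<sigma>1 \<or> supp \<rho>2 \<subseteq> supp \<sigma>2"
    and "r > 0"
  shows "((\<lambda>n. ereal (1 / real n) * - elog2 (1 - eps_P d1 d2 \<rho>1 \<sigma>1 \<rho>2 \<sigma>2 r n))
          \<longlongrightarrow> (SUP \<alpha>\<in>{1/2..1}. ereal ((1 - \<alpha>) / \<alpha>) *
                 (ereal r * sandwiched \<alpha> \<rho>2 \<sigma>2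
                  - (if \<alpha> = 1/2 then sandwiched_inf \<rho>1 \<sigma>1
                     else sandwiched (\<alpha> / (2 * \<alpha> - 1)) \<rho>1 \<sigma>1)))) sequentially"
proof -
  interpret dichotomy d1 d2 \<rho>1 \<sigma>1 \<rho>2 \<sigma>2 r by unfold_locales (rule assms)+
  \<comment> \<open>If the support inclusion fails for the first pair, the hypothesis supplies it
    for the second; otherwise orthogonality of the second pair decides the case.\<close>
  have "rate \<longlonglongrightarrow> (SUP \<alpha>\<in>{1/2..1}. exponent \<alpha>)"
    using limit_unsupported limit_orthogonal limit_regular assms(5) by blast
  thus ?thesis unfolding rate_def[abs_def] gap_def exponent_def .
qed

end
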